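(* Let $U$ and $V$ be corepresentations of a discrete quantum group $\widehat{\mathbb{G}}$. Then: (1) if $W$ is a finite-dimensional corepresentation of $\widehat{\mathbb{G}}$ such that $W\leq U$ and $W\leq V^{\mathrm{c}}$, then the tensor product $U\top V$ contains the trivial corepresentation; (2) if $\widehat{\mathbb{G}}$ is unimodular and $U\top V$ contains the trivial corepresentation, then there exists a finite-dimensional corepresentation $W$ contained both in $U$ and in $V^{\mathrm{c}}$.
   Context: Conventions: $C^*$-algebras (other than multiplier algebras) and Hilbert spaces are separable, tensor products of $C^*$-algebras are spatial, representations are $*$-representations. $\widehat{\mathbb{G}}$ is the discrete quantum group dual to a compact quantum group $\mathbb{G}$. $\mathrm{Pol}(\mathbb{G})$ is the Hopf $*$-algebra spanned by matrix elements of finite-dimensional corepresentations of $\mathbb{G}$, with comultiplication $\Delta$, counit $\varepsilon$ and antipode $\kappa$; for each class $\alpha\in\mathrm{Irr}(\mathbb{G})$ of irreducible corepresentations, $u^\alpha\in M_{n_\alpha}(\mathbb{C})\otimes\mathrm{Pol}(\mathbb{G})$ is a fixed unitary representative. $\mathrm{C}(\mathbb{G}_{\max})$ is the universal enveloping $C^*$-algebra of $\mathrm{Pol}(\mathbb{G})$; $\Delta$ and $\varepsilon$ extend to it. $\mathrm{c}_0(\widehat{\mathbb{G}})=\bigoplus_\alpha M_{n_\alpha}(\mathbb{C})$, $w=\bigoplus_\alpha u^\alpha\in\mathrm{M}(\mathrm{c}_0(\widehat{\mathbb{G}})\otimes\mathrm{C}(\mathbb{G}_{\max}))$ and the comultiplication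 $\widehat\Delta$ of $\widehat{\mathbb{G}}$ satisfies $(\widehat\Delta\otimes\mathrm{id})w=w_{23}w_{13}$. A corepresentation of $\widehat{\mathbb{G}}$ on a Hilbert space $H_U$ is a unitary $U\in\mathrm{M}(\mathrm{c}_0(\widehat{\mathbb{G}})\otimes\mathcal{K}(H_U))$ with $(\widehat\Delta\otimes\mathrm{id})U=U_{23}U_{13}$. Corepresentations are exactly the elements $U=(\mathrm{id}\otimes\pi_U)w$ with $\pi_U$ a (uniquely determined) representation of $\mathrm{C}(\mathbb{G}_{\max})$ on $H_U$. The trivial corepresentation corresponds to $\varepsilon$. $U$ is finite-dimensional if $\dim H_U<\infty$ (non-zero). $U\leq V$ ("$U$ is contained in $V$") means that $\pi_U$ is (unitarily equivalent to) a subrepresentation of $\pi_V$. Tensor product: $U\top V=U_{12}V_{13}=(\mathrm{id}\otimes[(\pi_U\otimes\pi_V)\circ\Delta])w$ on $H_U\otimes H_V$. Contragredient: for a Hilbert space $H$ with conjugate space $\overline{H}$, $\top:\mathrm{B}(H)\to\mathrm{B}(\overline{H})$ is the anti-isomorphism $m^\top\overline{x}=\overline{m^*x}$. $V^{\mathrm{c}}=(\widehat{R}\otimes\top)V=(\mathrm{id}\otimes\pi_V^{\mathrm{c}})w$ with $\pi_V^{\mathrm{c}}=\top\circ\pi_V\circ R$, where $R$ and $\widehat R$ are the unitary antipodes of $\mathbb{G}$ and $\widehat{\mathbb{G}}$. $\widehat{\mathbb{G}}$ is unimodular if its left and right Haar measures coincide; equivalently $\mathbb{G}$ is of Kac type,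 i.e. $\kappa$ is a $*$-anti-automorphism (and then $\kappa=R$). *)

theory Defs
  imports "HOL-Analysis.Analysis"
begin

section \<open>Complex vector spaces, star-algebras and Hilbert spaces\<close>

class complex_vector = ab_group_add +
  fixes scaleC :: "complex \<Rightarrow> 'a \<Rightarrow> 'a" (infixr \<open>*\<^sub>C\<close> 75)
  assumes scaleC_add_right: "a *\<^sub>C (x + y) = a *\<^sub>C x + a *\<^sub>C y"
    and scaleC_add_left: "(a + b) *\<^sub>C x = a *\<^sub>C x + b *\<^sub>C x"
    and scaleC_scaleC: "a *\<^sub>C b *\<^sub>C x = (a * b) *\<^sub>C x"
    and scaleC_one: "1 *\<^sub>C x = x"

lemma vector_space_scaleC: "vector_space (scaleC :: complex \<Rightarrow> 'a \<Rightarrow> 'a::complex_vector)"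
  by unfold_locales (rule scaleC_add_right scaleC_add_left scaleC_scaleC scaleC_one)+

abbreviation cspan :: "'a::complex_vector set \<Rightarrow> 'a set"
  where "cspan \<equiv> module.span scaleC"

abbreviation csubspace :: "'a::complex_vector set \<Rightarrow> bool"
  where "csubspace \<equiv> module.subspace scaleC"

class complex_star_algebra = complex_vector + ring_1 +
  fixes star :: "'a \<Rightarrow> 'a"
  assumes scaleC_mult_left: "(c *\<^sub>C x) * y = c *\<^sub>C (x * y)"
    and scaleC_mult_right: "x * (c *\<^sub>C y) = c *\<^sub>C (x * y)"
    and star_star: "star (star x) = x"
    and star_add: "star (x + y) = star x + star y"
    and star_scaleC: "star (c *\<^sub>C x) = cnj c *\<^sub>C star x"
    and star_mult: "star (x * y) = star y * star x"

text \<open>The inner product is linear in the second variable.\<close>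

class chilbert_space = complex_vector + real_normed_vector + complete_space +
  fixes cinner :: "'a \<Rightarrow> 'a \<Rightarrow> complex"
  assumes scaleR_scaleC: "scaleR r x = complex_of_real r *\<^sub>C x"
    and cinner_commute: "cinner x y = cnj (cinner y x)"
    and cinner_add_right: "cinner x (y + z) = cinner x y + cinner x z"
    and cinner_scaleC_right: "cinner x (c *\<^sub>C y) = c * cinner x y"
    and norm_eq_sqrt_cinner: "norm x = sqrt (Re (cinner x x))"

instantiation complex :: chilbert_space
begin
definition scaleC_complex :: "complex \<Rightarrow> complex \<Rightarrow> complex"
  where "scaleC_complex c x = c * x"
definition cinner_complex :: "complex \<Rightarrow> complex \<Rightarrow> complex"
  where "cinner_complex x y = cnj x * y"
instance
  by standard
    (auto simp: scaleC_complex_def cinner_complex_def algebra_simps scaleR_conv_of_real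
      cmod_def power2_eq_square)
end

section \<open>The conjugate Hilbert space\<close>

text \<open>A copy of \<^typ>\<open>'a\<close> in which scalars act through their complex conjugates;
  \<open>to_conj x\<close> is the vector usually written with a bar over \<open>x\<close>.\<close>

typedef 'a conjugate = "UNIV :: 'a set"
  morphisms of_conj to_conj ..

lemmas conj_simps = to_conj_inverse[OF UNIV_I] of_conj_inverse

instantiation conjugate :: (chilbert_space) "{complex_vector, real_normed_vector}"
begin
definition "0 = to_conj 0"
definition "x + y = to_conj (of_conj x + of_conj y)"
definition "x - y = to_conj (of_conj x - of_conj y)"
definition "- x = to_conj (- of_conj x)"
definition "r *\<^sub>R x = to_conj (r *\<^sub>R of_conj x)"
definition "c *\<^sub>C x = to_conj (cnj c *\<^sub>C of_conj x)"
definition "norm x = norm (of_conj x)"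
definition "dist x y = dist (of_conj x) (of_conj y)"
definition "sgn x = to_conj (sgn (of_conj x))"
definition uniformity_conjugate :: "('a conjugate \<times> 'a conjugate) filter"
  where "uniformity_conjugate = (INF e\<in>{0<..}. principal {(x, y). dist x y < e})"
definition open_conjugate :: "'a conjugate set \<Rightarrow> bool"
  where "open_conjugate S = (\<forall>x\<in>S. \<forall>\<^sub>F (x', y) in uniformity. x' = x \<longrightarrow> y \<in> S)"

lemmas conjugate_defs = zero_conjugate_def plus_conjugate_def minus_conjugate_def
  uminus_conjugate_def scaleR_conjugate_def scaleC_conjugate_def
  norm_conjugate_def dist_conjugate_def sgn_conjugate_def

instance
proof
  fix x y z :: "'a conjugate" and a b :: real and c d :: complex
  show "x + y + z = x + (y + z)" "x + y = y + x" "0 + x = x" "- x + x = 0" "x - y = x + - y"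
    "a *\<^sub>R (x + y) = a *\<^sub>R x + a *\<^sub>R y" "(a + b) *\<^sub>R x = a *\<^sub>R x + b *\<^sub>R x"
    "a *\<^sub>R b *\<^sub>R x = (a * b) *\<^sub>R x" "1 *\<^sub>R x = x"
    by (simp_all add: conjugate_defs conj_simps algebra_simps)
  show "c *\<^sub>C (x + y) = c *\<^sub>C x + c *\<^sub>C y" "(c + d) *\<^sub>C x = c *\<^sub>C x + d *\<^sub>C x"
    "c *\<^sub>C d *\<^sub>C x = (c * d) *\<^sub>C x" "1 *\<^sub>C x = x"
    by (simp_all add: conjugate_defs conj_simps scaleC_add_left scaleC_add_right
        scaleC_scaleC scaleC_one)
  show "dist x y = norm (x - y)"
    by (simp add: conjugate_defs conj_simps dist_norm)
  show "sgn x = inverse (norm x) *\<^sub>R x"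
    by (simp add: conjugate_defs conj_simps sgn_div_norm)
  show "norm x = 0 \<longleftrightarrow> x = 0"
    by (simp add: conjugate_defs) (metis conj_simps)
  show "norm (x + y) \<le> norm x + norm y" "norm (a *\<^sub>R x) = \<bar>a\<bar> * norm x"
    by (simp_all add: conjugate_defs conj_simps norm_triangle_ineq)
  show "uniformity = (INF e\<in>{0<..}. principal {(x :: 'a conjugate, y). dist x y < e})"
    by (rule uniformity_conjugate_def)
  show "open S = (\<forall>x\<in>S. \<forall>\<^sub>F (x', y) in uniformity. x' = x \<longrightarrow> y \<in> S)" for S :: "'a conjugate set"
    by (rule open_conjugate_def)
qed
end

instantiation conjugate :: (chilbert_space) chilbert_space
begin
definition "cinner x y = cinner (of_conj y) (of_conj x)"

instance
proof
  fix X :: "nat \<Rightarrow> 'a conjugate"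
  assume "Cauchy X"
  then have "Cauchy (\<lambda>n. of_conj (X n))"
    by (simp add: Cauchy_def dist_conjugate_def)
  then obtain l where l: "(\<lambda>n. of_conj (X n)) \<longlonglongrightarrow> l"
    by (auto simp: Cauchy_convergent_iff convergent_def)
  have "X \<longlonglongrightarrow> to_conj l"
    using l unfolding LIMSEQ_def dist_conjugate_def by (simp add: conj_simps)
  then show "convergent X"
    by (auto simp: convergent_def)
next
  fix x y z :: "'a conjugate" and a :: real and c :: complex
  show "a *\<^sub>R x = complex_of_real a *\<^sub>C x"
    by (simp add: conjugate_defs scaleR_scaleC)
  show "cinner x y = cnj (cinner y x)"
    by (simp add: cinner_conjugate_def flip: cinner_commute)
  have add: "cinner (u + v) w = cinner u w + cinner v w" for u v w :: 'a
    by (metis cinner_add_right cinner_commute complex_cnj_add)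
  have scale: "cinner (cnj e *\<^sub>C u) v = e * cinner u v" for e and u v :: 'a
    by (metis cinner_commute cinner_scaleC_right complex_cnj_cnj complex_cnj_mult)
  show "cinner x (y + z) = cinner x y + cinner x z" "cinner x (c *\<^sub>C y) = c * cinner x y"
    by (simp_all add: conjugate_defs cinner_conjugate_def conj_simps add scale)
  show "norm x = sqrt (Re (cinner x x))"
    by (simp add: conjugate_defs cinner_conjugate_def norm_eq_sqrt_cinner)
qed
end

section \<open>Bounded operators between Hilbert spaces\<close>

text \<open>A Hilbert space is a closed subspace of a type of class \<^class>\<open>chilbert_space\<close>. Operators
  out of the Hilbert space \<open>H\<close> are functions that vanish outside \<open>H\<close>, so that equality of
  operators is equality of functions.\<close>

definition hilbert_space :: "'h::chilbert_space set \<Rightarrow> bool"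
  where "hilbert_space H \<longleftrightarrow> csubspace H \<and> closed H"

definition finite_dim :: "'h::chilbert_space set \<Rightarrow> bool"
  where "finite_dim H \<longleftrightarrow> (\<exists>B. finite B \<and> H = cspan B)"

definition bounded_ops :: "'h::chilbert_space set \<Rightarrow> 'k::chilbert_space set \<Rightarrow> ('h \<Rightarrow> 'k) set"
  where "bounded_ops H K = {f.
    (\<forall>x\<in>H. f x \<in> K) \<and>
    (\<forall>x\<in>H. \<forall>y\<in>H. f (x + y) = f x + f y) \<and>
    (\<forall>c. \<forall>x\<in>H. f (c *\<^sub>C x) = c *\<^sub>C f x) \<and>
    (\<exists>C. \<forall>x\<in>H. norm (f x) \<le> C * norm x) \<and>
    (\<forall>x. x \<notin> H \<longrightarrow> f x = 0)}"

definition id_op :: "'h::chilbert_space set \<Rightarrow> 'h \<Rightarrow> 'h"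
  where "id_op H x = (if x \<in> H then x else 0)"

definition adj_op :: "'h::chilbert_space set \<Rightarrow> ('h \<Rightarrow> 'h) \<Rightarrow> 'h \<Rightarrow> 'h"
  where "adj_op H m y =
    (if y \<in> H then THE z. z \<in> H \<and> (\<forall>x\<in>H. cinner (m x) y = cinner x z) else 0)"

text \<open>The anti-isomorphism from operators on \<open>H\<close> to operators on the conjugate space
  \<open>to_conj ` H\<close>.\<close>

definition transpose_op :: "'h::chilbert_space set \<Rightarrow> ('h \<Rightarrow> 'h) \<Rightarrow> 'h conjugate \<Rightarrow> 'h conjugate"
  where "transpose_op H m z = to_conj (adj_op H m (of_conj z))"

definition unitary_op :: "'h::chilbert_space set \<Rightarrow> 'k::chilbert_space set \<Rightarrow> ('h \<Rightarrow> 'k) \<Rightarrow> bool"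
  where "unitary_op H K J \<longleftrightarrow> J \<in> bounded_ops H K \<and> J ` H = K \<and>
    (\<forall>x\<in>H. \<forall>y\<in>H. cinner (J x) (J y) = cinner x y)"

text \<open>\<open>K\<close> together with the bilinear map \<open>t\<close> is the Hilbert space tensor product of \<open>H1\<close> and
  \<open>H2\<close>. These properties determine \<open>(K, t)\<close> up to a unique unitary.\<close>

definition hilbert_tensor ::
  "'h1::chilbert_space set \<Rightarrow> 'h2::chilbert_space set \<Rightarrow> 'k::chilbert_space set \<Rightarrow>
   ('h1 \<Rightarrow> 'h2 \<Rightarrow> 'k) \<Rightarrow> bool"
  where "hilbert_tensor H1 H2 K t \<longleftrightarrow>
    hilbert_space K \<and>
    (\<forall>x\<in>H1. \<forall>x'\<in>H1. \<forall>y\<in>H2. t (x + x') y = t x y + t x' y) \<and>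
    (\<forall>x\<in>H1. \<forall>y\<in>H2. \<forall>y'\<in>H2. t x (y + y') = t x y + t x y') \<and>
    (\<forall>c. \<forall>x\<in>H1. \<forall>y\<in>H2. t (c *\<^sub>C x) y = c *\<^sub>C t x y \<and> t x (c *\<^sub>C y) = c *\<^sub>C t x y) \<and>
    (\<forall>x\<in>H1. \<forall>x'\<in>H1. \<forall>y\<in>H2. \<forall>y'\<in>H2.
       cinner (t x y) (t x' y') = cinner x x' * cinner y y') \<and>
    K = closure (cspan {t x y | x y. x \<in> H1 \<and> y \<in> H2})"

definition tensor_op ::
  "'h1::chilbert_space set \<Rightarrow> 'h2::chilbert_space set \<Rightarrow> 'k::chilbert_space set \<Rightarrow>
   ('h1 \<Rightarrow> 'h2 \<Rightarrow> 'k) \<Rightarrow> ('h1 \<Rightarrow> 'h1) \<Rightarrow> ('h2 \<Rightarrow> 'h2) \<Rightarrow> 'k \<Rightarrow> 'k"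
  where "tensor_op H1 H2 K t A B =
    (THE C. C \<in> bounded_ops K K \<and> (\<forall>x\<in>H1. \<forall>y\<in>H2. C (t x y) = t (A x) (B y)))"

section \<open>Algebraic tensors\<close>

text \<open>An element of the algebraic tensor square of \<open>A\<close> is represented by a list of pairs, which
  stands for the sum of the corresponding elementary tensors. Two lists represent the same tensor
  iff all bilinear forms agree on them, as bilinear forms separate the points of the tensor
  product. Likewise for the tensor cube.\<close>

definition clinear_map :: "('a::complex_vector \<Rightarrow> 'b::complex_vector) \<Rightarrow> bool"
  where "clinear_map f \<longleftrightarrow> (\<forall>x y. f (x + y) = f x + f y) \<and> (\<forall>c x. f (c *\<^sub>C x) = c *\<^sub>C f x)"

definition tensor_eq :: "('a::complex_vector \<times> 'a) list \<Rightarrow> ('a \<times> 'a) list \<Rightarrow> bool"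
  where "tensor_eq s t \<longleftrightarrow> (\<forall>\<beta> :: 'a \<Rightarrow> 'a \<Rightarrow> complex.
    (\<forall>x. clinear_map (\<lambda>y. \<beta> x y)) \<and> (\<forall>y. clinear_map (\<lambda>x. \<beta> x y)) \<longrightarrow>
    (\<Sum>(x, y)\<leftarrow>s. \<beta> x y) = (\<Sum>(x, y)\<leftarrow>t. \<beta> x y))"

definition tensor_eq3 :: "('a::complex_vector \<times> 'a \<times> 'a) list \<Rightarrow> ('a \<times> 'a \<times> 'a) list \<Rightarrow> bool"
  where "tensor_eq3 s t \<longleftrightarrow> (\<forall>\<beta> :: 'a \<Rightarrow> 'a \<Rightarrow> 'a \<Rightarrow> complex.
    (\<forall>x y. clinear_map (\<lambda>z. \<beta> x y z)) \<and> (\<forall>x z. clinear_map (\<lambda>y. \<beta> x y z)) \<and>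
    (\<forall>y z. clinear_map (\<lambda>x. \<beta> x y z)) \<longrightarrow>
    (\<Sum>(x, y, z)\<leftarrow>s. \<beta> x y z) = (\<Sum>(x, y, z)\<leftarrow>t. \<beta> x y z))"

section \<open>Compact quantum groups and their discrete duals\<close>

text \<open>A compact quantum group is given by its Hopf star-algebra of matrix coefficients, which is
  the type \<^typ>\<open>'a\<close> with the operations below. The type \<^typ>\<open>'i\<close> is the set of
  classes of irreducible corepresentations, and \<open>irr G \<alpha>\<close> is the chosen unitary representative of
  the class \<open>\<alpha>\<close>, a square matrix of size \<open>irr_dim G \<alpha>\<close>. All matrices are indexed from \<open>0\<close>, and their
  entries outside the index range are irrelevant.\<close>

record ('a, 'i) quantum_group =
  comult :: "'a \<Rightarrow> ('a \<times> 'a) list"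
  counit :: "'a \<Rightarrow> complex"
  antipode :: "'a \<Rightarrow> 'a"
  irr_dim :: "'i \<Rightarrow> nat"
  irr :: "'i \<Rightarrow> nat \<Rightarrow> nat \<Rightarrow> 'a"

definition hopf_star_algebra :: "('a::complex_star_algebra, 'i) quantum_group \<Rightarrow> bool"
  where "hopf_star_algebra G \<longleftrightarrow>
    (\<forall>a b. tensor_eq (comult G (a + b)) (comult G a @ comult G b)) \<and>
    (\<forall>c a. tensor_eq (comult G (c *\<^sub>C a)) [(c *\<^sub>C x, y). (x, y) \<leftarrow> comult G a]) \<and>
    tensor_eq (comult G 1) [(1, 1)] \<and>
    (\<forall>a b. tensor_eq (comult G (a * b))
       [(x * x', y * y'). (x, y) \<leftarrow> comult G a, (x', y') \<leftarrow> comult G b]) \<and>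
    (\<forall>a. tensor_eq (comult G (star a)) [(star x, star y). (x, y) \<leftarrow> comult G a]) \<and>
    (\<forall>a. tensor_eq3 [(x', x'', y). (x, y) \<leftarrow> comult G a, (x', x'') \<leftarrow> comult G x]
                    [(x, y', y''). (x, y) \<leftarrow> comult G a, (y', y'') \<leftarrow> comult G y]) \<and>
    clinear_map (counit G) \<and> counit G 1 = 1 \<and>
    (\<forall>a b. counit G (a * b) = counit G a * counit G b) \<and>
    (\<forall>a. (\<Sum>(x, y)\<leftarrow>comult G a. counit G x *\<^sub>C y) = a) \<and>
    (\<forall>a. (\<Sum>(x, y)\<leftarrow>comult G a. counit G y *\<^sub>C x) = a) \<and>
    clinear_map (antipode G) \<and>
    (\<forall>a. (\<Sum>(x, y)\<leftarrow>comult G a. antipode G x * y) = counit G a *\<^sub>C 1) \<and>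
    (\<forall>a. (\<Sum>(x, y)\<leftarrow>comult G a. x * antipode G y) = counit G a *\<^sub>C 1)"

definition unitary_corep ::
  "('a::complex_star_algebra, 'i) quantum_group \<Rightarrow> nat \<Rightarrow> (nat \<Rightarrow> nat \<Rightarrow> 'a) \<Rightarrow> bool"
  where "unitary_corep G n v \<longleftrightarrow>
    (\<forall>i<n. \<forall>j<n. tensor_eq (comult G (v i j)) [(v i k, v k j). k \<leftarrow> [0..<n]]) \<and>
    (\<forall>i<n. \<forall>j<n. (\<Sum>k<n. star (v k i) * v k j) = (if i = j then 1 else 0)) \<and>
    (\<forall>i<n. \<forall>j<n. (\<Sum>k<n. v i k * star (v j k)) = (if i = j then 1 else 0))"

text \<open>Morphisms from \<open>v\<close> (of size \<open>n\<close>) to \<open>v'\<close> (of size \<open>n'\<close>): complex matrices of shape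
  \<open>n'\<close> by \<open>n\<close>.\<close>

definition intertwines ::
  "nat \<Rightarrow> (nat \<Rightarrow> nat \<Rightarrow> 'a::complex_vector) \<Rightarrow> nat \<Rightarrow> (nat \<Rightarrow> nat \<Rightarrow> 'a) \<Rightarrow>
   (nat \<Rightarrow> nat \<Rightarrow> complex) \<Rightarrow> bool"
  where "intertwines n v n' v' T \<longleftrightarrow>
    (\<forall>i<n'. \<forall>j<n. (\<Sum>k<n. T i k *\<^sub>C v k j) = (\<Sum>k<n'. T k j *\<^sub>C v' i k))"

definition irreducible_corep ::
  "('a::complex_star_algebra, 'i) quantum_group \<Rightarrow> nat \<Rightarrow> (nat \<Rightarrow> nat \<Rightarrow> 'a) \<Rightarrow> bool"
  where "irreducible_corep G n v \<longleftrightarrow> unitary_corep G n v \<and> n > 0 \<and>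
    (\<forall>T. intertwines n v n v T \<longrightarrow>
      (\<exists>c. \<forall>i<n. \<forall>j<n. T i j = (if i = j then c else 0)))"

definition equivalent_coreps ::
  "nat \<Rightarrow> (nat \<Rightarrow> nat \<Rightarrow> 'a::complex_vector) \<Rightarrow> nat \<Rightarrow> (nat \<Rightarrow> nat \<Rightarrow> 'a) \<Rightarrow> bool"
  where "equivalent_coreps n v n' v' \<longleftrightarrow> (\<exists>T S.
    intertwines n v n' v' T \<and>
    (\<forall>i<n'. \<forall>j<n'. (\<Sum>k<n. T i k * S k j) = (if i = j then 1 else 0)) \<and>
    (\<forall>i<n. \<forall>j<n. (\<Sum>k<n'. S i k * T k j) = (if i = j then 1 else 0)))"

definition compact_quantum_group :: "('a::complex_star_algebra, 'i) quantum_group \<Rightarrow> bool"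
  where "compact_quantum_group G \<longleftrightarrow>
    hopf_star_algebra G \<and>
    cspan {v i j | n v i j. unitary_corep G n v \<and> i < n \<and> j < n} = UNIV \<and>
    (\<forall>\<alpha>. irreducible_corep G (irr_dim G \<alpha>) (irr G \<alpha>)) \<and>
    (\<forall>\<alpha> \<beta>. equivalent_coreps (irr_dim G \<alpha>) (irr G \<alpha>) (irr_dim G \<beta>) (irr G \<beta>) \<longrightarrow> \<alpha> = \<beta>) \<and>
    (\<forall>n v. irreducible_corep G n v \<longrightarrow> (\<exists>\<alpha>. equivalent_coreps n v (irr_dim G \<alpha>) (irr G \<alpha>)))"

text \<open>The unitary antipode \<open>R\<close> from the polar decomposition of the antipode \<open>\<kappa>\<close>: on the coefficients
  of each irreducible \<open>u\<close> there is a positive invertible matrix \<open>F = P\<^sup>2\<close>, unique up to a positive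
  factor, with \<open>\<kappa>\<^sup>2(u) = F u F\<^sup>-\<^sup>1\<close>. The scaling group is \<open>\<tau>\<^sub>t(u) = F\<^sup>i\<^sup>t u F\<^sup>-\<^sup>i\<^sup>t\<close>, and
  \<open>\<kappa>\<close> is the composition of \<open>R\<close> with the analytic extension of \<open>\<tau>\<close> to \<open>-i/2\<close>, that is,
  \<open>R(u) = P\<^sup>-\<^sup>1 \<kappa>(u) P\<close>.\<close>

definition positive_definite :: "nat \<Rightarrow> (nat \<Rightarrow> nat \<Rightarrow> complex) \<Rightarrow> bool"
  where "positive_definite n P \<longleftrightarrow>
    (\<forall>i<n. \<forall>j<n. P i j = cnj (P j i)) \<and>
    (\<forall>z. (\<exists>i<n. z i \<noteq> 0) \<longrightarrow> Re (\<Sum>i<n. \<Sum>j<n. cnj (z i) * P i j * z j) > 0)"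

definition unitary_antipode ::
  "('a::complex_star_algebra, 'i) quantum_group \<Rightarrow> ('a \<Rightarrow> 'a) \<Rightarrow> bool"
  where "unitary_antipode G R \<longleftrightarrow> clinear_map R \<and>
    (\<forall>\<alpha>. let n = irr_dim G \<alpha>; u = irr G \<alpha> in \<exists>P F.
       positive_definite n P \<and>
       (\<forall>i<n. \<forall>j<n. F i j = (\<Sum>k<n. P i k * P k j)) \<and>
       (\<forall>i<n. \<forall>j<n. (\<Sum>k<n. F k j *\<^sub>C antipode G (antipode G (u i k))) =
                    (\<Sum>k<n. F i k *\<^sub>C u k j)) \<and>
       (\<forall>i<n. \<forall>j<n. (\<Sum>k<n. P i k *\<^sub>C R (u k j)) = (\<Sum>k<n. P k j *\<^sub>C antipode G (u i k))))"

text \<open>The coefficients of the irreducible corepresentations form a linear basis;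
  \<open>irr_coeff G a \<alpha> m n\<close> is the coordinate of \<open>a\<close> at \<open>irr G \<alpha> m n\<close>.\<close>

definition irr_coeff ::
  "('a::complex_star_algebra, 'i) quantum_group \<Rightarrow> 'a \<Rightarrow> 'i \<Rightarrow> nat \<Rightarrow> nat \<Rightarrow> complex"
  where "irr_coeff G a \<alpha> m n = module.representation scaleC
    {irr G \<beta> i j | \<beta> i j. i < irr_dim G \<beta> \<and> j < irr_dim G \<beta>} a (irr G \<alpha> m n)"

definition irr_supp ::
  "('a::complex_star_algebra, 'i) quantum_group \<Rightarrow> 'a \<Rightarrow> ('i \<times> nat \<times> nat) set"
  where "irr_supp G a =
    {(\<alpha>, m, n). m < irr_dim G \<alpha> \<and> n < irr_dim G \<alpha> \<and> irr_coeff G a \<alpha> m n \<noteq> 0}"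

text \<open>The comultiplication \<open>\<Delta>\<close> of the dual, on the matrix units \<open>e\<close> of the direct sum of the matrix
  algebras \<open>M\<^sub>\<alpha>\<close>: \<open>dual_comult G \<alpha> m n \<beta> i j \<gamma> k l\<close> is the coefficient of
  \<open>e\<^sup>\<beta>\<^sub>i\<^sub>j \<otimes> e\<^sup>\<gamma>\<^sub>k\<^sub>l\<close> in the image of \<open>e\<^sup>\<alpha>\<^sub>m\<^sub>n\<close>. It is read off from
  \<open>(\<Delta> \<otimes> id) w = w\<^sub>2\<^sub>3 w\<^sub>1\<^sub>3\<close>, in which the right-hand side has the entry
  \<open>u\<^sup>\<gamma>\<^sub>k\<^sub>l u\<^sup>\<beta>\<^sub>i\<^sub>j\<close> at \<open>e\<^sup>\<beta>\<^sub>i\<^sub>j \<otimes> e\<^sup>\<gamma>\<^sub>k\<^sub>l\<close>; see the lemma below.\<close>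

definition dual_comult ::
  "('a::complex_star_algebra, 'i) quantum_group \<Rightarrow> 'i \<Rightarrow> nat \<Rightarrow> nat \<Rightarrow>
   'i \<Rightarrow> nat \<Rightarrow> nat \<Rightarrow> 'i \<Rightarrow> nat \<Rightarrow> nat \<Rightarrow> complex"
  where "dual_comult G \<alpha> m n \<beta> i j \<gamma> k l = irr_coeff G (irr G \<gamma> k l * irr G \<beta> i j) \<alpha> m n"

text \<open>Finitely many matrix units contribute to each coefficient.\<close>

definition comult_supp ::
  "('a::complex_star_algebra, 'i) quantum_group \<Rightarrow>
   'i \<Rightarrow> nat \<Rightarrow> nat \<Rightarrow> 'i \<Rightarrow> nat \<Rightarrow> nat \<Rightarrow> ('i \<times> nat \<times> nat) set"
  where "comult_supp G \<beta> i j \<gamma> k l = {(\<alpha>, m, n).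
    m < irr_dim G \<alpha> \<and> n < irr_dim G \<alpha> \<and> dual_comult G \<alpha> m n \<beta> i j \<gamma> k l \<noteq> 0}"

lemma dual_comult_w:
  fixes G :: "('a::complex_star_algebra, 'i) quantum_group"
  defines "I \<equiv> {(\<alpha>, m, n). m < irr_dim G \<alpha> \<and> n < irr_dim G \<alpha>}"
  defines "u \<equiv> \<lambda>(\<alpha>, m, n). irr G \<alpha> m n"
  assumes inj: "inj_on u I"
    and indep: "\<not> module.dependent scaleC (u ` I)"
    and span: "cspan (u ` I) = UNIV"
  shows "(\<Sum>(\<alpha>, m, n)\<in>comult_supp G \<beta> i j \<gamma> k l.
           dual_comult G \<alpha> m n \<beta> i j \<gamma> k l *\<^sub>C irr G \<alpha> m n) = irr G \<gamma> k l * irr G \<beta> i j"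
proof -
  interpret vector_space "scaleC :: complex \<Rightarrow> 'a \<Rightarrow> 'a"
    by (rule vector_space_scaleC)
  let ?a = "irr G \<gamma> k l * irr G \<beta> i j" and ?S = "comult_supp G \<beta> i j \<gamma> k l"
  have B: "{irr G \<beta> i j | \<beta> i j. i < irr_dim G \<beta> \<and> j < irr_dim G \<beta>} = u ` I"
    by (force simp: I_def u_def)
  have S: "?S = {p \<in> I. representation (u ` I) ?a (u p) \<noteq> 0}"
    unfolding comult_supp_def dual_comult_def irr_coeff_def B by (auto simp: I_def u_def)
  have im: "u ` ?S = {b. representation (u ` I) ?a b \<noteq> 0}"
    unfolding S using representation_ne_zero by fastforce
  have "(\<Sum>(\<alpha>, m, n)\<in>?S. dual_comult G \<alpha> m n \<beta> i j \<gamma> k l *\<^sub>C irr G \<alpha> m n) =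
      (\<Sum>p\<in>?S. representation (u ` I) ?a (u p) *\<^sub>C u p)"
    unfolding dual_comult_def irr_coeff_def B by (rule sum.cong) (auto simp: u_def)
  also have "\<dots> = (\<Sum>b\<in>u ` ?S. representation (u ` I) ?a b *\<^sub>C b)"
    using inj by (subst sum.reindex) (auto simp: S inj_on_def)
  also have "\<dots> = ?a"
    unfolding im using indep span by (intro sum_nonzero_representation_eq) auto
  finally show ?thesis .
qed

text \<open>A Haar measure of the discrete dual is a positive functional on the algebraic direct sum of
  the matrix algebras, given by its values \<open>\<phi> \<alpha> i j\<close> on the matrix units. Left and right
  invariance are \<open>(id \<otimes> \<phi>)(\<Delta> x) = \<phi>(x) 1\<close> and \<open>(\<phi> \<otimes> id)(\<Delta> x) = \<phi>(x) 1\<close> for \<open>x = e\<^sup>\<alpha>\<^sub>m\<^sub>n\<close>,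
  compared entry by entry; the sums have finitely many non-zero terms.\<close>

definition haar_functional ::
  "('a::complex_star_algebra, 'i) quantum_group \<Rightarrow> ('i \<Rightarrow> nat \<Rightarrow> nat \<Rightarrow> complex) \<Rightarrow> bool"
  where "haar_functional G \<phi> \<longleftrightarrow>
    (\<forall>\<alpha> (x :: nat \<Rightarrow> nat \<Rightarrow> complex). let n = irr_dim G \<alpha> in
       (\<Sum>i<n. \<Sum>j<n. \<Sum>k<n. cnj (x k i) * x k j * \<phi> \<alpha> i j) \<in> \<real>\<^sub>\<ge>\<^sub>0) \<and>
    (\<exists>\<alpha>. \<exists>i<irr_dim G \<alpha>. \<exists>j<irr_dim G \<alpha>. \<phi> \<alpha> i j \<noteq> 0)"

definition left_haar ::
  "('a::complex_star_algebra, 'i) quantum_group \<Rightarrow> ('i \<Rightarrow> nat \<Rightarrow> nat \<Rightarrow> complex) \<Rightarrow> bool"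
  where "left_haar G \<phi> \<longleftrightarrow> haar_functional G \<phi> \<and>
    (\<forall>\<alpha>. \<forall>m<irr_dim G \<alpha>. \<forall>n<irr_dim G \<alpha>. \<forall>\<beta>. \<forall>i<irr_dim G \<beta>. \<forall>j<irr_dim G \<beta>.
      (\<Sum>(\<gamma>, k, l)\<in>{(\<gamma>, k, l). k < irr_dim G \<gamma> \<and> l < irr_dim G \<gamma> \<and>
                              dual_comult G \<alpha> m n \<beta> i j \<gamma> k l \<noteq> 0}.
         dual_comult G \<alpha> m n \<beta> i j \<gamma> k l * \<phi> \<gamma> k l) = (if i = j then \<phi> \<alpha> m n else 0))"

definition right_haar ::
  "('a::complex_star_algebra, 'i) quantum_group \<Rightarrow> ('i \<Rightarrow> nat \<Rightarrow> nat \<Rightarrow> complex) \<Rightarrow> bool"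
  where "right_haar G \<phi> \<longleftrightarrow> haar_functional G \<phi> \<and>
    (\<forall>\<alpha>. \<forall>m<irr_dim G \<alpha>. \<forall>n<irr_dim G \<alpha>. \<forall>\<gamma>. \<forall>k<irr_dim G \<gamma>. \<forall>l<irr_dim G \<gamma>.
      (\<Sum>(\<beta>, i, j)\<in>{(\<beta>, i, j). i < irr_dim G \<beta> \<and> j < irr_dim G \<beta> \<and>
                              dual_comult G \<alpha> m n \<beta> i j \<gamma> k l \<noteq> 0}.
         dual_comult G \<alpha> m n \<beta> i j \<gamma> k l * \<phi> \<beta> i j) = (if k = l then \<phi> \<alpha> m n else 0))"

text \<open>Haar measures are unique up to a positive factor, so left and right Haar measures coincide iff
  some left Haar measure is a right Haar measure.\<close>

definition dual_unimodular :: "('a::complex_star_algebra, 'i) quantum_group \<Rightarrow> bool"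
  where "dual_unimodular G \<longleftrightarrow> (\<exists>\<phi>. left_haar G \<phi> \<and> right_haar G \<phi>)"

section \<open>Corepresentations of the discrete dual\<close>

text \<open>A unitary multiplier \<open>U\<close> of the tensor product of the direct sum of the matrix algebras with
  the compact operators on \<open>H\<close> is a family of unitary matrices over the bounded operators on \<open>H\<close>;
  \<open>U \<alpha> i j\<close> is the entry at \<open>e\<^sup>\<alpha>\<^sub>i\<^sub>j\<close>. The last condition is
  \<open>(\<Delta> \<otimes> id) U = U\<^sub>2\<^sub>3 U\<^sub>1\<^sub>3\<close> at \<open>e\<^sup>\<beta>\<^sub>i\<^sub>j \<otimes> e\<^sup>\<gamma>\<^sub>k\<^sub>l\<close>.\<close>

definition corepresentation ::
  "('a::complex_star_algebra, 'i) quantum_group \<Rightarrow> 'h::chilbert_space set \<Rightarrow>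
   ('i \<Rightarrow> nat \<Rightarrow> nat \<Rightarrow> 'h \<Rightarrow> 'h) \<Rightarrow> bool"
  where "corepresentation G H U \<longleftrightarrow>
    hilbert_space H \<and>
    (\<forall>\<alpha>. let n = irr_dim G \<alpha> in
       (\<forall>i<n. \<forall>j<n. U \<alpha> i j \<in> bounded_ops H H) \<and>
       (\<forall>i<n. \<forall>j<n. (\<lambda>x. \<Sum>k<n. adj_op H (U \<alpha> k i) (U \<alpha> k j x)) =
                    (if i = j then id_op H else (\<lambda>x. 0))) \<and>
       (\<forall>i<n. \<forall>j<n. (\<lambda>x. \<Sum>k<n. U \<alpha> i k (adj_op H (U \<alpha> j k) x)) =
                    (if i = j then id_op H else (\<lambda>x. 0)))) \<and>
    (\<forall>\<beta> \<gamma>. \<forall>i<irr_dim G \<beta>. \<forall>j<irr_dim G \<beta>. \<forall>k<irr_dim G \<gamma>. \<forall>l<irr_dim G \<gamma>.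
       (\<lambda>x. \<Sum>(\<alpha>, m, n)\<in>comult_supp G \<beta> i j \<gamma> k l.
              dual_comult G \<alpha> m n \<beta> i j \<gamma> k l *\<^sub>C U \<alpha> m n x) = U \<gamma> k l \<circ> U \<beta> i j)"

text \<open>The representation \<open>\<pi>\<^sub>U\<close>, determined by \<open>(id \<otimes> \<pi>\<^sub>U) w = U\<close>. It is recorded on the dense
  star-algebra \<^typ>\<open>'a\<close>, whose star-representations on Hilbert spaces are the
  restrictions of those of its universal enveloping C*-algebra.\<close>

definition rep_of ::
  "('a::complex_star_algebra, 'i) quantum_group \<Rightarrow>
   ('i \<Rightarrow> nat \<Rightarrow> nat \<Rightarrow> 'h::chilbert_space \<Rightarrow> 'h) \<Rightarrow> 'a \<Rightarrow> 'h \<Rightarrow> 'h"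
  where "rep_of G U a = (\<lambda>x. \<Sum>(\<alpha>, m, n)\<in>irr_supp G a. irr_coeff G a \<alpha> m n *\<^sub>C U \<alpha> m n x)"

definition contained_in ::
  "('a::complex_star_algebra, 'i) quantum_group \<Rightarrow>
   'h::chilbert_space set \<Rightarrow> ('i \<Rightarrow> nat \<Rightarrow> nat \<Rightarrow> 'h \<Rightarrow> 'h) \<Rightarrow>
   'k::chilbert_space set \<Rightarrow> ('i \<Rightarrow> nat \<Rightarrow> nat \<Rightarrow> 'k \<Rightarrow> 'k) \<Rightarrow> bool"
  where "contained_in G H U K V \<longleftrightarrow> (\<exists>L J.
    hilbert_space L \<and> L \<subseteq> K \<and> (\<forall>a. \<forall>x\<in>L. rep_of G V a x \<in> L) \<and>
    unitary_op H L J \<and> (\<forall>a. \<forall>x\<in>H. J (rep_of G U a x) = rep_of G V a (J x)))"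

text \<open>The trivial corepresentation acts on the Hilbert space \<^typ>\<open>complex\<close>.\<close>

definition trivial_corep ::
  "('a::complex_star_algebra, 'i) quantum_group \<Rightarrow> 'i \<Rightarrow> nat \<Rightarrow> nat \<Rightarrow> complex \<Rightarrow> complex"
  where "trivial_corep G \<alpha> i j = (\<lambda>z. counit G (irr G \<alpha> i j) * z)"

text \<open>\<open>U\<^sub>1\<^sub>2 V\<^sub>1\<^sub>3\<close> on the tensor product \<open>K\<close> of \<open>H1\<close> and \<open>H2\<close>.\<close>

definition tensor_corep ::
  "('a::complex_star_algebra, 'i) quantum_group \<Rightarrow>
   'h1::chilbert_space set \<Rightarrow> 'h2::chilbert_space set \<Rightarrow> 'k::chilbert_space set \<Rightarrow>
   ('h1 \<Rightarrow> 'h2 \<Rightarrow> 'k) \<Rightarrow>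
   ('i \<Rightarrow> nat \<Rightarrow> nat \<Rightarrow> 'h1 \<Rightarrow> 'h1) \<Rightarrow> ('i \<Rightarrow> nat \<Rightarrow> nat \<Rightarrow> 'h2 \<Rightarrow> 'h2) \<Rightarrow>
   'i \<Rightarrow> nat \<Rightarrow> nat \<Rightarrow> 'k \<Rightarrow> 'k"
  where "tensor_corep G H1 H2 K t U V \<alpha> i j =
    (\<lambda>z. \<Sum>k<irr_dim G \<alpha>. tensor_op H1 H2 K t (U \<alpha> i k) (V \<alpha> k j) z)"

text \<open>The contragredient \<open>V\<^sup>c\<close>, on the conjugate space \<open>to_conj ` H\<close>; \<open>R\<close> is the unitary antipode.\<close>

definition contragredient ::
  "('a::complex_star_algebra, 'i) quantum_group \<Rightarrow> ('a \<Rightarrow> 'a) \<Rightarrow> 'h::chilbert_space set \<Rightarrow>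
   ('i \<Rightarrow> nat \<Rightarrow> nat \<Rightarrow> 'h \<Rightarrow> 'h) \<Rightarrow> 'i \<Rightarrow> nat \<Rightarrow> nat \<Rightarrow> 'h conjugate \<Rightarrow> 'h conjugate"
  where "contragredient G R H V \<alpha> i j = transpose_op H (rep_of G V (R (irr G \<alpha> i j)))"

end

theory Submission
  imports Defs "HOL-Library.Function_Algebras" "HOL-Computational_Algebra.Fundamental_Theorem_Algebra"
begin

text \<open>
  The trivial corepresentation is contained in \<open>U\<close> tensor \<open>V\<close> iff there is a nonzero vector
  \<open>\<xi>\<close> with \<open>\<Sum>\<^sub>k (U\<^sub>i\<^sub>k \<otimes> V\<^sub>k\<^sub>j) \<xi> = \<delta>\<^sub>i\<^sub>j \<xi>\<close> for every irreducible. Such a vector is a Hilbert-Schmidt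
  operator between \<open>H\<^sub>U\<close> and the conjugate of \<open>H\<^sub>V\<close>, and its invariance says that this operator
  intertwines \<open>U\<close> with a twisted contragredient of \<open>V\<close>. The twist is the difference between the
  antipode and the unitary antipode, which is governed by the modular matrices \<open>F = P\<^sup>2\<close> with
  \<open>\<kappa>\<^sup>2(u) F = F u\<close>. Both parts of the theorem rest on showing that the twist is invisible.

  In the first part it is invisible because \<open>W\<close> is finite-dimensional: the trace of a
  finite-dimensional representation, together with the antipode relation
  \<open>\<Sum>\<^sub>k \<kappa>\<^sup>2(u\<^sub>k\<^sub>i) u\<^sub>k\<^sub>j* = \<delta>\<^sub>i\<^sub>j\<close>, forces \<open>F\<close> to commute with the image of \<open>u\<close>
  (\<open>matrix_rep_modular_commute\<close>, by equality in the Cauchy-Schwarz inequality). Then the sum of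
  \<open>e\<^sub>j \<otimes> conj e\<^sub>j\<close> over an orthonormal basis of the space of \<open>W\<close> is invariant
  (\<open>common_subcorep_invariant_vector\<close>).

  In the second part unimodularity is of Kac type: left and right invariance of a Haar measure of
  the dual determine its density on each block through the two orthogonality relations of the Haar
  functional, and equality of the two densities makes \<open>F\<^sup>2\<close>, hence \<open>F\<close>, commute with \<open>u\<close>
  (\<open>unimodular_kac\<close>). The operator \<open>T = Y* Y\<close> made from the Hilbert-Schmidt operator \<open>Y\<close> of \<open>\<xi>\<close>
  then commutes with \<open>U\<close>. It is compact and nonzero, so it has a finite-dimensional eigenspace for
  a positive eigenvalue, and \<open>Y\<close> is a multiple of an isometric intertwiner from that eigenspace to
  the contragredient of \<open>V\<close> (\<open>invariant_vector_common_subcorep\<close>).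

  Two bodies of theory come first. On the algebraic side the coefficients of the irreducibles are
  shown to be a linear basis, by complete reducibility and Schur's lemma, both of which come from
  orthogonal projections onto invariant subspaces of coordinate spaces. On the analytic side there
  are the Riesz representation theorem, adjoints, the tensor product of bounded operators, and the
  compactness of the operator defined by a vector of a tensor product.
\<close>

interpretation cv: vector_space "scaleC :: complex \<Rightarrow> 'a \<Rightarrow> 'a::complex_vector"
  by (rule vector_space_scaleC)

section \<open>Finite-dimensional linear algebra\<close>

instantiation "fun" :: (type, complex_vector) complex_vector
begin
definition "scaleC c f = (\<lambda>x. c *\<^sub>C f x)"
instance
  by standard (auto simp: scaleC_fun_def fun_eq_iff scaleC_add_right scaleC_add_left
      scaleC_scaleC scaleC_one)
end

lemma scaleC_complex [simp]: "c *\<^sub>C (x::complex) = c * x"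
  by (rule scaleC_complex_def)

lemma scaleC_fun_apply [simp]: "(c *\<^sub>C f) x = c *\<^sub>C f x"
  by (simp add: scaleC_fun_def)

lemma sum_fun_apply: "(\<Sum>i\<in>A. f i) x = (\<Sum>i\<in>A. f i x)"
  by (induction A rule: infinite_finite_induct) auto

lemma sum_rotate:
  "(\<Sum>k\<in>A. \<Sum>j\<in>B. \<Sum>i\<in>C. g i j k) = (\<Sum>i\<in>C. \<Sum>j\<in>B. \<Sum>k\<in>A. g i j k)"
proof -
  have "(\<Sum>k\<in>A. \<Sum>j\<in>B. \<Sum>i\<in>C. g i j k) = (\<Sum>k\<in>A. \<Sum>i\<in>C. \<Sum>j\<in>B. g i j k)"
    by (rule sum.cong[OF refl], rule sum.swap)
  also have "\<dots> = (\<Sum>i\<in>C. \<Sum>k\<in>A. \<Sum>j\<in>B. g i j k)" by (rule sum.swap)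
  also have "\<dots> = (\<Sum>i\<in>C. \<Sum>j\<in>B. \<Sum>k\<in>A. g i j k)"
    by (rule sum.cong[OF refl], rule sum.swap)
  finally show ?thesis .
qed

lemma linear_relation:
  fixes v :: "nat \<Rightarrow> 'v::complex_vector"
  assumes "finite B" "\<And>i. i \<le> card B \<Longrightarrow> v i \<in> cspan B"
  obtains c where "(\<Sum>i\<le>card B. c i *\<^sub>C v i) = 0" "\<exists>i\<le>card B. c i \<noteq> 0"
proof (cases "inj_on v {..card B}")
  case True
  have "cv.dependent (v ` {..card B})"
  proof (rule ccontr)
    assume "cv.independent (v ` {..card B})"
    then have "card (v ` {..card B}) \<le> card B"
      using cv.independent_span_bound[OF assms(1), of "v ` {..card B}"] assms(2) by auto
    then show False using True by (simp add: card_image)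
  qed
  then obtain u where u: "\<exists>w\<in>v ` {..card B}. u w \<noteq> 0" "(\<Sum>w\<in>v ` {..card B}. u w *\<^sub>C w) = 0"
    by (auto simp: cv.dependent_finite)
  show ?thesis
    using u by (intro that[of "\<lambda>i. u (v i)"]) (auto simp: sum.reindex[OF True])
next
  case False
  then obtain i j where ij: "i \<le> card B" "j \<le> card B" "i \<noteq> j" "v i = v j"
    by (auto simp: inj_on_def)
  let ?c = "\<lambda>k. if k = i then 1 else if k = j then -1 else 0 :: complex"
  have "(\<Sum>k\<le>card B. ?c k *\<^sub>C v k) = (\<Sum>k\<in>{i, j}. ?c k *\<^sub>C v k)"
    using ij by (intro sum.mono_neutral_right) auto
  also have "\<dots> = 0" using ij by simp
  finally show ?thesis using ij by (intro that[of ?c]) auto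
qed

text \<open>Over an algebraically closed field a vector is annihilated by a polynomial in the operator,
  and this polynomial splits into linear factors, one of which must be singular.\<close>

lemma eigenvector_exists:
  fixes T :: "'v::complex_vector \<Rightarrow> 'v"
  assumes N: "csubspace N" "finite B" "N \<subseteq> cspan B" and w: "w \<in> N" "w \<noteq> 0"
    and T: "\<And>x. x \<in> N \<Longrightarrow> T x \<in> N" "\<And>x y. T (x + y) = T x + T y" "\<And>c x. T (c *\<^sub>C x) = c *\<^sub>C T x"
  shows "\<exists>c. \<exists>x\<in>N. x \<noteq> 0 \<and> T x = c *\<^sub>C x"
proof (rule ccontr)
  assume no: "\<not> ?thesis"
  define ev where "ev M p = (\<Sum>i<M. coeff p i *\<^sub>C (T ^^ i) w)" for M p
  have TN: "(T ^^ i) w \<in> N" for i by (induction i) (use w T in auto)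
  have evN: "ev M p \<in> N" for M p
    unfolding ev_def by (intro cv.subspace_sum cv.subspace_scale N TN)
  have T0: "T 0 = 0" using T(3)[of 0 0] by simp
  have Tsum: "T (\<Sum>i\<in>A. f i) = (\<Sum>i\<in>A. T (f i))" for f and A :: "nat set"
    by (induction A rule: infinite_finite_induct) (auto simp: T T0)
  have step: "ev (Suc M) ([:-z, 1:] * q) = T (ev M q) - z *\<^sub>C ev M q" if "degree q < M" for M z q
  proof -
    have "ev (Suc M) ([:-z, 1:] * q) =
        (\<Sum>i<Suc M. (- z * coeff q i) *\<^sub>C (T ^^ i) w) + (\<Sum>i<Suc M. coeff (pCons 0 q) i *\<^sub>C (T ^^ i) w)"
      by (simp add: ev_def flip: sum.distrib) (simp add: algebra_simps cv.scale_left_distrib cv.scale_left_diff_distrib sum_subtractf sum_negf sum.distrib)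
    also have "(\<Sum>i<Suc M. (- z * coeff q i) *\<^sub>C (T ^^ i) w) = - (z *\<^sub>C ev M q)"
      using that by (simp add: ev_def coeff_eq_0 cv.scale_sum_right sum_negf)
    also have "(\<Sum>i<Suc M. coeff (pCons 0 q) i *\<^sub>C (T ^^ i) w) = (\<Sum>i<M. coeff q i *\<^sub>C (T ^^ Suc i) w)"
      by (simp only: sum.lessThan_Suc_shift) simp
    also have "\<dots> = T (ev M q)"
      by (simp add: ev_def Tsum T)
    finally show ?thesis by simp
  qed
  have nz: "degree p < M \<Longrightarrow> p \<noteq> 0 \<Longrightarrow> ev M p \<noteq> 0" for M p
  proof (induction M arbitrary: p)
    case (Suc M)
    show ?case
    proof (cases "degree p = 0")
      case True
      then obtain a where p: "p = [:a:]" by (metis degree_eq_zeroE)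
      have "ev (Suc M) p = a *\<^sub>C w"
        by (simp only: ev_def p sum.lessThan_Suc_shift) simp
      then show ?thesis using w Suc.prems p by simp
    next
      case False
      then have "\<not> constant (poly p)" by (simp add: constant_degree)
      then obtain z where "poly p z = 0" using fundamental_theorem_of_algebra by blast
      then obtain q where q: "p = [:-z, 1:] * q" by (auto simp: poly_eq_0_iff_dvd)
      with Suc.prems have q0: "q \<noteq> 0" by auto
      then have "degree p = Suc (degree q)"
        unfolding q by (subst degree_mult_eq) auto
      with Suc.prems have dq: "degree q < M" by simp
      have "ev M q \<noteq> 0" using Suc.IH[OF dq q0] .
      then have "T (ev M q) \<noteq> z *\<^sub>C ev M q" using no evN by blast
      then show ?thesis unfolding q step[OF dq] by simp
    qed
  qed simp
  obtain c where c: "(\<Sum>i\<le>card B. c i *\<^sub>C (T ^^ i) w) = 0" "\<exists>i\<le>card B. c i \<noteq> 0"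
    using linear_relation[OF N(2), of "\<lambda>i. (T ^^ i) w"] TN N(3) by (auto simp: subset_iff)
  define p where "p = (\<Sum>i\<le>card B. monom (c i) i)"
  have cp: "coeff p i = (if i \<le> card B then c i else 0)" for i
    by (simp add: p_def coeff_sum)
  then have "p \<noteq> 0" using c(2) by (metis coeff_0)
  moreover have "degree p < Suc (card B)"
    by (metis cp leI less_Suc_eq_le le_degree not_less_eq coeff_0 leading_coeff_0_iff \<open>p \<noteq> 0\<close>)
  ultimately have "ev (Suc (card B)) p \<noteq> 0" using nz by blast
  moreover have "ev (Suc (card B)) p = 0"
    unfolding ev_def lessThan_Suc_atMost using c(1) by (simp add: cp)
  ultimately show False by simp
qed

text \<open>Definiteness is required on \<open>S\<close> only. Thus the functions that are supported on a finite
  index set are an instance, although the form is degenerate on the type of all functions.\<close>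

locale inner_space =
  fixes S :: "'v::complex_vector set" and ip :: "'v \<Rightarrow> 'v \<Rightarrow> complex"
  assumes subspace_S: "csubspace S"
    and ip_add: "ip x (y + z) = ip x y + ip x z"
    and ip_scale: "ip x (c *\<^sub>C y) = c * ip x y"
    and ip_cnj: "ip x y = cnj (ip y x)"
    and ip_ge_0: "0 \<le> Re (ip x x)"
    and ip_eq_0: "x \<in> S \<Longrightarrow> ip x x = 0 \<Longrightarrow> x = 0"
begin

definition orthonormal :: "nat \<Rightarrow> (nat \<Rightarrow> 'v) \<Rightarrow> bool"
  where "orthonormal r e \<longleftrightarrow> (\<forall>k<r. e k \<in> S \<and> (\<forall>l<r. ip (e k) (e l) = (if k = l then 1 else 0)))"

lemma orthonormalD:
  assumes "orthonormal r e" "k < r"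
  shows "e k \<in> S" "l < r \<Longrightarrow> ip (e k) (e l) = (if k = l then 1 else 0)"
  using assms by (auto simp: orthonormal_def)

lemma ip_0: "ip x 0 = 0"
  using ip_scale[of x 0 0] by simp

lemma ip_sum: "ip x (\<Sum>i\<in>A. f i) = (\<Sum>i\<in>A. ip x (f i))"
  by (induction A rule: infinite_finite_induct) (auto simp: ip_0 ip_add)

lemma ip_diff: "ip x (y - z) = ip x y - ip x z"
  using ip_add[of x y "- z"] ip_scale[of x "-1" z] by simp

lemma ip_expansion:
  assumes "orthonormal r e" "l < r"
  shows "ip (e l) (\<Sum>k<r. c k *\<^sub>C e k) = c l"
proof -
  have "ip (e l) (\<Sum>k<r. c k *\<^sub>C e k) = (\<Sum>k<r. if k = l then c k else 0)"
    unfolding ip_sum ip_scale using assms by (intro sum.cong) (auto simp: orthonormal_def)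
  then show ?thesis using assms by simp
qed

lemma orthonormal_length:
  assumes "orthonormal r e" "finite B" "\<And>k. k < r \<Longrightarrow> e k \<in> cspan B"
  shows "r \<le> card B"
proof (rule ccontr)
  assume "\<not> r \<le> card B"
  then have r: "card B < r" by simp
  with assms(3) have "\<And>i. i \<le> card B \<Longrightarrow> e i \<in> cspan B" by simp
  then obtain c where c: "(\<Sum>i\<le>card B. c i *\<^sub>C e i) = 0" "\<exists>i\<le>card B. c i \<noteq> 0"
    using linear_relation[OF assms(2)] by metis
  then obtain l where l: "l \<le> card B" "c l \<noteq> 0" by auto
  have "ip (e l) (\<Sum>i\<le>card B. c i *\<^sub>C e i) = c l"
    unfolding lessThan_Suc_atMost[symmetric] using assms(1) l r
    by (intro ip_expansion) (auto simp: orthonormal_def)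
  with c l show False by (simp add: ip_0)
qed

text \<open>An orthonormal family of maximal length is a basis, as otherwise the normalised residual of
  some vector extends it.\<close>

lemma orthonormal_basis_exists:
  assumes N: "csubspace N" "N \<subseteq> S"
    and bound: "\<forall>r e. orthonormal r e \<and> (\<forall>k<r. e k \<in> N) \<longrightarrow> r \<le> m"
  obtains r e where "orthonormal r e" "\<forall>k<r. e k \<in> N" "\<forall>x\<in>N. x = (\<Sum>k<r. ip (e k) x *\<^sub>C e k)"
proof -
  define P where "P r \<longleftrightarrow> (\<exists>e. orthonormal r e \<and> (\<forall>k<r. e k \<in> N))" for r
  have P0: "P 0" by (auto simp: P_def orthonormal_def)
  have Pm: "P r \<Longrightarrow> r \<le> m" for r using bound by (auto simp: P_def)
  define r where "r = Greatest P"
  have "P r" unfolding r_def using P0 Pm by (rule GreatestI_nat)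
  then obtain e where e: "orthonormal r e" "\<forall>k<r. e k \<in> N" by (auto simp: P_def)
  have max: "\<not> P (Suc r)" using Greatest_le_nat[of P "Suc r" m] Pm by (auto simp: r_def)
  have "x = (\<Sum>k<r. ip (e k) x *\<^sub>C e k)" if x: "x \<in> N" for x
  proof (rule ccontr)
    assume neq: "x \<noteq> (\<Sum>k<r. ip (e k) x *\<^sub>C e k)"
    define y where "y = x - (\<Sum>k<r. ip (e k) x *\<^sub>C e k)"
    have yN: "y \<in> N" unfolding y_def
      using e by (intro cv.subspace_diff cv.subspace_sum cv.subspace_scale N x) auto
    have "y \<noteq> 0" using neq by (simp add: y_def)
    then have "ip y y \<noteq> 0" using ip_eq_0 yN N by blast
    moreover have yr: "ip y y = of_real (Re (ip y y))"
      using ip_cnj[of y y] by (simp add: complex_eq_iff)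
    ultimately have pos: "Re (ip y y) > 0" using ip_ge_0[of y] by (metis less_eq_real_def of_real_0)
    have orth: "ip (e k) y = 0" "ip y (e k) = 0" if "k < r" for k
    proof -
      show "ip (e k) y = 0" unfolding y_def by (simp add: ip_diff ip_expansion[OF e(1) that])
      then show "ip y (e k) = 0" using ip_cnj[of y "e k"] by simp
    qed
    define s where "s = complex_of_real (1 / sqrt (Re (ip y y)))"
    define e' where "e' = e(r := s *\<^sub>C y)"
    have s: "s * (cnj s * ip y y) = 1"
      unfolding s_def complex_cnj_complex_of_real
      by (subst yr) (use pos in \<open>simp flip: of_real_mult add: field_simps\<close>)
    have "ip (s *\<^sub>C y) (s *\<^sub>C y) = 1"
      using s by (simp add: ip_scale) (subst ip_cnj, simp add: ip_scale mult.commute ip_cnj[of y y, symmetric])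
    moreover have "ip (s *\<^sub>C y) (e k) = 0" "ip (e k) (s *\<^sub>C y) = 0" if "k < r" for k
      using orth[OF that] by (simp_all add: ip_scale ip_cnj[of "s *\<^sub>C y"])
    ultimately have "orthonormal (Suc r) e'"
      using e yN N cv.subspace_scale[OF N(1) yN, of s] unfolding orthonormal_def e'_def
      by (auto simp: less_Suc_eq)
    moreover have "\<forall>k<Suc r. e' k \<in> N"
      using e yN N by (auto simp: e'_def less_Suc_eq intro: cv.subspace_scale)
    ultimately show False using max by (auto simp: P_def)
  qed
  then show ?thesis using that e by blast
qed

end

section \<open>Orthogonal projections in coordinate spaces\<close>

text \<open>The space \<open>\<complex>\<^sup>n\<close> with varying \<open>n\<close>, and more generally the space of tuples over a finite index
  set \<open>I\<close>, is represented by the functions that vanish outside \<open>I\<close>.\<close>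

definition supported :: "'b set \<Rightarrow> ('b \<Rightarrow> complex) set"
  where "supported I = {x. \<forall>i. i \<notin> I \<longrightarrow> x i = 0}"

definition coord_ip :: "'b set \<Rightarrow> ('b \<Rightarrow> complex) \<Rightarrow> ('b \<Rightarrow> complex) \<Rightarrow> complex"
  where "coord_ip I x y = (\<Sum>i\<in>I. cnj (x i) * y i)"

definition mat_act :: "'b set \<Rightarrow> ('b \<Rightarrow> 'b \<Rightarrow> complex) \<Rightarrow> ('b \<Rightarrow> complex) \<Rightarrow> 'b \<Rightarrow> complex"
  where "mat_act I A x = (\<lambda>p. if p \<in> I then \<Sum>q\<in>I. A p q * x q else 0)"

lemma subspace_supported: "csubspace (supported I)"
  by (auto simp: cv.subspace_def supported_def)

lemma inner_space_coord:
  assumes "finite I"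
  shows "inner_space (supported I) (coord_ip I)"
proof
  fix x :: "'a \<Rightarrow> complex"
  have eq: "coord_ip I x x = of_real (\<Sum>i\<in>I. (cmod (x i))\<^sup>2)"
    by (simp add: coord_ip_def mult.commute flip: complex_norm_square)
  show "0 \<le> Re (coord_ip I x x)" unfolding eq by (simp add: sum_nonneg)
  assume "x \<in> supported I" "coord_ip I x x = 0"
  then have "\<forall>i\<in>I. (cmod (x i))\<^sup>2 = 0"
    unfolding eq of_real_eq_0_iff using assms by (subst (asm) sum_nonneg_eq_0_iff) auto
  then show "x = 0" using \<open>x \<in> supported I\<close> by (auto simp: supported_def fun_eq_iff)
qed (auto simp: subspace_supported coord_ip_def algebra_simps sum.distrib sum_distrib_left)

lemma supported_span:
  assumes "finite I" "x \<in> supported I"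
  shows "x \<in> cspan ((\<lambda>i j. if j = i then 1 else 0) ` I)"
proof -
  have "x = (\<Sum>i\<in>I. x i *\<^sub>C (\<lambda>j. if j = i then 1 else 0))"
    using assms by (auto simp: fun_eq_iff sum_fun_apply supported_def if_distrib cong: if_cong)
  also have "\<dots> \<in> cspan ((\<lambda>i j. if j = i then 1 else 0) ` I)"
    by (intro cv.span_sum cv.span_scale cv.span_base) auto
  finally show ?thesis .
qed

lemma coord_basis_exists:
  assumes "finite I" "csubspace N" "N \<subseteq> supported I"
  obtains r e where "inner_space.orthonormal (supported I) (coord_ip I) r e"
    "\<forall>k<r. e k \<in> N" "\<forall>x\<in>N. x = (\<Sum>k<r. coord_ip I (e k) x *\<^sub>C e k)"
proof -
  interpret inner_space "supported I" "coord_ip I" by (rule inner_space_coord) fact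
  have bound: "\<forall>r e. orthonormal r e \<and> (\<forall>k<r. e k \<in> N) \<longrightarrow>
      r \<le> card ((\<lambda>i j. if j = i then 1 else 0 :: complex) ` I)"
    using assms by (auto intro!: orthonormal_length supported_span)
  obtain r e where "orthonormal r e" "\<forall>k<r. e k \<in> N" "\<forall>x\<in>N. x = (\<Sum>k<r. coord_ip I (e k) x *\<^sub>C e k)"
    using orthonormal_basis_exists[OF assms(2,3) bound] by blast
  then show ?thesis by (rule that)
qed

lemma coord_ip_act:
  assumes "finite I"
  shows "coord_ip I x (mat_act I A y) = cnj (coord_ip I y (mat_act I (\<lambda>p q. cnj (A q p)) x))"
  unfolding coord_ip_def mat_act_def
  by (simp add: sum_distrib_left sum_distrib_right mult_ac) (rule sum.swap)

text \<open>A subspace that is invariant under a matrix and its adjoint reduces the matrix: the orthogonal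
  projection commutes with it.\<close>

lemma projection_commutes:
  fixes e :: "nat \<Rightarrow> 'b \<Rightarrow> complex"
  assumes "finite I" "N \<subseteq> supported I"
    and e: "\<And>k. k < r \<Longrightarrow> e k \<in> N" "\<And>x. x \<in> N \<Longrightarrow> x = (\<Sum>k<r. coord_ip I (e k) x *\<^sub>C e k)"
    and A: "\<And>x. x \<in> N \<Longrightarrow> mat_act I A x \<in> N"
      "\<And>x. x \<in> N \<Longrightarrow> mat_act I (\<lambda>p q. cnj (A q p)) x \<in> N"
    and pq: "p \<in> I" "q \<in> I"
  defines "prj \<equiv> \<lambda>p q. \<Sum>k<r. e k p * cnj (e k q)"
  shows "(\<Sum>s\<in>I. A p s * prj s q) = (\<Sum>s\<in>I. prj p s * A s q)"
proof -
  let ?A' = "\<lambda>p q. cnj (A q p)"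
  define m where "m k l = coord_ip I (e k) (mat_act I A (e l))" for k l
  have m': "coord_ip I (e k) (mat_act I ?A' (e l)) = cnj (m l k)" for k l
    unfolding m_def by (subst coord_ip_act[OF assms(1)]) simp
  have 1: "mat_act I A (e k) p = (\<Sum>l<r. m l k * e l p)" if "k < r" for k
    using fun_cong[OF e(2)[OF A(1)[OF e(1)[OF that]]], of p] by (simp add: sum_fun_apply m_def)
  have 2: "mat_act I ?A' (e k) q = (\<Sum>l<r. cnj (m k l) * e l q)" if "k < r" for k
    using fun_cong[OF e(2)[OF A(2)[OF e(1)[OF that]]], of q] by (simp add: sum_fun_apply m')
  have "(\<Sum>s\<in>I. A p s * prj s q) = (\<Sum>k<r. mat_act I A (e k) p * cnj (e k q))"
    unfolding prj_def mat_act_def using pq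
    by (simp add: sum_distrib_left sum_distrib_right mult_ac) (rule sum.swap)
  also have "\<dots> = (\<Sum>k<r. \<Sum>l<r. m l k * e l p * cnj (e k q))"
    by (simp add: 1 sum_distrib_right)
  also have "\<dots> = (\<Sum>l<r. \<Sum>k<r. m l k * e l p * cnj (e k q))"
    by (rule sum.swap)
  also have "\<dots> = (\<Sum>l<r. e l p * cnj (mat_act I ?A' (e l) q))"
    by (simp add: 2 sum_distrib_left mult_ac)
  also have "\<dots> = (\<Sum>s\<in>I. prj p s * A s q)"
    unfolding prj_def mat_act_def using pq
    by (simp add: sum_distrib_left sum_distrib_right mult_ac) (rule sum.swap)
  finally show ?thesis .
qed

section \<open>Matrices over a star-algebra\<close>

definition mm :: "nat \<Rightarrow> (nat \<Rightarrow> nat \<Rightarrow> 'a::semiring_0) \<Rightarrow> (nat \<Rightarrow> nat \<Rightarrow> 'a) \<Rightarrow> nat \<Rightarrow> nat \<Rightarrow> 'a"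
  where "mm n X Y = (\<lambda>i j. \<Sum>k<n. X i k * Y k j)"

definition dg :: "(nat \<Rightarrow> nat \<Rightarrow> 'a::complex_star_algebra) \<Rightarrow> nat \<Rightarrow> nat \<Rightarrow> 'a"
  where "dg X = (\<lambda>i j. star (X j i))"

text \<open>Truncating matrices to their index range turns equations between matrices, which concern
  finitely many entries, into equations between functions.\<close>

definition blk :: "nat \<Rightarrow> nat \<Rightarrow> (nat \<Rightarrow> nat \<Rightarrow> 'a::zero) \<Rightarrow> nat \<Rightarrow> nat \<Rightarrow> 'a"
  where "blk m n X = (\<lambda>i j. if i < m \<and> j < n then X i j else 0)"

definition emb :: "(nat \<Rightarrow> nat \<Rightarrow> complex) \<Rightarrow> nat \<Rightarrow> nat \<Rightarrow> 'a::complex_star_algebra"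
  where "emb P = (\<lambda>i j. P i j *\<^sub>C 1)"

abbreviation idm :: "nat \<Rightarrow> nat \<Rightarrow> nat \<Rightarrow> 'a::{zero, one}"
  where "idm n \<equiv> blk n n (\<lambda>i j. if i = j then 1 else 0)"

lemma mm_assoc: "mm n (mm m X Y) Z = mm m X (mm n Y Z)"
proof -
  have "(\<Sum>k<n. \<Sum>l<m. X i l * (Y l k * Z k j)) = (\<Sum>l<m. \<Sum>k<n. X i l * (Y l k * Z k j))" for i j
    by (rule sum.swap)
  then show ?thesis
    by (simp add: mm_def fun_eq_iff sum_distrib_left sum_distrib_right mult.assoc)
qed

lemma mm_idm_right: "mm n (blk m n X) (idm n) = (blk m n X :: nat \<Rightarrow> nat \<Rightarrow> 'a::semiring_1)"
proof -
  have "(\<Sum>k<n. blk m n X i k * idm n k j) = blk m n X i j" for i j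
  proof -
    have "(\<Sum>k<n. blk m n X i k * idm n k j) = (\<Sum>k<n. if k = j then blk m n X i j else 0)"
      by (intro sum.cong) (auto simp: blk_def)
    then show ?thesis by (auto simp: blk_def)
  qed
  then show ?thesis by (simp add: mm_def fun_eq_iff)
qed

lemma mm_idm_left: "mm n (idm n) (blk n m X) = (blk n m X :: nat \<Rightarrow> nat \<Rightarrow> 'a::semiring_1)"
proof -
  have "(\<Sum>k<n. idm n i k * blk n m X k j) = blk n m X i j" for i j
  proof -
    have "(\<Sum>k<n. idm n i k * blk n m X k j) = (\<Sum>k<n. if k = i then blk n m X i j else 0)"
      by (intro sum.cong) (auto simp: blk_def)
    then show ?thesis by (auto simp: blk_def)
  qed
  then show ?thesis by (simp add: mm_def fun_eq_iff)
qed

lemma blk_mm: "blk m n (mm k X Y) = mm k (blk m k X) (blk k n Y)"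
  by (auto simp: blk_def mm_def fun_eq_iff intro!: sum.neutral)

lemma star_0 [simp]: "star (0::'a::complex_star_algebra) = 0"
  using star_scaleC[of 0 "0::'a"] by (simp add: cv.scale_eq_0_iff)

lemma star_1 [simp]: "star (1::'a::complex_star_algebra) = 1"
  by (metis mult.right_neutral star_mult star_star)

lemma star_uminus: "star (- x) = - star (x::'a::complex_star_algebra)"
  by (metis add.right_inverse add_eq_0_iff star_0 star_add)

lemma star_diff: "star (x - y) = star x - star (y::'a::complex_star_algebra)"
  by (metis diff_conv_add_uminus star_add star_uminus)

lemma star_sum: "star (\<Sum>i\<in>A. f i) = (\<Sum>i\<in>A. star (f i :: 'a::complex_star_algebra))"
  by (induction A rule: infinite_finite_induct) (auto simp: star_add)

lemma dg_mm: "dg (mm n X Y) = mm n (dg Y) (dg X)"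
  by (simp add: dg_def mm_def star_sum star_mult)

lemma dg_dg [simp]: "dg (dg X) = X"
  by (simp add: dg_def star_star)

lemma dg_blk: "dg (blk m n X) = blk n m (dg X)"
  by (auto simp: dg_def blk_def fun_eq_iff)

lemma dg_emb: "dg (emb P) = emb (\<lambda>i j. cnj (P j i))"
  by (simp add: dg_def emb_def star_scaleC fun_eq_iff)

lemma emb_blk: "emb (blk m n P) = blk m n (emb P)"
  by (auto simp: emb_def blk_def fun_eq_iff)

lemma emb_mm: "emb (mm n P Q) = mm n (emb P) (emb Q)"
  by (simp add: emb_def mm_def scaleC_mult_left cv.scale_sum_left)

lemma emb_idm: "emb (idm n) = idm n"
  by (auto simp: emb_def blk_def fun_eq_iff)

lemma mm_emb_left: "mm n (emb P) X = (\<lambda>i j. \<Sum>k<n. P i k *\<^sub>C X k j)"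
  by (simp add: mm_def emb_def scaleC_mult_left)

lemma mm_emb_right: "mm n X (emb P) = (\<lambda>i j. \<Sum>k<n. P k j *\<^sub>C X i k)"
  by (simp add: mm_def emb_def scaleC_mult_right)

section \<open>Linear and bilinear maps on the algebraic tensor product\<close>

lemma clinear_mapD:
  assumes "clinear_map f"
  shows "f (x + y) = f x + f y" "f (c *\<^sub>C x) = c *\<^sub>C f x" "f 0 = 0"
  using assms cv.scale_zero_left[of "f 0"] cv.scale_zero_left[of 0] unfolding clinear_map_def by metis+

lemma clinear_map_sum:
  assumes "clinear_map f"
  shows "f (\<Sum>i\<in>A. g i) = (\<Sum>i\<in>A. f (g i))"
  by (induction A rule: infinite_finite_induct) (auto simp: clinear_mapD[OF assms])

lemma clinear_map_diff:
  assumes "clinear_map f"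
  shows "f (x - y) = f x - f y"
  by (metis assms clinear_mapD(1) diff_add_cancel diff_eq_eq)

lemma clinear_map_compose: "clinear_map f \<Longrightarrow> clinear_map g \<Longrightarrow> clinear_map (\<lambda>x. f (g x))"
  by (simp add: clinear_map_def)

lemma clinear_map_eq_on_span:
  assumes "clinear_map f" "clinear_map g" "\<And>x. x \<in> B \<Longrightarrow> f x = g x" "x \<in> cspan B"
  shows "f x = g x"
  using assms(4)
proof (induction rule: cv.span_induct)
  case base
  show ?case using assms(1,2) by (auto simp: cv.subspace_def clinear_mapD)
qed (use assms in auto)

lemma functionals_separate:
  fixes x y :: "'b::complex_vector"
  assumes "\<And>f :: 'b \<Rightarrow> complex. clinear_map f \<Longrightarrow> f x = f y"
  shows "x = y"
proof (rule ccontr)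
  assume "x \<noteq> y"
  define B where "B = cv.extend_basis {x - y}"
  have ind: "cv.independent {x - y}" using \<open>x \<noteq> y\<close> by (simp add: cv.dependent_single)
  have B: "cv.independent B" "cspan B = UNIV" "x - y \<in> B"
    using cv.independent_extend_basis[OF ind] cv.span_extend_basis[OF ind]
      cv.extend_basis_superset[OF ind] by (auto simp: B_def)
  define f where "f v = cv.representation B v (x - y)" for v
  have "clinear_map f" unfolding clinear_map_def f_def
    using B by (auto simp: cv.representation_add cv.representation_scale)
  then have "f x = f y" by (rule assms)
  then have "f (x - y) = 0" using clinear_map_diff[OF \<open>clinear_map f\<close>] by simp
  moreover have "f (x - y) = 1" unfolding f_def using B by (simp add: cv.representation_basis)
  ultimately show False by simp
qed

definition bilin :: "('a::complex_vector \<Rightarrow> 'a \<Rightarrow> 'b::complex_vector) \<Rightarrow> bool"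
  where "bilin \<beta> \<longleftrightarrow> (\<forall>x. clinear_map (\<lambda>y. \<beta> x y)) \<and> (\<forall>y. clinear_map (\<lambda>x. \<beta> x y))"

definition tsum :: "('a \<Rightarrow> 'a \<Rightarrow> 'b::comm_monoid_add) \<Rightarrow> ('a \<times> 'a) list \<Rightarrow> 'b"
  where "tsum \<beta> s = (\<Sum>(x, y)\<leftarrow>s. \<beta> x y)"

lemma tsum_simps [simp]:
  "tsum \<beta> [] = 0" "tsum \<beta> (p # s) = \<beta> (fst p) (snd p) + tsum \<beta> s" "tsum \<beta> (s @ s') = tsum \<beta> s + tsum \<beta> s'"
  by (auto simp: tsum_def case_prod_unfold)

lemma tsum_map: "tsum \<beta> (map (\<lambda>(x, y). (p x y, q x y)) s) = tsum (\<lambda>x y. \<beta> (p x y) (q x y)) s"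
  by (induction s) (auto simp: case_prod_unfold)

lemma tsum_upt: "tsum \<beta> (map (\<lambda>k. (p k, q k)) [0..<n]) = (\<Sum>k<n. \<beta> (p k) (q k))"
  by (induction n) auto

lemma tsum_concat:
  "tsum \<beta> (concat (map (\<lambda>(x, y). map (\<lambda>(x', y'). (p x y x' y', q x y x' y')) t) s)) =
   tsum (\<lambda>x y. tsum (\<lambda>x' y'. \<beta> (p x y x' y') (q x y x' y')) t) s"
  by (induction s) (auto simp: case_prod_unfold tsum_map[unfolded case_prod_unfold])

lemma tsum_cnj: "cnj (tsum \<beta> s) = tsum (\<lambda>x y. cnj (\<beta> x y)) s"
  by (induction s) auto

lemma clinear_map_tsum:
  assumes "clinear_map f"
  shows "f (tsum \<beta> s) = tsum (\<lambda>x y. f (\<beta> x y)) s"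
  by (induction s) (auto simp: clinear_mapD[OF assms])

text \<open>Tensors are compared through scalar bilinear forms; as linear functionals separate points,
  vector-valued bilinear maps cannot tell equal tensors apart either.\<close>

lemma tensor_eq_tsum:
  assumes "tensor_eq s t" "bilin (\<beta> :: 'a::complex_vector \<Rightarrow> 'a \<Rightarrow> 'b::complex_vector)"
  shows "tsum \<beta> s = tsum \<beta> t"
proof (rule functionals_separate)
  fix f :: "'b \<Rightarrow> complex"
  assume f: "clinear_map f"
  have "(\<forall>x. clinear_map (\<lambda>y. f (\<beta> x y))) \<and> (\<forall>y. clinear_map (\<lambda>x. f (\<beta> x y)))"
    using assms(2) f by (auto simp: bilin_def intro: clinear_map_compose[OF f])
  then have "tsum (\<lambda>x y. f (\<beta> x y)) s = tsum (\<lambda>x y. f (\<beta> x y)) t"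
    using assms(1) by (simp add: tensor_eq_def tsum_def)
  then show "f (tsum \<beta> s) = f (tsum \<beta> t)" by (simp add: clinear_map_tsum[OF f])
qed

section \<open>Counit and antipode on unitary corepresentations\<close>

locale cqg =
  fixes G :: "('a::complex_star_algebra, 'i) quantum_group"
  assumes cqg: "compact_quantum_group G"
begin

abbreviation "\<epsilon> \<equiv> counit G"
abbreviation "\<kappa> \<equiv> antipode G"
abbreviation "nd \<equiv> irr_dim G"
abbreviation "u \<equiv> irr G"

text \<open>In Sweedler notation, \<open>ce \<beta> a\<close> is \<open>\<beta>(a\<^sub>(\<^sub>1\<^sub>), a\<^sub>(\<^sub>2\<^sub>))\<close>. Working with values of bilinear maps
  avoids the choice of representing lists.\<close>

definition ce :: "('a \<Rightarrow> 'a \<Rightarrow> 'b::comm_monoid_add) \<Rightarrow> 'a \<Rightarrow> 'b"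
  where "ce \<beta> a = tsum \<beta> (comult G a)"

lemma hopf: "hopf_star_algebra G"
  using cqg by (simp add: compact_quantum_group_def)

lemma counit_linear: "clinear_map \<epsilon>" and counit_1 [simp]: "\<epsilon> 1 = 1"
  and counit_mult: "\<epsilon> (a * b) = \<epsilon> a * \<epsilon> b" and antipode_linear: "clinear_map \<kappa>"
  using hopf by (auto simp: hopf_star_algebra_def)

lemma ce_counit: "ce (\<lambda>x y. \<epsilon> x *\<^sub>C y) a = a" "ce (\<lambda>x y. \<epsilon> y *\<^sub>C x) a = a"
  and ce_antipode: "ce (\<lambda>x y. \<kappa> x * y) a = \<epsilon> a *\<^sub>C 1" "ce (\<lambda>x y. x * \<kappa> y) a = \<epsilon> a *\<^sub>C 1"
  using hopf by (auto simp: hopf_star_algebra_def ce_def tsum_def)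

lemma ce_linear:
  assumes "bilin (\<beta> :: 'a \<Rightarrow> 'a \<Rightarrow> 'b::complex_vector)"
  shows "clinear_map (ce \<beta>)"
proof -
  have "ce \<beta> (a + b) = ce \<beta> a + ce \<beta> b" for a b
  proof -
    have "tensor_eq (comult G (a + b)) (comult G a @ comult G b)"
      using hopf by (simp add: hopf_star_algebra_def)
    from tensor_eq_tsum[OF this assms] show ?thesis by (simp add: ce_def)
  qed
  moreover have "ce \<beta> (c *\<^sub>C a) = c *\<^sub>C ce \<beta> a" for c a
  proof -
    have "tensor_eq (comult G (c *\<^sub>C a)) [(c *\<^sub>C x, y). (x, y) \<leftarrow> comult G a]"
      using hopf by (simp add: hopf_star_algebra_def)
    from tensor_eq_tsum[OF this assms] have "ce \<beta> (c *\<^sub>C a) = tsum (\<lambda>x y. \<beta> (c *\<^sub>C x) y) (comult G a)"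
      by (simp add: ce_def tsum_map)
    also have "\<dots> = tsum (\<lambda>x y. c *\<^sub>C \<beta> x y) (comult G a)"
      using assms by (simp add: bilin_def clinear_map_def)
    also have "\<dots> = c *\<^sub>C ce \<beta> a"
      unfolding ce_def by (rule clinear_map_tsum[symmetric]) (simp add: clinear_map_def cv.scale_right_distrib cv.scale_left_commute)
    finally show ?thesis .
  qed
  ultimately show ?thesis by (simp add: clinear_map_def)
qed

lemma ce_mult:
  assumes "bilin (\<beta> :: 'a \<Rightarrow> 'a \<Rightarrow> 'b::complex_vector)"
  shows "ce \<beta> (a * b) = ce (\<lambda>x y. ce (\<lambda>x' y'. \<beta> (x * x') (y * y')) b) a"
proof -
  have "tensor_eq (comult G (a * b))
       [(x * x', y * y'). (x, y) \<leftarrow> comult G a, (x', y') \<leftarrow> comult G b]"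
    using hopf by (simp add: hopf_star_algebra_def)
  from tensor_eq_tsum[OF this assms] show ?thesis by (simp add: ce_def tsum_concat)
qed

lemma ce_star:
  assumes "bilin (\<beta> :: 'a \<Rightarrow> 'a \<Rightarrow> 'b::complex_vector)"
  shows "ce \<beta> (star a) = ce (\<lambda>x y. \<beta> (star x) (star y)) a"
proof -
  have "tensor_eq (comult G (star a)) [(star x, star y). (x, y) \<leftarrow> comult G a]"
    using hopf by (simp add: hopf_star_algebra_def)
  from tensor_eq_tsum[OF this assms] show ?thesis by (simp add: ce_def tsum_map)
qed

lemma ce_corep:
  assumes "unitary_corep G n v" "i < n" "j < n" "bilin (\<beta> :: 'a \<Rightarrow> 'a \<Rightarrow> 'b::complex_vector)"
  shows "ce \<beta> (v i j) = (\<Sum>k<n. \<beta> (v i k) (v k j))"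
proof -
  have "tensor_eq (comult G (v i j)) [(v i k, v k j). k \<leftarrow> [0..<n]]"
    using assms by (simp add: unitary_corep_def)
  from tensor_eq_tsum[OF this assms(4)] show ?thesis by (simp add: ce_def tsum_upt)
qed

text \<open>The form \<open>\<lambda>x y. cnj (\<phi> (\<beta> (star x) (star y)))\<close> is bilinear again, hence the formula for the
  coefficients of a corepresentation passes to their adjoints.\<close>

lemma ce_corep_star:
  assumes v: "unitary_corep G n v" "i < n" "j < n" and \<beta>: "bilin (\<beta> :: 'a \<Rightarrow> 'a \<Rightarrow> 'b::complex_vector)"
  shows "ce \<beta> (star (v i j)) = (\<Sum>k<n. \<beta> (star (v i k)) (star (v k j)))"
proof (rule functionals_separate)
  fix f :: "'b \<Rightarrow> complex"
  assume f: "clinear_map f"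
  define \<gamma> where "\<gamma> x y = cnj (f (\<beta> (star x) (star y)))" for x y
  have "bilin \<gamma>"
    using \<beta> unfolding \<gamma>_def bilin_def clinear_map_def
    by (auto simp: star_add star_scaleC clinear_mapD[OF f])
  then have "ce \<gamma> (v i j) = (\<Sum>k<n. \<gamma> (v i k) (v k j))"
    by (rule ce_corep[OF v])
  moreover have "cnj (ce \<gamma> (v i j)) = ce (\<lambda>x y. cnj (\<gamma> x y)) (v i j)"
    unfolding ce_def by (rule tsum_cnj)
  ultimately have "ce (\<lambda>x y. f (\<beta> (star x) (star y))) (v i j) = (\<Sum>k<n. f (\<beta> (star (v i k)) (star (v k j))))"
    by (simp add: \<gamma>_def)
  then show "f (ce \<beta> (star (v i j))) = f (\<Sum>k<n. \<beta> (star (v i k)) (star (v k j)))"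
    by (simp add: ce_star[OF \<beta>] clinear_map_sum[OF f]) (simp add: ce_def clinear_map_tsum[OF f])
qed

lemma unitary_blk:
  assumes "unitary_corep G n v"
  shows "mm n (dg (blk n n v)) (blk n n v) = idm n" "mm n (blk n n v) (dg (blk n n v)) = idm n"
proof -
  have "mm n (dg (blk n n v)) (blk n n v) = blk n n (mm n (dg v) v)"
    "mm n (blk n n v) (dg (blk n n v)) = blk n n (mm n v (dg v))"
    by (simp_all add: blk_mm dg_blk)
  then show "mm n (dg (blk n n v)) (blk n n v) = idm n" "mm n (blk n n v) (dg (blk n n v)) = idm n"
    using assms by (auto simp: unitary_corep_def mm_def dg_def blk_def fun_eq_iff)
qed

lemma one_neq_zero: "(1::'a) \<noteq> 0"
  by simp

lemma bilin_counit: "bilin (\<lambda>x y. \<epsilon> x *\<^sub>C y)"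
  using counit_linear by (auto simp: bilin_def clinear_map_def cv.scale_right_distrib cv.scale_left_distrib cv.scale_left_commute)

lemma bilin_antipode: "bilin (\<lambda>x y. \<kappa> x * y)" "bilin (\<lambda>x y. x * \<kappa> y)"
  using antipode_linear
  by (auto simp: bilin_def clinear_map_def algebra_simps scaleC_mult_left scaleC_mult_right)

lemma emb_inj: "c *\<^sub>C (1::'a) = d *\<^sub>C 1 \<Longrightarrow> c = d"
  using one_neq_zero cv.scale_right_imp_eq by blast

text \<open>The matrix \<open>\<epsilon>(v)\<close> satisfies \<open>\<epsilon>(v) v = v\<close>, and \<open>v\<close> is invertible.\<close>

lemma counit_corep:
  assumes v: "unitary_corep G n v" and ij: "i < n" "j < n"
  shows "\<epsilon> (v i j) = (if i = j then 1 else 0)"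
proof -
  let ?v = "blk n n v" and ?E = "blk n n (\<lambda>i j. \<epsilon> (v i j))"
  have "(\<Sum>k<n. \<epsilon> (v i k) *\<^sub>C v k j) = v i j" if "i < n" "j < n" for i j
    using ce_corep[OF v that bilin_counit] ce_counit by metis
  then have "mm n (emb ?E) ?v = ?v"
    unfolding mm_emb_left by (auto simp: blk_def fun_eq_iff intro!: sum.neutral)
  then have "mm n (mm n (emb ?E) ?v) (dg ?v) = idm n" by (simp add: unitary_blk[OF v])
  then have "emb ?E = (idm n :: nat \<Rightarrow> nat \<Rightarrow> 'a)"
    by (simp add: mm_assoc unitary_blk[OF v] emb_blk mm_idm_right)
  then have "emb ?E i j = (idm n :: nat \<Rightarrow> nat \<Rightarrow> 'a) i j" by simp
  then have "\<epsilon> (v i j) *\<^sub>C (1::'a) = (if i = j then 1 else 0) *\<^sub>C 1"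
    using ij by (simp add: emb_def blk_def split: if_splits)
  then show ?thesis by (rule emb_inj)
qed

text \<open>Both \<open>\<kappa>(v)\<close> and \<open>v*\<close> are inverse to \<open>v\<close>.\<close>

lemma antipode_corep:
  assumes v: "unitary_corep G n v" and ij: "i < n" "j < n"
  shows "\<kappa> (v i j) = star (v j i)"
proof -
  let ?v = "blk n n v" and ?K = "blk n n (\<lambda>i j. \<kappa> (v i j))"
  have "(\<Sum>k<n. \<kappa> (v i k) * v k j) = (if i = j then 1 else 0)" if "i < n" "j < n" for i j
    using ce_corep[OF v that bilin_antipode(1)] ce_antipode(1)[of "v i j"] counit_corep[OF v that]
    by (auto split: if_splits)
  then have "mm n ?K ?v = idm n"
    unfolding blk_mm[symmetric] by (auto simp: blk_def fun_eq_iff mm_def)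
  then have "mm n (mm n ?K ?v) (dg ?v) = dg ?v" by (simp add: dg_blk mm_idm_left)
  then have "?K = dg ?v" by (simp add: mm_assoc unitary_blk[OF v] mm_idm_right)
  then have "?K i j = dg ?v i j" by simp
  then show ?thesis using ij by (simp add: blk_def dg_def)
qed

text \<open>Apply the homomorphism \<open>\<epsilon>\<close> to \<open>v* v = 1\<close>.\<close>

lemma counit_star_corep:
  assumes v: "unitary_corep G n v" and ij: "i < n" "j < n"
  shows "\<epsilon> (star (v i j)) = (if i = j then 1 else 0)"
proof -
  have "(\<Sum>k<n. star (v k j) * v k i) = (if i = j then 1 else 0)"
    using v ij by (simp add: unitary_corep_def)
  then have "\<epsilon> (\<Sum>k<n. star (v k j) * v k i) = (if i = j then 1 else 0)"
    using clinear_mapD(3)[OF counit_linear] by simp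
  then have "(\<Sum>k<n. \<epsilon> (star (v k j)) * (if k = i then 1 else 0)) = (if i = j then 1 else 0)"
    using ij by (simp add: clinear_map_sum[OF counit_linear] counit_mult counit_corep[OF v])
  moreover have "(\<Sum>k<n. \<epsilon> (star (v k j)) * (if k = i then 1 else 0)) = \<epsilon> (star (v i j))"
    using ij by (simp add: if_distrib cong: if_cong)
  ultimately show ?thesis by auto
qed

text \<open>The two halves of the antipode axiom for the conjugate of a unitary corepresentation. As
  \<open>star (v i j) = \<kappa> (v j i)\<close>, they say how \<open>\<kappa> \<circ> \<kappa>\<close> differs from the identity.\<close>

lemma antipode_conjugate:
  assumes v: "unitary_corep G n v" and ij: "i < n" "j < n"
  shows "(\<Sum>k<n. \<kappa> (\<kappa> (v k i)) * star (v k j)) = (if i = j then 1 else 0)"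
    and "(\<Sum>k<n. star (v i k) * \<kappa> (\<kappa> (v j k))) = (if i = j then 1 else 0)"
proof -
  have "(\<Sum>k<n. \<kappa> (star (v i k)) * star (v k j)) = \<epsilon> (star (v i j)) *\<^sub>C 1"
    using ce_corep_star[OF v ij bilin_antipode(1)] ce_antipode(1)[of "star (v i j)"] by simp
  then show "(\<Sum>k<n. \<kappa> (\<kappa> (v k i)) * star (v k j)) = (if i = j then 1 else 0)"
    using ij by (simp add: counit_star_corep[OF v] antipode_corep[OF v])
  have "(\<Sum>k<n. star (v i k) * \<kappa> (star (v k j))) = \<epsilon> (star (v i j)) *\<^sub>C 1"
    using ce_corep_star[OF v ij bilin_antipode(2)] ce_antipode(2)[of "star (v i j)"] by simp
  then show "(\<Sum>k<n. star (v i k) * \<kappa> (\<kappa> (v j k))) = (if i = j then 1 else 0)"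
    using ij by (simp add: counit_star_corep[OF v] antipode_corep[OF v])
qed

end

section \<open>Schur's lemma and the Peter-Weyl basis\<close>

context cqg
begin

lemma irr_irreducible: "irreducible_corep G (nd \<alpha>) (u \<alpha>)"
  using cqg by (simp add: compact_quantum_group_def)

lemma irr_unitary: "unitary_corep G (nd \<alpha>) (u \<alpha>)"
  using irr_irreducible by (simp add: irreducible_corep_def)

lemma intertwines_mm:
  "intertwines n v n' v' T \<longleftrightarrow>
   mm n (emb (blk n' n T)) (blk n n v) = mm n' (blk n' n' v') (emb (blk n' n T :: nat \<Rightarrow> nat \<Rightarrow> complex))"
  (is "_ \<longleftrightarrow> ?L = ?R")
proof -
  have 1: "?L = blk n' n (\<lambda>i j. \<Sum>k<n. T i k *\<^sub>C v k j)"
    unfolding mm_emb_left by (auto simp: blk_def fun_eq_iff intro!: sum.neutral)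
  have 2: "?R = blk n' n (\<lambda>i j. \<Sum>k<n'. T k j *\<^sub>C v' i k)"
    unfolding mm_emb_right by (auto simp: blk_def fun_eq_iff intro!: sum.neutral)
  show ?thesis unfolding 1 2 intertwines_def by (auto simp: blk_def fun_eq_iff)
qed

lemma schur_scalar:
  assumes "intertwines (nd \<alpha>) (u \<alpha>) (nd \<alpha>) (u \<alpha>) T"
  obtains c where "\<And>i j. i < nd \<alpha> \<Longrightarrow> j < nd \<alpha> \<Longrightarrow> T i j = (if i = j then c else 0)"
  using assms irr_irreducible[of \<alpha>] by (auto simp: irreducible_corep_def)

lemma intertwines_adjoint:
  assumes v: "unitary_corep G n v" "unitary_corep G n' v'" and T: "intertwines n v n' v' T"
  shows "intertwines n' v' n v (\<lambda>i j. cnj (T j i))"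
proof -
  let ?v = "blk n n v" and ?v' = "blk n' n' v'" and ?T = "emb (blk n' n T) :: nat \<Rightarrow> nat \<Rightarrow> 'a"
  have bT: "?T = blk n' n (emb T)" by (rule emb_blk)
  have eq: "mm n ?T ?v = mm n' ?v' ?T" using T by (simp add: intertwines_mm)
  have "mm n' (dg ?v') ?T = mm n' (dg ?v') (mm n ?T (mm n ?v (dg ?v)))"
    by (simp add: unitary_blk[OF v(1)] bT mm_idm_right)
  also have "\<dots> = mm n' (dg ?v') (mm n (mm n' ?v' ?T) (dg ?v))"
    by (simp add: eq[symmetric] mm_assoc)
  also have "\<dots> = mm n (mm n' (mm n' (dg ?v') ?v') ?T) (dg ?v)"
    by (simp add: mm_assoc)
  also have "\<dots> = mm n ?T (dg ?v)"
    by (simp add: unitary_blk[OF v(2)] bT mm_idm_left)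
  finally have "dg (mm n' (dg ?v') ?T) = dg (mm n ?T (dg ?v))" by simp
  then have "mm n' (dg ?T) ?v' = mm n ?v (dg ?T)" by (simp add: dg_mm)
  moreover have "dg ?T = emb (blk n n' (\<lambda>i j. cnj (T j i)))"
    by (auto simp: dg_def star_scaleC blk_def emb_def fun_eq_iff)
  ultimately show ?thesis by (simp add: intertwines_mm)
qed

lemma intertwines_comp:
  fixes v :: "nat \<Rightarrow> nat \<Rightarrow> 'a"
  assumes "intertwines n v n' v' T" "intertwines n' v' n'' v'' S"
  shows "intertwines n v n'' v'' (mm n' S T)"
proof -
  let ?S = "emb (blk n'' n' S) :: nat \<Rightarrow> nat \<Rightarrow> 'a" and ?T = "emb (blk n' n T) :: nat \<Rightarrow> nat \<Rightarrow> 'a"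
  have eq: "emb (blk n'' n (mm n' S T)) = mm n' ?S ?T"
    by (simp add: blk_mm emb_mm)
  have "mm n (mm n' ?S ?T) (blk n n v) = mm n'' (blk n'' n'' v'') (mm n' ?S ?T)"
    using assms by (metis intertwines_mm mm_assoc)
  then show ?thesis by (simp add: intertwines_mm eq)
qed

text \<open>A nonzero intertwiner \<open>T\<close> between irreducibles would be a multiple of an equivalence, because
  \<open>T* T\<close> and \<open>T T*\<close> are scalar.\<close>

lemma schur_zero:
  assumes T: "intertwines (nd \<alpha>) (u \<alpha>) (nd \<beta>) (u \<beta>) T" and "\<alpha> \<noteq> \<beta>"
    and ij: "i < nd \<beta>" "j < nd \<alpha>"
  shows "T i j = 0"
proof (rule ccontr)
  assume nz: "T i j \<noteq> 0"
  define S where "S = (\<lambda>i j. cnj (T j i))"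
  have S: "intertwines (nd \<beta>) (u \<beta>) (nd \<alpha>) (u \<alpha>) S"
    unfolding S_def by (rule intertwines_adjoint[OF irr_unitary irr_unitary T])
  obtain c where c: "\<And>i j. i < nd \<alpha> \<Longrightarrow> j < nd \<alpha> \<Longrightarrow> mm (nd \<beta>) S T i j = (if i = j then c else 0)"
    using schur_scalar[OF intertwines_comp[OF T S]] by metis
  obtain d where d: "\<And>i j. i < nd \<beta> \<Longrightarrow> j < nd \<beta> \<Longrightarrow> mm (nd \<alpha>) T S i j = (if i = j then d else 0)"
    using schur_scalar[OF intertwines_comp[OF S T]] by metis
  have "c = (\<Sum>k<nd \<beta>. cnj (T k j) * T k j)"
    using c[OF ij(2) ij(2)] by (simp add: mm_def S_def)
  also have "\<dots> = of_real (\<Sum>k<nd \<beta>. (cmod (T k j))\<^sup>2)"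
    by (simp add: mult.commute flip: complex_norm_square)
  finally have "c = of_real (\<Sum>k<nd \<beta>. (cmod (T k j))\<^sup>2)" .
  moreover have "(cmod (T i j))\<^sup>2 \<le> (\<Sum>k<nd \<beta>. (cmod (T k j))\<^sup>2)"
    using ij by (intro member_le_sum) auto
  moreover have "(cmod (T i j))\<^sup>2 > 0" using nz by simp
  ultimately have c0: "c \<noteq> 0" by (metis of_real_eq_0_iff linorder_not_le)
  have "mm (nd \<alpha>) T (mm (nd \<beta>) S T) i j = mm (nd \<beta>) (mm (nd \<alpha>) T S) T i j"
    by (simp add: mm_assoc)
  moreover have "mm (nd \<alpha>) T (mm (nd \<beta>) S T) i j = (\<Sum>k<nd \<alpha>. if k = j then T i k * c else 0)"
    unfolding mm_def[of "nd \<alpha>"] using ij by (intro sum.cong) (auto simp: c)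
  moreover have "mm (nd \<beta>) (mm (nd \<alpha>) T S) T i j = (\<Sum>k<nd \<beta>. if k = i then d * T k j else 0)"
    unfolding mm_def[of "nd \<beta>" "mm (nd \<alpha>) T S"] using ij by (intro sum.cong) (auto simp: d)
  ultimately have "T i j * c = d * T i j" using ij by simp
  then have cd: "d = c" using nz by simp
  have "equivalent_coreps (nd \<alpha>) (u \<alpha>) (nd \<beta>) (u \<beta>)"
    unfolding equivalent_coreps_def
  proof (rule exI[of _ T], rule exI[of _ "\<lambda>i j. S i j / c"], intro conjI T allI impI)
    fix i j assume "i < nd \<beta>" "j < nd \<beta>"
    then show "(\<Sum>k<nd \<alpha>. T i k * (S k j / c)) = (if i = j then 1 else 0)"
      using d[of i j] c0 cd by (auto simp: mm_def simp flip: sum_divide_distrib)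
  next
    fix i j assume "i < nd \<alpha>" "j < nd \<alpha>"
    then show "(\<Sum>k<nd \<beta>. S i k / c * T k j) = (if i = j then 1 else 0)"
      using c[of i j] c0 by (auto simp: mm_def simp flip: sum_divide_distrib)
  qed
  then have "\<alpha> = \<beta>" using cqg by (simp add: compact_quantum_group_def)
  then show False using \<open>\<alpha> \<noteq> \<beta>\<close> by simp
qed

definition coef :: "'i \<times> nat \<times> nat \<Rightarrow> 'a"
  where "coef = (\<lambda>(\<alpha>, i, j). u \<alpha> i j)"

definition coef_index :: "('i \<times> nat \<times> nat) set"
  where "coef_index = {(\<alpha>, i, j). i < nd \<alpha> \<and> j < nd \<alpha>}"

text \<open>The adjoint of a functional with respect to the involution of the dual algebra.\<close>

definition dual_star :: "('a \<Rightarrow> complex) \<Rightarrow> 'a \<Rightarrow> complex"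
  where "dual_star f a = cnj (f (star (\<kappa> a)))"

lemma dual_star_linear: "clinear_map f \<Longrightarrow> clinear_map (dual_star f)"
  using antipode_linear by (auto simp: clinear_map_def dual_star_def star_add star_scaleC)

lemma dual_star_corep:
  "unitary_corep G n v \<Longrightarrow> i < n \<Longrightarrow> j < n \<Longrightarrow> dual_star f (v i j) = cnj (f (v j i))"
  by (simp add: dual_star_def antipode_corep star_star)

text \<open>The relations among finitely many coefficients form a subspace of a coordinate space. The
  dual algebra acts on the first matrix index, and this action is closed under adjoints, so that the
  orthogonal projection onto the relations is an intertwiner in that index. By Schur's lemma its
  columns are relations among the entries of a single row of a single irreducible; the counit
  shows that there are none.\<close>

lemma coef_relation_trivial:
  assumes F: "finite F" and I: "I = {(\<alpha>, i, j). \<alpha> \<in> F \<and> i < nd \<alpha> \<and> j < nd \<alpha>}"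
    and c: "c \<in> supported I" "(\<Sum>p\<in>I. c p *\<^sub>C coef p) = 0"
  shows "c = 0"
proof -
  have IS: "I = Sigma F (\<lambda>\<alpha>. {..<nd \<alpha>} \<times> {..<nd \<alpha>})" by (auto simp: I)
  have finI: "finite I" unfolding IS using F by auto
  have nested: "(\<Sum>p\<in>I. g p) = (\<Sum>\<alpha>\<in>F. \<Sum>i<nd \<alpha>. \<Sum>j<nd \<alpha>. g (\<alpha>, i, j))"
    for g :: "_ \<Rightarrow> 'z::comm_monoid_add"
  proof -
    have "(\<Sum>\<alpha>\<in>F. \<Sum>i<nd \<alpha>. \<Sum>j<nd \<alpha>. g (\<alpha>, i, j)) =
        (\<Sum>\<alpha>\<in>F. \<Sum>ij\<in>{..<nd \<alpha>} \<times> {..<nd \<alpha>}. g (\<alpha>, ij))"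
      by (simp add: sum.cartesian_product case_prod_unfold)
    then show ?thesis unfolding IS using F by (simp add: sum.Sigma case_prod_unfold)
  qed
  define N where "N = {x \<in> supported I. (\<Sum>p\<in>I. x p *\<^sub>C coef p) = 0}"
  have N: "csubspace N"
  proof -
    have "(\<Sum>p\<in>I. (a *\<^sub>C x) p *\<^sub>C coef p) = a *\<^sub>C (\<Sum>p\<in>I. x p *\<^sub>C coef p)" for a x
      by (simp add: cv.scale_sum_right)
    moreover have "(\<Sum>p\<in>I. (x + y) p *\<^sub>C coef p) = (\<Sum>p\<in>I. x p *\<^sub>C coef p) + (\<Sum>p\<in>I. y p *\<^sub>C coef p)" for x y
      by (simp add: cv.scale_left_distrib sum.distrib)
    ultimately show ?thesis
      using subspace_supported[of I] by (simp add: N_def cv.subspace_def)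
  qed
  have NI: "N \<subseteq> supported I" by (auto simp: N_def)
  \<comment> \<open>the action of the functional \<open>f\<close> of the dual algebra, as a matrix on index triples\<close>
  define A where "A f = (\<lambda>(\<alpha>, k, j :: nat) (\<beta>, i, j'). if \<beta> = \<alpha> \<and> j' = j then f (u \<alpha> i k) else 0)"
    for f :: "'a \<Rightarrow> complex"
  have row: "(\<Sum>q\<in>I. A f (\<alpha>, k, j) q * x q) = (\<Sum>i<nd \<alpha>. f (u \<alpha> i k) * x (\<alpha>, i, j))"
    if "(\<alpha>, k, j) \<in> I" for f \<alpha> k j x
  proof -
    have "(\<Sum>q\<in>I. A f (\<alpha>, k, j) q * x q) = (\<Sum>q\<in>(\<lambda>i. (\<alpha>, i, j)) ` {..<nd \<alpha>}. A f (\<alpha>, k, j) q * x q)"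
      using that finI by (intro sum.mono_neutral_right) (auto simp: A_def I split: if_splits)
    then show ?thesis by (simp add: sum.reindex inj_on_def A_def)
  qed
  have col: "(\<Sum>q\<in>I. x q * A f q (\<beta>, i, j)) = (\<Sum>k<nd \<beta>. f (u \<beta> i k) * x (\<beta>, k, j))"
    if "(\<beta>, i, j) \<in> I" for f \<beta> i j x
  proof -
    have "(\<Sum>q\<in>I. x q * A f q (\<beta>, i, j)) = (\<Sum>q\<in>(\<lambda>k. (\<beta>, k, j)) ` {..<nd \<beta>}. x q * A f q (\<beta>, i, j))"
      using that finI by (intro sum.mono_neutral_right) (auto simp: A_def I split: if_splits)
    then show ?thesis by (simp add: sum.reindex inj_on_def A_def mult.commute)
  qed
  have adj: "mat_act I (\<lambda>p q. cnj (A f q p)) x = mat_act I (A (dual_star f)) x" for f x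
    unfolding mat_act_def
    by (auto simp: fun_eq_iff A_def I dual_star_corep[OF irr_unitary] intro!: sum.cong)
  have inv: "mat_act I (A f) x \<in> N" if f: "clinear_map f" and x: "x \<in> N" for f x
  proof -
    have bf: "bilin (\<lambda>y z. f y *\<^sub>C z)"
      using f by (auto simp: bilin_def clinear_map_def cv.scale_right_distrib cv.scale_left_distrib cv.scale_left_commute)
    have "(\<Sum>p\<in>I. mat_act I (A f) x p *\<^sub>C coef p) =
        (\<Sum>\<alpha>\<in>F. \<Sum>k<nd \<alpha>. \<Sum>j<nd \<alpha>. (\<Sum>i<nd \<alpha>. f (u \<alpha> i k) * x (\<alpha>, i, j)) *\<^sub>C u \<alpha> k j)"
      unfolding nested
    proof (intro sum.cong refl)
      fix \<alpha> k j
      assume "\<alpha> \<in> F" "k \<in> {..<nd \<alpha>}" "j \<in> {..<nd \<alpha>}"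
      then have "(\<alpha>, k, j) \<in> I" by (auto simp: I)
      then show "mat_act I (A f) x (\<alpha>, k, j) *\<^sub>C coef (\<alpha>, k, j) =
          (\<Sum>i<nd \<alpha>. f (u \<alpha> i k) * x (\<alpha>, i, j)) *\<^sub>C u \<alpha> k j"
        by (simp add: mat_act_def row coef_def)
    qed
    also have "\<dots> = (\<Sum>\<alpha>\<in>F. \<Sum>k<nd \<alpha>. \<Sum>j<nd \<alpha>. \<Sum>i<nd \<alpha>. x (\<alpha>, i, j) *\<^sub>C f (u \<alpha> i k) *\<^sub>C u \<alpha> k j)"
      by (simp add: cv.scale_sum_left mult.commute)
    also have "\<dots> = (\<Sum>\<alpha>\<in>F. \<Sum>i<nd \<alpha>. \<Sum>j<nd \<alpha>. \<Sum>k<nd \<alpha>. x (\<alpha>, i, j) *\<^sub>C f (u \<alpha> i k) *\<^sub>C u \<alpha> k j)"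
      by (rule sum.cong[OF refl], rule sum_rotate)
    also have "\<dots> = (\<Sum>\<alpha>\<in>F. \<Sum>i<nd \<alpha>. \<Sum>j<nd \<alpha>. x (\<alpha>, i, j) *\<^sub>C ce (\<lambda>y z. f y *\<^sub>C z) (u \<alpha> i j))"
      by (intro sum.cong refl) (simp add: ce_corep[OF irr_unitary _ _ bf] cv.scale_sum_right)
    also have "\<dots> = (\<Sum>p\<in>I. x p *\<^sub>C ce (\<lambda>y z. f y *\<^sub>C z) (coef p))"
      by (simp add: nested coef_def)
    also have "\<dots> = ce (\<lambda>y z. f y *\<^sub>C z) (\<Sum>p\<in>I. x p *\<^sub>C coef p)"
      by (simp add: clinear_map_sum[OF ce_linear[OF bf]] clinear_mapD[OF ce_linear[OF bf]])
    also have "\<dots> = 0" using x by (simp add: N_def clinear_mapD[OF ce_linear[OF bf]])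
    finally show ?thesis by (simp add: N_def supported_def mat_act_def)
  qed
  obtain r :: nat and e where e': "\<forall>k<r. e k \<in> N" "\<forall>x\<in>N. x = (\<Sum>k<r. coord_ip I (e k) x *\<^sub>C e k)"
    by (rule coord_basis_exists[OF finI N NI], rule that)
  have e: "\<And>k. k < r \<Longrightarrow> e k \<in> N" using e'(1) by simp
  note e = e bspec[OF e'(2)]
  define prj where "prj p q = (\<Sum>k<r. e k p * cnj (e k q))" for p q
  have comm: "(\<Sum>s\<in>I. A f p s * prj s q) = (\<Sum>s\<in>I. prj p s * A f s q)"
    if "clinear_map f" "p \<in> I" "q \<in> I" for f p q
    unfolding prj_def
  proof (rule projection_commutes[OF finI NI e _ _ that(2,3)])
    show "mat_act I (A f) x \<in> N" if "x \<in> N" for x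
      using inv[OF \<open>clinear_map f\<close> that] .
    show "mat_act I (\<lambda>p q. cnj (A f q p)) x \<in> N" if "x \<in> N" for x
      unfolding adj using inv[OF dual_star_linear[OF \<open>clinear_map f\<close>] that] .
  qed
  have T: "intertwines (nd \<alpha>) (u \<alpha>) (nd \<beta>) (u \<beta>) (\<lambda>i k. prj (\<alpha>, k, j) (\<beta>, i, j'))"
    if \<alpha>\<beta>: "\<alpha> \<in> F" "\<beta> \<in> F" "j < nd \<alpha>" "j' < nd \<beta>" for \<alpha> \<beta> j j'
    unfolding intertwines_def
  proof (intro allI impI, rule functionals_separate)
    fix i k and f :: "'a \<Rightarrow> complex"
    assume ik: "i < nd \<beta>" "k < nd \<alpha>" and f: "clinear_map f"
    have p: "(\<alpha>, k, j) \<in> I" and q: "(\<beta>, i, j') \<in> I" using \<alpha>\<beta> ik by (auto simp: I)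
    show "f (\<Sum>l<nd \<alpha>. prj (\<alpha>, l, j) (\<beta>, i, j') *\<^sub>C u \<alpha> l k) =
        f (\<Sum>l<nd \<beta>. prj (\<alpha>, k, j) (\<beta>, l, j') *\<^sub>C u \<beta> i l)"
      using comm[OF f p q] unfolding row[OF p] col[OF q]
      by (simp add: clinear_map_sum[OF f] clinear_mapD[OF f] mult.commute)
  qed
  have other: "prj (\<alpha>, k, j) (\<beta>, i, j') = 0"
    if "\<alpha> \<noteq> \<beta>" "(\<alpha>, k, j) \<in> I" "(\<beta>, i, j') \<in> I" for \<alpha> k j \<beta> i j'
    using schur_zero[OF T that(1)] that(2,3) by (auto simp: I)
  have scalar: "prj (\<beta>, k, j) (\<beta>, i, j') = (if k = i then prj (\<beta>, l, j) (\<beta>, l, j') else 0)"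
    if lt: "\<beta> \<in> F" "k < nd \<beta>" "j < nd \<beta>" "i < nd \<beta>" "j' < nd \<beta>" "l < nd \<beta>" for \<beta> k j i j' l
  proof -
    obtain c where "\<And>i k. i < nd \<beta> \<Longrightarrow> k < nd \<beta> \<Longrightarrow>
        prj (\<beta>, k, j) (\<beta>, i, j') = (if i = k then c else 0)"
      using schur_scalar[OF T[OF lt(1) lt(1) lt(3) lt(5)]] by blast
    then show ?thesis using lt by auto
  qed
  \<comment> \<open>apply the counit to the relation given by the column at \<open>(\<beta>, i, j')\<close>\<close>
  have diag: "prj (\<beta>, i, i) (\<beta>, i, j') = 0" if q: "(\<beta>, i, j') \<in> I" for \<beta> i j'
  proof -
    have lt: "\<beta> \<in> F" "i < nd \<beta>" "j' < nd \<beta>" using q by (auto simp: I)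
    let ?q = "(\<beta>, i, j')"
    have "(\<lambda>p. prj p ?q) = (\<Sum>l<r. cnj (e l ?q) *\<^sub>C e l)"
      by (simp add: prj_def fun_eq_iff sum_fun_apply mult.commute)
    also have "\<dots> \<in> N" using e(1) by (intro cv.subspace_sum cv.subspace_scale N) auto
    finally have "(\<Sum>p\<in>I. prj p ?q *\<^sub>C coef p) = 0" by (simp add: N_def)
    then have "0 = (\<Sum>p\<in>I. prj p ?q * \<epsilon> (coef p))"
      using clinear_map_sum[OF counit_linear, of "\<lambda>p. prj p ?q *\<^sub>C coef p" I]
      by (simp add: clinear_mapD[OF counit_linear])
    also have "\<dots> = (\<Sum>\<alpha>\<in>F. \<Sum>k<nd \<alpha>. \<Sum>j<nd \<alpha>. if k = j then prj (\<alpha>, k, j) ?q else 0)"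
      unfolding nested by (intro sum.cong refl) (auto simp: coef_def counit_corep[OF irr_unitary])
    also have "\<dots> = (\<Sum>\<alpha>\<in>F. \<Sum>k<nd \<alpha>. prj (\<alpha>, k, k) ?q)"
      by (intro sum.cong refl) simp
    also have "\<dots> = (\<Sum>\<alpha>\<in>F. if \<alpha> = \<beta> then \<Sum>k<nd \<beta>. prj (\<beta>, k, k) ?q else 0)"
      using other q by (intro sum.cong refl) (auto simp: I intro!: sum.neutral)
    also have "\<dots> = (\<Sum>k<nd \<beta>. prj (\<beta>, k, k) ?q)"
      using F lt by simp
    also have "\<dots> = (\<Sum>k<nd \<beta>. if k = i then prj (\<beta>, i, i) ?q else 0)"
    proof (rule sum.cong[OF refl])
      fix k assume "k \<in> {..<nd \<beta>}"
      with lt scalar[of \<beta> k k i j' i]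
      show "prj (\<beta>, k, k) ?q = (if k = i then prj (\<beta>, i, i) ?q else 0)" by (cases "k = i") auto
    qed
    also have "\<dots> = prj (\<beta>, i, i) ?q" using lt by simp
    finally show ?thesis by simp
  qed
  have zero: "prj p q = 0" if pq: "p \<in> I" "q \<in> I" for p q
  proof -
    obtain \<alpha> k j \<beta> i j' where p: "p = (\<alpha>, k, j)" and q: "q = (\<beta>, i, j')" by (metis prod_cases3)
    show ?thesis
    proof (cases "\<alpha> = \<beta>")
      case True
      then have lt: "\<beta> \<in> F" "k < nd \<beta>" "j < nd \<beta>" "i < nd \<beta>" "j' < nd \<beta>"
        using pq by (auto simp: p q I)
      have "prj (\<beta>, j, j) (\<beta>, j, j') = 0" using lt by (intro diag) (simp add: I)
      then show ?thesis using scalar[OF lt lt(3)] by (simp add: p q True)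
    qed (use other pq in \<open>auto simp: p q\<close>)
  qed
  have cN: "c \<in> N" using c by (simp add: N_def)
  show "c = 0"
  proof
    fix p
    show "c p = 0 p"
    proof (cases "p \<in> I")
      case True
      have "c p = (\<Sum>k<r. coord_ip I (e k) c * e k p)"
        using fun_cong[OF e(2)[OF cN], of p] by (simp add: sum_fun_apply)
      also have "\<dots> = (\<Sum>q\<in>I. prj p q * c q)"
        by (simp add: coord_ip_def prj_def sum_distrib_left sum_distrib_right mult_ac) (rule sum.swap)
      also have "\<dots> = 0" using zero True by simp
      finally show ?thesis by simp
    next
      case False
      then have "c p = 0" using c(1) unfolding supported_def by blast
      then show ?thesis by simp
    qed
  qed
qed

lemma coef_inj: "inj_on coef coef_index"
proof (rule inj_onI, rule ccontr)
  fix p q assume p: "p \<in> coef_index" and q: "q \<in> coef_index" and eq: "coef p = coef q" and ne: "p \<noteq> q"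
  define I where "I = {(\<alpha>, i, j). \<alpha> \<in> {fst p, fst q} \<and> i < nd \<alpha> \<and> j < nd \<alpha>}"
  have pI: "p \<in> I" "q \<in> I" using p q by (auto simp: I_def coef_index_def)
  have IS: "I = Sigma {fst p, fst q} (\<lambda>\<alpha>. {..<nd \<alpha>} \<times> {..<nd \<alpha>})" by (auto simp: I_def)
  have finI: "finite I" unfolding IS by (intro finite_SigmaI) auto
  \<comment> \<open>equal coefficients at different indices would be a nontrivial relation\<close>
  define c where "c r = (if r = p then 1 else if r = q then -1 else 0 :: complex)" for r
  have "(\<Sum>r\<in>I. c r *\<^sub>C coef r) = (\<Sum>r\<in>{p, q}. c r *\<^sub>C coef r)"
    using finI pI by (intro sum.mono_neutral_right) (auto simp: c_def)
  also have "\<dots> = 0" using ne eq by (simp add: c_def)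
  finally have "c = 0"
    using pI by (intro coef_relation_trivial[OF _ I_def]) (auto simp: supported_def c_def)
  then have "c p = 0" by simp
  then show False by (simp add: c_def)
qed

lemma coef_independent: "cv.independent (coef ` coef_index)"
proof
  assume "cv.dependent (coef ` coef_index)"
  then obtain t w where t: "finite t" "t \<subseteq> coef ` coef_index" "(\<Sum>v\<in>t. w v *\<^sub>C v) = 0" "\<exists>v\<in>t. w v \<noteq> 0"
    unfolding cv.dependent_explicit by blast
  define J where "J = {p \<in> coef_index. coef p \<in> t}"
  have Jt: "coef ` J = t" using t(2) by (auto simp: J_def)
  have injJ: "inj_on coef J" using coef_inj by (auto simp: J_def inj_on_def)
  have finJ: "finite J" using finite_imageD[OF _ injJ] Jt t(1) by simp
  define F where "F = fst ` J"
  have finF: "finite F" using finJ by (simp add: F_def)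
  define I where "I = {(\<alpha>, i, j). \<alpha> \<in> F \<and> i < nd \<alpha> \<and> j < nd \<alpha>}"
  have IS: "I = Sigma F (\<lambda>\<alpha>. {..<nd \<alpha>} \<times> {..<nd \<alpha>})" by (auto simp: I_def)
  have finI: "finite I" unfolding IS using finF by (intro finite_SigmaI) auto
  have JI: "J \<subseteq> I" by (force simp: J_def I_def F_def coef_index_def)
  define c where "c p = (if p \<in> J then w (coef p) else 0)" for p
  have "(\<Sum>p\<in>I. c p *\<^sub>C coef p) = (\<Sum>p\<in>J. c p *\<^sub>C coef p)"
    using finI JI by (intro sum.mono_neutral_right) (auto simp: c_def)
  also have "\<dots> = (\<Sum>v\<in>t. w v *\<^sub>C v)"
    unfolding Jt[symmetric] by (simp add: sum.reindex[OF injJ] c_def)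
  finally have "c = 0"
    using JI t(3) by (intro coef_relation_trivial[OF finF I_def]) (auto simp: supported_def c_def)
  then have "\<forall>p\<in>J. w (coef p) = 0" by (metis c_def zero_fun_apply)
  then show False using t(4) Jt by auto
qed

text \<open>An orthonormal family \<open>e\<close> whose span reduces \<open>v\<close> gives the subcorepresentation
  \<open>E* v E\<close>, where \<open>E\<close> is the isometry with columns \<open>e\<close>.\<close>

lemma subcorep_of_projection:
  assumes v: "unitary_corep G n v"
    and on: "\<And>k l. k < r \<Longrightarrow> l < r \<Longrightarrow> (\<Sum>i<n. cnj (e k i) * e l i) = (if k = l then 1 else 0)"
    and comm: "\<And>i j. i < n \<Longrightarrow> j < n \<Longrightarrow>
      (\<Sum>s<n. (\<Sum>k<r. e k i * cnj (e k s)) *\<^sub>C v s j) = (\<Sum>s<n. (\<Sum>k<r. e k s * cnj (e k j)) *\<^sub>C v i s)"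
  obtains v' where "unitary_corep G r v'"
    "\<forall>i<n. \<forall>j<n. (\<Sum>s<n. (\<Sum>k<r. e k i * cnj (e k s)) *\<^sub>C v s j) \<in> cspan {v' a b | a b. a < r \<and> b < r}"
proof -
  define E :: "nat \<Rightarrow> nat \<Rightarrow> 'a" where "E = emb (blk n r (\<lambda>i a. e a i))"
  define prj where "prj i j = (\<Sum>k<r. e k i * cnj (e k j))" for i j
  define p :: "nat \<Rightarrow> nat \<Rightarrow> 'a" where "p = emb (blk n n prj)"
  define V where "V = blk n n v"
  define v' where "v' = mm n (dg E) (mm n V E)"
  have bE: "E = blk n r (emb (\<lambda>i a. e a i))" by (simp add: E_def emb_blk)
  have EE: "mm n (dg E) E = idm r"
  proof -
    have "mm n (\<lambda>i j. cnj (blk n r (\<lambda>i a. e a i) j i)) (blk n r (\<lambda>i a. e a i)) = idm r"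
      using on by (auto simp: mm_def blk_def fun_eq_iff intro!: sum.neutral)
    then show ?thesis unfolding E_def dg_emb emb_mm[symmetric] by (simp add: emb_idm)
  qed
  have pE': "mm r E (dg E) = p"
  proof -
    have "mm r (blk n r (\<lambda>i a. e a i)) (\<lambda>i j. cnj (blk n r (\<lambda>i a. e a i) j i)) = blk n n prj"
      by (auto simp: mm_def blk_def fun_eq_iff prj_def intro!: sum.neutral)
    then show ?thesis unfolding E_def p_def dg_emb emb_mm[symmetric] by simp
  qed
  have pV: "mm n p V = mm n V p"
  proof -
    have "mm n p V = blk n n (\<lambda>i j. \<Sum>s<n. prj i s *\<^sub>C v s j)"
      unfolding p_def V_def mm_emb_left by (auto simp: blk_def fun_eq_iff intro!: sum.neutral)
    moreover have "mm n V p = blk n n (\<lambda>i j. \<Sum>s<n. prj s j *\<^sub>C v i s)"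
      unfolding p_def V_def mm_emb_right by (auto simp: blk_def fun_eq_iff intro!: sum.neutral)
    ultimately show ?thesis using comm by (auto simp: blk_def fun_eq_iff prj_def)
  qed
  have EdE: "mm r E (mm n (dg E) X) = mm n p X" for X
    by (simp add: mm_assoc flip: pE')
  have pVX: "mm n p (mm n V X) = mm n V (mm n p X)" for X
    by (simp only: mm_assoc[symmetric] pV)
  have pE: "mm n p E = E" unfolding pE'[symmetric] mm_assoc EE
    by (simp add: bE mm_idm_right)
  have iE: "mm n (idm n) E = E" by (simp add: bE mm_idm_left)
  have uV: "mm n (dg V) (mm n V X) = mm n (idm n) X" "mm n V (mm n (dg V) X) = mm n (idm n) X" for X
    using unitary_blk[OF v] by (simp_all add: V_def flip: mm_assoc)
  have dv': "dg v' = mm n (dg E) (mm n (dg V) E)"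
    by (simp add: v'_def dg_mm mm_assoc)
  have "mm r (dg v') v' = idm r"
    unfolding dv' unfolding v'_def by (simp only: mm_assoc EdE pVX pE uV iE EE)
  moreover have "mm r v' (dg v') = idm r"
    unfolding dv' unfolding v'_def by (simp only: mm_assoc EdE uV iE EE pE pVX[symmetric])
  ultimately have un: "(\<Sum>k<r. star (v' k i) * v' k j) = (if i = j then 1 else 0)"
    "(\<Sum>k<r. v' i k * star (v' j k)) = (if i = j then 1 else 0)" if "i < r" "j < r" for i j
    using that by (auto simp: fun_eq_iff mm_def dg_def blk_def)
  have v'_eq: "v' a b = (\<Sum>i<n. \<Sum>j<n. (cnj (e a i) * e b j) *\<^sub>C v i j)" if "a < r" "b < r" for a b
    using that
    by (simp add: v'_def E_def dg_emb mm_emb_left mm_emb_right) (simp add: blk_def V_def cv.scale_sum_right)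
  have Ev': "(\<Sum>c<r. e c k *\<^sub>C v' c b) = (\<Sum>j<n. e b j *\<^sub>C v k j)" if "k < n" "b < r" for k b
  proof -
    have "mm r E v' = mm n V E" by (simp only: v'_def EdE pVX pE)
    then have "mm r E v' k b = mm n V E k b" by simp
    then show ?thesis using that
      by (simp add: E_def mm_emb_left mm_emb_right) (simp add: blk_def V_def)
  qed
  have "tensor_eq (comult G (v' a b)) [(v' a c, v' c b). c \<leftarrow> [0..<r]]" if ab: "a < r" "b < r" for a b
    unfolding tensor_eq_def
  proof (intro allI impI)
    fix \<beta> :: "'a \<Rightarrow> 'a \<Rightarrow> complex"
    assume "(\<forall>x. clinear_map (\<lambda>y. \<beta> x y)) \<and> (\<forall>y. clinear_map (\<lambda>x. \<beta> x y))"
    then have \<beta>: "bilin \<beta>" "\<And>x. clinear_map (\<lambda>y. \<beta> x y)" "\<And>y. clinear_map (\<lambda>x. \<beta> x y)"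
      by (auto simp: bilin_def)
    have "ce \<beta> (v' a b) = (\<Sum>i<n. \<Sum>j<n. \<Sum>k<n. (cnj (e a i) * e b j) * \<beta> (v i k) (v k j))"
      unfolding v'_eq[OF ab]
      by (simp add: clinear_map_sum[OF ce_linear[OF \<beta>(1)]] clinear_mapD[OF ce_linear[OF \<beta>(1)]]
          ce_corep[OF v _ _ \<beta>(1)] sum_distrib_left)
    also have "\<dots> = (\<Sum>i<n. \<Sum>k<n. \<Sum>j<n. cnj (e a i) * (e b j * \<beta> (v i k) (v k j)))"
      by (rule sum.cong[OF refl], subst sum.swap) (simp add: mult.assoc)
    also have "\<dots> = (\<Sum>i<n. \<Sum>k<n. cnj (e a i) * \<beta> (v i k) (\<Sum>j<n. e b j *\<^sub>C v k j))"
      by (simp add: clinear_map_sum[OF \<beta>(2)] clinear_mapD[OF \<beta>(2)] sum_distrib_left)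
    also have "\<dots> = (\<Sum>i<n. \<Sum>k<n. cnj (e a i) * \<beta> (v i k) (\<Sum>c<r. e c k *\<^sub>C v' c b))"
      using ab by (simp add: Ev')
    also have "\<dots> = (\<Sum>i<n. \<Sum>k<n. \<Sum>c<r. cnj (e a i) * (e c k * \<beta> (v i k) (v' c b)))"
      by (simp add: clinear_map_sum[OF \<beta>(2)] clinear_mapD[OF \<beta>(2)] sum_distrib_left)
    also have "\<dots> = (\<Sum>c<r. \<Sum>k<n. \<Sum>i<n. cnj (e a i) * (e c k * \<beta> (v i k) (v' c b)))"
      by (rule sum_rotate)
    also have "\<dots> = (\<Sum>c<r. \<Sum>i<n. \<Sum>k<n. cnj (e a i) * (e c k * \<beta> (v i k) (v' c b)))"
      by (rule sum.cong[OF refl], rule sum.swap)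
    also have "\<dots> = (\<Sum>c<r. \<beta> (v' a c) (v' c b))"
      using ab by (simp add: v'_eq[of a] clinear_map_sum[OF \<beta>(3)] clinear_mapD[OF \<beta>(3)] mult.assoc)
    finally show "(\<Sum>(x, y)\<leftarrow>comult G (v' a b). \<beta> x y) =
        (\<Sum>(x, y)\<leftarrow>[(v' a c, v' c b). c \<leftarrow> [0..<r]]. \<beta> x y)"
      unfolding tsum_def[symmetric] tsum_upt by (simp add: ce_def)
  qed
  with un have "unitary_corep G r v'" by (simp add: unitary_corep_def)
  moreover have "(\<Sum>s<n. prj i s *\<^sub>C v s j) \<in> cspan {v' a b | a b. a < r \<and> b < r}"
    if "i < n" "j < n" for i j
  proof -
    have "mm n p p = mm r (mm n p E) (dg E)" by (simp only: mm_assoc pE')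
    then have pp: "mm n p p = p" by (simp only: pE pE')
    have "mm n p V = mm n (mm n p p) V" by (simp only: pp)
    also have "\<dots> = mm n p (mm n V p)" by (simp only: mm_assoc pV)
    also have "\<dots> = mm r E (mm r v' (dg E))"
      by (simp only: v'_def mm_assoc pE'[symmetric])
    finally have "mm n p V i j = mm r E (mm r v' (dg E)) i j" by simp
    moreover have "mm n p V i j = (\<Sum>s<n. prj i s *\<^sub>C v s j)"
      using that by (simp add: p_def mm_emb_left) (simp add: blk_def V_def)
    moreover have "mm r E (mm r v' (dg E)) i j = (\<Sum>a<r. e a i *\<^sub>C (\<Sum>b<r. cnj (e b j) *\<^sub>C v' a b))"
      using that by (simp add: E_def dg_emb mm_emb_left mm_emb_right) (simp add: blk_def)
    moreover have "(\<Sum>a<r. e a i *\<^sub>C (\<Sum>b<r. cnj (e b j) *\<^sub>C v' a b)) \<in> cspan {v' a b | a b. a < r \<and> b < r}"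
      by (intro cv.span_sum cv.span_scale cv.span_base) auto
    ultimately show ?thesis by simp
  qed
  ultimately show ?thesis using that by (simp add: prj_def)
qed

text \<open>Invariance under all functionals includes invariance under the adjoints, because the dual
  algebra is closed under \<open>dual_star\<close>; so the subspace reduces \<open>v\<close>.\<close>

lemma reducing_subspace_subcorep:
  assumes v: "unitary_corep G n v" and N: "csubspace N" "N \<subseteq> supported {..<n}"
    and inv: "\<And>f x. clinear_map f \<Longrightarrow> x \<in> N \<Longrightarrow> mat_act {..<n} (\<lambda>p q. f (v p q)) x \<in> N"
  obtains r and e :: "nat \<Rightarrow> nat \<Rightarrow> complex" and v'
  where "\<forall>k<r. e k \<in> N" "\<forall>k<r. coord_ip {..<n} (e k) (e k) = 1"
    "\<forall>x\<in>N. x = (\<Sum>k<r. coord_ip {..<n} (e k) x *\<^sub>C e k)"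
    "unitary_corep G r v'"
    "\<forall>i<n. \<forall>j<n. (\<Sum>s<n. (\<Sum>k<r. e k i * cnj (e k s)) *\<^sub>C v s j) \<in> cspan {v' a b | a b. a < r \<and> b < r}"
proof -
  let ?I = "{..<n}"
  interpret inner_space "supported ?I" "coord_ip ?I" by (rule inner_space_coord) simp
  obtain r :: nat and e where on: "orthonormal r e"
    and eN: "\<forall>k<r. e k \<in> N" and ex: "\<forall>x\<in>N. x = (\<Sum>k<r. coord_ip ?I (e k) x *\<^sub>C e k)"
    by (rule coord_basis_exists[OF finite_lessThan N], rule that)
  have eN': "\<And>k. k < r \<Longrightarrow> e k \<in> N" using eN by simp
  have on': "(\<Sum>i<n. cnj (e k i) * e l i) = (if k = l then 1 else 0)" if "k < r" "l < r" for k l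
    using orthonormalD(2)[OF on that] by (simp add: coord_ip_def)
  have comm: "(\<Sum>s<n. (\<Sum>k<r. e k i * cnj (e k s)) *\<^sub>C v s j) = (\<Sum>s<n. (\<Sum>k<r. e k s * cnj (e k j)) *\<^sub>C v i s)"
    if ij: "i < n" "j < n" for i j
  proof (rule functionals_separate)
    fix f :: "'a \<Rightarrow> complex" assume f: "clinear_map f"
    have adj: "mat_act ?I (\<lambda>p q. cnj (f (v q p))) x = mat_act ?I (\<lambda>p q. dual_star f (v p q)) x" for x
      by (auto simp: mat_act_def fun_eq_iff dual_star_corep[OF v] intro!: sum.cong)
    have "(\<Sum>s<n. f (v i s) * (\<Sum>k<r. e k s * cnj (e k j))) =
        (\<Sum>s<n. (\<Sum>k<r. e k i * cnj (e k s)) * f (v s j))"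
      by (rule projection_commutes[OF finite_lessThan N(2) eN' bspec[OF ex]])
        (use ij inv[OF f] inv[OF dual_star_linear[OF f]] in \<open>auto simp: adj\<close>)
    then show "f (\<Sum>s<n. (\<Sum>k<r. e k i * cnj (e k s)) *\<^sub>C v s j) =
        f (\<Sum>s<n. (\<Sum>k<r. e k s * cnj (e k j)) *\<^sub>C v i s)"
      by (simp add: clinear_map_sum[OF f] clinear_mapD[OF f] mult.commute)
  qed
  obtain v' where v': "unitary_corep G r v'"
    and sp: "\<forall>i<n. \<forall>j<n. (\<Sum>s<n. (\<Sum>k<r. e k i * cnj (e k s)) *\<^sub>C v s j) \<in> cspan {v' a b | a b. a < r \<and> b < r}"
    by (rule subcorep_of_projection[OF v on' comm])
  have "\<forall>k<r. coord_ip ?I (e k) (e k) = 1" using on' by (simp add: coord_ip_def)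
  from that[OF eN this ex v' sp] show ?thesis .
qed

lemma mat_act_mat_act:
  "mat_act I A (mat_act I B x) = mat_act I (\<lambda>p q. \<Sum>s\<in>I. A p s * B s q) x"
  unfolding mat_act_def
  by (auto simp: fun_eq_iff sum_distrib_left sum_distrib_right mult.assoc intro: sum.swap)

text \<open>A reducible corepresentation splits along an eigenspace of a non-scalar self-intertwiner and
  the orthogonal complement of that eigenspace.\<close>

lemma corep_coef_span:
  "unitary_corep G n v \<Longrightarrow> i < n \<Longrightarrow> j < n \<Longrightarrow> v i j \<in> cspan (coef ` coef_index)"
proof (induction n arbitrary: v i j rule: less_induct)
  case (less n)
  note v = less.prems(1)
  show ?case
  proof (cases "irreducible_corep G n v")
    case True
    then obtain \<alpha> where "equivalent_coreps n v (nd \<alpha>) (u \<alpha>)"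
      using cqg unfolding compact_quantum_group_def by blast
    then obtain T S where T: "intertwines n v (nd \<alpha>) (u \<alpha>) T"
      and ST: "\<forall>i<n. \<forall>j<n. (\<Sum>k<nd \<alpha>. S i k * T k j) = (if i = j then 1 else 0)"
      unfolding equivalent_coreps_def by blast
    have "v i j = (\<Sum>k<n. if k = i then v k j else 0)" using less.prems by simp
    also have "\<dots> = (\<Sum>k<n. (\<Sum>l<nd \<alpha>. S i l * T l k) *\<^sub>C v k j)"
      using less.prems by (intro sum.cong) (auto simp: ST)
    also have "\<dots> = (\<Sum>k<n. \<Sum>l<nd \<alpha>. S i l *\<^sub>C T l k *\<^sub>C v k j)"
      by (simp add: cv.scale_sum_left)
    also have "\<dots> = (\<Sum>l<nd \<alpha>. S i l *\<^sub>C (\<Sum>k<n. T l k *\<^sub>C v k j))"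
      by (subst sum.swap) (simp add: cv.scale_sum_right)
    also have "\<dots> = (\<Sum>l<nd \<alpha>. S i l *\<^sub>C (\<Sum>k<nd \<alpha>. T k j *\<^sub>C coef (\<alpha>, l, k)))"
      using T less.prems by (simp add: intertwines_def coef_def)
    also have "\<dots> \<in> cspan (coef ` coef_index)"
      by (intro cv.span_sum cv.span_scale cv.span_base) (auto simp: coef_index_def)
    finally show ?thesis .
  next
    case False
    let ?I = "{..<n}"
    interpret inner_space "supported ?I" "coord_ip ?I" by (rule inner_space_coord) simp
    obtain T where T: "intertwines n v n v T"
      and nonscalar: "\<not> (\<exists>c. \<forall>i<n. \<forall>j<n. T i j = (if i = j then c else 0))"
      using False v less.prems unfolding irreducible_corep_def by (metis gr_zeroI less_zeroE)
    define \<delta> where "\<delta> j = (\<lambda>i. if i = j then 1 else 0 :: complex)" for j :: nat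
    have \<delta>: "\<delta> j \<in> supported ?I" if "j < n" for j using that by (auto simp: \<delta>_def supported_def)
    have "\<exists>c. \<exists>x\<in>supported ?I. x \<noteq> 0 \<and> mat_act ?I T x = c *\<^sub>C x"
    proof (rule eigenvector_exists[where w = "\<delta> i"])
      show "csubspace (supported ?I)" by (rule subspace_supported)
      show "supported ?I \<subseteq> cspan ((\<lambda>i j. if j = i then 1 else 0) ` ?I)"
        using supported_span[of ?I] by blast
      show "\<delta> i \<in> supported ?I" using \<delta> less.prems by simp
      show "\<delta> i \<noteq> 0" by (auto simp: \<delta>_def fun_eq_iff)
    qed (simp_all add: mat_act_def supported_def fun_eq_iff algebra_simps sum.distrib sum_distrib_left)
    then obtain c x0 where x0: "x0 \<in> supported ?I" "x0 \<noteq> 0" "mat_act ?I T x0 = c *\<^sub>C x0" by blast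
    define N where "N = {x \<in> supported ?I. mat_act ?I T x = c *\<^sub>C x}"
    have act_add: "mat_act ?I T (x + y) = mat_act ?I T x + mat_act ?I T y"
      and act_scale: "mat_act ?I T (a *\<^sub>C x) = a *\<^sub>C mat_act ?I T x" for x y a
      by (simp_all add: mat_act_def fun_eq_iff algebra_simps sum.distrib sum_distrib_left)
    have act_0: "mat_act ?I T 0 = 0"
      by (simp add: mat_act_def fun_eq_iff)
    have N: "csubspace N"
      using subspace_supported[of ?I]
      by (simp add: N_def cv.subspace_def act_0 act_add act_scale cv.scale_right_distrib mult.commute)
    have NI: "N \<subseteq> supported ?I" by (auto simp: N_def)
    have inv: "mat_act ?I (\<lambda>p q. f (v p q)) x \<in> N" if f: "clinear_map f" and x: "x \<in> N" for f x
    proof -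
      have "(\<Sum>s<n. T p s * f (v s q)) = (\<Sum>s<n. f (v p s) * T s q)" if "p < n" "q < n" for p q
      proof -
        have "f (\<Sum>s<n. T p s *\<^sub>C v s q) = f (\<Sum>s<n. T s q *\<^sub>C v p s)"
          using T that by (simp add: intertwines_def)
        then show ?thesis by (simp add: clinear_map_sum[OF f] clinear_mapD[OF f] mult.commute)
      qed
      then have "mat_act ?I T (mat_act ?I (\<lambda>p q. f (v p q)) x) = mat_act ?I (\<lambda>p q. f (v p q)) (mat_act ?I T x)"
        unfolding mat_act_mat_act by (auto simp: mat_act_def fun_eq_iff)
      also have "\<dots> = c *\<^sub>C mat_act ?I (\<lambda>p q. f (v p q)) x"
        using x by (auto simp: N_def mat_act_def fun_eq_iff sum_distrib_left mult_ac)
      finally show ?thesis by (simp add: N_def supported_def mat_act_def)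
    qed
    define N' where "N' = {x \<in> supported ?I. \<forall>y\<in>N. coord_ip ?I y x = 0}"
    have N': "csubspace N'"
      using subspace_supported[of ?I] by (auto simp: N'_def cv.subspace_def ip_0 ip_add ip_scale)
    have N'I: "N' \<subseteq> supported ?I" by (auto simp: N'_def)
    have inv': "mat_act ?I (\<lambda>p q. f (v p q)) x \<in> N'" if f: "clinear_map f" and x: "x \<in> N'" for f x
    proof -
      have "coord_ip ?I y (mat_act ?I (\<lambda>p q. f (v p q)) x) = 0" if y: "y \<in> N" for y
      proof -
        have "mat_act ?I (\<lambda>p q. cnj (f (v q p))) y = mat_act ?I (\<lambda>p q. dual_star f (v p q)) y"
          by (auto simp: mat_act_def fun_eq_iff dual_star_corep[OF v] intro!: sum.cong)
        then have "mat_act ?I (\<lambda>p q. cnj (f (v q p))) y \<in> N"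
          using inv[OF dual_star_linear[OF f] y] by simp
        then have "coord_ip ?I (mat_act ?I (\<lambda>p q. cnj (f (v q p))) y) x = 0"
          using x by (simp add: N'_def)
        then have "coord_ip ?I x (mat_act ?I (\<lambda>p q. cnj (f (v q p))) y) = 0"
          by (subst ip_cnj) simp
        then show ?thesis by (subst coord_ip_act) simp_all
      qed
      then show ?thesis by (simp add: N'_def supported_def mat_act_def)
    qed
    obtain r e w where e: "\<forall>k<r. e k \<in> N" "\<forall>k<r. coord_ip ?I (e k) (e k) = 1"
      "\<forall>x\<in>N. x = (\<Sum>k<r. coord_ip ?I (e k) x *\<^sub>C e k)" and w: "unitary_corep G r w"
      and we: "\<forall>i<n. \<forall>j<n. (\<Sum>s<n. (\<Sum>k<r. e k i * cnj (e k s)) *\<^sub>C v s j) \<in> cspan {w a b | a b. a < r \<and> b < r}"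
      by (rule reducing_subspace_subcorep[OF v N NI inv])
    obtain r' e' w' where e': "\<forall>k<r'. e' k \<in> N'" "\<forall>k<r'. coord_ip ?I (e' k) (e' k) = 1"
      "\<forall>x\<in>N'. x = (\<Sum>k<r'. coord_ip ?I (e' k) x *\<^sub>C e' k)" and w': "unitary_corep G r' w'"
      and we': "\<forall>i<n. \<forall>j<n. (\<Sum>s<n. (\<Sum>k<r'. e' k i * cnj (e' k s)) *\<^sub>C v s j) \<in> cspan {w' a b | a b. a < r' \<and> b < r'}"
      by (rule reducing_subspace_subcorep[OF v N' N'I inv'])
    have orth: "coord_ip ?I (e' k) x = 0" if "k < r'" "x \<in> N" for k x
    proof -
      have "coord_ip ?I x (e' k) = 0" using e'(1) that by (simp add: N'_def)
      then show ?thesis by (subst ip_cnj) simp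
    qed
    have split: "x = (\<Sum>k<r. coord_ip ?I (e k) x *\<^sub>C e k) + (\<Sum>k<r'. coord_ip ?I (e' k) x *\<^sub>C e' k)"
      if x: "x \<in> supported ?I" for x
    proof -
      define y where "y = (\<Sum>k<r. coord_ip ?I (e k) x *\<^sub>C e k)"
      have yN: "y \<in> N" unfolding y_def using e(1) by (intro cv.subspace_sum cv.subspace_scale N) auto
      have "coord_ip ?I z (x - y) = 0" if z: "z \<in> N" for z
      proof -
        have zr: "coord_ip ?I x z = (\<Sum>k<r. coord_ip ?I (e k) z * coord_ip ?I x (e k))"
          by (subst bspec[OF e(3) z]) (simp add: ip_sum ip_scale)
        have "coord_ip ?I y z = (\<Sum>k<r. coord_ip ?I (e k) z * coord_ip ?I y (e k))"
          by (subst bspec[OF e(3) z]) (simp add: ip_sum ip_scale)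
        moreover have "coord_ip ?I y (e k) = coord_ip ?I x (e k)" if "k < r" for k
        proof -
          have ek: "e k = (\<Sum>l<r. coord_ip ?I (e l) (e k) *\<^sub>C e l)"
            by (rule bspec[OF e(3)]) (use e(1) that in simp)
          have "coord_ip ?I x (e k) = (\<Sum>l<r. coord_ip ?I (e l) (e k) * coord_ip ?I x (e l))"
            by (subst ek) (simp only: ip_scale ip_sum)
          also have "\<dots> = cnj (\<Sum>l<r. coord_ip ?I (e l) x * coord_ip ?I (e k) (e l))"
            unfolding cnj_sum by (intro sum.cong refl) (simp add: ip_cnj[symmetric] mult.commute)
          also have "\<dots> = coord_ip ?I y (e k)"
            unfolding y_def by (subst ip_cnj) (simp add: ip_sum ip_scale)
          finally show ?thesis ..
        qed
        ultimately have "coord_ip ?I y z = coord_ip ?I x z" unfolding zr by simp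
        then have "coord_ip ?I z y = coord_ip ?I z x" by (subst (1 2) ip_cnj) simp
        then show ?thesis by (simp add: ip_diff)
      qed
      moreover have "x - y \<in> supported ?I"
        using yN NI x by (intro cv.subspace_diff subspace_supported) auto
      ultimately have "x - y \<in> N'" by (simp add: N'_def)
      then have "x - y = (\<Sum>k<r'. coord_ip ?I (e' k) (x - y) *\<^sub>C e' k)" by (rule bspec[OF e'(3)])
      also have "\<dots> = (\<Sum>k<r'. coord_ip ?I (e' k) x *\<^sub>C e' k)"
        by (intro sum.cong refl) (simp add: ip_diff orth yN)
      finally show ?thesis by (simp add: y_def algebra_simps)
    qed
    have ip_\<delta>: "coord_ip ?I z (\<delta> j) = cnj (z j)" if "j < n" for z j
      using that by (simp add: coord_ip_def \<delta>_def if_distrib cong: if_cong)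
    have unit: "\<delta> j i = (\<Sum>k<r. e k i * cnj (e k j)) + (\<Sum>k<r'. e' k i * cnj (e' k j))" if "j < n" for i j
      using fun_cong[OF split[OF \<delta>[OF that]], of i] that
      by (simp add: sum_fun_apply ip_\<delta> mult.commute)
    \<comment> \<open>comparing traces, the sizes of the two parts add up to \<open>n\<close>\<close>
    have "of_nat n = (\<Sum>i<n. \<delta> i i)" by (simp add: \<delta>_def)
    also have "\<dots> = (\<Sum>i<n. \<Sum>k<r. e k i * cnj (e k i)) + (\<Sum>i<n. \<Sum>k<r'. e' k i * cnj (e' k i))"
      by (simp add: unit sum.distrib)
    also have "(\<Sum>i<n. \<Sum>k<r. e k i * cnj (e k i)) = (\<Sum>k<r. coord_ip ?I (e k) (e k))"
      unfolding coord_ip_def by (subst sum.swap) (simp add: mult.commute)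
    also have "(\<Sum>i<n. \<Sum>k<r'. e' k i * cnj (e' k i)) = (\<Sum>k<r'. coord_ip ?I (e' k) (e' k))"
      unfolding coord_ip_def by (subst sum.swap) (simp add: mult.commute)
    finally have "of_nat n = (of_nat (r + r') :: complex)" using e(2) e'(2) by simp
    then have n: "n = r + r'" by (simp only: of_nat_eq_iff)
    have "x0 \<in> N" using x0 by (simp add: N_def)
    from bspec[OF e(3) this] have "r \<noteq> 0" using x0(2) by (cases "r = 0") auto
    have "r' \<noteq> 0"
    proof
      assume "r' = 0"
      have "\<delta> j \<in> N" if "j < n" for j
      proof -
        have "\<delta> j = (\<Sum>k<r. coord_ip ?I (e k) (\<delta> j) *\<^sub>C e k)"
          using split[OF \<delta>[OF that]] \<open>r' = 0\<close> by simp
        also have "\<dots> \<in> N" using e(1) by (intro cv.subspace_sum cv.subspace_scale N) auto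
        finally show ?thesis .
      qed
      then have "T i j = (if i = j then c else 0)" if "i < n" "j < n" for i j
      proof -
        have "mat_act ?I T (\<delta> j) i = c * \<delta> j i"
          using \<open>\<And>j. j < n \<Longrightarrow> \<delta> j \<in> N\<close>[OF that(2)] by (simp add: N_def)
        then show ?thesis using that by (simp add: mat_act_def \<delta>_def if_distrib cong: if_cong split: if_splits)
      qed
      then show False using nonscalar by blast
    qed
    have sub: "cspan {w a b | a b. a < r \<and> b < r} \<subseteq> cspan (coef ` coef_index)"
      using less.IH[of r w] w n \<open>r' \<noteq> 0\<close> by (intro cv.span_minimal cv.subspace_span) auto
    have sub': "cspan {w' a b | a b. a < r' \<and> b < r'} \<subseteq> cspan (coef ` coef_index)"
      using less.IH[of r' w'] w' n \<open>r \<noteq> 0\<close> by (intro cv.span_minimal cv.subspace_span) auto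
    have "v i j = (\<Sum>s<n. \<delta> s i *\<^sub>C v s j)"
      using less.prems by (simp add: \<delta>_def if_distrib[of "\<lambda>c. c *\<^sub>C _"] cong: if_cong)
    also have "\<dots> = (\<Sum>s<n. (\<Sum>k<r. e k i * cnj (e k s)) *\<^sub>C v s j) + (\<Sum>s<n. (\<Sum>k<r'. e' k i * cnj (e' k s)) *\<^sub>C v s j)"
      by (simp add: unit cv.scale_left_distrib sum.distrib)
    also have "\<dots> \<in> cspan (coef ` coef_index)"
      using we we' sub sub' less.prems by (intro cv.span_add) blast+
    finally show ?thesis .
  qed
qed

lemma coef_span: "cspan (coef ` coef_index) = UNIV"
proof -
  have "cspan {v i j | n v i j. unitary_corep G n v \<and> i < n \<and> j < n} \<subseteq> cspan (coef ` coef_index)"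
    by (intro cv.span_minimal cv.subspace_span) (auto intro: corep_coef_span)
  then show ?thesis using cqg by (auto simp: compact_quantum_group_def)
qed

end

section \<open>Positive definite matrices\<close>

lemma posdef_hermitian:
  "positive_definite n P \<Longrightarrow> i < n \<Longrightarrow> j < n \<Longrightarrow> cnj (P i j) = P j i"
  unfolding positive_definite_def by (metis complex_cnj_cnj)

lemma posdef_pos:
  assumes "positive_definite n P" "i < n" "z i \<noteq> 0"
  shows "0 < Re (\<Sum>i<n. \<Sum>j<n. cnj (z i) * P i j * z j)"
  using assms(1)[unfolded positive_definite_def, THEN conjunct2, THEN spec, of z] assms(2,3) by blast

lemma posdef_nonneg:
  assumes "positive_definite n P"
  shows "0 \<le> Re (\<Sum>i<n. \<Sum>j<n. cnj (z i) * P i j * z j)"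
proof (cases "\<exists>i<n. z i \<noteq> 0")
  case True
  then show ?thesis using posdef_pos[OF assms] less_imp_le by blast
next
  case False
  then have "(\<Sum>i<n. \<Sum>j<n. cnj (z i) * P i j * z j) = 0" by (intro sum.neutral ballI) simp
  then show ?thesis by simp
qed

lemma posdef_zero:
  assumes "positive_definite n P" "Re (\<Sum>i<n. \<Sum>j<n. cnj (z i) * P i j * z j) \<le> 0" "i < n"
  shows "z i = 0"
  using posdef_pos[of n P i z] assms by linarith

lemma posdef_kernel:
  assumes P: "positive_definite n P" and z: "\<And>i. i < n \<Longrightarrow> (\<Sum>j<n. P i j * z j) = 0" and "k < n"
  shows "z k = 0"
proof (rule posdef_zero[OF P _ \<open>k < n\<close>])
  have "(\<Sum>i<n. \<Sum>j<n. cnj (z i) * P i j * z j) = (\<Sum>i<n. cnj (z i) * (\<Sum>j<n. P i j * z j))"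
    by (simp add: sum_distrib_left mult.assoc)
  then show "Re (\<Sum>i<n. \<Sum>j<n. cnj (z i) * P i j * z j) \<le> 0" using z by simp
qed

lemma posdef_kernel_left:
  assumes P: "positive_definite n P" and z: "\<And>j. j < n \<Longrightarrow> (\<Sum>i<n. z i * P i j) = 0" and "k < n"
  shows "z k = 0"
proof -
  have "(\<Sum>j<n. P i j * cnj (z j)) = 0" if "i < n" for i
  proof -
    have "cnj (\<Sum>j<n. z j * P j i) = 0" using z[OF that] by simp
    then show ?thesis using that by (simp add: posdef_hermitian[OF P] mult.commute)
  qed
  from posdef_kernel[OF P this \<open>k < n\<close>] show ?thesis by simp
qed

text \<open>If \<open>P D = - D P\<close> then \<open>D* P D\<close> and \<open>D P D*\<close> have opposite traces, but both are positive.\<close>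

lemma posdef_anticommute:
  assumes P: "positive_definite n P"
    and D: "\<And>i j. i < n \<Longrightarrow> j < n \<Longrightarrow> (\<Sum>k<n. P i k * D k j) + (\<Sum>k<n. D i k * P k j) = 0"
    and ij: "i < n" "j < n"
  shows "D i j = 0"
proof (rule posdef_zero[OF P _ ij(1)])
  define a where "a j = (\<Sum>i<n. \<Sum>k<n. cnj (D i j) * P i k * D k j)" for j
  define b where "b i = (\<Sum>k<n. \<Sum>j<n. cnj (cnj (D i k)) * P k j * cnj (D i j))" for i
  have ge: "0 \<le> Re (a j)" "0 \<le> Re (b j)" for j
    unfolding a_def b_def by (rule posdef_nonneg[OF P])+
  have "(\<Sum>i<n. b i) = (\<Sum>i<n. \<Sum>j<n. \<Sum>k<n. cnj (D i j) * (D i k * P k j))"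
    unfolding b_def by (rule sum.cong[OF refl], subst sum.swap) (simp add: mult_ac)
  moreover have "(\<Sum>j<n. a j) = (\<Sum>i<n. \<Sum>j<n. \<Sum>k<n. cnj (D i j) * (P i k * D k j))"
    unfolding a_def by (subst sum.swap) (simp add: mult_ac)
  ultimately have "(\<Sum>j<n. a j) + (\<Sum>i<n. b i) =
      (\<Sum>i<n. \<Sum>j<n. cnj (D i j) * ((\<Sum>k<n. P i k * D k j) + (\<Sum>k<n. D i k * P k j)))"
    by (simp add: sum.distrib sum_distrib_left distrib_left)
  also have "\<dots> = 0" by (intro sum.neutral ballI) (simp add: D)
  finally have "Re ((\<Sum>j<n. a j) + (\<Sum>i<n. b i)) = 0" by simp
  then have "(\<Sum>j<n. Re (a j)) \<le> 0" using sum_nonneg[of "{..<n}" "\<lambda>i. Re (b i)"] ge by simp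
  moreover have "Re (a j) \<le> (\<Sum>j<n. Re (a j))" using ij ge by (intro member_le_sum) auto
  ultimately show "Re (\<Sum>i<n. \<Sum>k<n. cnj (D i j) * P i k * D k j) \<le> 0"
    by (simp add: a_def)
qed

text \<open>The commutator \<open>D = P X - X P\<close> satisfies \<open>P D + D P = F X - X F = 0\<close>.\<close>

lemma commute_posdef_sqrt:
  assumes P: "positive_definite n P" and F: "\<And>i j. i < n \<Longrightarrow> j < n \<Longrightarrow> F i j = (\<Sum>k<n. P i k * P k j)"
    and X: "\<And>i j. i < n \<Longrightarrow> j < n \<Longrightarrow> (\<Sum>k<n. F i k * X k j) = (\<Sum>k<n. X i k * F k j)"
    and ij: "i < n" "j < n"
  shows "(\<Sum>k<n. P i k * X k j) = (\<Sum>k<n. X i k * P k j)"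
proof -
  define D where "D i j = mm n P X i j - mm n X P i j" for i j
  have "(\<Sum>k<n. P i k * D k j) + (\<Sum>k<n. D i k * P k j) = 0" if "i < n" "j < n" for i j
  proof -
    have "(\<Sum>k<n. P i k * D k j) + (\<Sum>k<n. D i k * P k j) =
        mm n P (mm n P X) i j - mm n P (mm n X P) i j + (mm n (mm n P X) P i j - mm n (mm n X P) P i j)"
      unfolding D_def mm_def[of n P "mm n P X"] mm_def[of n P "mm n X P"]
        mm_def[of n "mm n P X" P] mm_def[of n "mm n X P" P]
      by (simp add: algebra_simps sum_subtractf)
    also have "\<dots> = mm n (mm n P P) X i j - mm n X (mm n P P) i j"
      by (simp add: mm_assoc)
    also have "\<dots> = (\<Sum>k<n. F i k * X k j) - (\<Sum>k<n. X i k * F k j)"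
      unfolding mm_def[of n "mm n P P"] mm_def[of n X] using that by (simp add: F) (simp add: mm_def)
    finally show ?thesis using X[OF that] by simp
  qed
  from posdef_anticommute[OF P this ij] show ?thesis by (simp add: D_def mm_def)
qed

text \<open>The quadratic form of \<open>P\<^sup>2\<close> at \<open>z\<close> is the squared norm of \<open>P z\<close>.\<close>

lemma posdef_square:
  assumes P: "positive_definite n P" and F: "\<And>i j. i < n \<Longrightarrow> j < n \<Longrightarrow> F i j = (\<Sum>k<n. P i k * P k j)"
  shows "positive_definite n F"
  unfolding positive_definite_def
proof (intro conjI allI impI)
  fix i j assume "i < n" "j < n"
  then show "F i j = cnj (F j i)" by (simp add: F posdef_hermitian[OF P] mult.commute)
next
  fix z :: "nat \<Rightarrow> complex"
  assume "\<exists>i<n. z i \<noteq> 0"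
  then obtain i where i: "i < n" "z i \<noteq> 0" by blast
  define y where "y k = (\<Sum>j<n. P k j * z j)" for k
  obtain k where k: "k < n" "y k \<noteq> 0"
    using posdef_kernel[OF P _ i(1), of z] i(2) by (auto simp: y_def)
  have "(\<Sum>i<n. \<Sum>j<n. cnj (z i) * F i j * z j) = (\<Sum>i<n. \<Sum>j<n. \<Sum>k<n. cnj (P k i * z i) * (P k j * z j))"
    by (intro sum.cong refl) (simp add: F posdef_hermitian[OF P] sum_distrib_left sum_distrib_right mult_ac)
  also have "\<dots> = (\<Sum>k<n. \<Sum>j<n. \<Sum>i<n. cnj (P k i * z i) * (P k j * z j))"
    by (rule sum_rotate)
  also have "\<dots> = (\<Sum>k<n. cnj (y k) * y k)"
    by (simp add: y_def sum_distrib_left sum_distrib_right)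
  also have "\<dots> = of_real (\<Sum>k<n. (cmod (y k))\<^sup>2)"
    by (simp add: mult.commute flip: complex_norm_square)
  finally have "Re (\<Sum>i<n. \<Sum>j<n. cnj (z i) * F i j * z j) = (\<Sum>k<n. (cmod (y k))\<^sup>2)" by simp
  moreover have "(cmod (y k))\<^sup>2 \<le> (\<Sum>k<n. (cmod (y k))\<^sup>2)" using k by (intro member_le_sum) auto
  moreover have "0 < (cmod (y k))\<^sup>2" using k by simp
  ultimately show "0 < Re (\<Sum>i<n. \<Sum>j<n. cnj (z i) * F i j * z j)" by linarith
qed

section \<open>The modular matrices of the irreducibles\<close>

context cqg
begin

text \<open>The matrices \<open>P\<close> and \<open>F = P\<^sup>2\<close> that relate the antipode, its square and the unitary
  antipode on the coefficients of \<open>u \<alpha>\<close>.\<close>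

definition modular_pair :: "('a \<Rightarrow> 'a) \<Rightarrow> 'i \<Rightarrow> (nat \<Rightarrow> nat \<Rightarrow> complex) \<Rightarrow> (nat \<Rightarrow> nat \<Rightarrow> complex) \<Rightarrow> bool"
  where "modular_pair R \<alpha> P F \<longleftrightarrow> positive_definite (nd \<alpha>) P \<and>
    (\<forall>i<nd \<alpha>. \<forall>j<nd \<alpha>. F i j = (\<Sum>k<nd \<alpha>. P i k * P k j)) \<and>
    (\<forall>i<nd \<alpha>. \<forall>j<nd \<alpha>. (\<Sum>k<nd \<alpha>. F k j *\<^sub>C \<kappa> (\<kappa> (u \<alpha> i k))) = (\<Sum>k<nd \<alpha>. F i k *\<^sub>C u \<alpha> k j)) \<and>
    (\<forall>i<nd \<alpha>. \<forall>j<nd \<alpha>. (\<Sum>k<nd \<alpha>. P i k *\<^sub>C R (u \<alpha> k j)) = (\<Sum>k<nd \<alpha>. P k j *\<^sub>C \<kappa> (u \<alpha> i k)))"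

lemma modular_pair_exists:
  assumes "unitary_antipode G R"
  obtains P F where "modular_pair R \<alpha> P F"
  using assms unfolding unitary_antipode_def modular_pair_def Let_def by blast

lemma modular_pairD:
  assumes "modular_pair R \<alpha> P F"
  shows "positive_definite (nd \<alpha>) P"
    and "i < nd \<alpha> \<Longrightarrow> j < nd \<alpha> \<Longrightarrow> F i j = (\<Sum>k<nd \<alpha>. P i k * P k j)"
    and "i < nd \<alpha> \<Longrightarrow> j < nd \<alpha> \<Longrightarrow> (\<Sum>k<nd \<alpha>. F k j *\<^sub>C \<kappa> (\<kappa> (u \<alpha> i k))) = (\<Sum>k<nd \<alpha>. F i k *\<^sub>C u \<alpha> k j)"
    and "i < nd \<alpha> \<Longrightarrow> j < nd \<alpha> \<Longrightarrow> (\<Sum>k<nd \<alpha>. P i k *\<^sub>C R (u \<alpha> k j)) = (\<Sum>k<nd \<alpha>. P k j *\<^sub>C \<kappa> (u \<alpha> i k))"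
  using assms by (auto simp: modular_pair_def)

lemma modular_pair_hermitian:
  assumes "modular_pair R \<alpha> P F" "i < nd \<alpha>" "j < nd \<alpha>"
  shows "cnj (F i j) = F j i"
  using assms(2,3) by (simp add: modular_pairD(2)[OF assms(1)] posdef_hermitian[OF modular_pairD(1)[OF assms(1)]] mult.commute)

text \<open>The relation \<open>\<Sum>\<^sub>k \<kappa>\<^sup>2(u\<^sub>k\<^sub>i) u\<^sub>k\<^sub>j* = \<delta>\<^sub>i\<^sub>j\<close> with \<open>\<kappa>\<^sup>2\<close> eliminated.\<close>

lemma modular_pair_relation:
  assumes F: "modular_pair R \<alpha> P F" and jl: "j < nd \<alpha>" "l < nd \<alpha>"
  shows "(\<Sum>k<nd \<alpha>. \<Sum>m<nd \<alpha>. F k m *\<^sub>C (u \<alpha> m l * star (u \<alpha> k j))) = F j l *\<^sub>C 1"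
proof -
  have "(\<Sum>k<nd \<alpha>. \<Sum>m<nd \<alpha>. F k m *\<^sub>C (u \<alpha> m l * star (u \<alpha> k j))) =
      (\<Sum>k<nd \<alpha>. (\<Sum>m<nd \<alpha>. F k m *\<^sub>C u \<alpha> m l) * star (u \<alpha> k j))"
    by (simp add: sum_distrib_right scaleC_mult_left)
  also have "\<dots> = (\<Sum>k<nd \<alpha>. (\<Sum>i<nd \<alpha>. F i l *\<^sub>C \<kappa> (\<kappa> (u \<alpha> k i))) * star (u \<alpha> k j))"
    using jl by (simp add: modular_pairD(3)[OF F])
  also have "\<dots> = (\<Sum>i<nd \<alpha>. \<Sum>k<nd \<alpha>. F i l *\<^sub>C (\<kappa> (\<kappa> (u \<alpha> k i)) * star (u \<alpha> k j)))"
    by (simp add: sum_distrib_right scaleC_mult_left) (rule sum.swap)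
  also have "\<dots> = (\<Sum>i<nd \<alpha>. if i = j then F i l *\<^sub>C 1 else 0)"
    using jl by (intro sum.cong refl)
      (auto simp: antipode_conjugate(1)[OF irr_unitary] simp flip: cv.scale_sum_right)
  finally show ?thesis using jl by simp
qed

text \<open>A functional \<open>f\<close> is said to be of Kac type if it cannot see that the modular matrices \<open>F\<close>
  fail to commute with the irreducible corepresentations. Such functionals do not distinguish the
  antipode from the unitary antipode.\<close>

definition kac_functional :: "('a \<Rightarrow> 'a) \<Rightarrow> ('a \<Rightarrow> complex) \<Rightarrow> bool"
  where "kac_functional R f \<longleftrightarrow> clinear_map f \<and> (\<forall>\<alpha> P F. modular_pair R \<alpha> P F \<longrightarrow>
    (\<forall>i<nd \<alpha>. \<forall>j<nd \<alpha>. (\<Sum>k<nd \<alpha>. F i k * f (u \<alpha> k j)) = (\<Sum>k<nd \<alpha>. f (u \<alpha> i k) * F k j)))"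

text \<open>Under \<open>f\<close> one has \<open>\<kappa>\<^sup>2(u) F = F u = u F\<close>, and \<open>F\<close> can be cancelled.\<close>

lemma kac_antipode_square:
  assumes R: "unitary_antipode G R" and f: "kac_functional R f" and ij: "i < nd \<alpha>" "j < nd \<alpha>"
  shows "f (\<kappa> (\<kappa> (u \<alpha> i j))) = f (u \<alpha> i j)"
proof -
  obtain P F where F: "modular_pair R \<alpha> P F" using modular_pair_exists[OF R] .
  have lin: "clinear_map f" using f by (simp add: kac_functional_def)
  have "f (\<kappa> (\<kappa> (u \<alpha> i j))) - f (u \<alpha> i j) = 0"
  proof (rule posdef_kernel_left[OF posdef_square[OF modular_pairD(1,2)[OF F]] _ ij(2)])
    fix l assume l: "l < nd \<alpha>"
    have "f (\<Sum>k<nd \<alpha>. F k l *\<^sub>C \<kappa> (\<kappa> (u \<alpha> i k))) = f (\<Sum>k<nd \<alpha>. F i k *\<^sub>C u \<alpha> k l)"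
      using modular_pairD(3)[OF F ij(1) l] by simp
    then have "(\<Sum>k<nd \<alpha>. F k l * f (\<kappa> (\<kappa> (u \<alpha> i k)))) = (\<Sum>k<nd \<alpha>. f (u \<alpha> i k) * F k l)"
      using f F ij l by (simp add: clinear_map_sum[OF lin] clinear_mapD[OF lin] kac_functional_def)
    then show "(\<Sum>k<nd \<alpha>. (f (\<kappa> (\<kappa> (u \<alpha> i k))) - f (u \<alpha> i k)) * F k l) = 0"
      by (simp add: left_diff_distrib right_diff_distrib sum_subtractf mult.commute)
  qed
  then show ?thesis by simp
qed

text \<open>The hypothesis concerns the adjoint of \<open>f\<close>. It says that \<open>F\<close>, and hence its square root \<open>P\<close>,
  commutes with \<open>u* = \<kappa>(u)\<close> under \<open>f\<close>; thus \<open>P R(u) = \<kappa>(u) P = P \<kappa>(u)\<close>, and \<open>P\<close> can be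
  cancelled.\<close>

lemma kac_unitary_antipode:
  assumes R: "unitary_antipode G R" and f: "clinear_map f" "kac_functional R (\<lambda>a. cnj (f (star a)))"
    and ij: "i < nd \<alpha>" "j < nd \<alpha>"
  shows "f (R (u \<alpha> i j)) = f (\<kappa> (u \<alpha> i j))"
proof -
  obtain P F where F: "modular_pair R \<alpha> P F" using modular_pair_exists[OF R] .
  note P = modular_pairD(1)[OF F]
  have "f (R (u \<alpha> i j)) - f (\<kappa> (u \<alpha> i j)) = 0"
  proof (rule posdef_kernel[OF P _ ij(1)])
    fix l assume l: "l < nd \<alpha>"
    have "(\<Sum>k<nd \<alpha>. P j k * cnj (f (star (u \<alpha> k l)))) = (\<Sum>k<nd \<alpha>. cnj (f (star (u \<alpha> j k))) * P k l)"
      by (rule commute_posdef_sqrt[OF P modular_pairD(2)[OF F] _ ij(2) l])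
        (use f(2) F in \<open>auto simp: kac_functional_def\<close>)
    then have "cnj (\<Sum>k<nd \<alpha>. P j k * cnj (f (star (u \<alpha> k l)))) = cnj (\<Sum>k<nd \<alpha>. cnj (f (star (u \<alpha> j k))) * P k l)"
      by simp
    then have comm: "(\<Sum>k<nd \<alpha>. P k j * f (\<kappa> (u \<alpha> l k))) = (\<Sum>k<nd \<alpha>. P l k * f (\<kappa> (u \<alpha> k j)))"
      using ij l by (simp add: posdef_hermitian[OF P] antipode_corep[OF irr_unitary] mult.commute)
    have "f (\<Sum>k<nd \<alpha>. P l k *\<^sub>C R (u \<alpha> k j)) = f (\<Sum>k<nd \<alpha>. P k j *\<^sub>C \<kappa> (u \<alpha> l k))"
      using modular_pairD(4)[OF F l ij(2)] by simp
    then show "(\<Sum>k<nd \<alpha>. P l k * (f (R (u \<alpha> k j)) - f (\<kappa> (u \<alpha> k j)))) = 0"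
      using comm by (simp add: clinear_map_sum[OF f(1)] clinear_mapD[OF f(1)] right_diff_distrib sum_subtractf)
  qed
  then show ?thesis by simp
qed

section \<open>Finite-dimensional representations are of Kac type\<close>

definition matrix_rep :: "nat \<Rightarrow> ('a \<Rightarrow> nat \<Rightarrow> nat \<Rightarrow> complex) \<Rightarrow> bool"
  where "matrix_rep d \<rho> \<longleftrightarrow>
    (\<forall>s<d. \<forall>t<d. clinear_map (\<lambda>a. \<rho> a s t)) \<and>
    (\<forall>a b. \<forall>s<d. \<forall>t<d. \<rho> (a * b) s t = (\<Sum>r<d. \<rho> a s r * \<rho> b r t)) \<and>
    (\<forall>s<d. \<forall>t<d. \<rho> 1 s t = (if s = t then 1 else 0)) \<and>
    (\<forall>a. \<forall>s<d. \<forall>t<d. \<rho> (star a) s t = cnj (\<rho> a t s))"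

text \<open>Let \<open>\<tau>\<close> be the trace of a finite-dimensional representation. Since \<open>\<tau>(Z) = \<tau>(F)\<close> for
  \<open>Z = u* F u\<close> by the antipode relation, and \<open>\<tau>(Z* Z) = \<tau>(F* F)\<close> by unitarity, \<open>Z\<close> and \<open>F\<close>
  have distance zero in the Hilbert-Schmidt norm.\<close>

lemma matrix_rep_modular_commute:
  assumes \<rho>: "matrix_rep d \<rho>" and F: "modular_pair R \<alpha> P F" and ij: "i < nd \<alpha>" "j < nd \<alpha>"
    and st: "s < d" "t < d"
  shows "(\<Sum>k<nd \<alpha>. F i k * \<rho> (u \<alpha> k j) s t) = (\<Sum>k<nd \<alpha>. \<rho> (u \<alpha> i k) s t * F k j)"
proof -
  let ?n = "nd \<alpha>"
  define \<tau> where "\<tau> a = (\<Sum>s<d. \<rho> a s s)" for a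
  have lin: "clinear_map (\<lambda>a. \<rho> a s t)" if "s < d" "t < d" for s t
    using \<rho> that by (simp add: matrix_rep_def)
  have \<rho>_mult: "\<rho> (a * b) s t = (\<Sum>r<d. \<rho> a s r * \<rho> b r t)" if "s < d" "t < d" for a b s t
    using \<rho> that by (simp add: matrix_rep_def)
  have \<tau>_lin: "clinear_map \<tau>"
    by (simp add: clinear_map_def \<tau>_def clinear_mapD[OF lin] sum.distrib sum_distrib_left)
  have \<tau>_comm: "\<tau> (a * b) = \<tau> (b * a)" for a b
    unfolding \<tau>_def by (simp add: \<rho>_mult) (subst sum.swap, simp add: mult.commute)
  define TT where "TT X = (\<Sum>j<?n. \<tau> (X j j))" for X
  have TT_comm: "TT (mm ?n X Y) = TT (mm ?n Y X)" for X Y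
    unfolding TT_def mm_def clinear_map_sum[OF \<tau>_lin]
    by (subst sum.swap) (simp add: \<tau>_comm)
  define U where "U = blk ?n ?n (u \<alpha>)"
  define E where "E = (emb (blk ?n ?n F) :: nat \<Rightarrow> nat \<Rightarrow> 'a)"
  define Z where "Z = mm ?n (dg U) (mm ?n E U)"
  define W where "W i j = Z i j - E i j" for i j
  have U: "mm ?n (dg U) U = idm ?n" "mm ?n U (dg U) = idm ?n"
    unfolding U_def by (rule unitary_blk[OF irr_unitary])+
  have dE: "dg E = E"
    unfolding E_def dg_emb by (auto simp: blk_def fun_eq_iff emb_def modular_pair_hermitian[OF F])
  have bE: "E = blk ?n ?n (emb F)" by (simp add: E_def emb_blk)
  have iE: "mm ?n (idm ?n) E = E" "mm ?n E (idm ?n) = E" by (simp_all add: bE mm_idm_left mm_idm_right)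
  have iU: "mm ?n (idm ?n) U = U" by (simp add: U_def mm_idm_left)
  have UdU: "mm ?n U (mm ?n (dg U) X) = mm ?n (idm ?n) X" for X
    by (simp only: mm_assoc[symmetric] U)
  have dZ: "dg Z = Z" by (simp add: Z_def dg_mm dE mm_assoc)
  have ZE: "\<tau> (Z j l) = \<tau> (E j l)" if jl: "j < ?n" "l < ?n" for j l
  proof -
    have "mm ?n E U = (\<lambda>i j. \<Sum>k<?n. blk ?n ?n F i k *\<^sub>C U k j)" by (simp add: E_def mm_emb_left)
    then have "\<tau> (Z j l) = (\<Sum>k<?n. \<Sum>m<?n. F k m * \<tau> (star (u \<alpha> k j) * u \<alpha> m l))"
      using jl by (simp add: Z_def mm_def dg_def U_def blk_def sum_distrib_left scaleC_mult_right
          clinear_map_sum[OF \<tau>_lin] clinear_mapD[OF \<tau>_lin])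
    also have "\<dots> = \<tau> (\<Sum>k<?n. \<Sum>m<?n. F k m *\<^sub>C (u \<alpha> m l * star (u \<alpha> k j)))"
      by (simp add: clinear_map_sum[OF \<tau>_lin] clinear_mapD[OF \<tau>_lin] \<tau>_comm)
    also have "\<dots> = \<tau> (E j l)"
      unfolding modular_pair_relation[OF F jl] using jl by (simp add: E_def emb_def blk_def)
    finally show ?thesis .
  qed
  have sc: "\<tau> (X * E i j) = blk ?n ?n F i j * \<tau> X" "\<tau> (E i j * X) = blk ?n ?n F i j * \<tau> X" for X i j
    by (simp_all add: E_def emb_def scaleC_mult_left scaleC_mult_right clinear_mapD[OF \<tau>_lin])
  have t1: "TT (mm ?n Z E) = TT (mm ?n E E)"
    unfolding TT_def mm_def clinear_map_sum[OF \<tau>_lin] sc by (simp add: ZE)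
  have t2: "TT (mm ?n E Z) = TT (mm ?n E E)"
    using t1 TT_comm by metis
  have "mm ?n Z Z = mm ?n (dg U) (mm ?n E (mm ?n E U))"
    by (simp only: Z_def mm_assoc UdU) (simp only: mm_assoc[symmetric] iE)
  then have "TT (mm ?n Z Z) = TT (mm ?n (mm ?n E (mm ?n E U)) (dg U))"
    by (simp only: TT_comm)
  also have "mm ?n (mm ?n E (mm ?n E U)) (dg U) = mm ?n E E"
    by (simp only: mm_assoc U iE)
  finally have t3: "TT (mm ?n Z Z) = TT (mm ?n E E)" .
  have "mm ?n W W i j = mm ?n Z Z i j - mm ?n Z E i j - mm ?n E Z i j + mm ?n E E i j" for i j
    by (simp add: mm_def W_def algebra_simps sum.distrib sum_subtractf)
  then have "TT (mm ?n W W) = TT (mm ?n Z Z) - TT (mm ?n Z E) - TT (mm ?n E Z) + TT (mm ?n E E)"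
    by (simp add: TT_def clinear_mapD[OF \<tau>_lin] clinear_map_diff[OF \<tau>_lin] sum.distrib sum_subtractf)
  then have "TT (mm ?n W W) = 0" by (simp add: t1 t2 t3)
  moreover have dW: "star (W j l) = W l j" for j l
    using fun_cong[OF fun_cong[OF dZ, of l], of j] fun_cong[OF fun_cong[OF dE, of l], of j]
    by (simp add: W_def star_diff dg_def)
  have "TT (mm ?n W W) = (\<Sum>j<?n. \<Sum>l<?n. \<tau> (star (W l j) * W l j))"
    by (simp add: TT_def mm_def clinear_map_sum[OF \<tau>_lin] dW)
  moreover have "\<tau> (star a * a) = of_real (\<Sum>s<d. \<Sum>t<d. (cmod (\<rho> a t s))\<^sup>2)" for a
    using \<rho> by (simp add: \<tau>_def matrix_rep_def mult.commute[of "cnj _"] flip: complex_norm_square)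
  ultimately have "complex_of_real (\<Sum>j<?n. \<Sum>l<?n. \<Sum>s<d. \<Sum>t<d. (cmod (\<rho> (W l j) t s))\<^sup>2) = 0"
    by simp
  then have "(\<Sum>j<?n. \<Sum>l<?n. \<Sum>s<d. \<Sum>t<d. (cmod (\<rho> (W l j) t s))\<^sup>2) = 0"
    by (simp only: of_real_eq_0_iff)
  then have W0: "\<rho> (W l j) t s = 0" if "l < ?n" "j < ?n" "s < d" "t < d" for l j s t
    using that by (simp add: sum_nonneg_eq_0_iff sum_nonneg)
  have UZ: "mm ?n U Z = mm ?n E U"
    unfolding Z_def UdU by (simp only: mm_assoc[symmetric] iE)
  have "\<rho> (mm ?n U W i j) s t = 0"
    unfolding mm_def using ij st by (simp add: clinear_map_sum[OF lin] \<rho>_mult W0)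
  moreover have "mm ?n U W i j = mm ?n U Z i j - mm ?n U E i j"
    by (simp add: mm_def W_def right_diff_distrib sum_subtractf)
  ultimately have "\<rho> (mm ?n E U i j) s t = \<rho> (mm ?n U E i j) s t"
    using clinear_map_diff[OF lin[OF st], of "mm ?n E U i j"] by (simp add: UZ)
  then show ?thesis
    using ij st by (simp add: E_def mm_emb_left mm_emb_right U_def blk_def clinear_map_sum[OF lin] clinear_mapD[OF lin] mult.commute)
qed

lemma matrix_rep_kac:
  assumes "matrix_rep d \<rho>" "s < d" "t < d"
  shows "kac_functional R (\<lambda>a. \<rho> a s t)"
  using assms matrix_rep_modular_commute[OF assms(1) _ _ _ assms(2,3)]
  by (simp add: kac_functional_def) (simp add: matrix_rep_def)

section \<open>Coordinates and the Haar functional\<close>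

lemma coef_basis: "{u \<beta> i j | \<beta> i j. i < nd \<beta> \<and> j < nd \<beta>} = coef ` coef_index"
  by (force simp: coef_def coef_index_def)

lemma irr_coeff_linear: "clinear_map (\<lambda>a. irr_coeff G a \<alpha> m n)"
  unfolding clinear_map_def irr_coeff_def coef_basis
  by (simp add: cv.representation_add cv.representation_scale coef_independent coef_span)

lemma irr_coeff_irr:
  assumes "i < nd \<beta>" "j < nd \<beta>" "m < nd \<alpha>" "n < nd \<alpha>"
  shows "irr_coeff G (u \<beta> i j) \<alpha> m n = (if \<alpha> = \<beta> \<and> m = i \<and> n = j then 1 else 0)"
proof -
  have p: "(\<beta>, i, j) \<in> coef_index" and q: "(\<alpha>, m, n) \<in> coef_index"
    using assms by (auto simp: coef_index_def)
  have "irr_coeff G (u \<beta> i j) \<alpha> m n = (if coef (\<alpha>, m, n) = coef (\<beta>, i, j) then 1 else 0)"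
    unfolding irr_coeff_def coef_basis using p coef_independent
    by (subst cv.representation_basis) (auto simp: coef_def intro!: rev_image_eqI[OF p])
  then show ?thesis using inj_on_eq_iff[OF coef_inj q p] by simp
qed

lemma coef_expansion:
  obtains Q c where "finite Q" "Q \<subseteq> coef_index" "a = (\<Sum>q\<in>Q. c q *\<^sub>C coef q)"
proof -
  have "a \<in> cspan (coef ` coef_index)" by (simp add: coef_span)
  then obtain t r where t: "finite t" "t \<subseteq> coef ` coef_index" "a = (\<Sum>v\<in>t. r v *\<^sub>C v)"
    unfolding cv.span_explicit by blast
  obtain Q where Q: "Q \<subseteq> coef_index" "finite Q" "t = coef ` Q"
    using finite_subset_image[OF t(1,2)] by blast
  have inj: "inj_on coef Q" using coef_inj Q(1) by (rule inj_on_subset)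
  have "a = (\<Sum>q\<in>Q. r (coef q) *\<^sub>C coef q)"
    unfolding t(3) Q(3) by (simp add: sum.reindex[OF inj])
  from that[OF Q(2,1) this] show ?thesis .
qed

lemma clinear_map_eqI:
  assumes "clinear_map f" "clinear_map g"
    and "\<And>\<alpha> i j. i < nd \<alpha> \<Longrightarrow> j < nd \<alpha> \<Longrightarrow> f (u \<alpha> i j) = g (u \<alpha> i j)"
  shows "f a = g a"
proof (rule clinear_map_eq_on_span[OF assms(1,2)])
  show "a \<in> cspan (coef ` coef_index)" by (simp add: coef_span)
qed (auto simp: coef_index_def coef_def assms(3))

text \<open>The unit is a one-dimensional corepresentation. An equivalence with an irreducible is a pair
  of mutually inverse matrices, whose trace shows that this irreducible has size one.\<close>

lemma trivial_irr_exists: "\<exists>\<alpha>. nd \<alpha> = 1 \<and> u \<alpha> 0 0 = 1"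
proof -
  define v :: "nat \<Rightarrow> nat \<Rightarrow> 'a" where "v = (\<lambda>i j. 1)"
  have "tensor_eq (comult G 1) [(1, 1)]"
    using hopf by (simp add: hopf_star_algebra_def)
  then have "unitary_corep G 1 v" by (simp add: unitary_corep_def v_def)
  then have "irreducible_corep G 1 v" by (auto simp: irreducible_corep_def)
  then obtain \<alpha> where "equivalent_coreps 1 v (nd \<alpha>) (u \<alpha>)"
    using cqg unfolding compact_quantum_group_def by blast
  then obtain T S where T: "intertwines 1 v (nd \<alpha>) (u \<alpha>) T"
    and TS: "\<forall>i<nd \<alpha>. \<forall>j<nd \<alpha>. (\<Sum>k<1. T i k * S k j) = (if i = j then 1 else 0)"
    and ST: "\<forall>i<1. \<forall>j<1. (\<Sum>k<nd \<alpha>. S i k * T k j) = (if i = j then 1 else 0)"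
    unfolding equivalent_coreps_def by blast
  have "of_nat (nd \<alpha>) = (\<Sum>i<nd \<alpha>. T i 0 * S 0 i)" using TS by simp
  also have "\<dots> = (\<Sum>i<nd \<alpha>. S 0 i * T i 0)" by (simp add: mult.commute)
  also have "\<dots> = of_nat 1" using ST by simp
  finally have n: "nd \<alpha> = 1" by (simp only: of_nat_eq_iff)
  have "T 0 0 *\<^sub>C 1 = T 0 0 *\<^sub>C u \<alpha> 0 0"
    using T n by (simp add: intertwines_def v_def)
  moreover have "T 0 0 \<noteq> 0" using TS n by auto
  ultimately have "u \<alpha> 0 0 = 1" using cv.scale_left_imp_eq by metis
  then show ?thesis using n by blast
qed

definition triv :: 'i
  where "triv = (SOME \<alpha>. nd \<alpha> = 1 \<and> u \<alpha> 0 0 = 1)"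

lemma triv: "nd triv = 1" "u triv 0 0 = 1"
  using someI_ex[OF trivial_irr_exists] by (simp_all add: triv_def)

text \<open>The Haar functional is the coordinate at the unit. Its invariance is immediate on the basis of
  coefficients.\<close>

definition haar :: "'a \<Rightarrow> complex"
  where "haar a = irr_coeff G a triv 0 0"

lemma haar_linear: "clinear_map haar"
  unfolding haar_def by (rule irr_coeff_linear)

lemma haar_irr: "i < nd \<alpha> \<Longrightarrow> j < nd \<alpha> \<Longrightarrow> haar (u \<alpha> i j) = (if \<alpha> = triv then 1 else 0)"
  unfolding haar_def using triv by (subst irr_coeff_irr) auto

lemma haar_1: "haar 1 = 1"
  using haar_irr[of 0 triv 0] triv by simp

lemma bilin_haar: "bilin (\<lambda>x y. haar x *\<^sub>C y)" "bilin (\<lambda>x y. haar y *\<^sub>C x)"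
  using haar_linear by (auto simp: bilin_def clinear_map_def cv.scale_right_distrib cv.scale_left_distrib cv.scale_left_commute)

lemma haar_invariant: "ce (\<lambda>x y. haar x *\<^sub>C y) a = haar a *\<^sub>C 1" "ce (\<lambda>x y. haar y *\<^sub>C x) a = haar a *\<^sub>C 1"
proof -
  have lin: "clinear_map (\<lambda>a. haar a *\<^sub>C (1::'a))"
    using haar_linear by (simp add: clinear_map_def cv.scale_left_distrib)
  have triv_irr: "u \<alpha> i j = 1" if "\<alpha> = triv" "i < nd \<alpha>" "j < nd \<alpha>" for \<alpha> i j
    using that triv by auto
  show "ce (\<lambda>x y. haar x *\<^sub>C y) a = haar a *\<^sub>C 1"
    by (rule clinear_map_eqI[OF ce_linear[OF bilin_haar(1)] lin])
      (auto simp: ce_corep[OF irr_unitary _ _ bilin_haar(1)] haar_irr triv_irr triv)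
  show "ce (\<lambda>x y. haar y *\<^sub>C x) a = haar a *\<^sub>C 1"
    by (rule clinear_map_eqI[OF ce_linear[OF bilin_haar(2)] lin])
      (auto simp: ce_corep[OF irr_unitary _ _ bilin_haar(2)] haar_irr triv_irr triv)
qed

lemma bilin_mult_left: "bilin \<beta> \<Longrightarrow> bilin (\<lambda>x y. \<beta> (a * x) (b * y))"
  for \<beta> :: "'a \<Rightarrow> 'a \<Rightarrow> 'b::complex_vector"
  unfolding bilin_def clinear_map_def
  by (simp_all add: distrib_left distrib_right scaleC_mult_left scaleC_mult_right)

lemma ce_irr_mult_star:
  assumes "bilin \<beta>" "i < nd \<alpha>" "j < nd \<alpha>" "k < nd \<gamma>" "l < nd \<gamma>"
  shows "ce \<beta> (u \<alpha> i j * star (u \<gamma> k l)) =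
    (\<Sum>p<nd \<alpha>. \<Sum>q<nd \<gamma>. \<beta> (u \<alpha> i p * star (u \<gamma> k q)) (u \<alpha> p j * star (u \<gamma> q l)))"
proof -
  let ?c = "\<lambda>x y. ce (\<lambda>x' y'. \<beta> (x * x') (y * y')) (star (u \<gamma> k l))"
  have c: "?c x y = (\<Sum>q<nd \<gamma>. \<beta> (x * star (u \<gamma> k q)) (y * star (u \<gamma> q l)))" for x y
    by (rule ce_corep_star[OF irr_unitary assms(4,5) bilin_mult_left[OF assms(1)]])
  have "bilin ?c"
    unfolding c using assms(1)
    by (simp add: bilin_def clinear_map_def distrib_right scaleC_mult_left sum.distrib cv.scale_sum_right)
  then have "ce ?c (u \<alpha> i j) = (\<Sum>p<nd \<alpha>. ?c (u \<alpha> i p) (u \<alpha> p j))"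
    by (rule ce_corep[OF irr_unitary assms(2,3)])
  then show ?thesis unfolding ce_mult[OF assms(1)] by (simp only: c)
qed

lemma ce_star_mult_irr:
  assumes "bilin \<beta>" "i < nd \<alpha>" "j < nd \<alpha>" "k < nd \<gamma>" "l < nd \<gamma>"
  shows "ce \<beta> (star (u \<gamma> k l) * u \<alpha> i j) =
    (\<Sum>q<nd \<gamma>. \<Sum>p<nd \<alpha>. \<beta> (star (u \<gamma> k q) * u \<alpha> i p) (star (u \<gamma> q l) * u \<alpha> p j))"
proof -
  let ?c = "\<lambda>x y. ce (\<lambda>x' y'. \<beta> (x * x') (y * y')) (u \<alpha> i j)"
  have c: "?c x y = (\<Sum>p<nd \<alpha>. \<beta> (x * u \<alpha> i p) (y * u \<alpha> p j))" for x y
    by (rule ce_corep[OF irr_unitary assms(2,3) bilin_mult_left[OF assms(1)]])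
  have "bilin ?c"
    unfolding c using assms(1)
    by (simp add: bilin_def clinear_map_def distrib_right scaleC_mult_left sum.distrib cv.scale_sum_right)
  then have "ce ?c (star (u \<gamma> k l)) = (\<Sum>q<nd \<gamma>. ?c (star (u \<gamma> k q)) (star (u \<gamma> q l)))"
    by (rule ce_corep_star[OF irr_unitary assms(4,5)])
  then show ?thesis unfolding ce_mult[OF assms(1)] by (simp only: c)
qed

text \<open>For \<open>X\<^sub>p\<^sub>q = haar (u\<^sup>\<gamma>\<^sub>p\<^sub>l u\<^sup>\<beta>\<^sub>q\<^sub>j*)\<close> invariance of the Haar functional reads
  \<open>u\<^sup>\<gamma> X (u\<^sup>\<beta>)* = X\<close>, and \<open>u\<^sup>\<beta>\<close> is unitary. The other order of the factors is similar.\<close>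

lemma haar_intertwiner_left:
  assumes l: "l < nd \<gamma>" and j: "j < nd \<beta>"
  shows "intertwines (nd \<beta>) (u \<beta>) (nd \<gamma>) (u \<gamma>) (\<lambda>p q. haar (u \<gamma> p l * star (u \<beta> q j)))"
  unfolding intertwines_def
proof (intro allI impI)
  fix k r assume k: "k < nd \<gamma>" and r: "r < nd \<beta>"
  define X where "X p q = haar (u \<gamma> p l * star (u \<beta> q j))" for p q
  have X: "X k i *\<^sub>C 1 = (\<Sum>p<nd \<gamma>. \<Sum>q<nd \<beta>. X p q *\<^sub>C (u \<gamma> k p * star (u \<beta> i q)))" if "i < nd \<beta>" for i
    using ce_irr_mult_star[OF bilin_haar(2) k l that j] haar_invariant(2) by (simp add: X_def)
  have "(\<Sum>i<nd \<beta>. X k i *\<^sub>C u \<beta> i r) = (\<Sum>i<nd \<beta>. (X k i *\<^sub>C 1) * u \<beta> i r)"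
    by (simp add: scaleC_mult_left)
  also have "\<dots> = (\<Sum>i<nd \<beta>. \<Sum>p<nd \<gamma>. \<Sum>q<nd \<beta>. X p q *\<^sub>C (u \<gamma> k p * (star (u \<beta> i q) * u \<beta> i r)))"
    by (rule sum.cong[OF refl]) (simp add: X sum_distrib_right scaleC_mult_left mult.assoc)
  also have "\<dots> = (\<Sum>q<nd \<beta>. \<Sum>p<nd \<gamma>. \<Sum>i<nd \<beta>. X p q *\<^sub>C (u \<gamma> k p * (star (u \<beta> i q) * u \<beta> i r)))"
    by (rule sum_rotate)
  also have "\<dots> = (\<Sum>q<nd \<beta>. \<Sum>p<nd \<gamma>. X p q *\<^sub>C (u \<gamma> k p * (\<Sum>i<nd \<beta>. star (u \<beta> i q) * u \<beta> i r)))"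
    by (simp add: sum_distrib_left cv.scale_sum_right)
  also have "\<dots> = (\<Sum>q<nd \<beta>. if q = r then \<Sum>p<nd \<gamma>. X p r *\<^sub>C u \<gamma> k p else 0)"
    using r irr_unitary[of \<beta>] by (intro sum.cong refl) (auto simp: unitary_corep_def)
  also have "\<dots> = (\<Sum>p<nd \<gamma>. X p r *\<^sub>C u \<gamma> k p)" using r by simp
  finally show "(\<Sum>i<nd \<beta>. haar (u \<gamma> k l * star (u \<beta> i j)) *\<^sub>C u \<beta> i r) =
      (\<Sum>p<nd \<gamma>. haar (u \<gamma> p l * star (u \<beta> r j)) *\<^sub>C u \<gamma> k p)"
    by (simp add: X_def)
qed

lemma haar_intertwiner_right:
  assumes i: "i < nd \<beta>" and k: "k < nd \<gamma>"
  shows "intertwines (nd \<gamma>) (u \<gamma>) (nd \<beta>) (u \<beta>) (\<lambda>p q. haar (star (u \<beta> i p) * u \<gamma> k q))"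
  unfolding intertwines_def
proof (intro allI impI)
  fix r l assume r: "r < nd \<beta>" and l: "l < nd \<gamma>"
  define X where "X p q = haar (star (u \<beta> i p) * u \<gamma> k q)" for p q
  have X: "X j l *\<^sub>C 1 = (\<Sum>p<nd \<beta>. \<Sum>q<nd \<gamma>. X p q *\<^sub>C (star (u \<beta> p j) * u \<gamma> q l))" if "j < nd \<beta>" for j
    using ce_star_mult_irr[OF bilin_haar(1) k l i that] haar_invariant(1) by (simp add: X_def)
  have "(\<Sum>j<nd \<beta>. X j l *\<^sub>C u \<beta> r j) = (\<Sum>j<nd \<beta>. u \<beta> r j * (X j l *\<^sub>C 1))"
    by (simp add: scaleC_mult_right)
  also have "\<dots> = (\<Sum>j<nd \<beta>. \<Sum>p<nd \<beta>. \<Sum>q<nd \<gamma>. X p q *\<^sub>C (u \<beta> r j * star (u \<beta> p j) * u \<gamma> q l))"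
    by (rule sum.cong[OF refl]) (simp add: X sum_distrib_left scaleC_mult_right mult.assoc)
  also have "\<dots> = (\<Sum>q<nd \<gamma>. \<Sum>p<nd \<beta>. \<Sum>j<nd \<beta>. X p q *\<^sub>C (u \<beta> r j * star (u \<beta> p j) * u \<gamma> q l))"
    by (rule sum_rotate)
  also have "\<dots> = (\<Sum>q<nd \<gamma>. \<Sum>p<nd \<beta>. X p q *\<^sub>C ((\<Sum>j<nd \<beta>. u \<beta> r j * star (u \<beta> p j)) * u \<gamma> q l))"
    by (simp add: sum_distrib_right cv.scale_sum_right)
  also have "\<dots> = (\<Sum>q<nd \<gamma>. \<Sum>p<nd \<beta>. if p = r then X r q *\<^sub>C u \<gamma> q l else 0)"
    using r irr_unitary[of \<beta>] by (intro sum.cong refl) (auto simp: unitary_corep_def)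
  also have "\<dots> = (\<Sum>q<nd \<gamma>. X r q *\<^sub>C u \<gamma> q l)" using r by simp
  finally show "(\<Sum>q<nd \<gamma>. haar (star (u \<beta> i r) * u \<gamma> k q) *\<^sub>C u \<gamma> q l) =
      (\<Sum>j<nd \<beta>. haar (star (u \<beta> i j) * u \<gamma> k l) *\<^sub>C u \<beta> r j)"
    by (simp add: X_def)
qed

lemma irr_dim_pos: "0 < nd \<alpha>"
  using irr_irreducible[of \<alpha>] by (simp add: irreducible_corep_def)

text \<open>Schur's lemma leaves one matrix of unknowns in each of the two orthogonality relations. It
  also shows that the index \<open>0\<close> in the following definitions could be any other.\<close>

definition haar_left :: "'i \<Rightarrow> nat \<Rightarrow> nat \<Rightarrow> complex"
  where "haar_left \<alpha> l j = haar (u \<alpha> 0 l * star (u \<alpha> 0 j))"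

definition haar_right :: "'i \<Rightarrow> nat \<Rightarrow> nat \<Rightarrow> complex"
  where "haar_right \<alpha> i k = haar (star (u \<alpha> i 0) * u \<alpha> k 0)"

lemma haar_orthogonality_left:
  assumes "k < nd \<gamma>" "l < nd \<gamma>" "i < nd \<beta>" "j < nd \<beta>"
  shows "haar (u \<gamma> k l * star (u \<beta> i j)) = (if \<gamma> = \<beta> \<and> k = i then haar_left \<beta> l j else 0)"
proof (cases "\<gamma> = \<beta>")
  case True
  obtain c where c: "\<And>p q. p < nd \<beta> \<Longrightarrow> q < nd \<beta> \<Longrightarrow> haar (u \<beta> p l * star (u \<beta> q j)) = (if p = q then c else 0)"
    using schur_scalar[OF haar_intertwiner_left[of l \<beta> j \<beta>]] assms True by blast
  show ?thesis using c[of k i] c[of 0 0] assms True irr_dim_pos[of \<beta>] by (simp add: haar_left_def)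
next
  case False
  with schur_zero[OF haar_intertwiner_left[OF assms(2,4)], of k i] assms show ?thesis by auto
qed

lemma haar_orthogonality_right:
  assumes "k < nd \<gamma>" "l < nd \<gamma>" "i < nd \<beta>" "j < nd \<beta>"
  shows "haar (star (u \<beta> i j) * u \<gamma> k l) = (if \<gamma> = \<beta> \<and> j = l then haar_right \<beta> i k else 0)"
proof (cases "\<gamma> = \<beta>")
  case True
  obtain c where c: "\<And>p q. p < nd \<beta> \<Longrightarrow> q < nd \<beta> \<Longrightarrow> haar (star (u \<beta> i p) * u \<beta> k q) = (if p = q then c else 0)"
    using schur_scalar[OF haar_intertwiner_right[of i \<beta> k \<beta>]] assms True by blast
  show ?thesis using c[of j l] c[of 0 0] assms True irr_dim_pos[of \<beta>] by (simp add: haar_right_def)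
next
  case False
  with schur_zero[OF haar_intertwiner_right[OF assms(3,1)], of j l] assms show ?thesis by auto
qed

end

section \<open>Unimodularity\<close>

context cqg
begin

text \<open>The Haar functional of the relation \<open>modular_pair_relation\<close>.\<close>

lemma haar_left_modular:
  assumes F: "modular_pair R \<alpha> P F" and jl: "j < nd \<alpha>" "l < nd \<alpha>"
  shows "(\<Sum>k<nd \<alpha>. F k k) * haar_left \<alpha> l j = F j l"
proof -
  have "F j l = haar (\<Sum>k<nd \<alpha>. \<Sum>m<nd \<alpha>. F k m *\<^sub>C (u \<alpha> m l * star (u \<alpha> k j)))"
    unfolding modular_pair_relation[OF F jl] by (simp add: clinear_mapD[OF haar_linear] haar_1)
  also have "\<dots> = (\<Sum>k<nd \<alpha>. \<Sum>m<nd \<alpha>. F k m * haar (u \<alpha> m l * star (u \<alpha> k j)))"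
    by (simp add: clinear_map_sum[OF haar_linear] clinear_mapD[OF haar_linear])
  also have "\<dots> = (\<Sum>k<nd \<alpha>. \<Sum>m<nd \<alpha>. if m = k then F k k * haar_left \<alpha> l j else 0)"
    using jl by (intro sum.cong refl) (auto simp: haar_orthogonality_left)
  also have "\<dots> = (\<Sum>k<nd \<alpha>. F k k) * haar_left \<alpha> l j"
    by (simp add: sum_distrib_right)
  finally show ?thesis ..
qed

text \<open>Invariance of the Haar functional at the products \<open>u\<^sub>i\<^sub>0* u\<^sub>k\<^sub>0\<close> is an equation between
  \<open>haar_right\<close>, \<open>u*\<close> and \<open>u\<close>, from which the antipode relation removes \<open>u*\<close>.\<close>

lemma haar_right_relation:
  assumes r: "r < nd \<alpha>" and k: "k < nd \<alpha>"
  shows "(\<Sum>p<nd \<alpha>. haar_right \<alpha> r p *\<^sub>C u \<alpha> k p) = (\<Sum>i<nd \<alpha>. haar_right \<alpha> i k *\<^sub>C \<kappa> (\<kappa> (u \<alpha> i r)))"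
proof -
  let ?n = "nd \<alpha>" and ?m = "haar_right \<alpha>"
  have m: "?m i k *\<^sub>C 1 = (\<Sum>q<?n. \<Sum>p<?n. ?m q p *\<^sub>C (star (u \<alpha> i q) * u \<alpha> k p))" if "i < ?n" for i
    using ce_star_mult_irr[OF bilin_haar(2) k irr_dim_pos that irr_dim_pos] haar_invariant(2)
    by (simp add: haar_right_def)
  have "(\<Sum>i<?n. ?m i k *\<^sub>C \<kappa> (\<kappa> (u \<alpha> i r))) = (\<Sum>i<?n. \<kappa> (\<kappa> (u \<alpha> i r)) * (?m i k *\<^sub>C 1))"
    by (simp add: scaleC_mult_right)
  also have "\<dots> = (\<Sum>i<?n. \<Sum>q<?n. \<Sum>p<?n. ?m q p *\<^sub>C (\<kappa> (\<kappa> (u \<alpha> i r)) * star (u \<alpha> i q) * u \<alpha> k p))"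
    by (rule sum.cong[OF refl]) (simp add: m sum_distrib_left scaleC_mult_right mult.assoc)
  also have "\<dots> = (\<Sum>p<?n. \<Sum>q<?n. \<Sum>i<?n. ?m q p *\<^sub>C (\<kappa> (\<kappa> (u \<alpha> i r)) * star (u \<alpha> i q) * u \<alpha> k p))"
    by (rule sum_rotate)
  also have "\<dots> = (\<Sum>p<?n. \<Sum>q<?n. ?m q p *\<^sub>C ((\<Sum>i<?n. \<kappa> (\<kappa> (u \<alpha> i r)) * star (u \<alpha> i q)) * u \<alpha> k p))"
    by (simp add: sum_distrib_right cv.scale_sum_right)
  also have "\<dots> = (\<Sum>p<?n. \<Sum>q<?n. if q = r then ?m r p *\<^sub>C u \<alpha> k p else 0)"
    using r by (intro sum.cong refl) (auto simp: antipode_conjugate(1)[OF irr_unitary])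
  also have "\<dots> = (\<Sum>p<?n. ?m r p *\<^sub>C u \<alpha> k p)" using r by simp
  finally show ?thesis ..
qed

text \<open>The invariance of a Haar measure of the dual is a statement about products with the
  coefficients \<open>u \<beta> i j\<close>. Both sides are linear in that factor.\<close>

lemma pairing_extends:
  fixes g :: "'a \<Rightarrow> 'i \<times> nat \<times> nat \<Rightarrow> complex"
  assumes lin: "\<And>p. clinear_map (\<lambda>a. g a p)"
    and fin: "\<And>a. finite {p \<in> coef_index. g a p \<noteq> 0}"
    and base: "\<And>\<beta> i j. i < nd \<beta> \<Longrightarrow> j < nd \<beta> \<Longrightarrow>
      (\<Sum>p\<in>{p \<in> coef_index. g (u \<beta> i j) p \<noteq> 0}. g (u \<beta> i j) p * \<phi> p) = \<epsilon> (u \<beta> i j) * z"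
    and P: "finite P" "P \<subseteq> coef_index" "{p \<in> coef_index. g a p \<noteq> 0} \<subseteq> P"
  shows "(\<Sum>p\<in>P. g a p * \<phi> p) = \<epsilon> a * z"
proof -
  obtain Q c where Q: "finite Q" "Q \<subseteq> coef_index" "a = (\<Sum>q\<in>Q. c q *\<^sub>C coef q)"
    by (rule coef_expansion)
  define P' where "P' = P \<union> (\<Union>q\<in>Q. {p \<in> coef_index. g (coef q) p \<noteq> 0})"
  have P': "finite P'" "P \<subseteq> P'" "P' \<subseteq> coef_index" using P Q fin by (auto simp: P'_def)
  have base': "(\<Sum>p\<in>P'. g (coef q) p * \<phi> p) = \<epsilon> (coef q) * z" if q: "q \<in> Q" for q
  proof -
    obtain \<beta> i j where b: "q = (\<beta>, i, j)" "i < nd \<beta>" "j < nd \<beta>"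
      using q Q(2) by (auto simp: coef_index_def)
    have "(\<Sum>p\<in>P'. g (coef q) p * \<phi> p) = (\<Sum>p\<in>{p \<in> coef_index. g (coef q) p \<noteq> 0}. g (coef q) p * \<phi> p)"
    proof (rule sum.mono_neutral_right[OF P'(1)])
      show "{p \<in> coef_index. g (coef q) p \<noteq> 0} \<subseteq> P'" using q by (auto simp: P'_def)
      show "\<forall>p\<in>P' - {p \<in> coef_index. g (coef q) p \<noteq> 0}. g (coef q) p * \<phi> p = 0"
      proof
        fix p assume "p \<in> P' - {p \<in> coef_index. g (coef q) p \<noteq> 0}"
        then have "g (coef q) p = 0" using P'(3) by blast
        then show "g (coef q) p * \<phi> p = 0" by simp
      qed
    qed
    then show ?thesis using base[OF b(2,3)] by (simp add: coef_def b(1))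
  qed
  have "(\<Sum>p\<in>P. g a p * \<phi> p) = (\<Sum>p\<in>P'. g a p * \<phi> p)"
  proof (rule sum.mono_neutral_left[OF P'(1,2)])
    show "\<forall>p\<in>P' - P. g a p * \<phi> p = 0"
    proof
      fix p assume "p \<in> P' - P"
      then have "g a p = 0" using P(3) P'(3) by blast
      then show "g a p * \<phi> p = 0" by simp
    qed
  qed
  also have "\<dots> = (\<Sum>p\<in>P'. \<Sum>q\<in>Q. c q * (g (coef q) p * \<phi> p))"
    unfolding Q(3) by (simp add: clinear_map_sum[OF lin] clinear_mapD[OF lin] sum_distrib_right mult.assoc)
  also have "\<dots> = (\<Sum>q\<in>Q. c q * (\<Sum>p\<in>P'. g (coef q) p * \<phi> p))"
    by (subst sum.swap) (simp add: sum_distrib_left)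
  also have "\<dots> = (\<Sum>q\<in>Q. c q * (\<epsilon> (coef q) * z))" by (simp add: base')
  also have "\<dots> = \<epsilon> a * z"
    unfolding Q(3) by (simp add: clinear_map_sum[OF counit_linear] clinear_mapD[OF counit_linear] sum_distrib_right mult.assoc)
  finally show ?thesis .
qed

lemma star_coef_expansion:
  obtains Q c where "finite Q" "Q \<subseteq> coef_index" "a = (\<Sum>q\<in>Q. c q *\<^sub>C star (coef q))"
proof -
  obtain Q c where Q: "finite Q" "Q \<subseteq> coef_index" "star a = (\<Sum>q\<in>Q. c q *\<^sub>C coef q)"
    by (rule coef_expansion)
  have "a = (\<Sum>q\<in>Q. cnj (c q) *\<^sub>C star (coef q))"
    using arg_cong[OF Q(3), of star] by (simp add: star_star star_sum star_scaleC)
  from that[OF Q(1,2) this] show ?thesis .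
qed

text \<open>By orthogonality a coefficient pairs with the adjoints of its own block only.\<close>

lemma haar_support_finite:
  "finite {p \<in> coef_index. haar (coef p * a) \<noteq> 0}" "finite {p \<in> coef_index. haar (a * coef p) \<noteq> 0}"
proof -
  obtain Q c where Q: "finite Q" "Q \<subseteq> coef_index" "a = (\<Sum>q\<in>Q. c q *\<^sub>C star (coef q))"
    by (rule star_coef_expansion)
  define S where "S = Sigma (fst ` Q) (\<lambda>\<alpha>. {..<nd \<alpha>} \<times> {..<nd \<alpha>})"
  have S: "finite S" unfolding S_def using Q(1) by (intro finite_SigmaI) auto
  have zero: "haar (coef p * star (coef q)) = 0" "haar (star (coef q) * coef p) = 0"
    if "p \<in> coef_index" "p \<notin> S" "q \<in> Q" for p q
  proof -
    obtain \<gamma> k l \<beta> i j where pq: "p = (\<gamma>, k, l)" "q = (\<beta>, i, j)" by (metis prod_cases3)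
    have lt: "k < nd \<gamma>" "l < nd \<gamma>" "i < nd \<beta>" "j < nd \<beta>"
      using that Q(2) by (auto simp: pq coef_index_def)
    have "\<gamma> \<noteq> \<beta>" using that lt by (force simp: S_def pq)
    then show "haar (coef p * star (coef q)) = 0" "haar (star (coef q) * coef p) = 0"
      using lt by (simp_all add: pq coef_def haar_orthogonality_left haar_orthogonality_right)
  qed
  have "haar (coef p * a) = 0" "haar (a * coef p) = 0" if "p \<in> coef_index" "p \<notin> S" for p
    unfolding Q(3) using zero[OF that]
    by (simp_all add: sum_distrib_left sum_distrib_right scaleC_mult_left scaleC_mult_right
        clinear_map_sum[OF haar_linear] clinear_mapD[OF haar_linear])
  then have "{p \<in> coef_index. haar (coef p * a) \<noteq> 0} \<subseteq> S" "{p \<in> coef_index. haar (a * coef p) \<noteq> 0} \<subseteq> S"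
    by blast+
  then show "finite {p \<in> coef_index. haar (coef p * a) \<noteq> 0}" "finite {p \<in> coef_index. haar (a * coef p) \<noteq> 0}"
    using S finite_subset by blast+
qed

text \<open>Left invariance of \<open>\<phi>\<close> at the unit of the trivial block is the pairing of \<open>\<phi>\<close> with products
  of two coefficients. Extended to \<open>u\<^sub>i\<^sub>j*\<close> in place of the second factor, it involves a single row of
  \<open>\<phi>\<close>.\<close>

lemma left_haar_inverse:
  assumes \<phi>: "left_haar G \<phi>" and ij: "i < nd \<beta>" "j < nd \<beta>"
  shows "(\<Sum>l<nd \<beta>. haar_left \<beta> l j * \<phi> \<beta> i l) = (if i = j then \<phi> triv 0 0 else 0)"
proof -
  define g where "g a p = haar (coef p * a)" for a p
  define \<psi> where "\<psi> = (\<lambda>(\<gamma>, k, l). \<phi> \<gamma> k l)"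
  have "(\<Sum>p\<in>(\<lambda>l. (\<beta>, i, l)) ` {..<nd \<beta>}. g (star (u \<beta> i j)) p * \<psi> p) = \<epsilon> (star (u \<beta> i j)) * \<phi> triv 0 0"
  proof (rule pairing_extends)
    show "clinear_map (\<lambda>a. g a p)" for p
      unfolding g_def using haar_linear by (simp add: clinear_map_def distrib_left scaleC_mult_right)
    show "finite {p \<in> coef_index. g a p \<noteq> 0}" for a
      unfolding g_def by (rule haar_support_finite)
    show "{p \<in> coef_index. g (star (u \<beta> i j)) p \<noteq> 0} \<subseteq> (\<lambda>l. (\<beta>, i, l)) ` {..<nd \<beta>}"
      using ij by (auto simp: g_def coef_def coef_index_def haar_orthogonality_left split: if_splits)
    fix \<beta> i j assume ij: "i < nd \<beta>" "j < nd \<beta>"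
    have supp: "{(\<gamma>, k, l). k < nd \<gamma> \<and> l < nd \<gamma> \<and> dual_comult G triv 0 0 \<beta> i j \<gamma> k l \<noteq> 0} =
        {p \<in> coef_index. g (u \<beta> i j) p \<noteq> 0}"
      by (auto simp: coef_index_def g_def coef_def dual_comult_def haar_def)
    have "(\<Sum>(\<gamma>, k, l)\<in>{(\<gamma>, k, l). k < nd \<gamma> \<and> l < nd \<gamma> \<and> dual_comult G triv 0 0 \<beta> i j \<gamma> k l \<noteq> 0}.
        dual_comult G triv 0 0 \<beta> i j \<gamma> k l * \<phi> \<gamma> k l) = (if i = j then \<phi> triv 0 0 else 0)"
      by (rule \<phi>[unfolded left_haar_def, THEN conjunct2, rule_format]) (use ij triv in simp_all)
    then show "(\<Sum>p\<in>{p \<in> coef_index. g (u \<beta> i j) p \<noteq> 0}. g (u \<beta> i j) p * \<psi> p) = \<epsilon> (u \<beta> i j) * \<phi> triv 0 0"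
      unfolding supp using ij
      by (simp add: g_def \<psi>_def coef_def dual_comult_def haar_def case_prod_unfold counit_corep[OF irr_unitary] del: mult_cancel_right)
  qed (use ij in \<open>auto simp: coef_index_def\<close>)
  then show ?thesis using ij
    by (simp add: sum.reindex inj_on_def g_def \<psi>_def coef_def haar_orthogonality_left counit_star_corep[OF irr_unitary])
qed

lemma right_haar_inverse:
  assumes \<phi>: "right_haar G \<phi>" and ij: "i < nd \<beta>" "j < nd \<beta>"
  shows "(\<Sum>k<nd \<beta>. haar_right \<beta> i k * \<phi> \<beta> k j) = (if i = j then \<phi> triv 0 0 else 0)"
proof -
  define g where "g a p = haar (a * coef p)" for a p
  define \<psi> where "\<psi> = (\<lambda>(\<gamma>, k, l). \<phi> \<gamma> k l)"
  have "(\<Sum>p\<in>(\<lambda>k. (\<beta>, k, j)) ` {..<nd \<beta>}. g (star (u \<beta> i j)) p * \<psi> p) = \<epsilon> (star (u \<beta> i j)) * \<phi> triv 0 0"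
  proof (rule pairing_extends)
    show "clinear_map (\<lambda>a. g a p)" for p
      unfolding g_def using haar_linear by (simp add: clinear_map_def distrib_right scaleC_mult_left)
    show "finite {p \<in> coef_index. g a p \<noteq> 0}" for a
      unfolding g_def by (rule haar_support_finite)
    show "{p \<in> coef_index. g (star (u \<beta> i j)) p \<noteq> 0} \<subseteq> (\<lambda>k. (\<beta>, k, j)) ` {..<nd \<beta>}"
      using ij by (auto simp: g_def coef_def coef_index_def haar_orthogonality_right split: if_splits)
    fix \<gamma> k l assume kl: "k < nd \<gamma>" "l < nd \<gamma>"
    have supp: "{(\<beta>, i, j). i < nd \<beta> \<and> j < nd \<beta> \<and> dual_comult G triv 0 0 \<beta> i j \<gamma> k l \<noteq> 0} =
        {p \<in> coef_index. g (u \<gamma> k l) p \<noteq> 0}"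
      by (auto simp: coef_index_def g_def coef_def dual_comult_def haar_def)
    have "(\<Sum>(\<beta>, i, j)\<in>{(\<beta>, i, j). i < nd \<beta> \<and> j < nd \<beta> \<and> dual_comult G triv 0 0 \<beta> i j \<gamma> k l \<noteq> 0}.
        dual_comult G triv 0 0 \<beta> i j \<gamma> k l * \<phi> \<beta> i j) = (if k = l then \<phi> triv 0 0 else 0)"
      by (rule \<phi>[unfolded right_haar_def, THEN conjunct2, rule_format]) (use kl triv in simp_all)
    then show "(\<Sum>p\<in>{p \<in> coef_index. g (u \<gamma> k l) p \<noteq> 0}. g (u \<gamma> k l) p * \<psi> p) = \<epsilon> (u \<gamma> k l) * \<phi> triv 0 0"
      unfolding supp using kl
      by (simp add: g_def \<psi>_def coef_def dual_comult_def haar_def case_prod_unfold counit_corep[OF irr_unitary] del: mult_cancel_right)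
  qed (use ij in \<open>auto simp: coef_index_def\<close>)
  then show ?thesis using ij
    by (simp add: sum.reindex inj_on_def g_def \<psi>_def coef_def haar_orthogonality_right counit_star_corep[OF irr_unitary])
qed

text \<open>Left and right invariance make the density matrix of \<open>\<phi>\<close> the inverse of \<open>haar_left\<close> and of
  \<open>haar_right\<close>, respectively. These are therefore equal, and the modular matrix \<open>F\<close>, which is a
  multiple of the former, intertwines \<open>u\<close> and \<open>\<kappa>\<^sup>2(u)\<close> in both directions.\<close>

lemma unimodular_kac:
  assumes R: "unitary_antipode G R" and uni: "dual_unimodular G" and f: "clinear_map f"
  shows "kac_functional R f"
proof -
  obtain \<phi> where l: "left_haar G \<phi>" and r: "right_haar G \<phi>"
    using uni by (auto simp: dual_unimodular_def)
  let ?z = "\<phi> triv 0 0"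
  \<comment> \<open>if \<open>\<phi>\<close> vanished on the trivial block, its density would be in the kernel of every \<open>F\<close>\<close>
  have z: "?z \<noteq> 0"
  proof
    assume z: "?z = 0"
    have "\<phi> \<alpha> i j = 0" if ij: "i < nd \<alpha>" "j < nd \<alpha>" for \<alpha> i j
    proof -
      obtain P F where F: "modular_pair R \<alpha> P F" using modular_pair_exists[OF R] .
      have F': "positive_definite (nd \<alpha>) F" by (rule posdef_square[OF modular_pairD(1,2)[OF F]])
      have "(\<Sum>l<nd \<alpha>. F k l * \<phi> \<alpha> i l) = 0" if k: "k < nd \<alpha>" for k
      proof -
        have "(\<Sum>l<nd \<alpha>. F k l * \<phi> \<alpha> i l) = (\<Sum>k<nd \<alpha>. F k k) * (\<Sum>l<nd \<alpha>. haar_left \<alpha> l k * \<phi> \<alpha> i l)"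
          unfolding sum_distrib_left
          by (intro sum.cong refl) (simp add: haar_left_modular[OF F k] flip: mult.assoc)
        then show ?thesis using left_haar_inverse[OF l ij(1) k] z by simp
      qed
      from posdef_kernel[OF F' this ij(2)] show ?thesis .
    qed
    then show False using l by (auto simp: left_haar_def haar_functional_def)
  qed
  show ?thesis
    unfolding kac_functional_def
  proof (intro conjI allI impI f)
    fix \<alpha> P F i j
    assume F: "modular_pair R \<alpha> P F" and ij: "i < nd \<alpha>" "j < nd \<alpha>"
    let ?n = "nd \<alpha>"
    have eq: "haar_right \<alpha> i k = haar_left \<alpha> i k" if ik: "i < ?n" "k < ?n" for i k
    proof -
      have "haar_right \<alpha> i k * ?z = (\<Sum>j<?n. if j = k then haar_right \<alpha> i j * ?z else 0)" using ik by simp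
      also have "\<dots> = (\<Sum>j<?n. haar_right \<alpha> i j * (\<Sum>l<?n. haar_left \<alpha> l k * \<phi> \<alpha> j l))"
        using ik by (intro sum.cong refl) (simp add: left_haar_inverse[OF l])
      also have "\<dots> = (\<Sum>l<?n. haar_left \<alpha> l k * (\<Sum>j<?n. haar_right \<alpha> i j * \<phi> \<alpha> j l))"
        by (simp add: sum_distrib_left mult_ac) (rule sum.swap)
      also have "\<dots> = (\<Sum>l<?n. if l = i then haar_left \<alpha> l k * ?z else 0)"
        using ik by (intro sum.cong refl) (simp add: right_haar_inverse[OF r])
      also have "\<dots> = haar_left \<alpha> i k * ?z" using ik by simp
      finally show ?thesis using z by simp
    qed
    define X where "X i j = f (u \<alpha> i j)" for i j
    define Y where "Y i j = f (\<kappa> (\<kappa> (u \<alpha> i j)))" for i j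
    have FX: "(\<Sum>k<?n. F i k * X k j) = (\<Sum>k<?n. Y i k * F k j)" if "i < ?n" "j < ?n" for i j
    proof -
      have "f (\<Sum>k<?n. F k j *\<^sub>C \<kappa> (\<kappa> (u \<alpha> i k))) = f (\<Sum>k<?n. F i k *\<^sub>C u \<alpha> k j)"
        using modular_pairD(3)[OF F that] by simp
      then show ?thesis by (simp add: X_def Y_def clinear_map_sum[OF f] clinear_mapD[OF f] mult.commute)
    qed
    have XF: "(\<Sum>k<?n. X i k * F k j) = (\<Sum>k<?n. F i k * Y k j)" if ij: "i < ?n" "j < ?n" for i j
    proof -
      have "f (\<Sum>p<?n. haar_right \<alpha> j p *\<^sub>C u \<alpha> i p) = f (\<Sum>k<?n. haar_right \<alpha> k i *\<^sub>C \<kappa> (\<kappa> (u \<alpha> k j)))"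
        using haar_right_relation[OF ij(2,1)] by simp
      then have "(\<Sum>k<?n. haar_left \<alpha> j k * X i k) = (\<Sum>k<?n. haar_left \<alpha> k i * Y k j)"
        using ij by (simp add: X_def Y_def clinear_map_sum[OF f] clinear_mapD[OF f] eq)
      then have "(\<Sum>k<?n. F k k) * (\<Sum>k<?n. haar_left \<alpha> j k * X i k) = (\<Sum>k<?n. F k k) * (\<Sum>k<?n. haar_left \<alpha> k i * Y k j)"
        by simp
      moreover have "(\<Sum>k<?n. F k k) * (\<Sum>k<?n. haar_left \<alpha> j k * X i k) = (\<Sum>k<?n. X i k * F k j)"
        unfolding sum_distrib_left using ij
        by (intro sum.cong refl, subst mult.assoc[symmetric], subst haar_left_modular[OF F])
          (simp_all add: mult.commute)
      moreover have "(\<Sum>k<?n. F k k) * (\<Sum>k<?n. haar_left \<alpha> k i * Y k j) = (\<Sum>k<?n. F i k * Y k j)"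
        unfolding sum_distrib_left using ij
        by (intro sum.cong refl) (simp add: haar_left_modular[OF F] flip: mult.assoc)
      ultimately show ?thesis by simp
    qed
    \<comment> \<open>\<open>F F X = F Y F = X F F\<close>\<close>
    have "(\<Sum>k<?n. mm ?n F F i k * X k j) = (\<Sum>k<?n. X i k * mm ?n F F k j)" if ij: "i < ?n" "j < ?n" for i j
    proof -
      have "mm ?n (mm ?n F F) X i j = mm ?n F (mm ?n F X) i j" by (simp add: mm_assoc)
      also have "\<dots> = mm ?n F (mm ?n Y F) i j"
        unfolding mm_def[of ?n F "mm ?n F X"] mm_def[of ?n F "mm ?n Y F"] using ij
        by (intro sum.cong refl) (simp add: mm_def FX)
      also have "\<dots> = mm ?n (mm ?n F Y) F i j" by (simp add: mm_assoc)
      also have "\<dots> = mm ?n (mm ?n X F) F i j"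
        unfolding mm_def[of ?n "mm ?n F Y" F] mm_def[of ?n "mm ?n X F" F] using ij
        by (intro sum.cong refl) (simp add: mm_def XF)
      also have "\<dots> = mm ?n X (mm ?n F F) i j" by (simp add: mm_assoc)
      finally show ?thesis by (simp add: mm_def)
    qed
    then have "(\<Sum>k<?n. F i k * X k j) = (\<Sum>k<?n. X i k * F k j)"
      by (intro commute_posdef_sqrt[OF posdef_square[OF modular_pairD(1,2)[OF F]] _ _ ij, of "mm ?n F F"])
        (auto simp: mm_def)
    then show "(\<Sum>k<?n. F i k * f (u \<alpha> k j)) = (\<Sum>k<?n. f (u \<alpha> i k) * F k j)" by (simp add: X_def)
  qed
qed

end

section \<open>Hilbert spaces\<close>

lemma cinner_0_right [simp]: "cinner x (0::'h::chilbert_space) = 0"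
  using cinner_scaleC_right[of x 0 "0::'h"] by simp

lemma cinner_add_left: "cinner (x + y) z = cinner x z + cinner y (z::'h::chilbert_space)"
  by (metis cinner_add_right cinner_commute complex_cnj_add)

lemma cinner_scaleC_left: "cinner (c *\<^sub>C x) y = cnj c * cinner x (y::'h::chilbert_space)"
  by (metis cinner_commute cinner_scaleC_right complex_cnj_mult)

lemma cinner_0_left [simp]: "cinner (0::'h::chilbert_space) x = 0"
  by (metis cinner_0_right cinner_commute complex_cnj_zero)

lemma cinner_diff_right: "cinner x (y - z) = cinner x y - cinner x (z::'h::chilbert_space)"
  by (metis add_diff_cancel cinner_add_right diff_add_cancel)

lemma cinner_diff_left: "cinner (x - y) z = cinner x z - cinner y (z::'h::chilbert_space)"
  by (metis add_diff_cancel cinner_add_left diff_add_cancel)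

lemma cinner_sum_right: "cinner x (\<Sum>i\<in>A. f i) = (\<Sum>i\<in>A. cinner x (f i :: 'h::chilbert_space))"
  by (induction A rule: infinite_finite_induct) (auto simp: cinner_add_right)

lemma cinner_sum_left: "cinner (\<Sum>i\<in>A. f i) x = (\<Sum>i\<in>A. cinner (f i :: 'h::chilbert_space) x)"
  by (induction A rule: infinite_finite_induct) (auto simp: cinner_add_left)

lemma cinner_self: "cinner x x = of_real ((norm (x::'h::chilbert_space))\<^sup>2)"
proof -
  have "0 \<le> sqrt (Re (cinner x x))" using norm_ge_zero[of x] by (simp only: norm_eq_sqrt_cinner)
  then have "0 \<le> Re (cinner x x)" by simp
  then have "(norm x)\<^sup>2 = Re (cinner x x)" by (simp add: norm_eq_sqrt_cinner)
  moreover have "Im (cinner x x) = 0" using cinner_commute[of x x] by (simp add: complex_eq_iff)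
  ultimately show ?thesis by (simp add: complex_eq_iff)
qed

lemma Re_cinner_self: "Re (cinner x x) = (norm (x::'h::chilbert_space))\<^sup>2"
  by (simp add: cinner_self)

lemma cmod_cinner_self: "cmod (cinner x x) = norm x * norm (x::'h::chilbert_space)"
  by (simp only: cinner_self norm_of_real) (simp add: power2_eq_square)

lemma norm_scaleC: "norm (c *\<^sub>C x) = cmod c * norm (x::'h::chilbert_space)"
proof -
  have "cinner (c *\<^sub>C x) (c *\<^sub>C x) = (c * cnj c) * cinner x x"
    by (simp add: cinner_scaleC_right cinner_scaleC_left mult_ac)
  also have "\<dots> = of_real ((cmod c * norm x)\<^sup>2)"
    by (simp only: cinner_self complex_norm_square[symmetric]) (simp add: power_mult_distrib)
  finally have "(norm (c *\<^sub>C x))\<^sup>2 = (cmod c * norm x)\<^sup>2"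
    unfolding cinner_self of_real_eq_iff .
  then show ?thesis by (simp add: power2_eq_iff_nonneg)
qed

lemma norm_diff_square: "(norm (x - y))\<^sup>2 = (norm x)\<^sup>2 + (norm y)\<^sup>2 - 2 * Re (cinner x (y::'h::chilbert_space))"
proof -
  have "Re (cinner y x) = Re (cinner x y)" by (subst cinner_commute) simp
  then show ?thesis
    by (simp only: Re_cinner_self[symmetric] cinner_diff_left cinner_diff_right minus_complex.sel)
qed

lemma cauchy_schwarz: "cmod (cinner x y) \<le> norm x * norm (y::'h::chilbert_space)"
proof (cases "x = 0")
  case False
  \<comment> \<open>\<open>c x\<close> is the projection of \<open>y\<close> to the line of \<open>x\<close>\<close>
  define c where "c = cinner x y / of_real ((norm x)\<^sup>2)"
  have "(norm (c *\<^sub>C x - y))\<^sup>2 = (cmod c)\<^sup>2 * (norm x)\<^sup>2 + (norm y)\<^sup>2 - 2 * Re (cnj c * cinner x y)"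
    by (simp add: norm_diff_square norm_scaleC cinner_scaleC_left power_mult_distrib)
  also have "cnj c * cinner x y = of_real ((cmod (cinner x y))\<^sup>2 / (norm x)\<^sup>2)"
    unfolding c_def of_real_divide complex_norm_square[of "cinner x y"] complex_cnj_divide complex_cnj_complex_of_real
    by (simp add: mult.commute)
  also have "cmod c = cmod (cinner x y) / (norm x)\<^sup>2"
    by (simp add: c_def norm_divide norm_power)
  also have "(cmod (cinner x y) / (norm x)\<^sup>2)\<^sup>2 * (norm x)\<^sup>2 = (cmod (cinner x y))\<^sup>2 / (norm x)\<^sup>2"
    using False by (simp add: power_divide power2_eq_square)
  finally have "0 \<le> (norm y)\<^sup>2 - (cmod (cinner x y))\<^sup>2 / (norm x)\<^sup>2"
    using zero_le_power2[of "norm (c *\<^sub>C x - y)"] by simp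
  then have "(cmod (cinner x y))\<^sup>2 \<le> (norm x * norm y)\<^sup>2"
    using False by (simp add: field_simps power_mult_distrib)
  then show ?thesis by (rule power2_le_imp_le) simp
qed simp

lemma tendsto_scaleC:
  assumes "(f \<longlongrightarrow> l) F"
  shows "((\<lambda>n. c *\<^sub>C f n) \<longlongrightarrow> c *\<^sub>C (l::'h::chilbert_space)) F"
proof -
  have "bounded_linear (\<lambda>x::'h. c *\<^sub>C x)"
  proof
    show "\<exists>K. \<forall>x::'h. norm (c *\<^sub>C x) \<le> norm x * K"
      by (rule exI[of _ "cmod c"]) (simp add: norm_scaleC mult.commute)
  qed (simp_all add: cv.scale_right_distrib scaleR_scaleC mult.commute)
  from bounded_linear.tendsto[OF this assms] show ?thesis .
qed

interpretation hs: inner_space "UNIV :: 'h::chilbert_space set" cinner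
proof
  show "cinner x y = cnj (cinner y x)" for x y :: 'h by (rule cinner_commute)
  show "0 \<le> Re (cinner x x)" for x :: 'h by (simp add: Re_cinner_self)
  show "cinner x x = 0 \<Longrightarrow> x = 0" for x :: 'h by (simp add: cinner_self)
qed (simp_all add: cinner_add_right cinner_scaleC_right)

lemma hilbert_spaceD:
  assumes "hilbert_space H"
  shows "csubspace H" "closed H" "0 \<in> H" "x \<in> H \<Longrightarrow> y \<in> H \<Longrightarrow> x + y \<in> H"
    "x \<in> H \<Longrightarrow> y \<in> H \<Longrightarrow> x - y \<in> H" "x \<in> H \<Longrightarrow> c *\<^sub>C x \<in> H"
  using assms by (auto simp: hilbert_space_def intro: cv.subspace_0 cv.subspace_add cv.subspace_diff cv.subspace_scale)

lemma hilbert_space_limit: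
  "hilbert_space H \<Longrightarrow> (\<And>n. f n \<in> H) \<Longrightarrow> f \<longlonglongrightarrow> l \<Longrightarrow> l \<in> H"
  unfolding hilbert_space_def using closed_sequentially by blast

lemma bounded_opsI:
  assumes "\<And>x. x \<in> H \<Longrightarrow> f x \<in> K" "\<And>x y. x \<in> H \<Longrightarrow> y \<in> H \<Longrightarrow> f (x + y) = f x + f y"
    "\<And>c x. x \<in> H \<Longrightarrow> f (c *\<^sub>C x) = c *\<^sub>C f x" "\<And>x. x \<in> H \<Longrightarrow> norm (f x) \<le> C * norm x"
    "\<And>x. x \<notin> H \<Longrightarrow> f x = 0"
  shows "f \<in> bounded_ops H K"
  using assms unfolding bounded_ops_def by blast

lemma bounded_opsD:
  assumes "f \<in> bounded_ops H K"
  shows "x \<in> H \<Longrightarrow> f x \<in> K" "x \<in> H \<Longrightarrow> y \<in> H \<Longrightarrow> f (x + y) = f x + f y"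
    "x \<in> H \<Longrightarrow> f (c *\<^sub>C x) = c *\<^sub>C f x" "x \<notin> H \<Longrightarrow> f x = 0"
  using assms by (auto simp: bounded_ops_def)

lemma bounded_ops_bound:
  assumes "f \<in> bounded_ops H K"
  obtains C where "C \<ge> 0" "\<forall>x\<in>H. norm (f x) \<le> C * norm x"
proof -
  obtain C where C: "\<forall>x\<in>H. norm (f x) \<le> C * norm x" using assms by (auto simp: bounded_ops_def)
  have "norm (f x) \<le> \<bar>C\<bar> * norm x" if "x \<in> H" for x
  proof -
    have "C * norm x \<le> \<bar>C\<bar> * norm x" by (intro mult_right_mono) auto
    then show ?thesis using C that by fastforce
  qed
  then show ?thesis by (intro that[of "\<bar>C\<bar>"]) auto
qed

lemma bounded_ops_0: "f \<in> bounded_ops H K \<Longrightarrow> hilbert_space H \<Longrightarrow> f 0 = 0"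
  using bounded_opsD(3)[of f H K 0 0] hilbert_spaceD(3) by fastforce

lemma bounded_ops_diff:
  assumes "f \<in> bounded_ops H K" "hilbert_space H" "x \<in> H" "y \<in> H"
  shows "f (x - y) = f x - f y"
  using bounded_opsD(2)[OF assms(1) hilbert_spaceD(5)[OF assms(2-4)] assms(4)] by (simp add: algebra_simps)

lemma bounded_ops_sum:
  assumes "f \<in> bounded_ops H K" "hilbert_space H" "\<And>i. i \<in> A \<Longrightarrow> g i \<in> H"
  shows "f (\<Sum>i\<in>A. g i) = (\<Sum>i\<in>A. f (g i))"
  using assms(3)
proof (induction A rule: infinite_finite_induct)
  case (insert a A)
  then have "f (g a + (\<Sum>i\<in>A. g i)) = f (g a) + f (\<Sum>i\<in>A. g i)"
    by (intro bounded_opsD(2)[OF assms(1)] cv.subspace_sum hilbert_spaceD[OF assms(2)]) auto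
  with insert show ?case by simp
qed (auto simp: bounded_ops_0[OF assms(1,2)])

lemma tendsto_zero_square_bound:
  assumes "\<And>n. (norm (f n :: 'b::real_normed_vector))\<^sup>2 \<le> b n" "b \<longlonglongrightarrow> 0"
  shows "f \<longlonglongrightarrow> 0"
proof -
  have "(\<lambda>n. (norm (f n))\<^sup>2) \<longlonglongrightarrow> 0"
  proof (rule tendsto_sandwich[OF _ _ tendsto_const assms(2)])
    show "\<forall>\<^sub>F n in sequentially. 0 \<le> (norm (f n))\<^sup>2" by (intro always_eventually allI) simp
    show "\<forall>\<^sub>F n in sequentially. (norm (f n))\<^sup>2 \<le> b n" by (intro always_eventually allI assms(1))
  qed
  then have "(\<lambda>n. sqrt ((norm (f n))\<^sup>2)) \<longlonglongrightarrow> sqrt 0" by (rule tendsto_real_sqrt)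
  then have "(\<lambda>n. norm (f n)) \<longlonglongrightarrow> 0" by simp
  then show ?thesis by (rule tendsto_norm_zero_cancel)
qed

lemma tendsto_lipschitz:
  fixes f :: "nat \<Rightarrow> 'b::real_normed_vector" and g :: "nat \<Rightarrow> 'c::real_normed_vector"
  assumes "\<And>n. norm (f n - l) \<le> C * norm (g n - m)" "g \<longlonglongrightarrow> m"
  shows "f \<longlonglongrightarrow> l"
proof -
  have "(\<lambda>n. f n - l) \<longlonglongrightarrow> 0"
  proof (rule tendsto_zero_square_bound)
    show "(norm (f n - l))\<^sup>2 \<le> (C * norm (g n - m))\<^sup>2" for n by (intro power_mono assms) simp
    have "(\<lambda>n. norm (g n - m)) \<longlonglongrightarrow> 0" using assms(2) by (simp add: tendsto_norm_zero LIM_zero)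
    then have "(\<lambda>n. (C * norm (g n - m))\<^sup>2) \<longlonglongrightarrow> (C * 0)\<^sup>2" by (intro tendsto_intros)
    then show "(\<lambda>n. (C * norm (g n - m))\<^sup>2) \<longlonglongrightarrow> 0" by simp
  qed
  then show ?thesis by (rule LIM_zero_cancel)
qed

lemma bounded_ops_limit:
  assumes f: "f \<in> bounded_ops H K" "hilbert_space H" and x: "\<And>n. x n \<in> H" "x \<longlonglongrightarrow> l"
  shows "(\<lambda>n. f (x n)) \<longlonglongrightarrow> f l"
proof -
  obtain C where C: "C \<ge> 0" "\<forall>x\<in>H. norm (f x) \<le> C * norm x" by (rule bounded_ops_bound[OF f(1)])
  note C = C(1) bspec[OF C(2)]
  have l: "l \<in> H" by (rule hilbert_space_limit[OF f(2) x])
  show ?thesis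
  proof (rule tendsto_lipschitz[OF _ x(2)])
    show "norm (f (x n) - f l) \<le> C * norm (x n - l)" for n
      using C(2)[OF hilbert_spaceD(5)[OF f(2) x(1) l], of n] by (simp add: bounded_ops_diff[OF f x(1) l])
  qed
qed

lemma bounded_ops_eqI:
  assumes f: "f \<in> bounded_ops H K" and g: "g \<in> bounded_ops H K" and H: "hilbert_space H" "H = closure (cspan S)"
    and eq: "\<And>x. x \<in> S \<Longrightarrow> f x = g x"
  shows "f = g"
proof
  fix x
  have sub: "cspan S \<subseteq> H" using H(2) closure_subset by blast
  have span: "y \<in> H \<and> f y = g y" if "y \<in> cspan S" for y
    using that
  proof (induction rule: cv.span_induct)
    case base
    show ?case
      using H(1) f g by (auto simp: cv.subspace_def hilbert_spaceD bounded_opsD bounded_ops_0)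
  next
    case (step y)
    then show ?case using eq sub cv.span_base by blast
  qed
  show "f x = g x"
  proof (cases "x \<in> H")
    case True
    then obtain y where y: "\<And>n. y n \<in> cspan S" "y \<longlonglongrightarrow> x"
      using H(2) closure_sequential by metis
    have yH: "y n \<in> H" for n using y(1) sub by blast
    have "(\<lambda>n. f (y n)) \<longlonglongrightarrow> f x" "(\<lambda>n. g (y n)) \<longlonglongrightarrow> g x"
      by (rule bounded_ops_limit[OF f H(1) yH y(2)], rule bounded_ops_limit[OF g H(1) yH y(2)])
    moreover have "f (y n) = g (y n)" for n using span y(1) by blast
    ultimately show ?thesis using LIMSEQ_unique by simp
  qed (simp add: bounded_opsD(4)[OF f] bounded_opsD(4)[OF g])
qed

text \<open>The representing vector minimises \<open>q x = (norm x)\<^sup>2 - 2 Re (f x)\<close>. Minimising sequences are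
  Cauchy by the parallelogram law.\<close>

lemma riesz:
  fixes f :: "'h::chilbert_space \<Rightarrow> complex"
  assumes H: "hilbert_space H" and f: "f \<in> bounded_ops H UNIV"
  obtains z where "z \<in> H" "\<forall>x\<in>H. f x = cinner z x"
proof -
  obtain C where C: "C \<ge> 0" "\<forall>x\<in>H. norm (f x) \<le> C * norm x" by (rule bounded_ops_bound[OF f])
  note C = C(1) bspec[OF C(2)]
  define q where "q x = (norm x)\<^sup>2 - 2 * Re (f x)" for x
  have low: "- C\<^sup>2 \<le> q x" if "x \<in> H" for x
  proof -
    have "Re (f x) \<le> C * norm x" using C(2)[OF that] abs_Re_le_cmod[of "f x"] by linarith
    moreover have "0 \<le> (norm x - C)\<^sup>2" by simp
    ultimately show ?thesis unfolding q_def by (simp add: power2_diff mult.commute)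
  qed
  define d where "d = Inf (q ` H)"
  have bdd: "bdd_below (q ` H)" using low by (auto simp: bdd_below_def)
  have ne: "q ` H \<noteq> {}" using hilbert_spaceD(3)[OF H] by blast
  have dle: "d \<le> q x" if "x \<in> H" for x unfolding d_def using bdd that by (simp add: cInf_lower)
  have "\<exists>x\<in>H. q x < d + 1 / real (Suc n)" for n
  proof -
    have "Inf (q ` H) < d + 1 / real (Suc n)" by (simp add: d_def)
    then show ?thesis using cInf_lessD[OF ne] by blast
  qed
  then obtain X where X: "\<And>n. X n \<in> H" "\<And>n. q (X n) < d + 1 / real (Suc n)" by metis
  have par: "(norm (x - y))\<^sup>2 \<le> 2 * q x + 2 * q y - 4 * d" if xy: "x \<in> H" "y \<in> H" for x y
  proof -
    let ?m = "(1/2) *\<^sub>C (x + y)"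
    have mH: "?m \<in> H" using xy by (intro hilbert_spaceD[OF H])
    have "(norm (x + y))\<^sup>2 = (norm x)\<^sup>2 + (norm y)\<^sup>2 + 2 * Re (cinner x y)"
      using norm_diff_square[of x "- y"] cinner_diff_right[of x 0 y] by simp
    moreover have "(norm ?m)\<^sup>2 = (norm (x + y))\<^sup>2 / 4"
      by (simp only: norm_scaleC power_mult_distrib) (simp add: norm_divide power_divide)
    moreover have fm: "f ?m = (1/2) * (f x + f y)"
      using xy by (subst bounded_opsD(3)[OF f]) (simp_all add: bounded_opsD(2)[OF f] hilbert_spaceD[OF H])
    have "Re (f ?m) = (Re (f x) + Re (f y)) / 2" unfolding fm by simp
    ultimately have "q ?m = q x / 2 + q y / 2 - (norm (x - y))\<^sup>2 / 4"
      unfolding q_def norm_diff_square by (simp add: field_simps)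
    then show ?thesis using dle[OF mH] by linarith
  qed
  have "Cauchy X"
  proof (rule CauchyI)
    fix e :: real assume e: "e > 0"
    then obtain N where N: "4 / real (Suc N) < e\<^sup>2"
      using reals_Archimedean[of "e\<^sup>2 / 4"] by (auto simp: field_simps)
    show "\<exists>M. \<forall>m\<ge>M. \<forall>n\<ge>M. norm (X m - X n) < e"
    proof (intro exI[of _ N] allI impI)
      fix m n assume mn: "N \<le> m" "N \<le> n"
      have le: "1 / real (Suc k) \<le> 1 / real (Suc N)" if "N \<le> k" for k using that by (simp add: frac_le)
      have "(norm (X m - X n))\<^sup>2 \<le> 2 * q (X m) + 2 * q (X n) - 4 * d" by (rule par[OF X(1) X(1)])
      also have "\<dots> < 4 / real (Suc N)"
        using X(2)[of m] X(2)[of n] le[OF mn(1)] le[OF mn(2)] by simp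
      finally have "(norm (X m - X n))\<^sup>2 < e\<^sup>2" using N by linarith
      then show "norm (X m - X n) < e" using e power2_less_imp_less by fastforce
    qed
  qed
  then obtain z where z: "X \<longlonglongrightarrow> z" using Cauchy_convergent convergent_def by blast
  have zH: "z \<in> H" by (rule hilbert_space_limit[OF H X(1) z])
  have "(\<lambda>n. q (X n)) \<longlonglongrightarrow> q z"
    unfolding q_def by (intro tendsto_intros z bounded_ops_limit[OF f H X(1)])
  moreover have "(\<lambda>n. d + 1 / real (Suc n)) \<longlonglongrightarrow> d + 0"
    by (intro tendsto_add tendsto_const) (rule LIMSEQ_Suc[OF lim_1_over_n])
  ultimately have qz: "q z \<le> d"
    using X(2) by (intro LIMSEQ_le[of "\<lambda>n. q (X n)" _ "\<lambda>n. d + 1 / real (Suc n)"]) (auto intro: less_imp_le)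
  have "f x = cinner z x" if x: "x \<in> H" for x
  proof -
    define w where "w = f x - cinner z x"
    \<comment> \<open>move the minimiser \<open>z\<close> in the direction of \<open>x\<close>, with the phase that makes \<open>w\<close> real\<close>
    have ineq: "2 * e * (cmod w)\<^sup>2 \<le> e\<^sup>2 * ((cmod w)\<^sup>2 * (norm x)\<^sup>2)" for e :: real
    proof -
      define c where "c = complex_of_real e * cnj w"
      have "q z \<le> q (z + c *\<^sub>C x)"
        using qz dle[of "z + c *\<^sub>C x"] zH x by (simp add: hilbert_spaceD[OF H])
      also have "(norm (z + c *\<^sub>C x))\<^sup>2 = (norm z)\<^sup>2 + (cmod c)\<^sup>2 * (norm x)\<^sup>2 + 2 * Re (c * cinner z x)"
        using norm_diff_square[of z "- (c *\<^sub>C x)"] cinner_diff_right[of z 0 "c *\<^sub>C x"]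
        by (simp add: norm_scaleC cinner_scaleC_right power_mult_distrib)
      then have "q (z + c *\<^sub>C x) = q z + (cmod c)\<^sup>2 * (norm x)\<^sup>2 - 2 * Re (c * w)"
        by (simp add: q_def bounded_opsD[OF f] hilbert_spaceD[OF H] zH x w_def algebra_simps)
      also have "c * w = of_real (e * (cmod w)\<^sup>2)"
        unfolding c_def of_real_mult complex_norm_square by (simp add: mult_ac)
      also have "(cmod c)\<^sup>2 = e\<^sup>2 * (cmod w)\<^sup>2" by (simp add: c_def norm_mult power_mult_distrib)
      finally show ?thesis by (simp add: mult.assoc)
    qed
    have "w = 0"
    proof (rule ccontr)
      assume "w \<noteq> 0"
      then have w: "(cmod w)\<^sup>2 > 0" by simp
      define e where "e = 1 / ((norm x)\<^sup>2 + 1)"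
      have pos: "(norm x)\<^sup>2 + 1 > 0" by (simp add: add_nonneg_pos)
      then have e: "e > 0" by (simp add: e_def)
      have "e * (2 * (cmod w)\<^sup>2) \<le> e * ((cmod w)\<^sup>2 * (e * (norm x)\<^sup>2))"
        using ineq[of e] by (simp add: power2_eq_square mult_ac)
      then have "2 * (cmod w)\<^sup>2 \<le> (cmod w)\<^sup>2 * (e * (norm x)\<^sup>2)" using e by (simp only: mult_le_cancel_left_pos)
      moreover have "e * (norm x)\<^sup>2 \<le> 1" using pos by (simp add: e_def field_simps)
      then have "(cmod w)\<^sup>2 * (e * (norm x)\<^sup>2) \<le> (cmod w)\<^sup>2" using w by (simp add: mult_left_le)
      ultimately show False using w by linarith
    qed
    then show ?thesis by (simp add: w_def)
  qed
  then show ?thesis using that zH by blast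
qed

lemma cinner_ext:
  assumes "hilbert_space H" "y \<in> H" "z \<in> H" "\<And>x. x \<in> H \<Longrightarrow> cinner x y = cinner x z"
  shows "y = z"
proof -
  have "cinner (y - z) (y - z) = 0"
    using assms(4)[OF hilbert_spaceD(5)[OF assms(1-3)]] by (simp add: cinner_diff_right)
  then show ?thesis by (simp add: cinner_self)
qed

lemma cinner_ext_left:
  assumes "hilbert_space H" "y \<in> H" "z \<in> H" "\<And>x. x \<in> H \<Longrightarrow> cinner y x = cinner z x"
  shows "y = z"
  by (rule cinner_ext[OF assms(1-3)]) (metis assms(4) cinner_commute)

lemma cinner_functional:
  assumes "A \<in> bounded_ops H H'" "hilbert_space H"
  shows "(\<lambda>x. if x \<in> H then cinner y (A x) else 0) \<in> bounded_ops H UNIV"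
proof -
  obtain C where C: "C \<ge> 0" "\<forall>x\<in>H. norm (A x) \<le> C * norm x" by (rule bounded_ops_bound[OF assms(1)])
  note C = C(1) bspec[OF C(2)]
  show ?thesis
  proof (rule bounded_opsI[where C = "norm y * C"])
    fix x assume x: "x \<in> H"
    have "cmod (cinner y (A x)) \<le> norm y * norm (A x)" by (rule cauchy_schwarz)
    also have "\<dots> \<le> norm y * (C * norm x)" by (intro mult_left_mono C(2) x) simp
    finally show "norm (if x \<in> H then cinner y (A x) else 0) \<le> norm y * C * norm x" using x by (simp add: mult.assoc)
  qed (auto simp: bounded_opsD[OF assms(1)] hilbert_spaceD[OF assms(2)] cinner_add_right cinner_scaleC_right)
qed

lemma adj_op_eqI:
  assumes "hilbert_space H" "y \<in> H" "z \<in> H" "\<And>x. x \<in> H \<Longrightarrow> cinner (A x) y = cinner x z"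
  shows "adj_op H A y = z"
proof -
  have "(THE z. z \<in> H \<and> (\<forall>x\<in>H. cinner (A x) y = cinner x z)) = z"
    using assms by (intro the_equality conjI ballI) (auto intro: cinner_ext[OF assms(1)])
  then show ?thesis using assms(2) by (simp add: adj_op_def)
qed

lemma adj_op_props:
  assumes H: "hilbert_space H" and A: "A \<in> bounded_ops H H" and y: "y \<in> H"
  shows "adj_op H A y \<in> H" "x \<in> H \<Longrightarrow> cinner (A x) y = cinner x (adj_op H A y)"
    "x \<in> H \<Longrightarrow> cinner y (A x) = cinner (adj_op H A y) x"
proof -
  obtain z where z: "z \<in> H" "\<forall>x\<in>H. (if x \<in> H then cinner y (A x) else 0) = cinner z x"
    by (rule riesz[OF H cinner_functional[OF A H]])
  have 1: "cinner (A x) y = cinner x z" if "x \<in> H" for x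
    using z(2) that by (metis cinner_commute)
  have eq: "adj_op H A y = z" by (rule adj_op_eqI[OF H y z(1) 1])
  show "adj_op H A y \<in> H" using z eq by simp
  show "x \<in> H \<Longrightarrow> cinner (A x) y = cinner x (adj_op H A y)" using 1 eq by simp
  show "x \<in> H \<Longrightarrow> cinner y (A x) = cinner (adj_op H A y) x" using z(2) eq by simp
qed

lemma adj_op_bounded:
  assumes H: "hilbert_space H" and A: "A \<in> bounded_ops H H"
  shows "adj_op H A \<in> bounded_ops H H"
proof -
  obtain C where C: "C \<ge> 0" "\<forall>x\<in>H. norm (A x) \<le> C * norm x" by (rule bounded_ops_bound[OF A])
  note C = C(1) bspec[OF C(2)]
  note p = adj_op_props[OF H A]
  show ?thesis
  proof (rule bounded_opsI[where C = C])
    show "adj_op H A x \<in> H" if "x \<in> H" for x by (rule p(1)[OF that])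
    show "adj_op H A (x + y) = adj_op H A x + adj_op H A y" if "x \<in> H" "y \<in> H" for x y
      using that p by (intro adj_op_eqI[OF H]) (auto simp: cinner_add_right hilbert_spaceD[OF H])
    show "adj_op H A (c *\<^sub>C x) = c *\<^sub>C adj_op H A x" if "x \<in> H" for x c
      using that p by (intro adj_op_eqI[OF H]) (auto simp: cinner_scaleC_right hilbert_spaceD[OF H])
    show "adj_op H A x = 0" if "x \<notin> H" for x using that by (simp add: adj_op_def)
    fix x assume x: "x \<in> H"
    let ?a = "adj_op H A x"
    have "(norm ?a)\<^sup>2 = cmod (cinner (A ?a) x)"
      using p(2)[OF x p(1)[OF x]] by (simp add: cinner_self norm_power)
    also have "\<dots> \<le> norm (A ?a) * norm x" by (rule cauchy_schwarz)
    also have "\<dots> \<le> C * norm ?a * norm x" by (intro mult_right_mono C(2) p(1) x) simp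
    finally have "norm ?a * norm ?a \<le> norm ?a * (C * norm x)" by (simp add: power2_eq_square mult_ac)
    then show "norm ?a \<le> C * norm x"
      using C(1) by (cases "?a = 0") (auto simp: mult_le_cancel_left_pos)
  qed
qed

lemma isometric_image_hilbert:
  assumes H: "hilbert_space H" and J: "J \<in> bounded_ops H UNIV"
    and iso: "\<And>x y. x \<in> H \<Longrightarrow> y \<in> H \<Longrightarrow> cinner (J x) (J y) = cinner x y"
  shows "hilbert_space (J ` H)"
  unfolding hilbert_space_def
proof
  have "0 \<in> J ` H" using bounded_ops_0[OF J H] hilbert_spaceD(3)[OF H] by (metis imageI)
  moreover have "a + b \<in> J ` H" if "a \<in> J ` H" "b \<in> J ` H" for a b
    using that by (auto simp flip: bounded_opsD(2)[OF J] intro!: imageI hilbert_spaceD[OF H])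
  moreover have "c *\<^sub>C a \<in> J ` H" if "a \<in> J ` H" for a c
    using that by (auto simp flip: bounded_opsD(3)[OF J] intro!: imageI hilbert_spaceD[OF H])
  ultimately show "csubspace (J ` H)" by (simp add: cv.subspace_def)
  have nJ: "norm (J x) = norm x" if "x \<in> H" for x
    using iso[OF that that] by (simp add: norm_eq_sqrt_cinner)
  show "closed (J ` H)"
    unfolding closed_sequential_limits
  proof (intro allI impI, elim conjE)
    fix y l assume y: "\<forall>n. y n \<in> J ` H" and l: "y \<longlonglongrightarrow> l"
    then have "\<forall>n. \<exists>x. x \<in> H \<and> y n = J x" by blast
    then obtain x where x': "\<forall>n. x n \<in> H \<and> y n = J (x n)" by (rule choice[THEN exE])
    then have x: "\<And>n. x n \<in> H" "\<And>n. y n = J (x n)" by simp_all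
    have "norm (x m - x n) = norm (y m - y n)" for m n
      using nJ[OF hilbert_spaceD(5)[OF H x(1) x(1)]] by (simp add: bounded_ops_diff[OF J H x(1) x(1)] x(2))
    moreover have "Cauchy y" using l by (rule LIMSEQ_imp_Cauchy)
    ultimately have "Cauchy x" by (simp add: Cauchy_iff)
    then obtain z where z: "x \<longlonglongrightarrow> z" using Cauchy_convergent convergent_def by blast
    have "z \<in> H" by (rule hilbert_space_limit[OF H x(1) z])
    moreover have "(\<lambda>n. J (x n)) \<longlonglongrightarrow> J z" by (rule bounded_ops_limit[OF J H x(1) z])
    then have "l = J z" using l LIMSEQ_unique by (simp flip: x(2))
    ultimately show "l \<in> J ` H" by blast
  qed
qed

section \<open>Tensor products of Hilbert spaces\<close>

text \<open>The closure of a densely defined bounded linear relation is the graph of a bounded operator.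
  Relations avoid the question whether an assignment on sums of elementary tensors is well defined.\<close>

lemma extend_operator:
  fixes K :: "'k::chilbert_space set"
  assumes K: "hilbert_space K" and sub: "Rl \<subseteq> K \<times> K"
    and add: "\<And>z w z' w'. (z, w) \<in> Rl \<Longrightarrow> (z', w') \<in> Rl \<Longrightarrow> (z + z', w + w') \<in> Rl"
    and scale: "\<And>c z w. (z, w) \<in> Rl \<Longrightarrow> (c *\<^sub>C z, c *\<^sub>C w) \<in> Rl"
    and bound: "\<And>z w. (z, w) \<in> Rl \<Longrightarrow> norm w \<le> C * norm z"
    and dense: "K \<subseteq> closure (Domain Rl)"
  shows "\<exists>T\<in>bounded_ops K K. \<forall>(z, w)\<in>Rl. T z = w"
proof -
  define Q where "Q z w \<longleftrightarrow> (\<exists>zs ws. (\<forall>n. (zs n, ws n) \<in> Rl) \<and> zs \<longlonglongrightarrow> z \<and> ws \<longlonglongrightarrow> w)" for z w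
  have diff: "(z - z', w - w') \<in> Rl" if "(z, w) \<in> Rl" "(z', w') \<in> Rl" for z w z' w'
    using add[OF that(1) scale[OF that(2), of "-1"]] by simp
  have Qadd: "Q (z + z') (w + w')" if q: "Q z w" "Q z' w'" for z w z' w'
  proof -
    obtain zs ws where s: "\<forall>n. (zs n, ws n) \<in> Rl" "zs \<longlonglongrightarrow> z" "ws \<longlonglongrightarrow> w"
      using q(1) unfolding Q_def by blast
    obtain zs' ws' where s': "\<forall>n. (zs' n, ws' n) \<in> Rl" "zs' \<longlonglongrightarrow> z'" "ws' \<longlonglongrightarrow> w'"
      using q(2) unfolding Q_def by blast
    from s s' show ?thesis unfolding Q_def
      by (intro exI[of _ "\<lambda>n. zs n + zs' n"] exI[of _ "\<lambda>n. ws n + ws' n"]) (auto intro: add tendsto_add)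
  qed
  have Qscale: "Q (c *\<^sub>C z) (c *\<^sub>C w)" if q: "Q z w" for c z w
  proof -
    obtain zs ws where "\<forall>n. (zs n, ws n) \<in> Rl" "zs \<longlonglongrightarrow> z" "ws \<longlonglongrightarrow> w"
      using q unfolding Q_def by blast
    then show ?thesis unfolding Q_def
      by (intro exI[of _ "\<lambda>n. c *\<^sub>C zs n"] exI[of _ "\<lambda>n. c *\<^sub>C ws n"]) (auto intro: scale tendsto_scaleC)
  qed
  have Qbound: "norm w \<le> C * norm z" if q: "Q z w" for z w
  proof -
    obtain zs ws where s: "\<forall>n. (zs n, ws n) \<in> Rl" "zs \<longlonglongrightarrow> z" "ws \<longlonglongrightarrow> w"
      using q unfolding Q_def by blast
    have "(\<lambda>n. norm (ws n)) \<longlonglongrightarrow> norm w" by (intro tendsto_norm s)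
    moreover have "(\<lambda>n. C * norm (zs n)) \<longlonglongrightarrow> C * norm z" by (intro tendsto_mult tendsto_const tendsto_norm s)
    ultimately show ?thesis using s(1) bound by (intro LIMSEQ_le) auto
  qed
  have Qunique: "w = w'" if "Q z w" "Q z w'" for z w w'
    using Qbound[OF Qadd[OF that(1) Qscale[OF that(2), of "-1"]]] by simp
  have QK: "w \<in> K" if q: "Q z w" for z w
  proof -
    obtain zs ws where s: "\<forall>n. (zs n, ws n) \<in> Rl" "ws \<longlonglongrightarrow> w"
      using q unfolding Q_def by blast
    then have "\<And>n. ws n \<in> K" using sub by blast
    then show ?thesis by (rule hilbert_space_limit[OF K _ s(2)])
  qed
  have Qtotal: "\<exists>w. Q z w" if z: "z \<in> K" for z
  proof -
    have "z \<in> closure (Domain Rl)" using z dense by blast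
    then obtain zs where zs: "\<forall>n. zs n \<in> Domain Rl" "zs \<longlonglongrightarrow> z" unfolding closure_sequential by blast
    have "\<forall>n. \<exists>w. (zs n, w) \<in> Rl" using zs(1) by blast
    then obtain ws where ws: "\<forall>n. (zs n, ws n) \<in> Rl" by (rule choice[THEN exE])
    have le: "norm (ws m - ws n) \<le> \<bar>C\<bar> * norm (zs m - zs n)" for m n
    proof -
      have "norm (ws m - ws n) \<le> C * norm (zs m - zs n)" using ws by (intro bound diff) auto
      also have "\<dots> \<le> \<bar>C\<bar> * norm (zs m - zs n)" by (intro mult_right_mono) auto
      finally show ?thesis .
    qed
    have "Cauchy ws"
    proof (rule CauchyI)
      fix e :: real assume e: "e > 0"
      have "Cauchy zs" using zs(2) by (rule LIMSEQ_imp_Cauchy)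
      moreover have "e / (\<bar>C\<bar> + 1) > 0" using e by (simp add: add_nonneg_pos)
      ultimately obtain M where M: "\<And>m n. m \<ge> M \<Longrightarrow> n \<ge> M \<Longrightarrow> norm (zs m - zs n) < e / (\<bar>C\<bar> + 1)"
        unfolding Cauchy_iff by blast
      have "norm (ws m - ws n) < e" if "m \<ge> M" "n \<ge> M" for m n
      proof -
        have "norm (ws m - ws n) \<le> \<bar>C\<bar> * norm (zs m - zs n)" by (rule le)
        also have "\<dots> \<le> (\<bar>C\<bar> + 1) * norm (zs m - zs n)" by (intro mult_right_mono) auto
        also have "\<dots> < e" using M[OF that] by (simp add: pos_less_divide_eq add_nonneg_pos mult.commute)
        finally show ?thesis .
      qed
      then show "\<exists>M. \<forall>m\<ge>M. \<forall>n\<ge>M. norm (ws m - ws n) < e" by blast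
    qed
    then obtain w where "ws \<longlonglongrightarrow> w" using Cauchy_convergent convergent_def by blast
    then show ?thesis using ws zs unfolding Q_def by blast
  qed
  define T where "T z = (if z \<in> K then THE w. Q z w else 0)" for z
  have TQ: "Q z (T z)" if z: "z \<in> K" for z
  proof -
    obtain w where w: "Q z w" using Qtotal[OF z] by blast
    have "(THE w. Q z w) = w"
    proof (rule the_equality)
      show "Q z w" by (rule w)
      show "w' = w" if "Q z w'" for w' using that w by (rule Qunique)
    qed
    then show ?thesis using w z by (simp add: T_def)
  qed
  have "T \<in> bounded_ops K K"
  proof (rule bounded_opsI)
    show "T z \<in> K" if "z \<in> K" for z by (rule QK[OF TQ[OF that]])
    show "T (z + z') = T z + T z'" if "z \<in> K" "z' \<in> K" for z z'
      using that by (intro Qunique[OF TQ Qadd[OF TQ TQ]] hilbert_spaceD[OF K])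
    show "T (c *\<^sub>C z) = c *\<^sub>C T z" if "z \<in> K" for c z
      using that by (intro Qunique[OF TQ Qscale[OF TQ]] hilbert_spaceD[OF K])
    show "norm (T z) \<le> C * norm z" if "z \<in> K" for z by (rule Qbound[OF TQ[OF that]])
    show "T z = 0" if "z \<notin> K" for z using that by (simp add: T_def)
  qed
  moreover have "T z = w" if zw: "(z, w) \<in> Rl" for z w
  proof -
    have "Q z w" unfolding Q_def using zw by (intro exI[of _ "\<lambda>_. z"] exI[of _ "\<lambda>_. w"]) auto
    moreover have "z \<in> K" using sub zw by blast
    ultimately show ?thesis using Qunique TQ by blast
  qed
  ultimately show ?thesis by blast
qed

lemma bessel:
  assumes "hs.orthonormal r g"
  shows "(\<Sum>k<r. (cmod (cinner (g k) x))\<^sup>2) \<le> (norm (x::'h::chilbert_space))\<^sup>2"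
proof -
  define y where "y = (\<Sum>k<r. cinner (g k) x *\<^sub>C g k)"
  have xy: "cinner x y = of_real (\<Sum>k<r. (cmod (cinner (g k) x))\<^sup>2)"
  proof -
    have "cinner x y = (\<Sum>k<r. cinner (g k) x * cnj (cinner (g k) x))"
      unfolding y_def cinner_sum_right cinner_scaleC_right by (simp flip: cinner_commute)
    then show ?thesis by (simp flip: complex_norm_square)
  qed
  have "cinner y y = (\<Sum>k<r. cnj (cinner (g k) x) * cinner (g k) y)"
    unfolding y_def[of] by (simp add: cinner_sum_left cinner_scaleC_left)
  also have "\<dots> = (\<Sum>k<r. cnj (cinner (g k) x) * cinner (g k) x)"
    unfolding y_def by (intro sum.cong refl) (simp add: hs.ip_expansion[OF assms])
  also have "\<dots> = of_real (\<Sum>k<r. (cmod (cinner (g k) x))\<^sup>2)"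
    by (simp add: mult.commute flip: complex_norm_square)
  finally have "(norm y)\<^sup>2 = (\<Sum>k<r. (cmod (cinner (g k) x))\<^sup>2)"
    unfolding cinner_self of_real_eq_iff .
  moreover have "0 \<le> (norm (x - y))\<^sup>2" by simp
  ultimately show ?thesis unfolding norm_diff_square xy by simp
qed

locale tensor_space =
  fixes H1 :: "'h1::chilbert_space set" and H2 :: "'h2::chilbert_space set"
    and K :: "'k::chilbert_space set" and t :: "'h1 \<Rightarrow> 'h2 \<Rightarrow> 'k"
  assumes H1: "hilbert_space H1" and H2: "hilbert_space H2" and tensor: "hilbert_tensor H1 H2 K t"
begin

lemma K: "hilbert_space K"
  using tensor unfolding hilbert_tensor_def by blast

lemma K_closure: "K = closure (cspan {t x y | x y. x \<in> H1 \<and> y \<in> H2})"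
  using tensor unfolding hilbert_tensor_def by blast

lemma t_in: "x \<in> H1 \<Longrightarrow> y \<in> H2 \<Longrightarrow> t x y \<in> K"
  by (subst K_closure) (auto intro!: subsetD[OF closure_subset] cv.span_base)

lemma t_add: "x \<in> H1 \<Longrightarrow> x' \<in> H1 \<Longrightarrow> y \<in> H2 \<Longrightarrow> t (x + x') y = t x y + t x' y"
    "x \<in> H1 \<Longrightarrow> y \<in> H2 \<Longrightarrow> y' \<in> H2 \<Longrightarrow> t x (y + y') = t x y + t x y'"
  and t_scale: "x \<in> H1 \<Longrightarrow> y \<in> H2 \<Longrightarrow> t (c *\<^sub>C x) y = c *\<^sub>C t x y"
    "x \<in> H1 \<Longrightarrow> y \<in> H2 \<Longrightarrow> t x (c *\<^sub>C y) = c *\<^sub>C t x y"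
  and t_cinner: "x \<in> H1 \<Longrightarrow> x' \<in> H1 \<Longrightarrow> y \<in> H2 \<Longrightarrow> y' \<in> H2 \<Longrightarrow>
    cinner (t x y) (t x' y') = cinner x x' * cinner y y'"
  using tensor by (simp_all add: hilbert_tensor_def)

lemma t_norm: "x \<in> H1 \<Longrightarrow> y \<in> H2 \<Longrightarrow> norm (t x y) = norm x * norm y"
  by (simp add: norm_eq_sqrt_cinner t_cinner) (simp add: cinner_self real_sqrt_mult)

lemma t_sum_left: "(\<And>i. i \<in> A \<Longrightarrow> f i \<in> H1) \<Longrightarrow> y \<in> H2 \<Longrightarrow> t (\<Sum>i\<in>A. f i) y = (\<Sum>i\<in>A. t (f i) y)"
proof (induction A rule: infinite_finite_induct)
  case (insert a A)
  then have "t (f a + (\<Sum>i\<in>A. f i)) y = t (f a) y + t (\<Sum>i\<in>A. f i) y"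
    by (intro t_add cv.subspace_sum hilbert_spaceD[OF H1]) auto
  with insert show ?case by simp
qed (use t_scale(1)[of 0 y 0] hilbert_spaceD(3)[OF H1] in auto)

lemma t_sum_right: "(\<And>i. i \<in> A \<Longrightarrow> f i \<in> H2) \<Longrightarrow> x \<in> H1 \<Longrightarrow> t x (\<Sum>i\<in>A. f i) = (\<Sum>i\<in>A. t x (f i))"
proof (induction A rule: infinite_finite_induct)
  case (insert a A)
  then have "t x (f a + (\<Sum>i\<in>A. f i)) = t x (f a) + t x (\<Sum>i\<in>A. f i)"
    by (intro t_add cv.subspace_sum hilbert_spaceD[OF H2]) auto
  with insert show ?case by simp
qed (use t_scale(2)[of x 0 0] hilbert_spaceD(3)[OF H2] in auto)

lemma swap: "tensor_space H2 H1 K (\<lambda>y x. t x y)"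
proof
  have "{t x y | y x. y \<in> H2 \<and> x \<in> H1} = {t x y | x y. x \<in> H1 \<and> y \<in> H2}" by blast
  then show "hilbert_tensor H2 H1 K (\<lambda>y x. t x y)"
    by (simp add: hilbert_tensor_def K t_add t_scale t_cinner mult.commute K_closure[symmetric])
qed (fact H1 H2)+

lemma pure_tensors_span:
  assumes "z \<in> cspan {t x y | x y. x \<in> H1 \<and> y \<in> H2}"
  shows "\<exists>ps. set ps \<subseteq> H1 \<times> H2 \<and> z = (\<Sum>(x, y)\<leftarrow>ps. t x y)"
  using assms
proof (induction rule: cv.span_induct_alt)
  case base
  show ?case by (rule exI[of _ "[]"]) simp
next
  case (step c v z)
  then obtain x y ps where "v = t x y" "x \<in> H1" "y \<in> H2" "set ps \<subseteq> H1 \<times> H2" "z = (\<Sum>(x, y)\<leftarrow>ps. t x y)"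
    by blast
  then show ?case
    by (intro exI[of _ "(c *\<^sub>C x, y) # ps"]) (auto simp: t_scale hilbert_spaceD[OF H1])
qed

lemma orthonormal_leg_norm:
  assumes f: "hs.orthonormal r f" "\<forall>k<r. f k \<in> H2" and x: "\<forall>k<r. x k \<in> H1"
  shows "(norm (\<Sum>k<r. t (x k) (f k)))\<^sup>2 = (\<Sum>k<r. (norm (x k))\<^sup>2)"
proof -
  have "cinner (\<Sum>k<r. t (x k) (f k)) (\<Sum>k<r. t (x k) (f k)) = (\<Sum>k<r. \<Sum>l<r. if l = k then cinner (x k) (x l) else 0)"
    unfolding cinner_sum_left cinner_sum_right using f x
    by (intro sum.cong refl) (simp add: t_cinner hs.orthonormalD(2)[OF f(1)])
  also have "\<dots> = of_real (\<Sum>k<r. (norm (x k))\<^sup>2)" by (simp add: cinner_self)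
  finally show ?thesis unfolding cinner_self of_real_eq_iff .
qed

text \<open>Every sum of elementary tensors can be rewritten over an orthonormal family \<open>f\<close> in the second
  leg. Its squared norm is then the sum of the squared norms in the first leg, on which \<open>A\<close> acts.\<close>

lemma left_leg_bound:
  assumes A: "A \<in> bounded_ops H1 H1" and C: "C \<ge> 0" "\<forall>x\<in>H1. norm (A x) \<le> C * norm x"
    and ps: "set ps \<subseteq> H1 \<times> H2"
  shows "norm (\<Sum>(x, y)\<leftarrow>ps. t (A x) y) \<le> C * norm (\<Sum>(x, y)\<leftarrow>ps. t x y)"
proof -
  define N where "N = length ps"
  define a where "a i = fst (ps ! i)" for i
  define b where "b i = snd (ps ! i)" for i
  have ab: "a i \<in> H1" "b i \<in> H2" if "i < N" for i
  proof -
    have "ps ! i \<in> H1 \<times> H2" using ps nth_mem[of i ps] that by (auto simp: N_def)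
    then show "a i \<in> H1" "b i \<in> H2" by (simp_all add: a_def b_def mem_Times_iff)
  qed
  have ps_sum: "(\<Sum>(x, y)\<leftarrow>ps. g x y) = (\<Sum>i<N. g (a i) (b i))" for g :: "_ \<Rightarrow> _ \<Rightarrow> 'k"
    by (simp add: sum_list_sum_nth N_def a_def b_def case_prod_unfold atLeast0LessThan)
  let ?M = "cspan (b ` {..<N})"
  have MH: "?M \<subseteq> H2" using ab by (intro cv.span_minimal hilbert_spaceD[OF H2]) auto
  have len: "\<forall>r e. hs.orthonormal r e \<and> (\<forall>k<r. e k \<in> ?M) \<longrightarrow> r \<le> card (b ` {..<N})"
    by (auto intro: hs.orthonormal_length)
  obtain r f where f: "hs.orthonormal r f" "\<forall>k<r. f k \<in> ?M"
      and ex: "\<forall>x\<in>?M. x = (\<Sum>k<r. cinner (f k) x *\<^sub>C f k)"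
    by (rule hs.orthonormal_basis_exists[OF cv.subspace_span subset_UNIV len], rule that)
  have fH: "\<forall>k<r. f k \<in> H2" using f MH by blast
  define x where "x k = (\<Sum>i<N. cinner (f k) (b i) *\<^sub>C a i)" for k
  have xH: "\<forall>k<r. x k \<in> H1"
    using ab unfolding x_def by (auto intro!: cv.subspace_sum hilbert_spaceD[OF H1])
  have leg: "(\<Sum>i<N. t (B (a i)) (b i)) = (\<Sum>k<r. t (B (x k)) (f k))" if B: "B \<in> bounded_ops H1 H1" for B
  proof -
    have "(\<Sum>i<N. t (B (a i)) (b i)) = (\<Sum>i<N. \<Sum>k<r. cinner (f k) (b i) *\<^sub>C t (B (a i)) (f k))"
    proof (rule sum.cong[OF refl])
      fix i assume "i \<in> {..<N}"
      then have i: "i < N" by simp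
      have bi: "b i = (\<Sum>k<r. cinner (f k) (b i) *\<^sub>C f k)"
        by (rule bspec[OF ex]) (use i in \<open>auto intro: cv.span_base\<close>)
      have "t (B (a i)) (b i) = t (B (a i)) (\<Sum>k<r. cinner (f k) (b i) *\<^sub>C f k)"
        using bi by simp
      also have "\<dots> = (\<Sum>k<r. t (B (a i)) (cinner (f k) (b i) *\<^sub>C f k))"
        using fH ab[OF i] by (intro t_sum_right bounded_opsD[OF B] hilbert_spaceD[OF H2]) auto
      also have "\<dots> = (\<Sum>k<r. cinner (f k) (b i) *\<^sub>C t (B (a i)) (f k))"
        using fH ab[OF i] by (intro sum.cong refl) (simp add: t_scale bounded_opsD[OF B])
      finally show "t (B (a i)) (b i) = (\<Sum>k<r. cinner (f k) (b i) *\<^sub>C t (B (a i)) (f k))" .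
    qed
    also have "\<dots> = (\<Sum>k<r. \<Sum>i<N. cinner (f k) (b i) *\<^sub>C t (B (a i)) (f k))" by (rule sum.swap)
    also have "\<dots> = (\<Sum>k<r. t (B (x k)) (f k))"
    proof (rule sum.cong[OF refl])
      fix k assume k: "k \<in> {..<r}"
      have "B (x k) = (\<Sum>i<N. cinner (f k) (b i) *\<^sub>C B (a i))"
        unfolding x_def using ab
        by (subst bounded_ops_sum[OF B H1]) (auto simp: bounded_opsD(3)[OF B] intro: hilbert_spaceD[OF H1])
      then have "t (B (x k)) (f k) = (\<Sum>i<N. t (cinner (f k) (b i) *\<^sub>C B (a i)) (f k))"
        using k fH ab by (simp only:) (intro t_sum_left, auto simp: bounded_opsD(1)[OF B] hilbert_spaceD[OF H1])
      then show "(\<Sum>i<N. cinner (f k) (b i) *\<^sub>C t (B (a i)) (f k)) = t (B (x k)) (f k)"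
        using k fH ab by (simp add: t_scale bounded_opsD(1)[OF B])
    qed
    finally show ?thesis .
  qed
  have id: "id_op H1 \<in> bounded_ops H1 H1"
    by (rule bounded_opsI[where C = 1]) (auto simp: id_op_def hilbert_spaceD[OF H1])
  have "(norm (\<Sum>(x, y)\<leftarrow>ps. t (A x) y))\<^sup>2 = (\<Sum>k<r. (norm (A (x k)))\<^sup>2)"
    unfolding ps_sum leg[OF A] using xH by (intro orthonormal_leg_norm f(1) fH) (auto simp: bounded_opsD[OF A])
  also have "\<dots> \<le> (\<Sum>k<r. (C * norm (x k))\<^sup>2)"
    using C xH by (intro sum_mono power_mono) auto
  also have "\<dots> = C\<^sup>2 * (norm (\<Sum>k<r. t (x k) (f k)))\<^sup>2"
    by (simp add: orthonormal_leg_norm[OF f(1) fH xH] power_mult_distrib sum_distrib_left)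
  also have "(\<Sum>k<r. t (x k) (f k)) = (\<Sum>(x, y)\<leftarrow>ps. t x y)"
    using leg[OF id] ab xH by (simp add: ps_sum id_op_def)
  finally have "(norm (\<Sum>(x, y)\<leftarrow>ps. t (A x) y))\<^sup>2 \<le> (C * norm (\<Sum>(x, y)\<leftarrow>ps. t x y))\<^sup>2"
    by (simp add: power_mult_distrib)
  then show ?thesis by (rule power2_le_imp_le) (use C in simp)
qed

lemma left_leg_operator:
  assumes A: "A \<in> bounded_ops H1 H1"
  shows "\<exists>T\<in>bounded_ops K K. \<forall>x\<in>H1. \<forall>y\<in>H2. T (t x y) = t (A x) y"
proof -
  obtain C where C: "C \<ge> 0" "\<forall>x\<in>H1. norm (A x) \<le> C * norm x" by (rule bounded_ops_bound[OF A])
  define Rl where "Rl = {((\<Sum>(x, y)\<leftarrow>ps. t x y), (\<Sum>(x, y)\<leftarrow>ps. t (A x) y)) | ps. set ps \<subseteq> H1 \<times> H2}"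
  have sumK: "(\<Sum>(x, y)\<leftarrow>ps. t (B x) y) \<in> K" if "set ps \<subseteq> H1 \<times> H2" "\<And>x. x \<in> H1 \<Longrightarrow> B x \<in> H1" for ps B
    using that(1) by (induction ps) (auto intro!: hilbert_spaceD[OF K] t_in that(2))
  have "\<exists>T\<in>bounded_ops K K. \<forall>(z, w)\<in>Rl. T z = w"
  proof (rule extend_operator[OF K])
    show "Rl \<subseteq> K \<times> K"
      using sumK[of _ "\<lambda>x. x"] sumK[of _ A] bounded_opsD(1)[OF A] by (auto simp: Rl_def)
    show "(z + z', w + w') \<in> Rl" if "(z, w) \<in> Rl" "(z', w') \<in> Rl" for z w z' w'
    proof -
      obtain ps ps' where "set ps \<subseteq> H1 \<times> H2" "z = (\<Sum>(x, y)\<leftarrow>ps. t x y)" "w = (\<Sum>(x, y)\<leftarrow>ps. t (A x) y)"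
        "set ps' \<subseteq> H1 \<times> H2" "z' = (\<Sum>(x, y)\<leftarrow>ps'. t x y)" "w' = (\<Sum>(x, y)\<leftarrow>ps'. t (A x) y)"
        using \<open>(z, w) \<in> Rl\<close> \<open>(z', w') \<in> Rl\<close> unfolding Rl_def mem_Collect_eq prod.inject by (elim exE conjE)
      then show ?thesis unfolding Rl_def mem_Collect_eq by (intro exI[of _ "ps @ ps'"]) simp
    qed
    show "(c *\<^sub>C z, c *\<^sub>C w) \<in> Rl" if zw: "(z, w) \<in> Rl" for c z w
    proof -
      obtain ps where ps: "set ps \<subseteq> H1 \<times> H2" "z = (\<Sum>(x, y)\<leftarrow>ps. t x y)" "w = (\<Sum>(x, y)\<leftarrow>ps. t (A x) y)"
        using zw unfolding Rl_def by blast
      let ?qs = "map (\<lambda>(x, y). (c *\<^sub>C x, y)) ps"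
      have "(\<Sum>(x, y)\<leftarrow>?qs. t x y) = c *\<^sub>C (\<Sum>(x, y)\<leftarrow>ps. t x y)"
        "(\<Sum>(x, y)\<leftarrow>?qs. t (A x) y) = c *\<^sub>C (\<Sum>(x, y)\<leftarrow>ps. t (A x) y)"
        using ps(1) by (induction ps) (auto simp: t_scale cv.scale_right_distrib bounded_opsD[OF A])
      moreover have "set ?qs \<subseteq> H1 \<times> H2" using ps(1) by (auto simp: hilbert_spaceD[OF H1])
      ultimately show ?thesis unfolding Rl_def mem_Collect_eq using ps by (intro exI[of _ ?qs]) simp
    qed
    show "norm w \<le> C * norm z" if "(z, w) \<in> Rl" for z w
      using that left_leg_bound[OF A C] unfolding Rl_def by blast
    have "cspan {t x y | x y. x \<in> H1 \<and> y \<in> H2} \<subseteq> Domain Rl"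
    proof
      fix z assume "z \<in> cspan {t x y | x y. x \<in> H1 \<and> y \<in> H2}"
      then obtain ps where "set ps \<subseteq> H1 \<times> H2" "z = (\<Sum>(x, y)\<leftarrow>ps. t x y)"
        using pure_tensors_span by blast
      then have "(z, \<Sum>(x, y)\<leftarrow>ps. t (A x) y) \<in> Rl" unfolding Rl_def by blast
      then show "z \<in> Domain Rl" by (rule DomainI)
    qed
    then show "K \<subseteq> closure (Domain Rl)" by (subst K_closure) (rule closure_mono)
  qed
  then obtain T where T: "T \<in> bounded_ops K K" "\<forall>(z, w)\<in>Rl. T z = w" by blast
  have "T (t x y) = t (A x) y" if "x \<in> H1" "y \<in> H2" for x y
  proof -
    have "(t x y, t (A x) y) \<in> Rl" unfolding Rl_def mem_Collect_eq using that by (intro exI[of _ "[(x, y)]"]) simp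
    with T(2) show ?thesis by auto
  qed
  then show ?thesis using T(1) by blast
qed

lemma operator_eqI:
  assumes "T \<in> bounded_ops K L" "S \<in> bounded_ops K L" "\<And>x y. x \<in> H1 \<Longrightarrow> y \<in> H2 \<Longrightarrow> T (t x y) = S (t x y)"
  shows "T = S"
  by (rule bounded_ops_eqI[OF assms(1,2) K K_closure]) (use assms(3) in blast)

lemma tensor_op:
  assumes A: "A \<in> bounded_ops H1 H1" and B: "B \<in> bounded_ops H2 H2"
  shows "tensor_op H1 H2 K t A B \<in> bounded_ops K K"
    and "x \<in> H1 \<Longrightarrow> y \<in> H2 \<Longrightarrow> tensor_op H1 H2 K t A B (t x y) = t (A x) (B y)"
proof -
  interpret sw: tensor_space H2 H1 K "\<lambda>y x. t x y" by (rule swap)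
  obtain T S where T: "T \<in> bounded_ops K K" "\<forall>x\<in>H1. \<forall>y\<in>H2. T (t x y) = t (A x) y"
    and S: "S \<in> bounded_ops K K" "\<forall>y\<in>H2. \<forall>x\<in>H1. S (t x y) = t x (B y)"
    using left_leg_operator[OF A] sw.left_leg_operator[OF B] by blast
  obtain C where C: "C \<ge> 0" "\<forall>z\<in>K. norm (T z) \<le> C * norm z" by (rule bounded_ops_bound[OF T(1)])
  obtain D where D: "D \<ge> 0" "\<forall>z\<in>K. norm (S z) \<le> D * norm z" by (rule bounded_ops_bound[OF S(1)])
  let ?P = "\<lambda>z. T (S z)"
  have P: "?P \<in> bounded_ops K K"
  proof (rule bounded_opsI[where C = "C * D"])
    fix z assume z: "z \<in> K"
    have "norm (T (S z)) \<le> C * norm (S z)" using C(2) bounded_opsD(1)[OF S(1) z] by blast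
    also have "\<dots> \<le> C * (D * norm z)" using C(1) D(2) z by (intro mult_left_mono) auto
    finally show "norm (T (S z)) \<le> C * D * norm z" by (simp add: mult.assoc)
  qed (auto simp: bounded_opsD[OF T(1)] bounded_opsD[OF S(1)] bounded_ops_0[OF T(1) K])
  have Pt: "\<forall>x\<in>H1. \<forall>y\<in>H2. ?P (t x y) = t (A x) (B y)"
    using T(2) S(2) bounded_opsD(1)[OF B] by simp
  have "tensor_op H1 H2 K t A B = ?P"
    unfolding tensor_op_def
  proof (rule the_equality)
    fix Q assume Q: "Q \<in> bounded_ops K K \<and> (\<forall>x\<in>H1. \<forall>y\<in>H2. Q (t x y) = t (A x) (B y))"
    show "Q = ?P" by (rule operator_eqI) (use Q P Pt in auto)
  qed (use P Pt in blast)
  then show "tensor_op H1 H2 K t A B \<in> bounded_ops K K"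
    "x \<in> H1 \<Longrightarrow> y \<in> H2 \<Longrightarrow> tensor_op H1 H2 K t A B (t x y) = t (A x) (B y)"
    using P Pt by auto
qed

text \<open>Both sides are bounded in \<open>z\<close>, so they are compared on elementary tensors.\<close>

lemma tensor_op_adjoint:
  assumes A: "A \<in> bounded_ops H1 H1" and B: "B \<in> bounded_ops H2 H2"
    and z: "z \<in> K" and x: "x \<in> H1" and y: "y \<in> H2"
  shows "cinner (tensor_op H1 H2 K t A B z) (t x y) = cinner z (t (adj_op H1 A x) (adj_op H2 B y))"
proof -
  let ?T = "tensor_op H1 H2 K t A B" and ?w = "t (adj_op H1 A x) (adj_op H2 B y)"
  have id: "id_op K \<in> bounded_ops K K"
    by (rule bounded_opsI[where C = 1]) (auto simp: id_op_def hilbert_spaceD[OF K])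
  have "(\<lambda>z. if z \<in> K then cinner (t x y) (?T z) else 0) = (\<lambda>z. if z \<in> K then cinner ?w (id_op K z) else 0)"
    by (rule operator_eqI[OF cinner_functional[OF tensor_op(1)[OF A B] K] cinner_functional[OF id K]])
      (simp add: t_in tensor_op(2)[OF A B] id_op_def t_cinner x y bounded_opsD(1)[OF A] bounded_opsD(1)[OF B]
        adj_op_props[OF H1 A x] adj_op_props[OF H2 B y])
  from fun_cong[OF this, of z] z have "cinner (t x y) (?T z) = cinner ?w z" by (simp add: id_op_def)
  then show ?thesis by (metis cinner_commute)
qed

section \<open>Slices of a vector in a tensor product\<close>

text \<open>A vector \<open>\<xi>\<close> of the tensor product is a Hilbert-Schmidt operator from either leg to the
  conjugate of the other. It is used here as an antilinear map between the legs themselves.\<close>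

definition slice :: "'k \<Rightarrow> 'h1 \<Rightarrow> 'h2"
  where "slice \<xi> x = (SOME z. z \<in> H2 \<and> (\<forall>y\<in>H2. cinner \<xi> (t x y) = cinner z y))"

lemma slice:
  assumes x: "x \<in> H1"
  shows "slice \<xi> x \<in> H2" "y \<in> H2 \<Longrightarrow> cinner (slice \<xi> x) y = cinner \<xi> (t x y)"
proof -
  have "(\<lambda>y. if y \<in> H2 then t x y else 0) \<in> bounded_ops H2 UNIV"
    by (rule bounded_opsI[where C = "norm x"]) (auto simp: t_add t_scale t_norm x hilbert_spaceD[OF H2])
  from cinner_functional[OF this H2, of \<xi>]
  obtain z where z: "z \<in> H2" "\<forall>y\<in>H2. (if y \<in> H2 then cinner \<xi> (if y \<in> H2 then t x y else 0) else 0) = cinner z y"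
    using riesz[OF H2] by blast
  have "z \<in> H2 \<and> (\<forall>y\<in>H2. cinner \<xi> (t x y) = cinner z y)" using z by simp
  from someI[of "\<lambda>z. z \<in> H2 \<and> (\<forall>y\<in>H2. cinner \<xi> (t x y) = cinner z y)", OF this]
  show "slice \<xi> x \<in> H2" "y \<in> H2 \<Longrightarrow> cinner (slice \<xi> x) y = cinner \<xi> (t x y)"
    by (auto simp: slice_def)
qed

lemma slice_add: "x \<in> H1 \<Longrightarrow> x' \<in> H1 \<Longrightarrow> slice \<xi> (x + x') = slice \<xi> x + slice \<xi> x'"
  by (rule cinner_ext[OF H2])
    (auto simp: slice hilbert_spaceD[OF H1] hilbert_spaceD[OF H2] t_add cinner_add_right cinner_add_left
      cinner_commute[of _ "slice _ _"] cinner_commute[of _ "_ + _"])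

lemma slice_scale: "x \<in> H1 \<Longrightarrow> slice \<xi> (c *\<^sub>C x) = cnj c *\<^sub>C slice \<xi> x"
  by (rule cinner_ext[OF H2])
    (auto simp: slice hilbert_spaceD[OF H1] hilbert_spaceD[OF H2] t_scale cinner_scaleC_right cinner_scaleC_left
      cinner_commute[of _ "slice _ _"])

lemma slice_diff: "x \<in> H1 \<Longrightarrow> x' \<in> H1 \<Longrightarrow> slice \<xi> (x - x') = slice \<xi> x - slice \<xi> x'"
  using slice_add[of "x - x'" x' \<xi>] by (simp add: hilbert_spaceD[OF H1] algebra_simps)

lemma slice_norm: "x \<in> H1 \<Longrightarrow> norm (slice \<xi> x) \<le> norm \<xi> * norm x"
proof -
  assume x: "x \<in> H1"
  let ?y = "slice \<xi> x"
  have "norm ?y * norm ?y = cmod (cinner ?y ?y)" by (simp only: cmod_cinner_self)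
  also have "\<dots> = cmod (cinner \<xi> (t x ?y))" using x by (simp add: slice)
  also have "\<dots> \<le> norm \<xi> * norm (t x ?y)" by (rule cauchy_schwarz)
  also have "\<dots> = norm ?y * (norm \<xi> * norm x)" using x by (simp add: t_norm slice)
  finally show ?thesis by (cases "?y = 0") (auto simp: mult_le_cancel_left_pos)
qed

lemma slice_zero:
  assumes "\<xi> \<in> K" "\<And>x. x \<in> H1 \<Longrightarrow> slice \<xi> x = 0"
  shows "\<xi> = 0"
proof -
  have id: "id_op K \<in> bounded_ops K K"
    by (rule bounded_opsI[where C = 1]) (auto simp: id_op_def hilbert_spaceD[OF K])
  have "(\<lambda>z. if z \<in> K then cinner \<xi> (id_op K z) else 0) = (\<lambda>z. if z \<in> K then cinner 0 (id_op K z) else 0)"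
  proof (rule operator_eqI[OF cinner_functional[OF id K] cinner_functional[OF id K]])
    fix x y assume "x \<in> H1" "y \<in> H2"
    then show "(if t x y \<in> K then cinner \<xi> (id_op K (t x y)) else 0) = (if t x y \<in> K then cinner 0 (id_op K (t x y)) else 0)"
      using slice(2)[of x y \<xi>] assms(2)[of x] by (simp add: id_op_def)
  qed
  from fun_cong[OF this, of \<xi>] have "cinner \<xi> \<xi> = 0" using assms(1) by (simp add: id_op_def)
  then show ?thesis by (simp add: cinner_self)
qed

lemma compact_combinations:
  fixes ps :: "('h1 \<times> 'h2) list"
  shows "\<exists>C. compact C \<and> (\<forall>x. norm x \<le> 1 \<longrightarrow> (\<Sum>(a, b)\<leftarrow>ps. cnj (cinner a x) *\<^sub>C b) \<in> C)"
proof (induction ps)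
  case Nil
  show ?case by (rule exI[of _ "{0}"]) simp
next
  case (Cons p ps)
  obtain a b where p: "p = (a, b)" by fastforce
  obtain C where C: "compact C" "\<forall>x. norm x \<le> 1 \<longrightarrow> (\<Sum>(a, b)\<leftarrow>ps. cnj (cinner a x) *\<^sub>C b) \<in> C"
    using Cons by blast
  have "bounded_linear (\<lambda>c. c *\<^sub>C b)"
  proof
    show "\<exists>K. \<forall>c. norm (c *\<^sub>C b) \<le> norm c * K" by (rule exI[of _ "norm b"]) (simp add: norm_scaleC)
  qed (simp_all add: cv.scale_left_distrib scaleR_scaleC scaleR_conv_of_real)
  then have "continuous_on (cball 0 (norm a)) (\<lambda>c. c *\<^sub>C b)"
    by (intro linear_continuous_on)
  then have D: "compact ((\<lambda>c. c *\<^sub>C b) ` cball 0 (norm a))"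
    by (rule compact_continuous_image) simp
  let ?C = "{v + w | v w. v \<in> (\<lambda>c. c *\<^sub>C b) ` cball 0 (norm a) \<and> w \<in> C}"
  have "compact ?C" using compact_sums[OF D C(1)] .
  moreover have "(\<Sum>(a, b)\<leftarrow>p # ps. cnj (cinner a x) *\<^sub>C b) \<in> ?C" if x: "norm x \<le> 1" for x
  proof -
    have "cmod (cinner a x) \<le> norm a * norm x" by (rule cauchy_schwarz)
    also have "\<dots> \<le> norm a * 1" using x by (intro mult_left_mono) auto
    finally have "cnj (cinner a x) *\<^sub>C b \<in> (\<lambda>c. c *\<^sub>C b) ` cball 0 (norm a)" by (intro imageI) simp
    then show ?thesis using C(2) x by (auto simp: p)
  qed
  ultimately show ?case by blast
qed

text \<open>Slices of algebraic tensors have finite rank, and \<open>\<xi>\<close> is a limit of such tensors; so the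
  slice operator is compact.\<close>

lemma slice_compact:
  assumes \<xi>: "\<xi> \<in> K" and x: "\<And>n::nat. x n \<in> H1" "\<And>n. norm (x n) \<le> 1"
  shows "\<exists>l r. strict_mono (r :: nat \<Rightarrow> nat) \<and> (\<lambda>n. slice \<xi> (x (r n))) \<longlonglongrightarrow> l"
proof -
  define S where "S = slice \<xi> ` {x \<in> H1. norm x \<le> 1}"
  have approx: "\<exists>C. compact C \<and> (\<forall>y\<in>S. \<exists>c\<in>C. dist y c < e)" if e: "e > 0" for e
  proof -
    have "\<xi> \<in> closure (cspan {t x y | x y. x \<in> H1 \<and> y \<in> H2})" using \<xi> K_closure by blast
    then obtain \<zeta> where \<zeta>: "\<zeta> \<in> cspan {t x y | x y. x \<in> H1 \<and> y \<in> H2}" "dist \<zeta> \<xi> < e"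
      unfolding closure_approachable using e by blast
    obtain ps where ps: "set ps \<subseteq> H1 \<times> H2" "\<zeta> = (\<Sum>(a, b)\<leftarrow>ps. t a b)"
      using pure_tensors_span[OF \<zeta>(1)] by blast
    define c where "c x = (\<Sum>(a, b)\<leftarrow>ps. cnj (cinner a x) *\<^sub>C b)" for x
    obtain C where C: "compact C" "\<forall>x. norm x \<le> 1 \<longrightarrow> c x \<in> C"
      using compact_combinations[of ps] unfolding c_def by blast
    have "dist (slice \<xi> x) (c x) < e" if x: "x \<in> H1" "norm x \<le> 1" for x
    proof -
      have cH: "c x \<in> H2"
        unfolding c_def using ps(1) by (induction ps) (auto intro!: hilbert_spaceD[OF H2])
      have c\<zeta>: "cinner (c x) y = cinner \<zeta> (t x y)" if y: "y \<in> H2" for y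
        unfolding c_def ps(2) using ps(1)
        by (induction ps) (auto simp: cinner_add_left cinner_scaleC_left t_cinner x(1) y)
      let ?y = "slice \<xi> x - c x"
      have yH: "?y \<in> H2" using cH x(1) by (intro hilbert_spaceD[OF H2] slice)
      have yy: "cinner ?y ?y = cinner (\<xi> - \<zeta>) (t x ?y)"
        using c\<zeta>[OF yH] slice(2)[OF x(1) yH] by (simp only: cinner_diff_left)
      have "norm ?y * norm ?y = cmod (cinner (\<xi> - \<zeta>) (t x ?y))"
        using cmod_cinner_self[of ?y] by (simp only: yy)
      also have "\<dots> \<le> norm (\<xi> - \<zeta>) * (norm x * norm ?y)"
        using cauchy_schwarz[of "\<xi> - \<zeta>" "t x ?y"] by (simp add: t_norm x(1) yH)
      also have "\<dots> \<le> norm (\<xi> - \<zeta>) * (1 * norm ?y)"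
        using x(2) by (intro mult_left_mono mult_right_mono) auto
      finally have "norm ?y * norm ?y \<le> norm ?y * norm (\<xi> - \<zeta>)" by (simp add: mult.commute)
      then have "norm ?y \<le> norm (\<xi> - \<zeta>)" by (cases "?y = 0") (auto simp: mult_le_cancel_left_pos)
      also have "\<dots> < e" using \<zeta>(2) by (simp add: dist_norm norm_minus_commute)
      finally show ?thesis by (simp add: dist_norm)
    qed
    then show ?thesis using C unfolding S_def by (intro exI[of _ C]) auto
  qed
  have "compact (closure S)"
    unfolding compact_eq_totally_bounded
  proof (intro conjI allI impI)
    show "complete (closure S)" by (simp add: complete_eq_closed)
    fix e :: real assume e: "e > 0"
    obtain C where C: "compact C" "\<forall>y\<in>S. \<exists>c\<in>C. dist y c < e / 3" using approx[of "e / 3"] e by auto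
    obtain k where k: "finite k" "C \<subseteq> (\<Union>x\<in>k. ball x (e / 3))"
      using C(1) e unfolding compact_eq_totally_bounded by (meson divide_pos_pos zero_less_numeral)
    have "closure S \<subseteq> (\<Union>x\<in>k. ball x e)"
    proof
      fix y assume "y \<in> closure S"
      then obtain y' where y': "y' \<in> S" "dist y' y < e / 3"
        unfolding closure_approachable using e by (meson divide_pos_pos zero_less_numeral)
      obtain c where c: "c \<in> C" "dist y' c < e / 3" using C(2) y'(1) by blast
      obtain p where p: "p \<in> k" "dist p c < e / 3" using k(2) c(1) by auto
      have "dist p y \<le> dist p c + dist y' c + dist y' y"
        using dist_triangle[of p y c] dist_triangle[of c y y'] by (simp add: dist_commute)
      then have "dist p y < e" using p c y' by simp
      then show "y \<in> (\<Union>x\<in>k. ball x e)" using p(1) by auto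
    qed
    then show "\<exists>k. finite k \<and> closure S \<subseteq> (\<Union>x\<in>k. ball x e)" using k(1) by blast
  qed
  then have "seq_compact (closure S)" by (simp add: compact_eq_seq_compact_metric)
  moreover have "\<forall>n. slice \<xi> (x n) \<in> closure S"
    using x closure_subset[of S] by (auto simp: S_def)
  ultimately obtain l r where "strict_mono (r :: nat \<Rightarrow> nat)" "((\<lambda>n. slice \<xi> (x n)) \<circ> r) \<longlonglongrightarrow> l"
    by (rule seq_compactE)
  then show ?thesis by (auto simp: o_def)
qed

end

section \<open>The spectral decomposition of a slice operator\<close>

context tensor_space
begin

abbreviation coslice :: "'k \<Rightarrow> 'h2 \<Rightarrow> 'h1"
  where "coslice \<equiv> tensor_space.slice H1 (\<lambda>y x. t x y)"

lemma coslice: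
  assumes y: "y \<in> H2"
  shows "coslice \<xi> y \<in> H1" "x \<in> H1 \<Longrightarrow> cinner (coslice \<xi> y) x = cinner \<xi> (t x y)"
  using tensor_space.slice[OF swap y] by auto

lemma coslice_slice:
  assumes "x \<in> H1" "x' \<in> H1"
  shows "cinner (coslice \<xi> (slice \<xi> x)) x' = cinner (slice \<xi> x') (slice \<xi> x)"
  using assms by (simp add: coslice slice)

lemma coslice_slice_linear:
  assumes "x \<in> H1"
  shows "x' \<in> H1 \<Longrightarrow> coslice \<xi> (slice \<xi> (x + x')) = coslice \<xi> (slice \<xi> x) + coslice \<xi> (slice \<xi> x')"
    and "coslice \<xi> (slice \<xi> (c *\<^sub>C x)) = c *\<^sub>C coslice \<xi> (slice \<xi> x)"
  using assms tensor_space.slice_add[OF swap] tensor_space.slice_scale[OF swap]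
  by (simp_all add: slice_add slice_scale slice)

text \<open>The norm of the slice operator is attained on an eigenvector: a maximising sequence consists
  of approximate eigenvectors, and compactness makes a subsequence converge.\<close>

lemma slice_eigenvector:
  assumes \<xi>: "\<xi> \<in> K" "\<xi> \<noteq> 0"
  shows "\<exists>s>0. \<exists>x\<in>H1. x \<noteq> 0 \<and> coslice \<xi> (slice \<xi> x) = of_real (s\<^sup>2) *\<^sub>C x"
proof -
  interpret sw: tensor_space H2 H1 K "\<lambda>y x. t x y" by (rule swap)
  let ?Y = "slice \<xi>" and ?X = "coslice \<xi>"
  define D where "D = (\<lambda>x. norm (?Y x)) ` {x \<in> H1. norm x \<le> 1}"
  define s where "s = Sup D"
  have "norm (?Y x) \<le> norm \<xi>" if "x \<in> H1" "norm x \<le> 1" for x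
  proof -
    have "norm (?Y x) \<le> norm \<xi> * norm x" by (rule slice_norm[OF that(1)])
    also have "\<dots> \<le> norm \<xi> * 1" using that by (intro mult_left_mono) auto
    finally show ?thesis by simp
  qed
  then have bdd: "bdd_above D" by (auto simp: D_def bdd_above_def)
  have unit: "norm (?Y x) \<le> s" if "x \<in> H1" "norm x \<le> 1" for x
    unfolding s_def using bdd that by (intro cSup_upper) (auto simp: D_def)
  have normalize: "norm (?Y x) \<le> s * norm x" if x: "x \<in> H1" for x
  proof (cases "x = 0")
    case True
    then show ?thesis using slice_norm[OF x, of \<xi>] by simp
  next
    case False
    let ?c = "complex_of_real (1 / norm x)"
    have "norm (?Y (?c *\<^sub>C x)) \<le> s"
      using x False by (intro unit hilbert_spaceD[OF H1]) (simp_all add: norm_scaleC norm_divide)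
    then have "norm (?Y x) / norm x \<le> s" using x by (simp add: slice_scale norm_scaleC norm_divide)
    then show ?thesis using False by (simp add: divide_le_eq)
  qed
  obtain x1 where x1: "x1 \<in> H1" "?Y x1 \<noteq> 0" using slice_zero[OF \<xi>(1)] \<xi>(2) by blast
  have "0 < s * norm x1" using normalize[OF x1(1)] x1(2) by (metis norm_eq_zero norm_ge_zero order.strict_trans1 less_eq_real_def)
  then have s: "s > 0" by (simp add: zero_less_mult_iff)
  have X_bound: "norm (?X y) \<le> s * norm y" if y: "y \<in> H2" for y
  proof -
    have "norm (?X y) * norm (?X y) = cmod (cinner (?Y (?X y)) y)"
      using y by (simp add: slice coslice flip: cmod_cinner_self)
    also have "\<dots> \<le> norm (?Y (?X y)) * norm y" by (rule cauchy_schwarz)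
    also have "\<dots> \<le> s * norm (?X y) * norm y" using y by (intro mult_right_mono normalize coslice) auto
    finally have "norm (?X y) * norm (?X y) \<le> norm (?X y) * (s * norm y)" by (simp add: mult_ac)
    then show ?thesis using s by (cases "?X y = 0") (auto simp: mult_le_cancel_left_pos)
  qed
  have "\<exists>x. x \<in> H1 \<and> norm x \<le> 1 \<and> s - 1 / real (Suc n) < norm (?Y x)" for n
  proof -
    have "s - 1 / real (Suc n) < Sup D" by (simp add: s_def)
    moreover have "D \<noteq> {}" using hilbert_spaceD(3)[OF H1] by (auto simp: D_def intro: exI[of _ 0])
    ultimately obtain d where "d \<in> D" "s - 1 / real (Suc n) < d" using less_cSupD by blast
    then show ?thesis by (auto simp: D_def)
  qed
  then obtain x where x': "\<forall>n. x n \<in> H1 \<and> norm (x n) \<le> 1 \<and> s - 1 / real (Suc n) < norm (?Y (x n))"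
    using choice[of "\<lambda>n x. x \<in> H1 \<and> norm x \<le> 1 \<and> s - 1 / real (Suc n) < norm (?Y x)"] by blast
  then have x: "\<And>n. x n \<in> H1" "\<And>n. norm (x n) \<le> 1" "\<And>n. s - 1 / real (Suc n) < norm (?Y (x n))" by simp_all
  obtain l r where r: "strict_mono (r :: nat \<Rightarrow> nat)" and l: "(\<lambda>n. ?Y (x (r n))) \<longlonglongrightarrow> l"
    using slice_compact[where x = x, OF \<xi>(1) x(1,2)] by blast
  have lH: "l \<in> H2" by (rule hilbert_space_limit[OF H2 _ l]) (rule slice(1)[OF x(1)])
  have "(\<lambda>n. s - 1 / real (Suc n)) \<longlonglongrightarrow> s - 0"
    by (intro tendsto_diff tendsto_const LIMSEQ_Suc[OF lim_1_over_n])
  then have low: "(\<lambda>n. s - 1 / real (Suc n)) \<longlonglongrightarrow> s" by simp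
  have lim: "(\<lambda>n. norm (?Y (x n))) \<longlonglongrightarrow> s"
  proof (rule tendsto_sandwich[OF _ _ low tendsto_const])
    show "\<forall>\<^sub>F n in sequentially. s - 1 / real (Suc n) \<le> norm (?Y (x n))"
      by (intro always_eventually allI less_imp_le x(3))
    show "\<forall>\<^sub>F n in sequentially. norm (?Y (x n)) \<le> s"
      by (intro always_eventually allI unit x)
  qed
  then have lim': "(\<lambda>n. norm (?Y (x (r n)))) \<longlonglongrightarrow> s"
    using LIMSEQ_subseq_LIMSEQ[OF lim r] by (simp add: o_def)
  have nl: "norm l = s" using LIMSEQ_unique[OF tendsto_norm[OF l] lim'] .
  have Xl: "(\<lambda>n. ?X (?Y (x (r n)))) \<longlonglongrightarrow> ?X l"
  proof (rule tendsto_lipschitz[OF _ l])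
    show "norm (?X (?Y (x (r n))) - ?X l) \<le> s * norm (?Y (x (r n)) - l)" for n
      using X_bound[of "?Y (x (r n)) - l"] x(1) lH by (simp add: sw.slice_diff slice hilbert_spaceD[OF H2])
  qed
  have almost: "(norm (?X (?Y z) - of_real (s\<^sup>2) *\<^sub>C z))\<^sup>2 \<le> 2 * s\<^sup>2 * (s\<^sup>2 - (norm (?Y z))\<^sup>2)"
    if z: "z \<in> H1" "norm z \<le> 1" for z
  proof -
    have "cinner (?X (?Y z)) z = of_real ((norm (?Y z))\<^sup>2)"
      using coslice_slice[OF z(1) z(1)] by (simp only: cinner_self)
    then have "(norm (?X (?Y z) - of_real (s\<^sup>2) *\<^sub>C z))\<^sup>2 =
        (norm (?X (?Y z)))\<^sup>2 + (s\<^sup>2 * norm z)\<^sup>2 - 2 * (s\<^sup>2 * (norm (?Y z))\<^sup>2)"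
      unfolding norm_diff_square by (simp add: norm_scaleC norm_power cinner_scaleC_right flip: of_real_power of_real_mult)
    moreover have "norm (?X (?Y z)) \<le> s * s"
    proof -
      have "norm (?X (?Y z)) \<le> s * norm (?Y z)" using z by (intro X_bound slice)
      also have "\<dots> \<le> s * s" using s unit[OF z] by (intro mult_left_mono) auto
      finally show ?thesis .
    qed
    then have "(norm (?X (?Y z)))\<^sup>2 \<le> (s * s)\<^sup>2" by (intro power_mono) auto
    moreover have "(s\<^sup>2 * norm z)\<^sup>2 \<le> (s\<^sup>2 * 1)\<^sup>2" using z s by (intro power_mono mult_left_mono) auto
    ultimately show ?thesis by (simp add: algebra_simps power2_eq_square)
  qed
  have zero: "(\<lambda>n. ?X (?Y (x (r n))) - of_real (s\<^sup>2) *\<^sub>C x (r n)) \<longlonglongrightarrow> 0"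
  proof (rule tendsto_zero_square_bound)
    show "(norm (?X (?Y (x (r n))) - of_real (s\<^sup>2) *\<^sub>C x (r n)))\<^sup>2 \<le> 2 * s\<^sup>2 * (s\<^sup>2 - (norm (?Y (x (r n))))\<^sup>2)" for n
      by (intro almost x)
    have "(\<lambda>n. 2 * s\<^sup>2 * (s\<^sup>2 - (norm (?Y (x (r n))))\<^sup>2)) \<longlonglongrightarrow> 2 * s\<^sup>2 * (s\<^sup>2 - s\<^sup>2)"
      by (intro tendsto_mult tendsto_diff tendsto_const tendsto_power lim')
    then show "(\<lambda>n. 2 * s\<^sup>2 * (s\<^sup>2 - (norm (?Y (x (r n))))\<^sup>2)) \<longlonglongrightarrow> 0" by simp
  qed
  define e where "e = of_real (1 / s\<^sup>2) *\<^sub>C ?X l"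
  have "(\<lambda>n. ?X (?Y (x (r n))) - (?X (?Y (x (r n))) - of_real (s\<^sup>2) *\<^sub>C x (r n))) \<longlonglongrightarrow> ?X l - 0"
    by (intro tendsto_diff Xl zero)
  then have "(\<lambda>n. of_real (1 / s\<^sup>2) *\<^sub>C of_real (s\<^sup>2) *\<^sub>C x (r n)) \<longlonglongrightarrow> e"
    unfolding e_def by (intro tendsto_scaleC) simp
  moreover have "complex_of_real (1 / s\<^sup>2) * of_real (s\<^sup>2) = 1"
    using s by (simp flip: of_real_mult)
  ultimately have xe: "(\<lambda>n. x (r n)) \<longlonglongrightarrow> e" by (simp add: cv.scale_scale)
  have eH: "e \<in> H1" unfolding e_def by (intro hilbert_spaceD[OF H1] coslice lH)
  have "(\<lambda>n. ?Y (x (r n))) \<longlonglongrightarrow> ?Y e"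
  proof (rule tendsto_lipschitz[OF _ xe])
    show "norm (?Y (x (r n)) - ?Y e) \<le> norm \<xi> * norm (x (r n) - e)" for n
      using slice_norm[of "x (r n) - e" \<xi>] x(1) eH by (simp add: slice_diff hilbert_spaceD[OF H1])
  qed
  then have Ye: "?Y e = l" using l LIMSEQ_unique by blast
  then have "e \<noteq> 0" using nl s slice_norm[OF eH, of \<xi>] by auto
  moreover have "of_real (s\<^sup>2) *\<^sub>C e = ?X l"
    using s by (simp add: e_def)
  then have "?X (?Y e) = of_real (s\<^sup>2) *\<^sub>C e" by (simp only: Ye)
  ultimately show ?thesis using s eH by blast
qed

definition slice_eigenspace :: "'k \<Rightarrow> real \<Rightarrow> 'h1 set"
  where "slice_eigenspace \<xi> s = {x \<in> H1. coslice \<xi> (slice \<xi> x) = of_real (s\<^sup>2) *\<^sub>C x}"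

lemma slice_eigenspace_subspace: "csubspace (slice_eigenspace \<xi> s)"
proof -
  have "coslice \<xi> (slice \<xi> 0) = 0"
    using coslice_slice_linear(2)[OF hilbert_spaceD(3)[OF H1], of \<xi> 0] by simp
  then show ?thesis
    by (auto simp: cv.subspace_def slice_eigenspace_def hilbert_spaceD[OF H1] coslice_slice_linear
        cv.scale_right_distrib mult.commute)
qed

lemma slice_isometry:
  assumes "x \<in> slice_eigenspace \<xi> s" "x' \<in> H1"
  shows "cinner (slice \<xi> x') (slice \<xi> x) = of_real (s\<^sup>2) * cinner x x'"
  using coslice_slice[of x x' \<xi>] assms by (simp add: slice_eigenspace_def cinner_scaleC_left)

text \<open>An orthonormal family \<open>e\<close> of eigenvectors gives the orthonormal family
  \<open>e\<^sub>k \<otimes> slice \<xi> e\<^sub>k / s\<close>, whose coefficients at \<open>\<xi>\<close> all equal \<open>s\<close>.\<close>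

lemma slice_eigenspace_finite_dim:
  assumes s: "s > 0"
  shows "finite_dim (slice_eigenspace \<xi> s)"
proof -
  let ?E = "slice_eigenspace \<xi> s"
  let ?c = "complex_of_real (1 / s)"
  have bound: "\<forall>r e. hs.orthonormal r e \<and> (\<forall>k<r. e k \<in> ?E) \<longrightarrow> r \<le> nat \<lfloor>(norm \<xi>)\<^sup>2 / s\<^sup>2\<rfloor>"
  proof (intro allI impI, elim conjE)
    fix r e assume e: "hs.orthonormal r e" "\<forall>k<r. e k \<in> ?E"
    have eH: "e k \<in> H1" if "k < r" for k using e(2) that by (simp add: slice_eigenspace_def)
    define g where "g k = t (e k) (?c *\<^sub>C slice \<xi> (e k))" for k
    have "hs.orthonormal r g"
      unfolding hs.orthonormal_def
    proof (intro allI impI conjI UNIV_I)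
      fix k l assume kl: "k < r" "l < r"
      have "cinner (slice \<xi> (e k)) (slice \<xi> (e l)) = of_real (s\<^sup>2) * cinner (e l) (e k)"
        using e(2) kl eH by (intro slice_isometry) auto
      moreover have "?c * ?c * of_real (s\<^sup>2) = 1"
        using s by (simp add: power2_eq_square flip: of_real_mult)
      ultimately show "cinner (g k) (g l) = (if k = l then 1 else 0)"
        using kl eH hs.orthonormalD(2)[OF e(1)]
        by (auto simp: g_def t_cinner slice hilbert_spaceD[OF H2] cinner_scaleC_left cinner_scaleC_right mult.assoc[symmetric])
    qed
    from bessel[OF this, of \<xi>] have "(\<Sum>k<r. (cmod (cinner (g k) \<xi>))\<^sup>2) \<le> (norm \<xi>)\<^sup>2" .
    moreover have "(cmod (cinner (g k) \<xi>))\<^sup>2 = s\<^sup>2" if k: "k < r" for k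
    proof -
      have "cinner \<xi> (g k) = ?c * cinner (slice \<xi> (e k)) (slice \<xi> (e k))"
        using eH[OF k] by (simp add: g_def slice t_scale cinner_scaleC_right)
      also have "cinner (slice \<xi> (e k)) (slice \<xi> (e k)) = of_real (s\<^sup>2)"
        using slice_isometry[of "e k" \<xi> s "e k"] e(2) eH[OF k] k hs.orthonormalD(2)[OF e(1) k k] by simp
      also have "?c * of_real (s\<^sup>2) = of_real s" using s by (simp add: power2_eq_square)
      finally have "cinner \<xi> (g k) = of_real s" .
      then have "cinner (g k) \<xi> = of_real s" by (subst cinner_commute) simp
      then show ?thesis by simp
    qed
    ultimately have "real r * s\<^sup>2 \<le> (norm \<xi>)\<^sup>2" by simp
    then have "real r \<le> (norm \<xi>)\<^sup>2 / s\<^sup>2" using s by (simp add: pos_le_divide_eq)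
    then show "r \<le> nat \<lfloor>(norm \<xi>)\<^sup>2 / s\<^sup>2\<rfloor>" by (simp add: le_nat_floor)
  qed
  obtain r e where e: "hs.orthonormal r e" "\<forall>k<r. e k \<in> ?E"
      and ex: "\<forall>x\<in>?E. x = (\<Sum>k<r. cinner (e k) x *\<^sub>C e k)"
    by (rule hs.orthonormal_basis_exists[OF slice_eigenspace_subspace subset_UNIV bound], rule that)
  have "?E \<subseteq> cspan (e ` {..<r})"
  proof
    fix x assume "x \<in> ?E"
    then have "x = (\<Sum>k<r. cinner (e k) x *\<^sub>C e k)" by (rule bspec[OF ex])
    also have "\<dots> \<in> cspan (e ` {..<r})" by (intro cv.span_sum cv.span_scale cv.span_base) auto
    finally show "x \<in> cspan (e ` {..<r})" .
  qed
  moreover have "cspan (e ` {..<r}) \<subseteq> ?E"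
    using e(2) by (intro cv.span_minimal slice_eigenspace_subspace) auto
  ultimately show ?thesis unfolding finite_dim_def by (intro exI[of _ "e ` {..<r}"]) auto
qed

lemma slice_eigenspace_hilbert: "hilbert_space (slice_eigenspace \<xi> s)"
  unfolding hilbert_space_def
proof (intro conjI slice_eigenspace_subspace)
  interpret sw: tensor_space H2 H1 K "\<lambda>y x. t x y" by (rule swap)
  have "(\<lambda>x. if x \<in> H1 then coslice \<xi> (slice \<xi> x) else 0) \<in> bounded_ops H1 UNIV"
  proof (rule bounded_opsI[where C = "norm \<xi> * norm \<xi>"])
    fix x assume x: "x \<in> H1"
    have "norm (coslice \<xi> (slice \<xi> x)) \<le> norm \<xi> * norm (slice \<xi> x)"
      using x by (intro sw.slice_norm slice)
    also have "\<dots> \<le> norm \<xi> * (norm \<xi> * norm x)" using x by (intro mult_left_mono slice_norm) auto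
    finally show "norm (if x \<in> H1 then coslice \<xi> (slice \<xi> x) else 0) \<le> norm \<xi> * norm \<xi> * norm x"
      using x by (simp add: mult.assoc)
  qed (auto simp: coslice_slice_linear hilbert_spaceD[OF H1])
  note T = bounded_ops_limit[OF this H1]
  show "closed (slice_eigenspace \<xi> s)"
    unfolding closed_sequential_limits
  proof (intro allI impI, elim conjE)
    fix x l assume x: "\<forall>n. x n \<in> slice_eigenspace \<xi> s" and l: "x \<longlonglongrightarrow> l"
    have xH: "x n \<in> H1" for n using x by (simp add: slice_eigenspace_def)
    have lH: "l \<in> H1" by (rule hilbert_space_limit[OF H1 xH l])
    have "(\<lambda>n. of_real (s\<^sup>2) *\<^sub>C x n) \<longlonglongrightarrow> coslice \<xi> (slice \<xi> l)"
      using T[OF xH l] x xH lH by (simp add: slice_eigenspace_def)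
    moreover have "(\<lambda>n. of_real (s\<^sup>2) *\<^sub>C x n) \<longlonglongrightarrow> of_real (s\<^sup>2) *\<^sub>C l" by (rule tendsto_scaleC[OF l])
    ultimately show "l \<in> slice_eigenspace \<xi> s"
      using lH LIMSEQ_unique by (auto simp: slice_eigenspace_def)
  qed
qed

end

section \<open>The representation of a corepresentation\<close>

lemma bounded_ops_linear_combination:
  assumes H: "hilbert_space H" "hilbert_space K" and f: "\<And>p. p \<in> S \<Longrightarrow> f p \<in> bounded_ops H K"
  shows "(\<lambda>x. \<Sum>p\<in>S. c p *\<^sub>C f p x) \<in> bounded_ops H K"
  using f
proof (induction S rule: infinite_finite_induct)
  case (insert q S)
  have fq: "f q \<in> bounded_ops H K" using insert.prems by simp
  have g: "(\<lambda>x. \<Sum>p\<in>S. c p *\<^sub>C f p x) \<in> bounded_ops H K" (is "?g \<in> _")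
    by (rule insert.IH) (use insert.prems in simp)
  obtain C where C: "C \<ge> 0" "\<forall>x\<in>H. norm (f q x) \<le> C * norm x" by (rule bounded_ops_bound[OF fq])
  obtain D where D: "D \<ge> 0" "\<forall>x\<in>H. norm (?g x) \<le> D * norm x" by (rule bounded_ops_bound[OF g])
  have "(\<lambda>x. c q *\<^sub>C f q x + ?g x) \<in> bounded_ops H K"
  proof (rule bounded_opsI[where C = "cmod (c q) * C + D"])
    show "c q *\<^sub>C f q x + ?g x \<in> K" if "x \<in> H" for x
      using that by (intro hilbert_spaceD[OF H(2)] bounded_opsD(1)[OF fq] bounded_opsD(1)[OF g])
    show "c q *\<^sub>C f q (x + y) + ?g (x + y) = c q *\<^sub>C f q x + ?g x + (c q *\<^sub>C f q y + ?g y)"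
      if "x \<in> H" "y \<in> H" for x y
      using bounded_opsD(2)[OF fq that] bounded_opsD(2)[OF g that] by (simp add: cv.scale_right_distrib)
    show "c q *\<^sub>C f q (a *\<^sub>C x) + ?g (a *\<^sub>C x) = a *\<^sub>C (c q *\<^sub>C f q x + ?g x)" if "x \<in> H" for a x
      using bounded_opsD(3)[OF fq that, of a] bounded_opsD(3)[OF g that, of a]
      by (simp add: cv.scale_right_distrib mult.commute)
    show "norm (c q *\<^sub>C f q x + ?g x) \<le> (cmod (c q) * C + D) * norm x" if x: "x \<in> H" for x
    proof -
      have "norm (c q *\<^sub>C f q x + ?g x) \<le> cmod (c q) * norm (f q x) + norm (?g x)"
        using norm_triangle_ineq[of "c q *\<^sub>C f q x" "?g x"] by (simp add: norm_scaleC)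
      also have "\<dots> \<le> cmod (c q) * (C * norm x) + D * norm x"
        using C D x by (intro add_mono mult_left_mono) auto
      finally show ?thesis by (simp add: algebra_simps)
    qed
    show "c q *\<^sub>C f q x + ?g x = 0" if "x \<notin> H" for x
      using bounded_opsD(4)[OF fq that] bounded_opsD(4)[OF g that] by simp
  qed
  then show ?case using insert.hyps by simp
qed (auto intro!: bounded_opsI[where C = 0] simp: hilbert_spaceD[OF H(2)])

context cqg
begin

lemma irr_supp_eq: "irr_supp G a = {p \<in> coef_index. cv.representation (coef ` coef_index) a (coef p) \<noteq> 0}"
  by (auto simp: irr_supp_def coef_index_def irr_coeff_def coef_basis[unfolded coef_index_def] coef_def)

lemma irr_supp_finite: "finite (irr_supp G a)"
proof (rule finite_imageD)
  show "finite (coef ` irr_supp G a)"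
    by (rule finite_subset[OF _ cv.finite_representation[of "coef ` coef_index" a]]) (auto simp: irr_supp_eq)
  show "inj_on coef (irr_supp G a)"
    by (rule inj_on_subset[OF coef_inj]) (auto simp: irr_supp_eq)
qed

lemma rep_of_irr:
  assumes "i < nd \<alpha>" "j < nd \<alpha>"
  shows "rep_of G U (u \<alpha> i j) = U \<alpha> i j"
proof -
  have "irr_supp G (u \<alpha> i j) = {(\<alpha>, i, j)}"
    using assms by (auto simp: irr_supp_def irr_coeff_irr split: if_splits)
  then show ?thesis using assms by (simp add: rep_of_def irr_coeff_irr)
qed

lemma rep_of_linear: "clinear_map (\<lambda>a. rep_of G U a x)"
proof -
  have ext: "rep_of G U a x = (\<Sum>(\<alpha>, m, n)\<in>S. irr_coeff G a \<alpha> m n *\<^sub>C U \<alpha> m n x)"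
    if S: "finite S" "S \<subseteq> coef_index" "irr_supp G a \<subseteq> S" for S a
    unfolding rep_of_def
  proof (rule sum.mono_neutral_left[OF S(1,3)])
    show "\<forall>p\<in>S - irr_supp G a. (case p of (\<alpha>, m, n) \<Rightarrow> irr_coeff G a \<alpha> m n *\<^sub>C U \<alpha> m n x) = 0"
      using S(2) by (auto simp: irr_supp_def coef_index_def)
  qed
  have sub: "irr_supp G a \<subseteq> coef_index" for a by (auto simp: irr_supp_eq)
  have "rep_of G U (a + b) x = rep_of G U a x + rep_of G U b x" for a b
  proof -
    let ?S = "irr_supp G a \<union> irr_supp G b \<union> irr_supp G (a + b)"
    have S: "finite ?S" "?S \<subseteq> coef_index" using irr_supp_finite sub by auto
    have "irr_supp G a \<subseteq> ?S" "irr_supp G b \<subseteq> ?S" "irr_supp G (a + b) \<subseteq> ?S" by auto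
    then show ?thesis
      by (simp only: ext[OF S] case_prod_unfold sum.distrib[symmetric] cv.scale_left_distrib[symmetric]
          clinear_mapD(1)[OF irr_coeff_linear])
  qed
  moreover have "rep_of G U (c *\<^sub>C a) x = c *\<^sub>C rep_of G U a x" for c a
  proof -
    let ?S = "irr_supp G a \<union> irr_supp G (c *\<^sub>C a)"
    have S: "finite ?S" "?S \<subseteq> coef_index" using irr_supp_finite sub by auto
    have "irr_supp G a \<subseteq> ?S" "irr_supp G (c *\<^sub>C a) \<subseteq> ?S" by auto
    then show ?thesis
      by (simp only: ext[OF S] case_prod_unfold cv.scale_sum_right cv.scale_scale
          clinear_mapD(2)[OF irr_coeff_linear] scaleC_complex)
  qed
  ultimately show ?thesis by (simp add: clinear_map_def)
qed

lemma corepresentationD: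
  assumes "corepresentation G H U"
  shows "hilbert_space H" "i < nd \<alpha> \<Longrightarrow> j < nd \<alpha> \<Longrightarrow> U \<alpha> i j \<in> bounded_ops H H"
  using assms by (auto simp: corepresentation_def Let_def)

lemma corepresentation_unitary:
  assumes U: "corepresentation G H U" and ij: "i < nd \<alpha>" "j < nd \<alpha>"
  shows "(\<Sum>k<nd \<alpha>. adj_op H (U \<alpha> k i) (U \<alpha> k j x)) = (if i = j then id_op H x else 0)"
    and "(\<Sum>k<nd \<alpha>. U \<alpha> i k (adj_op H (U \<alpha> j k) x)) = (if i = j then id_op H x else 0)"
proof -
  have "(\<lambda>x. \<Sum>k<nd \<alpha>. adj_op H (U \<alpha> k i) (U \<alpha> k j x)) = (if i = j then id_op H else (\<lambda>x. 0))"
    "(\<lambda>x. \<Sum>k<nd \<alpha>. U \<alpha> i k (adj_op H (U \<alpha> j k) x)) = (if i = j then id_op H else (\<lambda>x. 0))"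
    using U ij unfolding corepresentation_def Let_def by blast+
  from this[THEN fun_cong, of x]
  show "(\<Sum>k<nd \<alpha>. adj_op H (U \<alpha> k i) (U \<alpha> k j x)) = (if i = j then id_op H x else 0)"
    "(\<Sum>k<nd \<alpha>. U \<alpha> i k (adj_op H (U \<alpha> j k) x)) = (if i = j then id_op H x else 0)"
    by auto
qed

lemma rep_of_bounded:
  assumes U: "corepresentation G H U"
  shows "rep_of G U a \<in> bounded_ops H H"
  unfolding rep_of_def case_prod_unfold
  by (rule bounded_ops_linear_combination) (auto simp: irr_supp_def corepresentationD[OF U])

text \<open>On a pair of coefficients multiplicativity is the defining equation of a corepresentation,
  in the coordinates of their product; both sides are linear in \<open>a\<close> and \<open>b\<close>.\<close>

lemma rep_of_mult:
  assumes U: "corepresentation G H U" and x: "x \<in> H"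
  shows "rep_of G U (a * b) x = rep_of G U a (rep_of G U b x)"
proof -
  have irr: "rep_of G U (u \<gamma> k l * u \<beta> i j) x = U \<gamma> k l (U \<beta> i j x)"
    if "k < nd \<gamma>" "l < nd \<gamma>" "i < nd \<beta>" "j < nd \<beta>" for \<gamma> k l \<beta> i j
  proof -
    have "(\<lambda>x. \<Sum>(\<alpha>, m, n)\<in>comult_supp G \<beta> i j \<gamma> k l.
        dual_comult G \<alpha> m n \<beta> i j \<gamma> k l *\<^sub>C U \<alpha> m n x) = U \<gamma> k l \<circ> U \<beta> i j"
      using U that unfolding corepresentation_def by blast
    moreover have "comult_supp G \<beta> i j \<gamma> k l = irr_supp G (u \<gamma> k l * u \<beta> i j)"
      by (simp add: comult_supp_def irr_supp_def dual_comult_def)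
    ultimately show ?thesis by (simp add: rep_of_def dual_comult_def fun_eq_iff)
  qed
  have left: "rep_of G U (a * u \<beta> i j) x = rep_of G U a (U \<beta> i j x)"
    if ij: "i < nd \<beta>" "j < nd \<beta>" for a \<beta> i j
  proof (rule clinear_map_eqI[OF _ rep_of_linear])
    show "clinear_map (\<lambda>a. rep_of G U (a * u \<beta> i j) x)"
      by (rule clinear_map_compose[OF rep_of_linear]) (simp add: clinear_map_def distrib_right scaleC_mult_left)
  qed (use ij in \<open>simp add: irr rep_of_irr\<close>)
  show ?thesis
  proof (rule clinear_map_eqI)
    show "clinear_map (\<lambda>b. rep_of G U (a * b) x)"
      by (rule clinear_map_compose[OF rep_of_linear]) (simp add: clinear_map_def distrib_left scaleC_mult_right)
    note bU = rep_of_bounded[OF U]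
    show "clinear_map (\<lambda>b. rep_of G U a (rep_of G U b x))"
      using x bounded_opsD[OF bU] by (simp add: clinear_map_def clinear_mapD[OF rep_of_linear])
  qed (simp add: left rep_of_irr)
qed

text \<open>The operator \<open>U triv 0 0\<close> is idempotent and unitary.\<close>

lemma rep_of_1:
  assumes U: "corepresentation G H U" and x: "x \<in> H"
  shows "rep_of G U 1 x = x"
proof -
  note H = corepresentationD(1)[OF U]
  have eq: "rep_of G U 1 = U triv 0 0" using rep_of_irr[of 0 triv 0 U] triv by simp
  have Ux: "U triv 0 0 x \<in> H" using corepresentationD(2)[OF U, of 0 triv 0] triv x by (simp add: bounded_opsD)
  have inv: "adj_op H (U triv 0 0) (U triv 0 0 y) = y" if "y \<in> H" for y
    using corepresentation_unitary(1)[OF U, of 0 triv 0 y] triv that by (simp add: id_op_def)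
  have "U triv 0 0 (U triv 0 0 x) = U triv 0 0 x" using rep_of_mult[OF U x, of 1 1] by (simp add: eq)
  then have "adj_op H (U triv 0 0) (U triv 0 0 (U triv 0 0 x)) = adj_op H (U triv 0 0) (U triv 0 0 x)" by simp
  then show ?thesis using inv x Ux by (simp add: eq)
qed

text \<open>Applying the representation to \<open>u* u = 1\<close> shows that the matrix of the operators
  \<open>rep_of G U (star (u\<^sub>j\<^sub>i))\<close> is a left inverse of the unitary matrix \<open>U\<close>.\<close>

lemma rep_of_star_irr:
  assumes U: "corepresentation G H U" and ij: "i < nd \<alpha>" "j < nd \<alpha>" and x: "x \<in> H"
  shows "rep_of G U (star (u \<alpha> i j)) x = adj_op H (U \<alpha> i j) x"
proof -
  note H = corepresentationD(1)[OF U]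
  let ?n = "nd \<alpha>"
  define S where "S k m = rep_of G U (star (u \<alpha> k m))" for k m
  have bS: "S k m \<in> bounded_ops H H" for k m unfolding S_def by (rule rep_of_bounded[OF U])
  have adjH: "adj_op H (U \<alpha> i m) x \<in> H" if "m < ?n" for m
    using that ij x by (intro adj_op_props(1)[OF H] corepresentationD[OF U])
  have SU: "(\<Sum>k<?n. S k j (U \<alpha> k m y)) = (if j = m then y else 0)" if "m < ?n" "y \<in> H" for m y
  proof -
    have "(\<Sum>k<?n. S k j (U \<alpha> k m y)) = rep_of G U (\<Sum>k<?n. star (u \<alpha> k j) * u \<alpha> k m) y"
      using that by (simp add: clinear_map_sum[OF rep_of_linear] rep_of_mult[OF U] S_def rep_of_irr)
    also have "(\<Sum>k<?n. star (u \<alpha> k j) * u \<alpha> k m) = (if j = m then 1 else 0)"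
      using irr_unitary[of \<alpha>] ij that by (simp add: unitary_corep_def)
    finally show ?thesis using that by (simp add: rep_of_1[OF U] clinear_mapD(3)[OF rep_of_linear])
  qed
  have "S i j x = (\<Sum>k<?n. S k j (if k = i then x else 0))"
    using ij by (simp add: if_distrib bounded_ops_0[OF bS H] cong: if_cong)
  also have "\<dots> = (\<Sum>k<?n. S k j (\<Sum>m<?n. U \<alpha> k m (adj_op H (U \<alpha> i m) x)))"
    using x ij by (intro sum.cong refl) (simp add: corepresentation_unitary(2)[OF U] id_op_def)
  also have "\<dots> = (\<Sum>k<?n. \<Sum>m<?n. S k j (U \<alpha> k m (adj_op H (U \<alpha> i m) x)))"
    using adjH by (intro sum.cong refl bounded_ops_sum[OF bS H]) (auto intro: bounded_opsD corepresentationD[OF U])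
  also have "\<dots> = (\<Sum>m<?n. \<Sum>k<?n. S k j (U \<alpha> k m (adj_op H (U \<alpha> i m) x)))" by (rule sum.swap)
  also have "\<dots> = (\<Sum>m<?n. if m = j then adj_op H (U \<alpha> i m) x else 0)"
    by (intro sum.cong refl) (use adjH SU in auto)
  also have "\<dots> = adj_op H (U \<alpha> i j) x" using ij by simp
  finally show ?thesis by (simp add: S_def)
qed

lemma rep_of_star:
  assumes U: "corepresentation G H U" and x: "x \<in> H" and y: "y \<in> H"
  shows "cinner x (rep_of G U (star a) y) = cinner (rep_of G U a x) y"
proof -
  note H = corepresentationD(1)[OF U]
  have "cnj (cinner x (rep_of G U (star a) y)) = cnj (cinner (rep_of G U a x) y)"
  proof (rule clinear_map_eqI)
    show "clinear_map (\<lambda>a. cnj (cinner x (rep_of G U (star a) y)))"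
      by (simp add: clinear_map_def star_add star_scaleC clinear_mapD[OF rep_of_linear] cinner_add_right cinner_scaleC_right)
    show "clinear_map (\<lambda>a. cnj (cinner (rep_of G U a x) y))"
      by (simp add: clinear_map_def clinear_mapD[OF rep_of_linear] cinner_add_left cinner_scaleC_left)
    fix \<alpha> i j assume "i < nd \<alpha>" "j < nd \<alpha>"
    then show "cnj (cinner x (rep_of G U (star (u \<alpha> i j)) y)) = cnj (cinner (rep_of G U (u \<alpha> i j) x) y)"
      using x y corepresentationD[OF U]
      by (simp add: rep_of_star_irr[OF U] rep_of_irr adj_op_props(2)[OF H])
  qed
  then show ?thesis by simp
qed

lemma contained_inD:
  assumes "contained_in G H U K V"
  obtains L J where "hilbert_space L" "L \<subseteq> K" "unitary_op H L J"
    "\<forall>\<alpha>. \<forall>i<nd \<alpha>. \<forall>j<nd \<alpha>. \<forall>x\<in>H. J (U \<alpha> i j x) = V \<alpha> i j (J x)"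
proof -
  obtain L J where *: "hilbert_space L" "L \<subseteq> K" "unitary_op H L J"
    "\<forall>a. \<forall>x\<in>H. J (rep_of G U a x) = rep_of G V a (J x)"
    using assms unfolding contained_in_def by blast
  have "\<forall>\<alpha>. \<forall>i<nd \<alpha>. \<forall>j<nd \<alpha>. \<forall>x\<in>H. J (U \<alpha> i j x) = V \<alpha> i j (J x)"
    using *(4) rep_of_irr by metis
  with * that show ?thesis by blast
qed

lemma contained_inI:
  assumes H: "hilbert_space H" and J: "J \<in> bounded_ops H UNIV" "\<And>x. x \<in> H \<Longrightarrow> J x \<in> K"
    and iso: "\<And>x y. x \<in> H \<Longrightarrow> y \<in> H \<Longrightarrow> cinner (J x) (J y) = cinner x y"
    and UH: "\<And>\<alpha> i j x. i < nd \<alpha> \<Longrightarrow> j < nd \<alpha> \<Longrightarrow> x \<in> H \<Longrightarrow> U \<alpha> i j x \<in> H"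
    and int: "\<And>\<alpha> i j x. i < nd \<alpha> \<Longrightarrow> j < nd \<alpha> \<Longrightarrow> x \<in> H \<Longrightarrow> J (U \<alpha> i j x) = V \<alpha> i j (J x)"
  shows "contained_in G H U K V"
proof -
  have rep: "rep_of G U a x \<in> H \<and> J (rep_of G U a x) = rep_of G V a (J x)" if x: "x \<in> H" for a x
  proof -
    have inH: "irr_coeff G a (fst p) (fst (snd p)) (snd (snd p)) *\<^sub>C U (fst p) (fst (snd p)) (snd (snd p)) x \<in> H"
      if "p \<in> irr_supp G a" for p
      using that x by (intro hilbert_spaceD[OF H] UH) (auto simp: irr_supp_def)
    have "J (rep_of G U a x) = rep_of G V a (J x)"
      unfolding rep_of_def case_prod_unfold
    proof (subst bounded_ops_sum[OF J(1) H inH], assumption, rule sum.cong[OF refl])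
      fix p assume "p \<in> irr_supp G a"
      then have lt: "fst (snd p) < nd (fst p)" "snd (snd p) < nd (fst p)" by (auto simp: irr_supp_def)
      show "J (irr_coeff G a (fst p) (fst (snd p)) (snd (snd p)) *\<^sub>C U (fst p) (fst (snd p)) (snd (snd p)) x) =
          irr_coeff G a (fst p) (fst (snd p)) (snd (snd p)) *\<^sub>C V (fst p) (fst (snd p)) (snd (snd p)) (J x)"
        by (simp only: bounded_opsD(3)[OF J(1) UH[OF lt x]] int[OF lt x])
    qed
    moreover have "rep_of G U a x \<in> H"
      unfolding rep_of_def case_prod_unfold by (rule cv.subspace_sum[OF hilbert_spaceD(1)[OF H]]) (rule inH)
    ultimately show ?thesis by blast
  qed
  have "J \<in> bounded_ops H (J ` H)" using J(1) by (auto simp: bounded_ops_def)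
  then have "unitary_op H (J ` H) J" using iso by (simp add: unitary_op_def)
  moreover have "\<forall>a. \<forall>y\<in>J ` H. rep_of G V a y \<in> J ` H"
  proof (intro allI ballI)
    fix a y assume "y \<in> J ` H"
    then obtain x where x: "x \<in> H" "y = J x" by blast
    then have "rep_of G V a y = J (rep_of G U a x)" using rep by simp
    then show "rep_of G V a y \<in> J ` H" using rep[OF x(1)] by blast
  qed
  ultimately show ?thesis
    unfolding contained_in_def using isometric_image_hilbert[OF H J(1) iso] J(2) rep
    by (intro exI[of _ "J ` H"] exI[of _ J]) auto
qed

lemma trivial_corep_irr: "i < nd \<alpha> \<Longrightarrow> j < nd \<alpha> \<Longrightarrow> trivial_corep G \<alpha> i j z = (if i = j then z else 0)"
  by (simp add: trivial_corep_def counit_corep[OF irr_unitary])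

end

lemma (in tensor_space) tensor_corep_bounded:
  assumes G: "compact_quantum_group G"
    and U: "corepresentation G H1 U" and V: "corepresentation G H2 V"
    and ij: "i < irr_dim G \<alpha>" "j < irr_dim G \<alpha>"
  shows "tensor_corep G H1 H2 K t U V \<alpha> i j \<in> bounded_ops K K"
proof -
  interpret cqg G using G by unfold_locales
  have "(\<lambda>z. \<Sum>k<nd \<alpha>. 1 *\<^sub>C tensor_op H1 H2 K t (U \<alpha> i k) (V \<alpha> k j) z) \<in> bounded_ops K K"
    using ij by (intro bounded_ops_linear_combination K tensor_op corepresentationD[OF U] corepresentationD[OF V]) auto
  then show ?thesis by (simp add: tensor_corep_def)
qed

text \<open>An intertwiner from the trivial corepresentation is determined by the image of \<open>1\<close>.\<close>

lemma (in tensor_space) trivial_contained_iff: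
  assumes G: "compact_quantum_group G"
    and U: "corepresentation G H1 U" and V: "corepresentation G H2 V"
  shows "contained_in G UNIV (trivial_corep G) K (tensor_corep G H1 H2 K t U V) \<longleftrightarrow>
    (\<exists>\<xi>\<in>K. \<xi> \<noteq> 0 \<and> (\<forall>\<alpha>. \<forall>i<irr_dim G \<alpha>. \<forall>j<irr_dim G \<alpha>.
      tensor_corep G H1 H2 K t U V \<alpha> i j \<xi> = (if i = j then \<xi> else 0)))"
proof -
  interpret cqg G using G by unfold_locales
  note bT = tensor_corep_bounded[OF G U V]
  have UNIV: "hilbert_space (UNIV :: complex set)" by (simp add: hilbert_space_def)
  show ?thesis
  proof
    assume "contained_in G UNIV (trivial_corep G) K (tensor_corep G H1 H2 K t U V)"
    then obtain L J where J: "L \<subseteq> K" "unitary_op UNIV L J"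
      "\<forall>\<alpha>. \<forall>i<nd \<alpha>. \<forall>j<nd \<alpha>. \<forall>x\<in>UNIV. J (trivial_corep G \<alpha> i j x) = tensor_corep G H1 H2 K t U V \<alpha> i j (J x)"
      by (rule contained_inD)
    have bJ: "J \<in> bounded_ops UNIV L" and iso: "cinner (J x) (J y) = cinner x y" for x y
      using J(2) by (auto simp: unitary_op_def)
    have "J 1 \<in> K" using bounded_opsD(1)[OF bJ] J(1) by blast
    moreover have "J 1 \<noteq> 0" using iso[of 1 1] by (auto simp: cinner_complex_def)
    moreover have "tensor_corep G H1 H2 K t U V \<alpha> i j (J 1) = (if i = j then J 1 else 0)"
      if ij: "i < nd \<alpha>" "j < nd \<alpha>" for \<alpha> i j
    proof -
      have "tensor_corep G H1 H2 K t U V \<alpha> i j (J 1) = J (trivial_corep G \<alpha> i j 1)" using J(3) ij by simp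
      then show ?thesis using ij by (simp add: trivial_corep_irr bounded_ops_0[OF bJ UNIV])
    qed
    ultimately show "\<exists>\<xi>\<in>K. \<xi> \<noteq> 0 \<and> (\<forall>\<alpha>. \<forall>i<nd \<alpha>. \<forall>j<nd \<alpha>.
      tensor_corep G H1 H2 K t U V \<alpha> i j \<xi> = (if i = j then \<xi> else 0))" by blast
  next
    assume "\<exists>\<xi>\<in>K. \<xi> \<noteq> 0 \<and> (\<forall>\<alpha>. \<forall>i<nd \<alpha>. \<forall>j<nd \<alpha>.
      tensor_corep G H1 H2 K t U V \<alpha> i j \<xi> = (if i = j then \<xi> else 0))"
    then obtain \<xi> where \<xi>: "\<xi> \<in> K" "\<xi> \<noteq> 0" "\<forall>\<alpha>. \<forall>i<nd \<alpha>. \<forall>j<nd \<alpha>.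
      tensor_corep G H1 H2 K t U V \<alpha> i j \<xi> = (if i = j then \<xi> else 0)" by blast
    define \<eta> where "\<eta> = of_real (1 / norm \<xi>) *\<^sub>C \<xi>"
    have \<eta>: "\<eta> \<in> K" "norm \<eta> = 1"
      using \<xi> by (auto simp: \<eta>_def norm_scaleC norm_divide intro: hilbert_spaceD[OF K])
    have inv: "tensor_corep G H1 H2 K t U V \<alpha> i j \<eta> = (if i = j then \<eta> else 0)"
      if ij: "i < nd \<alpha>" "j < nd \<alpha>" for \<alpha> i j
      unfolding \<eta>_def bounded_opsD(3)[OF bT[OF ij] \<xi>(1)] using \<xi>(3) ij by simp
    show "contained_in G UNIV (trivial_corep G) K (tensor_corep G H1 H2 K t U V)"
    proof (rule contained_inI[OF UNIV, where J = "\<lambda>z. z *\<^sub>C \<eta>"])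
      show "(\<lambda>z. z *\<^sub>C \<eta>) \<in> bounded_ops UNIV UNIV"
        by (rule bounded_opsI[where C = 1]) (auto simp: cv.scale_left_distrib norm_scaleC \<eta>(2))
      show "z *\<^sub>C \<eta> \<in> K" for z using \<eta>(1) by (rule hilbert_spaceD[OF K])
      show "cinner (z *\<^sub>C \<eta>) (w *\<^sub>C \<eta>) = cinner z w" for z w
        by (simp add: cinner_scaleC_left cinner_scaleC_right cinner_self \<eta>(2) cinner_complex_def)
      show "trivial_corep G \<alpha> i j z *\<^sub>C \<eta> = tensor_corep G H1 H2 K t U V \<alpha> i j (z *\<^sub>C \<eta>)"
        if ij: "i < nd \<alpha>" "j < nd \<alpha>" for \<alpha> i j z
        unfolding bounded_opsD(3)[OF bT[OF ij] \<eta>(1)] using ij by (simp add: inv trivial_corep_irr)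
    qed simp
  qed
qed

section \<open>A common finite-dimensional subrepresentation gives an invariant vector\<close>

lemma of_conj_sum: "of_conj (\<Sum>i\<in>A. f i) = (\<Sum>i\<in>A. of_conj (f i :: 'h::chilbert_space conjugate))"
  by (induction A rule: infinite_finite_induct) (auto simp: zero_conjugate_def plus_conjugate_def conj_simps)

lemma of_conj_scaleC: "of_conj (c *\<^sub>C x) = cnj c *\<^sub>C of_conj (x :: 'h::chilbert_space conjugate)"
  by (simp add: scaleC_conjugate_def conj_simps)

context cqg
begin

lemma rep_of_star':
  assumes U: "corepresentation G H U" and x: "x \<in> H" and y: "y \<in> H"
  shows "cinner (rep_of G U (star a) x) y = cinner x (rep_of G U a y)"
  using rep_of_star[OF U y x, of a] by (metis cinner_commute)

text \<open>A finite-dimensional subspace of the conjugate space that is invariant under the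
  contragredient is invariant under the adjoints of all \<open>V (R a)\<close>. The relation between \<open>R\<close>
  and the antipode turns this into invariance under \<open>V\<close>, as \<open>P\<close> is injective.\<close>

lemma contragredient_invariant:
  assumes R: "unitary_antipode G R" and V: "corepresentation G H V"
    and f: "hs.orthonormal d f" "\<forall>j<d. f j \<in> H"
    and inv: "\<And>\<alpha> m n j. m < nd \<alpha> \<Longrightarrow> n < nd \<alpha> \<Longrightarrow> j < d \<Longrightarrow>
      \<exists>c. adj_op H (rep_of G V (R (u \<alpha> m n))) (f j) = (\<Sum>i<d. c i *\<^sub>C f i)"
    and j: "j < d"
  shows "rep_of G V a (f j) = (\<Sum>s<d. cinner (f s) (rep_of G V a (f j)) *\<^sub>C f s)"
proof (rule clinear_map_eqI[OF rep_of_linear])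
  note H = corepresentationD(1)[OF V]
  note bV = rep_of_bounded[OF V]
  have fj: "f j \<in> H" using f(2) j by simp
  show "clinear_map (\<lambda>a. \<Sum>s<d. cinner (f s) (rep_of G V a (f j)) *\<^sub>C f s)"
    by (simp add: clinear_map_def clinear_mapD[OF rep_of_linear] cinner_add_right cinner_scaleC_right
        cv.scale_left_distrib sum.distrib cv.scale_sum_right)
  fix \<alpha> k l assume kl: "k < nd \<alpha>" "l < nd \<alpha>"
  let ?n = "nd \<alpha>"
  obtain P F where F: "modular_pair R \<alpha> P F" using modular_pair_exists[OF R] .
  note P = modular_pairD(1)[OF F]
  have orth: "cinner y (rep_of G V (u \<alpha> k l) (f j)) = 0"
    if y: "y \<in> H" "\<And>s. s < d \<Longrightarrow> cinner y (f s) = 0" for y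
  proof (rule posdef_kernel[OF P _ kl(1), of "\<lambda>k. cinner y (rep_of G V (u \<alpha> k l) (f j))"])
    fix i assume i: "i < ?n"
    have zero: "cinner (rep_of G V (R (u \<alpha> k i)) y) (f j) = 0" if k: "k < ?n" for k
    proof -
      obtain c where c: "adj_op H (rep_of G V (R (u \<alpha> k i))) (f j) = (\<Sum>i<d. c i *\<^sub>C f i)"
        using inv[OF k i j] by blast
      have "cinner (rep_of G V (R (u \<alpha> k i)) y) (f j) = cinner y (\<Sum>i<d. c i *\<^sub>C f i)"
        using adj_op_props(2)[OF H bV fj y(1)] by (simp only: c)
      also have "\<dots> = 0" using y(2) by (simp add: cinner_sum_right cinner_scaleC_right)
      finally show ?thesis .
    qed
    have "cinner (rep_of G V (\<Sum>k<?n. P l k *\<^sub>C R (u \<alpha> k i)) y) (f j) = 0"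
      by (simp add: clinear_map_sum[OF rep_of_linear] clinear_mapD[OF rep_of_linear] cinner_sum_left cinner_scaleC_left zero)
    moreover have "cinner (rep_of G V (\<Sum>k<?n. P k i *\<^sub>C \<kappa> (u \<alpha> l k)) y) (f j) =
        (\<Sum>k<?n. P i k * cinner y (rep_of G V (u \<alpha> k l) (f j)))"
      using kl i
      by (simp add: clinear_map_sum[OF rep_of_linear] clinear_mapD[OF rep_of_linear] cinner_sum_left cinner_scaleC_left
          antipode_corep[OF irr_unitary] rep_of_star'[OF V y(1) fj] posdef_hermitian[OF P])
    ultimately show "(\<Sum>k<?n. P i k * cinner y (rep_of G V (u \<alpha> k l) (f j))) = 0"
      using modular_pairD(4)[OF F kl(2) i] by simp
  qed
  let ?v = "rep_of G V (u \<alpha> k l) (f j)"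
  define w where "w = (\<Sum>s<d. cinner (f s) ?v *\<^sub>C f s)"
  have vH: "?v \<in> H" by (rule bounded_opsD(1)[OF bV fj])
  have wH: "w \<in> H" unfolding w_def using f(2) by (intro cv.subspace_sum hilbert_spaceD[OF H]) auto
  have yH: "?v - w \<in> H" by (rule hilbert_spaceD(5)[OF H vH wH])
  have yf: "cinner (?v - w) (f s) = 0" if "s < d" for s
  proof -
    have "cinner (f s) (?v - w) = 0"
      unfolding w_def by (simp add: cinner_diff_right hs.ip_expansion[OF f(1) that])
    then show ?thesis by (subst cinner_commute) simp
  qed
  have "cinner (?v - w) w = 0"
    unfolding w_def cinner_sum_right cinner_scaleC_right using yf[unfolded w_def] by simp
  moreover have "cinner (?v - w) ?v = 0" by (rule orth[OF yH yf])
  ultimately have "cinner (?v - w) (?v - w) = 0" by (simp only: cinner_diff_right[of "?v - w"] diff_self)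
  then have "?v - w = 0" by (simp add: cinner_self)
  then show "?v = (\<Sum>s<d. cinner (f s) ?v *\<^sub>C f s)" by (simp add: w_def)
qed

lemma invariant_family_matrix_rep:
  assumes V: "corepresentation G H V" and f: "hs.orthonormal d f" "\<forall>j<d. f j \<in> H"
    and ex: "\<And>a j. j < d \<Longrightarrow> rep_of G V a (f j) = (\<Sum>s<d. cinner (f s) (rep_of G V a (f j)) *\<^sub>C f s)"
  shows "matrix_rep d (\<lambda>a s t. cinner (f s) (rep_of G V a (f t)))"
  unfolding matrix_rep_def
proof (intro conjI allI impI)
  note H = corepresentationD(1)[OF V]
  note bV = rep_of_bounded[OF V]
  fix s t assume st: "s < d" "t < d"
  then have fH: "f s \<in> H" "f t \<in> H" using f(2) by auto
  show "clinear_map (\<lambda>a. cinner (f s) (rep_of G V a (f t)))"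
    by (simp add: clinear_map_def clinear_mapD[OF rep_of_linear] cinner_add_right cinner_scaleC_right)
  show "cinner (f s) (rep_of G V 1 (f t)) = (if s = t then 1 else 0)"
    using hs.orthonormalD(2)[OF f(1) st] fH by (simp add: rep_of_1[OF V])
  show "cinner (f s) (rep_of G V (star a) (f t)) = cnj (cinner (f t) (rep_of G V a (f s)))" for a
    by (simp only: rep_of_star[OF V fH] cinner_commute[of "rep_of G V a (f s)"])
  fix a b
  have "rep_of G V (a * b) (f t) = rep_of G V a (\<Sum>r<d. cinner (f r) (rep_of G V b (f t)) *\<^sub>C f r)"
    using ex[OF st(2), of b] by (simp add: rep_of_mult[OF V fH(2)])
  also have "\<dots> = (\<Sum>r<d. rep_of G V a (cinner (f r) (rep_of G V b (f t)) *\<^sub>C f r))"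
    using f(2) by (intro bounded_ops_sum[OF bV H] hilbert_spaceD[OF H]) auto
  also have "\<dots> = (\<Sum>r<d. cinner (f r) (rep_of G V b (f t)) *\<^sub>C rep_of G V a (f r))"
    using f(2) by (intro sum.cong refl bounded_opsD(3)[OF bV]) auto
  finally show "cinner (f s) (rep_of G V (a * b) (f t)) =
      (\<Sum>r<d. cinner (f s) (rep_of G V a (f r)) * cinner (f r) (rep_of G V b (f t)))"
    by (simp add: cinner_sum_right cinner_scaleC_right mult.commute)
qed

end

text \<open>Let \<open>J\<^sub>1\<close> and \<open>J\<^sub>2\<close> embed the space of \<open>W\<close> into \<open>H\<^sub>1\<close> and into the conjugate of \<open>H\<^sub>2\<close>, and let
  \<open>e\<close> be an orthonormal basis. The vectors \<open>f\<^sub>j = conj (J\<^sub>2 e\<^sub>j)\<close> span an invariant subspace of \<open>V\<close>, on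
  which \<open>V\<close> is a matrix representation \<open>\<rho>\<close>; the matrix coefficients of \<open>W\<close> are those of
  \<open>\<rho> \<circ> R\<close>, transposed. As \<open>\<rho>\<close> is finite-dimensional, \<open>R\<close> may be replaced by \<open>\<kappa>\<close>, and \<open>\<kappa>\<^sup>2\<close>
  by the identity. The invariance of \<open>\<Sum>\<^sub>j J\<^sub>1 e\<^sub>j \<otimes> f\<^sub>j\<close> becomes the antipode relation
  \<open>\<Sum>\<^sub>k u\<^sub>k\<^sub>l u\<^sub>k\<^sub>i* = \<delta>\<^sub>i\<^sub>l\<close> under \<open>\<rho>\<close>.\<close>

lemma (in tensor_space) common_subcorep_invariant_vector:
  assumes G: "compact_quantum_group G" and R: "unitary_antipode G R"
    and U: "corepresentation G H1 U" and V: "corepresentation G H2 V" and W: "corepresentation G HW W"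
    and fd: "finite_dim HW" "HW \<noteq> {0}"
    and WU: "contained_in G HW W H1 U"
    and WV: "contained_in G HW W (to_conj ` H2) (contragredient G R H2 V)"
  shows "\<exists>\<xi>\<in>K. \<xi> \<noteq> 0 \<and> (\<forall>\<alpha>. \<forall>i<irr_dim G \<alpha>. \<forall>j<irr_dim G \<alpha>.
    tensor_corep G H1 H2 K t U V \<alpha> i j \<xi> = (if i = j then \<xi> else 0))"
proof -
  interpret cqg G using G by unfold_locales
  note HW = corepresentationD(1)[OF W]
  obtain L1 J1 where J1: "L1 \<subseteq> H1" "unitary_op HW L1 J1"
    "\<forall>\<alpha>. \<forall>i<nd \<alpha>. \<forall>j<nd \<alpha>. \<forall>x\<in>HW. J1 (W \<alpha> i j x) = U \<alpha> i j (J1 x)"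
    by (rule contained_inD[OF WU])
  obtain L2 J2 where J2: "L2 \<subseteq> to_conj ` H2" "unitary_op HW L2 J2"
    "\<forall>\<alpha>. \<forall>i<nd \<alpha>. \<forall>j<nd \<alpha>. \<forall>x\<in>HW. J2 (W \<alpha> i j x) = contragredient G R H2 V \<alpha> i j (J2 x)"
    by (rule contained_inD[OF WV])
  have b1: "J1 \<in> bounded_ops HW L1" and b2: "J2 \<in> bounded_ops HW L2"
    using J1(2) J2(2) by (auto simp: unitary_op_def)
  obtain B where B: "finite B" "HW = cspan B" using fd(1) by (auto simp: finite_dim_def)
  have len: "\<forall>r e. hs.orthonormal r e \<and> (\<forall>k<r. e k \<in> HW) \<longrightarrow> r \<le> card B"
    using B by (auto intro: hs.orthonormal_length)
  obtain d e where e: "hs.orthonormal d e" "\<forall>k<d. e k \<in> HW" and ex: "\<forall>x\<in>HW. x = (\<Sum>k<d. cinner (e k) x *\<^sub>C e k)"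
    by (rule hs.orthonormal_basis_exists[OF hilbert_spaceD(1)[OF HW] subset_UNIV len], rule that)
  have d: "d > 0"
  proof (rule ccontr)
    assume "\<not> d > 0"
    then have "x = 0" if "x \<in> HW" for x using bspec[OF ex that] by simp
    then show False using fd(2) hilbert_spaceD(3)[OF HW] by blast
  qed
  define f where "f j = of_conj (J2 (e j))" for j
  have e1: "J1 (e j) \<in> H1" if "j < d" for j using bounded_opsD(1)[OF b1] J1(1) e(2) that by blast
  have fH: "f j \<in> H2" if "j < d" for j
  proof -
    have "J2 (e j) \<in> to_conj ` H2" using bounded_opsD(1)[OF b2] J2(1) e(2) that by blast
    then show ?thesis by (auto simp: f_def conj_simps)
  qed
  have ip2: "cinner (f i) (f j) = (if i = j then 1 else 0)" if "i < d" "j < d" for i j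
  proof -
    have "cinner (f i) (f j) = cinner (J2 (e j)) (J2 (e i))" by (simp add: f_def cinner_conjugate_def)
    also have "\<dots> = cinner (e j) (e i)" using J2(2) e(2) that by (simp add: unitary_op_def)
    finally show ?thesis using hs.orthonormalD(2)[OF e(1) that(2,1)] by auto
  qed
  have f: "hs.orthonormal d f" using ip2 by (simp add: hs.orthonormal_def)
  have ip1: "cinner (J1 (e i)) (J1 (e j)) = (if i = j then 1 else 0)" if "i < d" "j < d" for i j
    using J1(2) e(2) that hs.orthonormalD(2)[OF e(1) that] by (simp add: unitary_op_def)
  define w where "w \<alpha> m n i j = cinner (e i) (W \<alpha> m n (e j))" for \<alpha> m n i j
  have We: "W \<alpha> m n (e j) = (\<Sum>i<d. w \<alpha> m n i j *\<^sub>C e i)" if "m < nd \<alpha>" "n < nd \<alpha>" "j < d" for \<alpha> m n j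
    unfolding w_def using that e(2) by (intro bspec[OF ex] bounded_opsD(1)[OF corepresentationD(2)[OF W]]) auto
  have eW: "w \<alpha> m n i j *\<^sub>C e i \<in> HW" if "i < d" for \<alpha> m n i j
    using e(2) that by (intro hilbert_spaceD[OF HW]) auto
  have UJ: "U \<alpha> m n (J1 (e j)) = (\<Sum>i<d. w \<alpha> m n i j *\<^sub>C J1 (e i))"
    if "m < nd \<alpha>" "n < nd \<alpha>" "j < d" for \<alpha> m n j
  proof -
    have "U \<alpha> m n (J1 (e j)) = J1 (W \<alpha> m n (e j))" using J1(3) that e(2) by simp
    also have "\<dots> = (\<Sum>i<d. J1 (w \<alpha> m n i j *\<^sub>C e i))"
      unfolding We[OF that] by (rule bounded_ops_sum[OF b1 HW]) (simp add: eW)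
    also have "\<dots> = (\<Sum>i<d. w \<alpha> m n i j *\<^sub>C J1 (e i))"
      using e(2) by (intro sum.cong refl bounded_opsD(3)[OF b1]) auto
    finally show ?thesis .
  qed
  have Vf: "adj_op H2 (rep_of G V (R (u \<alpha> m n))) (f j) = (\<Sum>i<d. cnj (w \<alpha> m n i j) *\<^sub>C f i)"
    if "m < nd \<alpha>" "n < nd \<alpha>" "j < d" for \<alpha> m n j
  proof -
    have "adj_op H2 (rep_of G V (R (u \<alpha> m n))) (f j) = of_conj (contragredient G R H2 V \<alpha> m n (J2 (e j)))"
      by (simp add: contragredient_def transpose_op_def conj_simps f_def)
    also have "\<dots> = of_conj (J2 (W \<alpha> m n (e j)))" using J2(3) that e(2) by simp
    also have "J2 (W \<alpha> m n (e j)) = (\<Sum>i<d. J2 (w \<alpha> m n i j *\<^sub>C e i))"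
      unfolding We[OF that] by (rule bounded_ops_sum[OF b2 HW]) (simp add: eW)
    also have "\<dots> = (\<Sum>i<d. w \<alpha> m n i j *\<^sub>C J2 (e i))"
      using e(2) by (intro sum.cong refl bounded_opsD(3)[OF b2]) auto
    finally show ?thesis by (simp add: of_conj_sum of_conj_scaleC f_def)
  qed
  have inv: "\<exists>c. adj_op H2 (rep_of G V (R (u \<alpha> m n))) (f j) = (\<Sum>i<d. c i *\<^sub>C f i)"
    if "m < nd \<alpha>" "n < nd \<alpha>" "j < d" for \<alpha> m n j
    by (rule exI[of _ "\<lambda>i. cnj (w \<alpha> m n i j)"]) (rule Vf[OF that])
  have fH': "\<forall>j<d. f j \<in> H2" using fH by simp
  define \<rho> where "\<rho> a s t = cinner (f s) (rep_of G V a (f t))" for a s t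
  have rep: "rep_of G V a (f j) = (\<Sum>s<d. \<rho> a s j *\<^sub>C f s)" if "j < d" for a j
    unfolding \<rho>_def by (rule contragredient_invariant[OF R V f fH' inv that])
  have \<rho>: "matrix_rep d \<rho>"
    unfolding \<rho>_def by (rule invariant_family_matrix_rep[OF V f fH' contragredient_invariant[OF R V f fH' inv]])
  have w: "w \<alpha> m n i j = \<rho> (star (u \<alpha> n m)) j i" if mn: "m < nd \<alpha>" "n < nd \<alpha>" and ij: "i < d" "j < d" for \<alpha> m n i j
  proof -
    have "\<rho> (R (u \<alpha> m n)) j i = cinner (adj_op H2 (rep_of G V (R (u \<alpha> m n))) (f j)) (f i)"
      unfolding \<rho>_def using fH ij by (intro adj_op_props(3)[OF H2 rep_of_bounded[OF V]])
    also have "\<dots> = (\<Sum>k<d. if k = i then w \<alpha> m n k j else 0)"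
      unfolding Vf[OF mn ij(2)] cinner_sum_left cinner_scaleC_left using ij
      by (intro sum.cong refl) (simp add: ip2)
    also have "\<dots> = w \<alpha> m n i j" using ij by simp
    finally have "w \<alpha> m n i j = \<rho> (R (u \<alpha> m n)) j i" ..
    also have "\<dots> = \<rho> (\<kappa> (u \<alpha> m n)) j i"
    proof (rule kac_unitary_antipode[OF R _ _ mn])
      show "clinear_map (\<lambda>a. \<rho> a j i)" using \<rho> ij by (simp add: matrix_rep_def)
      have "(\<lambda>a. cnj (\<rho> (star a) j i)) = (\<lambda>a. \<rho> a i j)" using \<rho> ij by (simp add: matrix_rep_def)
      then show "kac_functional R (\<lambda>a. cnj (\<rho> (star a) j i))" using matrix_rep_kac[OF \<rho> ij] by simp
    qed
    also have "\<kappa> (u \<alpha> m n) = star (u \<alpha> n m)" using mn by (rule antipode_corep[OF irr_unitary])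
    finally show ?thesis .
  qed
  define \<xi> where "\<xi> = (\<Sum>j<d. t (J1 (e j)) (f j))"
  have \<xi>K: "\<xi> \<in> K" unfolding \<xi>_def using e1 fH by (intro cv.subspace_sum hilbert_spaceD[OF K] t_in) auto
  have "(norm \<xi>)\<^sup>2 = (\<Sum>k<d. (norm (J1 (e k)))\<^sup>2)"
    unfolding \<xi>_def using e1 fH by (intro orthonormal_leg_norm f) auto
  also have "\<dots> = (\<Sum>k<d. Re (cinner (J1 (e k)) (J1 (e k))))" by (simp only: Re_cinner_self)
  also have "\<dots> = real d" by (simp add: ip1)
  finally have \<xi>0: "\<xi> \<noteq> 0" using d by auto
  have "tensor_corep G H1 H2 K t U V \<alpha> i l \<xi> = (if i = l then \<xi> else 0)" if il: "i < nd \<alpha>" "l < nd \<alpha>" for \<alpha> i l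
  proof -
    let ?n = "nd \<alpha>"
    have T: "tensor_op H1 H2 K t (U \<alpha> i k) (V \<alpha> k l) \<xi> =
        (\<Sum>m<d. t (J1 (e m)) (\<Sum>s<d. \<rho> (u \<alpha> k l * star (u \<alpha> k i)) s m *\<^sub>C f s))" if k: "k < ?n" for k
    proof -
      note bU = corepresentationD(2)[OF U il(1) k] and bV = corepresentationD(2)[OF V k il(2)]
      have Vfj: "V \<alpha> k l (f j) = (\<Sum>s<d. \<rho> (u \<alpha> k l) s j *\<^sub>C f s)" if "j < d" for j
        using rep[OF that, of "u \<alpha> k l"] k il by (simp add: rep_of_irr)
      have VH: "V \<alpha> k l (f j) \<in> H2" if "j < d" for j using fH[OF that] by (rule bounded_opsD(1)[OF bV])
      have "tensor_op H1 H2 K t (U \<alpha> i k) (V \<alpha> k l) \<xi> =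
          (\<Sum>j<d. tensor_op H1 H2 K t (U \<alpha> i k) (V \<alpha> k l) (t (J1 (e j)) (f j)))"
        unfolding \<xi>_def using e1 fH by (intro bounded_ops_sum[OF tensor_op(1)[OF bU bV] K] t_in) auto
      also have "\<dots> = (\<Sum>j<d. t (U \<alpha> i k (J1 (e j))) (V \<alpha> k l (f j)))"
        using e1 fH by (intro sum.cong refl tensor_op(2)[OF bU bV]) auto
      also have "\<dots> = (\<Sum>j<d. \<Sum>m<d. w \<alpha> i k m j *\<^sub>C t (J1 (e m)) (V \<alpha> k l (f j)))"
      proof (rule sum.cong[OF refl])
        fix j assume "j \<in> {..<d}"
        then have j: "j < d" by simp
        have "t (U \<alpha> i k (J1 (e j))) (V \<alpha> k l (f j)) = (\<Sum>m<d. t (w \<alpha> i k m j *\<^sub>C J1 (e m)) (V \<alpha> k l (f j)))"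
          unfolding UJ[OF il(1) k j] using e1 by (intro t_sum_left hilbert_spaceD[OF H1] VH[OF j]) auto
        also have "\<dots> = (\<Sum>m<d. w \<alpha> i k m j *\<^sub>C t (J1 (e m)) (V \<alpha> k l (f j)))"
          using e1 VH[OF j] by (intro sum.cong refl t_scale) auto
        finally show "t (U \<alpha> i k (J1 (e j))) (V \<alpha> k l (f j)) = (\<Sum>m<d. w \<alpha> i k m j *\<^sub>C t (J1 (e m)) (V \<alpha> k l (f j)))" .
      qed
      also have "\<dots> = (\<Sum>m<d. \<Sum>j<d. t (J1 (e m)) (w \<alpha> i k m j *\<^sub>C V \<alpha> k l (f j)))"
        using e1 VH by (subst sum.swap) (simp add: t_scale)
      also have "\<dots> = (\<Sum>m<d. t (J1 (e m)) (\<Sum>j<d. w \<alpha> i k m j *\<^sub>C V \<alpha> k l (f j)))"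
        using e1 VH by (intro sum.cong refl t_sum_right[symmetric] hilbert_spaceD[OF H2]) auto
      also have "\<dots> = (\<Sum>m<d. t (J1 (e m)) (\<Sum>s<d. \<rho> (u \<alpha> k l * star (u \<alpha> k i)) s m *\<^sub>C f s))"
      proof (rule sum.cong[OF refl])
        fix m assume "m \<in> {..<d}"
        then have m: "m < d" by simp
        have "(\<Sum>j<d. w \<alpha> i k m j *\<^sub>C V \<alpha> k l (f j)) =
            (\<Sum>j<d. \<Sum>s<d. (\<rho> (u \<alpha> k l) s j * \<rho> (star (u \<alpha> k i)) j m) *\<^sub>C f s)"
          using il k m by (intro sum.cong refl) (simp add: Vfj w cv.scale_sum_right mult.commute)
        also have "\<dots> = (\<Sum>s<d. (\<Sum>j<d. \<rho> (u \<alpha> k l) s j * \<rho> (star (u \<alpha> k i)) j m) *\<^sub>C f s)"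
          by (subst sum.swap) (simp add: cv.scale_sum_left)
        also have "\<dots> = (\<Sum>s<d. \<rho> (u \<alpha> k l * star (u \<alpha> k i)) s m *\<^sub>C f s)"
          using \<rho> m by (intro sum.cong refl) (simp add: matrix_rep_def)
        finally show "t (J1 (e m)) (\<Sum>j<d. w \<alpha> i k m j *\<^sub>C V \<alpha> k l (f j)) =
            t (J1 (e m)) (\<Sum>s<d. \<rho> (u \<alpha> k l * star (u \<alpha> k i)) s m *\<^sub>C f s)" by simp
      qed
      finally show ?thesis .
    qed
    have coeff: "(\<Sum>k<?n. \<rho> (u \<alpha> k l * star (u \<alpha> k i)) s m) = (if i = l \<and> s = m then 1 else 0)"
      if sm: "s < d" "m < d" for s m
    proof -
      have lin: "clinear_map (\<lambda>a. \<rho> a s m)" using \<rho> sm by (simp add: matrix_rep_def)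
      have "(\<Sum>k<?n. \<rho> (u \<alpha> k l * star (u \<alpha> k i)) s m) = (\<Sum>k<?n. \<rho> (\<kappa> (\<kappa> (u \<alpha> k l)) * star (u \<alpha> k i)) s m)"
      proof (rule sum.cong[OF refl])
        fix k assume "k \<in> {..<?n}"
        then have "\<rho> (\<kappa> (\<kappa> (u \<alpha> k l))) s r = \<rho> (u \<alpha> k l) s r" if "r < d" for r
          using kac_antipode_square[OF R matrix_rep_kac[OF \<rho> sm(1) that]] il by simp
        then show "\<rho> (u \<alpha> k l * star (u \<alpha> k i)) s m = \<rho> (\<kappa> (\<kappa> (u \<alpha> k l)) * star (u \<alpha> k i)) s m"
          using \<rho> sm by (simp add: matrix_rep_def)
      qed
      also have "\<dots> = \<rho> (\<Sum>k<?n. \<kappa> (\<kappa> (u \<alpha> k l)) * star (u \<alpha> k i)) s m"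
        by (simp add: clinear_map_sum[OF lin])
      also have "\<dots> = \<rho> (if l = i then 1 else 0) s m"
        by (simp only: antipode_conjugate(1)[OF irr_unitary il(2,1)])
      also have "\<dots> = (if i = l \<and> s = m then 1 else 0)"
        using \<rho> sm clinear_mapD(3)[OF lin] by (auto simp: matrix_rep_def)
      finally show ?thesis .
    qed
    have gH: "(\<Sum>s<d. c s *\<^sub>C f s) \<in> H2" for c
      using fH by (intro cv.subspace_sum hilbert_spaceD[OF H2]) auto
    have "tensor_corep G H1 H2 K t U V \<alpha> i l \<xi> =
        (\<Sum>k<?n. \<Sum>m<d. t (J1 (e m)) (\<Sum>s<d. \<rho> (u \<alpha> k l * star (u \<alpha> k i)) s m *\<^sub>C f s))"
      unfolding tensor_corep_def by (intro sum.cong refl T) simp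
    also have "\<dots> = (\<Sum>m<d. \<Sum>k<?n. t (J1 (e m)) (\<Sum>s<d. \<rho> (u \<alpha> k l * star (u \<alpha> k i)) s m *\<^sub>C f s))"
      by (rule sum.swap)
    also have "\<dots> = (\<Sum>m<d. t (J1 (e m)) (\<Sum>k<?n. \<Sum>s<d. \<rho> (u \<alpha> k l * star (u \<alpha> k i)) s m *\<^sub>C f s))"
      using e1 gH by (intro sum.cong refl t_sum_right[symmetric]) auto
    also have "\<dots> = (\<Sum>m<d. t (J1 (e m)) (if i = l then f m else 0))"
    proof (rule sum.cong[OF refl])
      fix m assume "m \<in> {..<d}"
      then have m: "m < d" by simp
      have "(\<Sum>k<?n. \<Sum>s<d. \<rho> (u \<alpha> k l * star (u \<alpha> k i)) s m *\<^sub>C f s) =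
          (\<Sum>s<d. (\<Sum>k<?n. \<rho> (u \<alpha> k l * star (u \<alpha> k i)) s m) *\<^sub>C f s)"
        by (subst sum.swap) (simp add: cv.scale_sum_left)
      also have "\<dots> = (\<Sum>s<d. if s = m then if i = l then f m else 0 else 0)"
        by (intro sum.cong refl) (use coeff m in auto)
      also have "\<dots> = (if i = l then f m else 0)" using m by simp
      finally show "t (J1 (e m)) (\<Sum>k<?n. \<Sum>s<d. \<rho> (u \<alpha> k l * star (u \<alpha> k i)) s m *\<^sub>C f s) =
          t (J1 (e m)) (if i = l then f m else 0)" by simp
    qed
    also have "\<dots> = (if i = l then \<xi> else 0)"
      using t_scale(2)[OF e1 hilbert_spaceD(3)[OF H2], of _ 0] by (simp add: \<xi>_def)
    finally show ?thesis .
  qed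
  then show ?thesis using \<xi>K \<xi>0 by blast
qed

section \<open>An invariant vector gives a common finite-dimensional subrepresentation\<close>

text \<open>Invariance under the adjoints makes the restriction unitary.\<close>

lemma (in cqg) corepresentation_restrict:
  assumes U: "corepresentation G H U" and E: "hilbert_space E" "E \<subseteq> H"
    and inv: "\<And>\<alpha> i j x. i < nd \<alpha> \<Longrightarrow> j < nd \<alpha> \<Longrightarrow> x \<in> E \<Longrightarrow> U \<alpha> i j x \<in> E"
    and inv': "\<And>\<alpha> i j x. i < nd \<alpha> \<Longrightarrow> j < nd \<alpha> \<Longrightarrow> x \<in> E \<Longrightarrow> adj_op H (U \<alpha> i j) x \<in> E"
  shows "corepresentation G E (\<lambda>\<alpha> i j x. if x \<in> E then U \<alpha> i j x else 0)" (is "corepresentation G E ?W")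
proof -
  note H = corepresentationD(1)[OF U]
  have EH: "x \<in> H" if "x \<in> E" for x using that E(2) by blast
  have bW: "?W \<alpha> i j \<in> bounded_ops E E" if ij: "i < nd \<alpha>" "j < nd \<alpha>" for \<alpha> i j
  proof -
    note bU = corepresentationD(2)[OF U ij]
    obtain C where C: "C \<ge> 0" "\<forall>x\<in>H. norm (U \<alpha> i j x) \<le> C * norm x" by (rule bounded_ops_bound[OF bU])
    show ?thesis
      by (rule bounded_opsI[where C = C])
        (use C in \<open>auto simp: inv ij hilbert_spaceD[OF E(1)] bounded_opsD[OF bU] EH\<close>)
  qed
  have adj: "adj_op E (?W \<alpha> i j) x = adj_op H (U \<alpha> i j) x" if ij: "i < nd \<alpha>" "j < nd \<alpha>" and x: "x \<in> E" for \<alpha> i j x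
    by (rule adj_op_eqI[OF E(1) x inv'[OF ij x]])
      (simp add: adj_op_props(2)[OF H corepresentationD(2)[OF U ij] EH[OF x] EH])
  have adj0: "adj_op E (?W \<alpha> i j) 0 = 0" if ij: "i < nd \<alpha>" "j < nd \<alpha>" for \<alpha> i j
    by (rule bounded_ops_0[OF adj_op_bounded[OF E(1) bW[OF ij]] E(1)])
  show ?thesis
    unfolding corepresentation_def Let_def
  proof (intro conjI allI impI E(1))
    fix \<alpha> i j assume ij: "i < nd \<alpha>" "j < nd \<alpha>"
    show "?W \<alpha> i j \<in> bounded_ops E E" by (rule bW[OF ij])
    show "(\<lambda>x. \<Sum>k<nd \<alpha>. adj_op E (?W \<alpha> k i) (?W \<alpha> k j x)) = (if i = j then id_op E else (\<lambda>x. 0))"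
    proof
      fix x
      show "(\<Sum>k<nd \<alpha>. adj_op E (?W \<alpha> k i) (?W \<alpha> k j x)) = (if i = j then id_op E else (\<lambda>x. 0)) x"
      proof (cases "x \<in> E")
        case True
        then have "(\<Sum>k<nd \<alpha>. adj_op E (?W \<alpha> k i) (?W \<alpha> k j x)) = (\<Sum>k<nd \<alpha>. adj_op H (U \<alpha> k i) (U \<alpha> k j x))"
          using ij by (intro sum.cong refl) (simp add: adj inv)
        then show ?thesis using corepresentation_unitary(1)[OF U ij, of x] True EH by (simp add: id_op_def)
      next
        case False
        then have "(\<Sum>k<nd \<alpha>. adj_op E (?W \<alpha> k i) (?W \<alpha> k j x)) = 0"
          using ij by (intro sum.neutral ballI) (simp add: adj0)
        then show ?thesis using False by (simp add: id_op_def)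
      qed
    qed
    show "(\<lambda>x. \<Sum>k<nd \<alpha>. ?W \<alpha> i k (adj_op E (?W \<alpha> j k) x)) = (if i = j then id_op E else (\<lambda>x. 0))"
    proof
      fix x
      show "(\<Sum>k<nd \<alpha>. ?W \<alpha> i k (adj_op E (?W \<alpha> j k) x)) = (if i = j then id_op E else (\<lambda>x. 0)) x"
      proof (cases "x \<in> E")
        case True
        then have "(\<Sum>k<nd \<alpha>. ?W \<alpha> i k (adj_op E (?W \<alpha> j k) x)) = (\<Sum>k<nd \<alpha>. U \<alpha> i k (adj_op H (U \<alpha> j k) x))"
          using ij by (intro sum.cong refl) (simp add: adj inv')
        then show ?thesis using corepresentation_unitary(2)[OF U ij, of x] True EH by (simp add: id_op_def)
      next
        case False
        have "U \<alpha> i k 0 = 0" if "k < nd \<alpha>" for k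
          by (rule bounded_ops_0[OF corepresentationD(2)[OF U ij(1) that] H])
        then have "(\<Sum>k<nd \<alpha>. ?W \<alpha> i k (adj_op E (?W \<alpha> j k) x)) = 0"
          using False by (intro sum.neutral ballI) (simp add: adj_op_def)
        then show ?thesis using False by (simp add: id_op_def)
      qed
    qed
  next
    fix \<beta> \<gamma> i j k l
    assume ij: "i < nd \<beta>" "j < nd \<beta>" and kl: "k < nd \<gamma>" "l < nd \<gamma>"
    have eq: "(\<lambda>x. \<Sum>(\<alpha>, m, n)\<in>comult_supp G \<beta> i j \<gamma> k l. dual_comult G \<alpha> m n \<beta> i j \<gamma> k l *\<^sub>C U \<alpha> m n x) = U \<gamma> k l \<circ> U \<beta> i j"
      using U ij kl unfolding corepresentation_def by blast
    show "(\<lambda>x. \<Sum>(\<alpha>, m, n)\<in>comult_supp G \<beta> i j \<gamma> k l. dual_comult G \<alpha> m n \<beta> i j \<gamma> k l *\<^sub>C ?W \<alpha> m n x) = ?W \<gamma> k l \<circ> ?W \<beta> i j"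
    proof
      fix x
      show "(\<Sum>(\<alpha>, m, n)\<in>comult_supp G \<beta> i j \<gamma> k l. dual_comult G \<alpha> m n \<beta> i j \<gamma> k l *\<^sub>C ?W \<alpha> m n x) = (?W \<gamma> k l \<circ> ?W \<beta> i j) x"
      proof (cases "x \<in> E")
        case True
        then show ?thesis using fun_cong[OF eq, of x] inv[OF ij True] by simp
      next
        case False
        then show ?thesis
          using bounded_ops_0[OF corepresentationD(2)[OF U kl] H] by (simp add: case_prod_unfold)
      qed
    qed
  qed
qed

text \<open>Invariance of \<open>\<xi>\<close> moves \<open>U\<close> from the first leg to \<open>V*\<close> on the second; in the Kac case
  \<open>U*\<close> moves to \<open>V\<close> as well. So the slice operator of \<open>\<xi>\<close> and its adjoint are intertwiners, the
  eigenspaces of their product reduce \<open>U\<close>, and on an eigenspace the slice operator is an isometry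
  up to the factor \<open>s\<close>.\<close>

lemma (in tensor_space) invariant_vector_common_subcorep:
  assumes G: "compact_quantum_group G" and R: "unitary_antipode G R" and uni: "dual_unimodular G"
    and U: "corepresentation G H1 U" and V: "corepresentation G H2 V"
    and \<xi>: "\<xi> \<in> K" "\<xi> \<noteq> 0"
    and inv: "\<forall>\<alpha>. \<forall>i<irr_dim G \<alpha>. \<forall>j<irr_dim G \<alpha>. tensor_corep G H1 H2 K t U V \<alpha> i j \<xi> = (if i = j then \<xi> else 0)"
  shows "\<exists>(HW :: 'h1 set) W. corepresentation G HW W \<and> finite_dim HW \<and> HW \<noteq> {0} \<and>
    contained_in G HW W H1 U \<and> contained_in G HW W (to_conj ` H2) (contragredient G R H2 V)"
proof -
  interpret cqg G using G by unfold_locales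
  have kac: "kac_functional R f" if "clinear_map f" for f by (rule unimodular_kac[OF R uni that])
  have \<kappa>\<kappa>: "\<kappa> (\<kappa> (u \<alpha> i j)) = u \<alpha> i j" if "i < nd \<alpha>" "j < nd \<alpha>" for \<alpha> i j
    by (rule functionals_separate) (rule kac_antipode_square[OF R kac that])
  have R\<kappa>: "R (u \<alpha> i j) = star (u \<alpha> j i)" if ij: "i < nd \<alpha>" "j < nd \<alpha>" for \<alpha> i j
  proof -
    have "R (u \<alpha> i j) = \<kappa> (u \<alpha> i j)"
    proof (rule functionals_separate)
      fix f :: "'a \<Rightarrow> complex" assume f: "clinear_map f"
      then have "clinear_map (\<lambda>a. cnj (f (star a)))" by (simp add: clinear_map_def star_add star_scaleC)
      then show "f (R (u \<alpha> i j)) = f (\<kappa> (u \<alpha> i j))" by (intro kac_unitary_antipode[OF R f _ ij] kac)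
    qed
    then show ?thesis using antipode_corep[OF irr_unitary ij] by simp
  qed
  note bU = corepresentationD(2)[OF U] and bV = corepresentationD(2)[OF V]
  have UH: "U \<alpha> i j x \<in> H1" "adj_op H1 (U \<alpha> i j) x \<in> H1" if "i < nd \<alpha>" "j < nd \<alpha>" "x \<in> H1" for \<alpha> i j x
    using bounded_opsD(1)[OF bU[OF that(1,2)] that(3)] adj_op_props(1)[OF H1 bU[OF that(1,2)] that(3)] by auto
  have VH: "V \<alpha> i j y \<in> H2" "adj_op H2 (V \<alpha> i j) y \<in> H2" if "i < nd \<alpha>" "j < nd \<alpha>" "y \<in> H2" for \<alpha> i j y
    using bounded_opsD(1)[OF bV[OF that(1,2)] that(3)] adj_op_props(1)[OF H2 bV[OF that(1,2)] that(3)] by auto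
  have t0: "t 0 y = 0" if "y \<in> H2" for y using t_scale(1)[OF hilbert_spaceD(3)[OF H1] that, of 0] by simp
  \<comment> \<open>insert \<open>\<Sum>\<^sub>i U\<^sub>i\<^sub>k* U\<^sub>i\<^sub>l = \<delta>\<^sub>k\<^sub>l\<close> and use invariance for each \<open>i\<close>\<close>
  have slide: "cinner \<xi> (t (U \<alpha> j l x) y) = cinner \<xi> (t x (adj_op H2 (V \<alpha> l j) y))"
    if jl: "j < nd \<alpha>" "l < nd \<alpha>" and x: "x \<in> H1" and y: "y \<in> H2" for \<alpha> j l x y
  proof -
    let ?n = "nd \<alpha>"
    have "cinner \<xi> (t (U \<alpha> j l x) y) = (\<Sum>i<?n. if i = j then cinner \<xi> (t (U \<alpha> i l x) y) else 0)"
      using jl by simp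
    also have "\<dots> = (\<Sum>i<?n. cinner (tensor_corep G H1 H2 K t U V \<alpha> i j \<xi>) (t (U \<alpha> i l x) y))"
      using inv jl by (intro sum.cong refl) simp
    also have "\<dots> = (\<Sum>i<?n. \<Sum>k<?n. cinner \<xi> (t (adj_op H1 (U \<alpha> i k) (U \<alpha> i l x)) (adj_op H2 (V \<alpha> k j) y)))"
      unfolding tensor_corep_def cinner_sum_left using jl x y
      by (intro sum.cong refl tensor_op_adjoint bU bV \<xi>(1) UH) auto
    also have "\<dots> = (\<Sum>k<?n. \<Sum>i<?n. cinner \<xi> (t (adj_op H1 (U \<alpha> i k) (U \<alpha> i l x)) (adj_op H2 (V \<alpha> k j) y)))"
      by (rule sum.swap)
    also have "\<dots> = (\<Sum>k<?n. cinner \<xi> (t (\<Sum>i<?n. adj_op H1 (U \<alpha> i k) (U \<alpha> i l x)) (adj_op H2 (V \<alpha> k j) y)))"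
    proof (rule sum.cong[OF refl])
      fix k assume "k \<in> {..<?n}"
      then have "t (\<Sum>i<?n. adj_op H1 (U \<alpha> i k) (U \<alpha> i l x)) (adj_op H2 (V \<alpha> k j) y) =
          (\<Sum>i<?n. t (adj_op H1 (U \<alpha> i k) (U \<alpha> i l x)) (adj_op H2 (V \<alpha> k j) y))"
        using jl x y by (intro t_sum_left UH VH) auto
      then show "(\<Sum>i<?n. cinner \<xi> (t (adj_op H1 (U \<alpha> i k) (U \<alpha> i l x)) (adj_op H2 (V \<alpha> k j) y))) =
          cinner \<xi> (t (\<Sum>i<?n. adj_op H1 (U \<alpha> i k) (U \<alpha> i l x)) (adj_op H2 (V \<alpha> k j) y))"
        by (simp add: cinner_sum_right)
    qed
    also have "\<dots> = (\<Sum>k<?n. if k = l then cinner \<xi> (t x (adj_op H2 (V \<alpha> k j) y)) else 0)"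
      by (rule sum.cong[OF refl])
        (use jl x y in \<open>simp add: corepresentation_unitary(1)[OF U] id_op_def t0 VH\<close>)
    also have "\<dots> = cinner \<xi> (t x (adj_op H2 (V \<alpha> l j) y))" using jl by simp
    finally show ?thesis .
  qed
  have slide_all: "cinner \<xi> (t (rep_of G U a x) y) = cinner \<xi> (t x (rep_of G V (\<kappa> a) y))"
    if x: "x \<in> H1" and y: "y \<in> H2" for a x y
  proof (rule clinear_map_eqI[where f = "\<lambda>a. cinner \<xi> (t (rep_of G U a x) y)"])
    note rU = bounded_opsD(1)[OF rep_of_bounded[OF U] x] and rV = bounded_opsD(1)[OF rep_of_bounded[OF V] y]
    show "clinear_map (\<lambda>a. cinner \<xi> (t (rep_of G U a x) y))"
      by (simp add: clinear_map_def clinear_mapD[OF rep_of_linear] t_add t_scale rU y cinner_add_right cinner_scaleC_right)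
    show "clinear_map (\<lambda>a. cinner \<xi> (t x (rep_of G V (\<kappa> a) y)))"
      by (simp add: clinear_map_def clinear_mapD[OF antipode_linear] clinear_mapD[OF rep_of_linear] t_add t_scale rV x
          cinner_add_right cinner_scaleC_right)
    show "cinner \<xi> (t (rep_of G U (u \<alpha> i j) x) y) = cinner \<xi> (t x (rep_of G V (\<kappa> (u \<alpha> i j)) y))"
      if ij: "i < nd \<alpha>" "j < nd \<alpha>" for \<alpha> i j
      using ij x y by (simp add: rep_of_irr slide antipode_corep[OF irr_unitary] rep_of_star_irr[OF V])
  qed
  have slide_star: "cinner \<xi> (t (adj_op H1 (U \<alpha> i j) x) y) = cinner \<xi> (t x (V \<alpha> j i y))"
    if ij: "i < nd \<alpha>" "j < nd \<alpha>" and x: "x \<in> H1" and y: "y \<in> H2" for \<alpha> i j x y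
  proof -
    have "\<kappa> (star (u \<alpha> i j)) = u \<alpha> j i"
      using \<kappa>\<kappa>[OF ij(2,1)] by (simp add: antipode_corep[OF irr_unitary ij(2,1)])
    then show ?thesis using slide_all[OF x y, of "star (u \<alpha> i j)"] ij x by (simp add: rep_of_star_irr[OF U] rep_of_irr)
  qed
  have YU: "slice \<xi> (U \<alpha> j l x) = V \<alpha> l j (slice \<xi> x)"
    if jl: "j < nd \<alpha>" "l < nd \<alpha>" and x: "x \<in> H1" for \<alpha> j l x
  proof (rule cinner_ext_left[OF H2])
    show "slice \<xi> (U \<alpha> j l x) \<in> H2" "V \<alpha> l j (slice \<xi> x) \<in> H2" using jl x by (simp_all add: slice UH VH)
    show "cinner (slice \<xi> (U \<alpha> j l x)) y = cinner (V \<alpha> l j (slice \<xi> x)) y" if y: "y \<in> H2" for y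
      using jl x y by (simp add: slice UH VH slide adj_op_props(2)[OF H2 bV])
  qed
  have YU': "slice \<xi> (adj_op H1 (U \<alpha> i j) x) = adj_op H2 (V \<alpha> j i) (slice \<xi> x)"
    if ij: "i < nd \<alpha>" "j < nd \<alpha>" and x: "x \<in> H1" for \<alpha> i j x
  proof (rule cinner_ext_left[OF H2])
    show "slice \<xi> (adj_op H1 (U \<alpha> i j) x) \<in> H2" "adj_op H2 (V \<alpha> j i) (slice \<xi> x) \<in> H2"
      using ij x by (simp_all add: slice UH VH)
    show "cinner (slice \<xi> (adj_op H1 (U \<alpha> i j) x)) y = cinner (adj_op H2 (V \<alpha> j i) (slice \<xi> x)) y" if y: "y \<in> H2" for y
      using ij x y by (simp add: slice UH VH slide_star adj_op_props(3)[OF H2 bV, symmetric])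
  qed
  have XV: "coslice \<xi> (V \<alpha> j i y) = U \<alpha> i j (coslice \<xi> y)"
    if ij: "i < nd \<alpha>" "j < nd \<alpha>" and y: "y \<in> H2" for \<alpha> i j y
  proof (rule cinner_ext_left[OF H1])
    show "coslice \<xi> (V \<alpha> j i y) \<in> H1" "U \<alpha> i j (coslice \<xi> y) \<in> H1"
      using ij y by (simp_all add: coslice UH VH)
    show "cinner (coslice \<xi> (V \<alpha> j i y)) x = cinner (U \<alpha> i j (coslice \<xi> y)) x" if x: "x \<in> H1" for x
      using ij x y by (simp add: coslice UH VH adj_op_props(2)[OF H1 bU] flip: slide_star)
  qed
  have XV': "coslice \<xi> (adj_op H2 (V \<alpha> l j) y) = adj_op H1 (U \<alpha> j l) (coslice \<xi> y)"
    if jl: "j < nd \<alpha>" "l < nd \<alpha>" and y: "y \<in> H2" for \<alpha> j l y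
  proof (rule cinner_ext_left[OF H1])
    show "coslice \<xi> (adj_op H2 (V \<alpha> l j) y) \<in> H1" "adj_op H1 (U \<alpha> j l) (coslice \<xi> y) \<in> H1"
      using jl y by (simp_all add: coslice UH VH)
    show "cinner (coslice \<xi> (adj_op H2 (V \<alpha> l j) y)) x = cinner (adj_op H1 (U \<alpha> j l) (coslice \<xi> y)) x" if x: "x \<in> H1" for x
      using jl x y by (simp add: coslice UH VH adj_op_props(3)[OF H1 bU, symmetric] flip: slide)
  qed
  obtain s x0 where s: "s > 0" and x0: "x0 \<in> H1" "x0 \<noteq> 0" "coslice \<xi> (slice \<xi> x0) = of_real (s\<^sup>2) *\<^sub>C x0"
    using slice_eigenvector[OF \<xi>] by blast
  define E where "E = slice_eigenspace \<xi> s"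
  have E: "hilbert_space E" "finite_dim E"
    unfolding E_def by (rule slice_eigenspace_hilbert, rule slice_eigenspace_finite_dim[OF s])
  have EH: "E \<subseteq> H1" by (auto simp: E_def slice_eigenspace_def)
  have x0E: "x0 \<in> E" using x0 by (simp add: E_def slice_eigenspace_def)
  have invE: "U \<alpha> i j x \<in> E" if ij: "i < nd \<alpha>" "j < nd \<alpha>" and x: "x \<in> E" for \<alpha> i j x
  proof -
    have xH: "x \<in> H1" using x EH by blast
    have "coslice \<xi> (slice \<xi> (U \<alpha> i j x)) = U \<alpha> i j (coslice \<xi> (slice \<xi> x))"
      using ij xH by (simp add: YU XV slice)
    also have "\<dots> = of_real (s\<^sup>2) *\<^sub>C U \<alpha> i j x"
      using x xH bounded_opsD(3)[OF bU[OF ij]] by (simp add: E_def slice_eigenspace_def)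
    finally show ?thesis using ij xH by (simp add: E_def slice_eigenspace_def UH)
  qed
  have invE': "adj_op H1 (U \<alpha> i j) x \<in> E" if ij: "i < nd \<alpha>" "j < nd \<alpha>" and x: "x \<in> E" for \<alpha> i j x
  proof -
    have xH: "x \<in> H1" using x EH by blast
    have "coslice \<xi> (slice \<xi> (adj_op H1 (U \<alpha> i j) x)) = adj_op H1 (U \<alpha> i j) (coslice \<xi> (slice \<xi> x))"
      using ij xH by (simp add: YU' XV' slice)
    also have "\<dots> = of_real (s\<^sup>2) *\<^sub>C adj_op H1 (U \<alpha> i j) x"
      using x xH bounded_opsD(3)[OF adj_op_bounded[OF H1 bU[OF ij]]] by (simp add: E_def slice_eigenspace_def)
    finally show ?thesis using ij xH by (simp add: E_def slice_eigenspace_def UH)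
  qed
  define W where "W = (\<lambda>\<alpha> i j x. if x \<in> E then U \<alpha> i j x else 0)"
  have W: "corepresentation G E W"
    unfolding W_def by (rule corepresentation_restrict[OF U E(1) EH invE invE'])
  have WU: "contained_in G E W H1 U"
  proof (rule contained_inI[OF E(1), where J = "id_op E"])
    show "id_op E \<in> bounded_ops E UNIV"
      by (rule bounded_opsI[where C = 1]) (auto simp: id_op_def hilbert_spaceD[OF E(1)])
  qed (use EH invE in \<open>auto simp: id_op_def W_def\<close>)
  \<comment> \<open>the slice operator multiplies norms on \<open>E\<close> by \<open>s\<close>\<close>
  define c where "c = complex_of_real (1 / s)"
  have cc: "c * c * of_real (s\<^sup>2) = 1" "cnj c = c"
    using s by (simp_all add: c_def power2_eq_square flip: of_real_mult)
  define J where "J x = (if x \<in> E then to_conj (c *\<^sub>C slice \<xi> x) else 0)" for x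
  have iso: "cinner (J x) (J y) = cinner x y" if xy: "x \<in> E" "y \<in> E" for x y
  proof -
    have "cinner (J x) (J y) = c * c * cinner (slice \<xi> y) (slice \<xi> x)"
      using xy by (simp add: J_def cinner_conjugate_def conj_simps cinner_scaleC_left cinner_scaleC_right cc mult_ac)
    also have "\<dots> = (c * c * of_real (s\<^sup>2)) * cinner x y"
      using xy EH slice_isometry[of x \<xi> s y] by (auto simp: E_def mult.assoc)
    finally show ?thesis by (simp only: cc mult_1_left)
  qed
  have WV: "contained_in G E W (to_conj ` H2) (contragredient G R H2 V)"
  proof (rule contained_inI[OF E(1), where J = J])
    show "J \<in> bounded_ops E UNIV"
    proof (rule bounded_opsI[where C = 1])
      show "J (x + y) = J x + J y" if "x \<in> E" "y \<in> E" for x y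
        using that subsetD[OF EH] by (simp add: J_def hilbert_spaceD[OF E(1)] slice_add plus_conjugate_def conj_simps cv.scale_right_distrib)
      show "J (a *\<^sub>C x) = a *\<^sub>C J x" if "x \<in> E" for a x
        using that subsetD[OF EH] by (simp add: J_def hilbert_spaceD[OF E(1)] slice_scale scaleC_conjugate_def conj_simps mult.commute)
      show "norm (J x) \<le> 1 * norm x" if "x \<in> E" for x
        using iso[OF that that] by (simp add: norm_eq_sqrt_cinner)
    qed (auto simp: J_def)
    show "J x \<in> to_conj ` H2" if "x \<in> E" for x
      using that subsetD[OF EH] by (simp add: J_def imageI hilbert_spaceD[OF H2] slice)
    show "cinner (J x) (J y) = cinner x y" if "x \<in> E" "y \<in> E" for x y by (rule iso[OF that])
    fix \<alpha> i j x assume ij: "i < nd \<alpha>" "j < nd \<alpha>" and x: "x \<in> E"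
    show "W \<alpha> i j x \<in> E" using ij x by (simp add: W_def invE)
    have xH: "x \<in> H1" using x EH by blast
    have yH: "c *\<^sub>C slice \<xi> x \<in> H2" using xH by (intro hilbert_spaceD[OF H2] slice)
    have "adj_op H2 (rep_of G V (R (u \<alpha> i j))) (c *\<^sub>C slice \<xi> x) = V \<alpha> j i (c *\<^sub>C slice \<xi> x)"
    proof (rule adj_op_eqI[OF H2 yH VH(1)[OF ij(2,1) yH]])
      fix z assume z: "z \<in> H2"
      show "cinner (rep_of G V (R (u \<alpha> i j)) z) (c *\<^sub>C slice \<xi> x) = cinner z (V \<alpha> j i (c *\<^sub>C slice \<xi> x))"
        using rep_of_star'[OF V z yH, of "u \<alpha> j i"] ij by (simp only: R\<kappa> rep_of_irr)
    qed
    then have "contragredient G R H2 V \<alpha> i j (J x) = to_conj (V \<alpha> j i (c *\<^sub>C slice \<xi> x))"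
      using x by (simp add: contragredient_def transpose_op_def J_def conj_simps)
    also have "\<dots> = to_conj (c *\<^sub>C slice \<xi> (U \<alpha> i j x))"
      using ij xH by (simp add: YU bounded_opsD(3)[OF bV] slice)
    also have "\<dots> = J (W \<alpha> i j x)" using ij x by (simp add: J_def W_def invE)
    finally show "J (W \<alpha> i j x) = contragredient G R H2 V \<alpha> i j (J x)" ..
  qed
  have "E \<noteq> {0}" using x0E x0(2) by blast
  then show ?thesis using W E(2) WU WV by (intro exI[of _ E] exI[of _ W]) simp
qed

theorem theorem2p6:
  fixes G :: "('a::complex_star_algebra, 'i) quantum_group"
    and R :: "'a \<Rightarrow> 'a"
    and H_U :: "'hu::chilbert_space set" and U :: "'i \<Rightarrow> nat \<Rightarrow> nat \<Rightarrow> 'hu \<Rightarrow> 'hu"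
    and H_V :: "'hv::chilbert_space set" and V :: "'i \<Rightarrow> nat \<Rightarrow> nat \<Rightarrow> 'hv \<Rightarrow> 'hv"
    and K :: "'k::chilbert_space set" and t :: "'hu \<Rightarrow> 'hv \<Rightarrow> 'k"
  assumes "compact_quantum_group G"
    and "countable (UNIV :: 'i set)"
    and "unitary_antipode G R"
    and "corepresentation G H_U U" and "separable_space (top_of_set H_U)"
    and "corepresentation G H_V V" and "separable_space (top_of_set H_V)"
    and "hilbert_tensor H_U H_V K t"
  shows "(\<forall>(H_W :: 'hw::chilbert_space set) W.
            corepresentation G H_W W \<and> finite_dim H_W \<and> H_W \<noteq> {0} \<and>
            contained_in G H_W W H_U U \<and>
            contained_in G H_W W (to_conj ` H_V) (contragredient G R H_V V) \<longrightarrow>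
            contained_in G UNIV (trivial_corep G) K (tensor_corep G H_U H_V K t U V))
       \<and> (dual_unimodular G \<and>
          contained_in G UNIV (trivial_corep G) K (tensor_corep G H_U H_V K t U V) \<longrightarrow>
          (\<exists>(H_W :: 'hu set) W.
             corepresentation G H_W W \<and> finite_dim H_W \<and> H_W \<noteq> {0} \<and>
             contained_in G H_W W H_U U \<and>
             contained_in G H_W W (to_conj ` H_V) (contragredient G R H_V V)))"
proof -
  have "hilbert_space H_U" "hilbert_space H_V"
    using assms(4,6) by (simp_all add: corepresentation_def)
  then interpret tensor_space H_U H_V K t using assms(8) by unfold_locales
  note iff = trivial_contained_iff[OF assms(1,4,6)]
  show ?thesis
  proof (intro conjI allI impI)
    fix H_W :: "'hw set" and W
    assume W: "corepresentation G H_W W \<and> finite_dim H_W \<and> H_W \<noteq> {0} \<and>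
      contained_in G H_W W H_U U \<and> contained_in G H_W W (to_conj ` H_V) (contragredient G R H_V V)"
    show "contained_in G UNIV (trivial_corep G) K (tensor_corep G H_U H_V K t U V)"
      unfolding iff using W by (intro common_subcorep_invariant_vector[OF assms(1,3,4,6)]) auto
  next
    assume "dual_unimodular G \<and> contained_in G UNIV (trivial_corep G) K (tensor_corep G H_U H_V K t U V)"
    then obtain \<xi> where "dual_unimodular G" "\<xi> \<in> K" "\<xi> \<noteq> 0"
      "\<forall>\<alpha>. \<forall>i<irr_dim G \<alpha>. \<forall>j<irr_dim G \<alpha>. tensor_corep G H_U H_V K t U V \<alpha> i j \<xi> = (if i = j then \<xi> else 0)"
      unfolding iff by blast
    then show "\<exists>(H_W :: 'hu set) W. corepresentation G H_W W \<and> finite_dim H_W \<and> H_W \<noteq> {0} \<and>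
      contained_in G H_W W H_U U \<and> contained_in G H_W W (to_conj ` H_V) (contragredient G R H_V V)"
      by (rule invariant_vector_common_subcorep[OF assms(1,3) _ assms(4,6)])
  qed
qed

end
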